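(* Let $\bar{\mathbb S}=\mathbb S\cup\partial\mathbb S\subset\mathbb R^d$, let $\mu,\Sigma,\beta,\Gamma,\rho$ satisfy the assumptions (1)–(4) listed in the context, and let $X$ be the associated diffusion with sticky boundary $\partial\mathbb S$, with transition semigroup $\mathcal P_tf(x)=\mathbb E_x(f(X_t))$ on $C_0(\bar{\mathbb S})$. Let $\mathcal A$ and $\mathcal K$ be the operators $$\mathcal A f(x)=\sum_{i=1}^d\mu^i(x)\frac{\partial f}{\partial x^i}(x)+\frac12\sum_{i,j=1}^dA^{i,j}(x)\frac{\partial^2 f}{\partial x^i\partial x^j}(x),\quad x\in\bar{\mathbb S},$$ $$\mathcal K f(x)=\sum_{i=1}^d\hat\beta^i(x)\frac{\partial f}{\partial x^i}(x)+\frac12\sum_{i,j=1}^d\hat G^{i,j}(x)\frac{\partial^2 f}{\partial x^i\partial x^j}(x),\quad x\in\partial\mathbb S.$$ Then for every $f\in C^2_0(\bar{\mathbb S})$ satisfying the Wentzell boundary condition $\mathcal A f(x)=\mathcal K f(x)$ for all $x\in\partial\mathbb S$, the limit $$\mathcal G f=\lim_{t\searrow0}\frac{\mathcal P_tf-f}{t}$$ exists in the supremum norm of $C_0(\bar{\mathbb S})$, and for all $x\in\bar{\mathbb S}$ $$\mathcal G f(x)=I(x\in\mathbb S)\,\mathcal A f(x)+I(x\in\partial\mathbb S)\,\mathcal K f(x).$$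
   Context: State space. $\mathbb S=\{x\in\mathbb R^d:\Phi(x)>0\}$ and $\partial\mathbb S=\{x\in\mathbb R^d:\Phi(x)=0\}$ for some $\Phi\in C_b^2(\mathbb R^d)$ (twice continuously differentiable, with the function and its first and second order derivatives bounded). $n(x)=\nabla\Phi(x)/\|\nabla\Phi(x)\|$ is the inward unit normal at $x\in\partial\mathbb S$. $\bar{\mathbb S}=\mathbb S\cup\partial\mathbb S$. Coefficients. Measurable functions $\mu:\bar{\mathbb S}\to\mathbb R^d$, $\Sigma:\bar{\mathbb S}\to\mathbb R^{d\times d}$, $\beta:\partial\mathbb S\to\mathbb R^d$, $\Gamma:\partial\mathbb S\to\mathbb R^{d\times d}$, $\rho:\partial\mathbb S\to\mathbb R_+$. Put $A=\Sigma\Sigma^\top$, and on $\partial\mathbb S$: $\hat\beta=\beta/\rho$, $\hat\Gamma=\Gamma/\sqrt\rho$, $\hat G=\hat\Gamma\hat\Gamma^\top$. Superscripts denote coordinates/entries. Assumptions. (1) $\mu$ and $\Sigma$ are bounded and Lipschitz continuous on $\bar{\mathbb S}$, $\Sigma(x)$ has full rank for every $x\in\bar{\mathbb S}$, and there is a constant $C>0$ with $n(x)^\top A(x)n(x)>C$ for all $x\in\partial\mathbb S$. (2) $\beta$ and $\Gamma$ are bounded and Lipschitz continuous on $\partial\mathbb S$. (3) $\Gamma(x)^\top n(x)=0$ for $x\in\partial\mathbb S$. (4) $\rho$ is strictly positive, and there is a constant $C>0$ with $\beta(x)^\top n(x)>C$ for all $x\in\partial\mathbb S$. The process. $X$ is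 the (unique in law) weak solution of $$dX_t=\mu(X_t)\left(dt-\rho(X_t)dL_t\right)+\Sigma(X_t)dM_t+\beta(X_t)dL_t+\Gamma(X_t)dB_{L_t},\quad X_0=x,$$ where $B$ is a standard $d$-dimensional Brownian motion, $L$ is the local time of $X$ on the boundary, $L_t=\int_0^tI(X_s\in\partial\mathbb S)dL_s$, and $M$ is a $d$-dimensional continuous martingale with $\langle M^i,M^j\rangle_t=\delta_{i,j}\left(t-\int_0^t\rho(X_s)dL_s\right)$. It satisfies the sojourn condition $I(X_t\in\partial\mathbb S)dt=\rho(X_t)dL_t$, and can equivalently be written as $$dX_t=I(X_t\in\mathbb S)\left(\mu(X_t)dt+\Sigma(X_t)dB_{1,t}\right)+I(X_t\in\partial\mathbb S)\left(\hat\beta(X_t)dt+\hat\Gamma(X_t)dB_{2,t}\right)$$ with independent standard $d$-dimensional Brownian motions $B_1,B_2$. Existence and uniqueness in law of the weak solution, the sojourn condition, and the fact that $X$ is a Feller process (so that $(\mathcal P_t)_{t\ge0}$ is a strongly continuous contraction semigroup on $C_0(\bar{\mathbb S})$) are known under these assumptions. Function spaces. $C_0(\bar{\mathbb S})$ is the space of continuous functions on $\bar{\mathbb S}$ vanishing at infinity, with the supremum norm. $C_0^2(\bar{\mathbb S})$ is the set of $f\in C_0(\bar{\mathbb S})$ whose first and second order derivatives are continuous on $\bar{\mathbb S}$ and vanish at infinity. $I(\cdot)$ denotes the indicator. *)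

theory Defs
  imports "HOL-Probability.Probability"
begin

section \<open>State space and function spaces\<close>

definition domain_of :: "(real^'d \<Rightarrow> real) \<Rightarrow> (real^'d) set" where
  "domain_of \<Phi> = {x. \<Phi> x > 0}"

text \<open>This is the zero set of \<open>\<Phi>\<close> by definition, not the topological frontier.\<close>

definition bdry_of :: "(real^'d \<Rightarrow> real) \<Rightarrow> (real^'d) set" where
  "bdry_of \<Phi> = {x. \<Phi> x = 0}"

definition closed_domain :: "(real^'d \<Rightarrow> real) \<Rightarrow> (real^'d) set" where
  "closed_domain \<Phi> = domain_of \<Phi> \<union> bdry_of \<Phi>"

text \<open>Derivatives are taken within \<open>S\<close>, so that they are available up to the boundary of a closed
  domain.  On an open set, or at a point of \<open>{x. \<Phi> x = 0}\<close> with nonzero gradient for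
  \<open>S = {x. \<Phi> x \<ge> 0}\<close>, the derivative within \<open>S\<close> is unique, and it is the continuous extension
  of the derivative in the interior whenever it is continuous on \<open>S\<close>.\<close>

definition partial_on :: "(real^'d) set \<Rightarrow> 'd \<Rightarrow> (real^'d \<Rightarrow> real) \<Rightarrow> real^'d \<Rightarrow> real" where
  "partial_on S i f x = frechet_derivative f (at x within S) (axis i 1)"

definition C2_on :: "(real^'d) set \<Rightarrow> (real^'d \<Rightarrow> real) \<Rightarrow> bool" where
  "C2_on S f \<longleftrightarrow>
     f differentiable_on S \<and>
     (\<forall>i. partial_on S i f differentiable_on S) \<and>
     (\<forall>i j. continuous_on S (partial_on S i (partial_on S j f)))"

definition C2_bounded :: "(real^'d \<Rightarrow> real) \<Rightarrow> bool" where
  "C2_bounded f \<longleftrightarrow>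
     C2_on UNIV f \<and> bounded (range f) \<and>
     (\<forall>i. bounded (range (partial_on UNIV i f))) \<and>
     (\<forall>i j. bounded (range (partial_on UNIV i (partial_on UNIV j f))))"

text \<open>Functions are total; only their values on \<open>S\<close> matter.\<close>

definition C0 :: "(real^'d) set \<Rightarrow> (real^'d \<Rightarrow> real) set" where
  "C0 S = {f. continuous_on S f \<and> (f \<longlongrightarrow> 0) (inf at_infinity (principal S))}"

definition C2_0 :: "(real^'d) set \<Rightarrow> (real^'d \<Rightarrow> real) set" where
  "C2_0 S = {f \<in> C0 S. C2_on S f \<and>
     (\<forall>i. partial_on S i f \<in> C0 S) \<and>
     (\<forall>i j. partial_on S i (partial_on S j f) \<in> C0 S)}"

definition inward_normal :: "(real^'d \<Rightarrow> real) \<Rightarrow> real^'d \<Rightarrow> real^'d" where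
  "inward_normal \<Phi> x = (let g = (\<chi> i. partial_on UNIV i \<Phi> x) in (1 / norm g) *\<^sub>R g)"

section \<open>The two second order operators\<close>

definition second_order_op ::
  "(real^'d) set \<Rightarrow> (real^'d \<Rightarrow> real^'d) \<Rightarrow> (real^'d \<Rightarrow> real^'d^'d) \<Rightarrow>
     (real^'d \<Rightarrow> real) \<Rightarrow> real^'d \<Rightarrow> real" where
  "second_order_op S b a f x =
     (\<Sum>i\<in>UNIV. b x $ i * partial_on S i f x) +
     1/2 * (\<Sum>i\<in>UNIV. \<Sum>j\<in>UNIV. a x $ i $ j * partial_on S i (partial_on S j f) x)"

definition gram :: "(real^'d \<Rightarrow> real^'d^'d) \<Rightarrow> real^'d \<Rightarrow> real^'d^'d" where
  "gram \<sigma> x = \<sigma> x ** transpose (\<sigma> x)"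

definition bulk_op ::
  "(real^'d \<Rightarrow> real) \<Rightarrow> (real^'d \<Rightarrow> real^'d) \<Rightarrow> (real^'d \<Rightarrow> real^'d^'d) \<Rightarrow>
     (real^'d \<Rightarrow> real) \<Rightarrow> real^'d \<Rightarrow> real" where
  "bulk_op \<Phi> \<mu> \<sigma> = second_order_op (closed_domain \<Phi>) \<mu> (gram \<sigma>)"

definition bdry_op ::
  "(real^'d \<Rightarrow> real) \<Rightarrow> (real^'d \<Rightarrow> real^'d) \<Rightarrow> (real^'d \<Rightarrow> real^'d^'d) \<Rightarrow> (real^'d \<Rightarrow> real) \<Rightarrow>
     (real^'d \<Rightarrow> real) \<Rightarrow> real^'d \<Rightarrow> real" where
  "bdry_op \<Phi> \<beta> \<Gamma> \<rho> =
     second_order_op (closed_domain \<Phi>)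
       (\<lambda>x. (1 / \<rho> x) *\<^sub>R \<beta> x) (gram (\<lambda>x. (1 / sqrt (\<rho> x)) *\<^sub>R \<Gamma> x))"

section \<open>Processes, martingales and brackets\<close>

text \<open>Processes are indexed by real time; only times \<open>t \<ge> 0\<close> are relevant.  A filtration is
  indexed by all reals to match the library locale; its members at negative times play no role.\<close>

definition usual_filtration :: "'w measure \<Rightarrow> (real \<Rightarrow> 'w measure) \<Rightarrow> bool" where
  "usual_filtration M F \<longleftrightarrow>
     filtration (space M) F \<and>
     (\<forall>t. subalgebra M (F t)) \<and>
     (\<forall>t\<ge>0. sets (F t) = (\<Inter>u\<in>{t<..}. sets (F u))) \<and>
     (\<forall>N\<in>null_sets M. \<forall>A\<subseteq>N. A \<in> sets (F 0))"

definition adapted ::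
  "(real \<Rightarrow> 'w measure) \<Rightarrow> (real \<Rightarrow> 'w \<Rightarrow> 'b::topological_space) \<Rightarrow> bool" where
  "adapted F Y \<longleftrightarrow> (\<forall>t\<ge>0. Y t \<in> borel_measurable (F t))"

definition progressive :: "(real \<Rightarrow> 'w measure) \<Rightarrow> (real \<Rightarrow> 'w \<Rightarrow> real) \<Rightarrow> bool" where
  "progressive F Y \<longleftrightarrow>
     (\<forall>t\<ge>0. (\<lambda>(s, \<omega>). Y s \<omega>) \<in> borel_measurable (restrict_space borel {0..t} \<Otimes>\<^sub>M F t))"

definition continuous_paths :: "'w measure \<Rightarrow> (real \<Rightarrow> 'w \<Rightarrow> 'b::topological_space) \<Rightarrow> bool" where
  "continuous_paths M Y \<longleftrightarrow> (\<forall>\<omega>\<in>space M. continuous_on {0..} (\<lambda>t. Y t \<omega>))"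

definition AE_continuous_paths :: "'w measure \<Rightarrow> (real \<Rightarrow> 'w \<Rightarrow> real) \<Rightarrow> bool" where
  "AE_continuous_paths M Y \<longleftrightarrow> (AE \<omega> in M. continuous_on {0..} (\<lambda>t. Y t \<omega>))"

definition martingale ::
  "'w measure \<Rightarrow> (real \<Rightarrow> 'w measure) \<Rightarrow> (real \<Rightarrow> 'w \<Rightarrow> real) \<Rightarrow> bool" where
  "martingale M F Y \<longleftrightarrow>
     adapted F Y \<and> (\<forall>t\<ge>0. integrable M (Y t)) \<and>
     (\<forall>s\<ge>0. \<forall>t\<ge>s. AE \<omega> in M. real_cond_exp M (F s) (Y t) \<omega> = Y s \<omega>)"

definition cont_local_martingale ::
  "'w measure \<Rightarrow> (real \<Rightarrow> 'w measure) \<Rightarrow> (real \<Rightarrow> 'w \<Rightarrow> real) \<Rightarrow> bool" where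
  "cont_local_martingale M F Y \<longleftrightarrow>
     adapted F Y \<and> AE_continuous_paths M Y \<and>
     (\<exists>T :: nat \<Rightarrow> 'w \<Rightarrow> real.
        (\<forall>n. stopping_time F (T n) \<and> (\<forall>\<omega>\<in>space M. 0 \<le> T n \<omega> \<and> T n \<omega> \<le> T (Suc n) \<omega>)) \<and>
        (AE \<omega> in M. filterlim (\<lambda>n. T n \<omega>) at_top sequentially) \<and>
        (\<forall>n. martingale M F (\<lambda>t \<omega>. Y (min t (T n \<omega>)) \<omega> - Y 0 \<omega>)))"

text \<open>\<open>bracket M F Y Z V\<close>: the process \<open>V\<close> is (a version of) the bracket of the continuous local
  martingales \<open>Y\<close> and \<open>Z\<close>.\<close>

definition bracket ::
  "'w measure \<Rightarrow> (real \<Rightarrow> 'w measure) \<Rightarrow> (real \<Rightarrow> 'w \<Rightarrow> real) \<Rightarrow> (real \<Rightarrow> 'w \<Rightarrow> real) \<Rightarrow>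
     (real \<Rightarrow> 'w \<Rightarrow> real) \<Rightarrow> bool" where
  "bracket M F Y Z V \<longleftrightarrow>
     cont_local_martingale M F Y \<and> cont_local_martingale M F Z \<and>
     adapted F V \<and> AE_continuous_paths M V \<and>
     (AE \<omega> in M. V 0 \<omega> = 0 \<and>
        (\<exists>u v :: real \<Rightarrow> real. mono_on {0..} u \<and> mono_on {0..} v \<and> (\<forall>t\<ge>0. V t \<omega> = u t - v t))) \<and>
     cont_local_martingale M F (\<lambda>t \<omega>. Y t \<omega> * Z t \<omega> - V t \<omega>)"

definition std_brownian :: "'w measure \<Rightarrow> (real \<Rightarrow> 'w \<Rightarrow> real^'d) \<Rightarrow> bool" where
  "std_brownian M B \<longleftrightarrow>
     continuous_paths M B \<and>
     (\<forall>t\<ge>0. B t \<in> borel_measurable M) \<and>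
     (AE \<omega> in M. B 0 \<omega> = 0) \<and>
     (\<forall>s\<ge>0. \<forall>t>s. distributed M lborel (\<lambda>\<omega>. B t \<omega> - B s \<omega>)
        (\<lambda>x. ennreal (\<Prod>i\<in>UNIV. normal_density 0 (sqrt (t - s)) (x $ i)))) \<and>
     (\<forall>n. \<forall>\<tau> :: nat \<Rightarrow> real. 0 \<le> \<tau> 0 \<and> (\<forall>k<n. \<tau> k \<le> \<tau> (Suc k)) \<longrightarrow>
        prob_space.indep_vars M (\<lambda>_. borel) (\<lambda>k \<omega>. B (\<tau> (Suc k)) \<omega> - B (\<tau> k) \<omega>) {..<n})"

section \<open>Pathwise Stieltjes and stochastic integrals\<close>

text \<open>The Stieltjes measure \<open>dV\<close> on \<open>[0,\<infinity>)\<close> of a continuous nondecreasing path; the path is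
  extended by a constant to negative times, as the library measure lives on the whole line.\<close>

definition path_measure :: "(real \<Rightarrow> 'w \<Rightarrow> real) \<Rightarrow> 'w \<Rightarrow> real measure" where
  "path_measure V \<omega> = interval_measure (\<lambda>s. V (max 0 s) \<omega>)"

definition simple_integrand ::
  "'w measure \<Rightarrow> (real \<Rightarrow> 'w measure) \<Rightarrow> nat \<Rightarrow> (nat \<Rightarrow> real) \<Rightarrow> (nat \<Rightarrow> 'w \<Rightarrow> real) \<Rightarrow> bool" where
  "simple_integrand M F N \<tau> \<xi> \<longleftrightarrow>
     0 \<le> \<tau> 0 \<and>
     (\<forall>k<N. \<tau> k \<le> \<tau> (Suc k) \<and> \<xi> k \<in> borel_measurable (F (\<tau> k)) \<and> bounded (\<xi> k ` space M))"

definition simple_process ::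
  "nat \<Rightarrow> (nat \<Rightarrow> real) \<Rightarrow> (nat \<Rightarrow> 'w \<Rightarrow> real) \<Rightarrow> real \<Rightarrow> 'w \<Rightarrow> real" where
  "simple_process N \<tau> \<xi> s \<omega> = (\<Sum>k<N. \<xi> k \<omega> * indicator {\<tau> k<..\<tau> (Suc k)} s)"

definition simple_integral ::
  "nat \<Rightarrow> (nat \<Rightarrow> real) \<Rightarrow> (nat \<Rightarrow> 'w \<Rightarrow> real) \<Rightarrow> (real \<Rightarrow> 'w \<Rightarrow> real) \<Rightarrow> real \<Rightarrow> 'w \<Rightarrow> real" where
  "simple_integral N \<tau> \<xi> Y t \<omega> =
     (\<Sum>k<N. \<xi> k \<omega> * (Y (min t (\<tau> (Suc k))) \<omega> - Y (min t (\<tau> k)) \<omega>))"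

text \<open>\<open>ito_integral M F H Y K\<close>: the process \<open>K\<close> is (a version of) the stochastic integral of \<open>H\<close>
  with respect to the continuous local martingale \<open>Y\<close>, i.e. the limit, locally uniformly in time,
  of integrals of simple integrands that approximate \<open>H\<close> in \<open>L\<^sup>2(d\<langle>Y\<rangle>)\<close> on bounded time
  intervals.  Both convergences are required almost surely along the sequence; this is the same as
  the usual convergence in probability, after passing to a subsequence.\<close>

definition ito_integral ::
  "'w measure \<Rightarrow> (real \<Rightarrow> 'w measure) \<Rightarrow> (real \<Rightarrow> 'w \<Rightarrow> real) \<Rightarrow> (real \<Rightarrow> 'w \<Rightarrow> real) \<Rightarrow>
     (real \<Rightarrow> 'w \<Rightarrow> real) \<Rightarrow> bool" where
  "ito_integral M F H Y K \<longleftrightarrow>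
     progressive F H \<and> adapted F K \<and> AE_continuous_paths M K \<and>
     (\<exists>V. bracket M F Y Y V \<and> (AE \<omega> in M. mono_on {0..} (\<lambda>t. V t \<omega>)) \<and>
       (\<exists>(N :: nat \<Rightarrow> nat) \<tau> \<xi>.
          (\<forall>m. simple_integrand M F (N m) (\<tau> m) (\<xi> m)) \<and>
          (AE \<omega> in M. \<forall>t\<ge>0.
             ((\<lambda>m. \<integral>\<^sup>+s\<in>{0..t}. ennreal ((simple_process (N m) (\<tau> m) (\<xi> m) s \<omega> - H s \<omega>)\<^sup>2)
                 \<partial>path_measure V \<omega>) \<longlonglongrightarrow> 0) \<and>
             uniform_limit {0..t} (\<lambda>m s. simple_integral (N m) (\<tau> m) (\<xi> m) Y s \<omega>)
               (\<lambda>s. K s \<omega>) sequentially)))"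

section \<open>The sticky diffusion\<close>

text \<open>Adapted continuous nondecreasing process, null at zero, that increases only while \<open>X\<close> is on
  the boundary.\<close>

definition bdry_local_time ::
  "(real^'d \<Rightarrow> real) \<Rightarrow> 'w measure \<Rightarrow> (real \<Rightarrow> 'w measure) \<Rightarrow> (real \<Rightarrow> 'w \<Rightarrow> real^'d) \<Rightarrow>
     (real \<Rightarrow> 'w \<Rightarrow> real) \<Rightarrow> bool" where
  "bdry_local_time \<Phi> M F X L \<longleftrightarrow>
     adapted F L \<and> continuous_paths M L \<and>
     (\<forall>\<omega>\<in>space M. L 0 \<omega> = 0 \<and> mono_on {0..} (\<lambda>t. L t \<omega>)) \<and>
     (AE \<omega> in M. \<forall>t\<ge>0.
        L t \<omega> = (LINT s:{0..t}|path_measure L \<omega>. indicator (bdry_of \<Phi>) (X s \<omega>)))"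

text \<open>The process \<open>\<integral>\<^sub>0\<^sup>t \<rho>(X\<^sub>s) dL\<^sub>s\<close>.  Boundary coefficients are only meaningful on the boundary,
  hence the indicator here and below; it does not change integrals against \<open>dL\<close>.\<close>

definition bdry_clock ::
  "(real^'d \<Rightarrow> real) \<Rightarrow> (real^'d \<Rightarrow> real) \<Rightarrow> (real \<Rightarrow> 'w \<Rightarrow> real^'d) \<Rightarrow> (real \<Rightarrow> 'w \<Rightarrow> real) \<Rightarrow>
     real \<Rightarrow> 'w \<Rightarrow> real" where
  "bdry_clock \<Phi> \<rho> X L t \<omega> =
     (LINT s:{0..t}|path_measure L \<omega>. indicator (bdry_of \<Phi>) (X s \<omega>) * \<rho> (X s \<omega>))"

text \<open>Weak solution \<open>X\<close>, started at \<open>x\<close>, of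
  \<open>dX = \<mu>(X) (dt - \<rho>(X) dL) + \<sigma>(X) dW + \<beta>(X) dL + \<Gamma>(X) dB\<^sub>L\<close>
  on the filtered probability space \<open>(M, F)\<close>.  The time-changed Brownian motion \<open>t \<mapsto> B\<^bsub>L t\<^esub>\<close> is a
  continuous local martingale of the filtration \<open>F\<close> with bracket \<open>L\<close>; the stochastic integral
  against \<open>dB\<^sub>L\<close> is taken with respect to this local martingale.  The integrability clause makes
  \<open>\<integral>\<rho>(X) dL\<close> meaningful.\<close>

definition weak_solution ::
  "(real^'d \<Rightarrow> real) \<Rightarrow> (real^'d \<Rightarrow> real^'d) \<Rightarrow> (real^'d \<Rightarrow> real^'d^'d) \<Rightarrow>
     (real^'d \<Rightarrow> real^'d) \<Rightarrow> (real^'d \<Rightarrow> real^'d^'d) \<Rightarrow> (real^'d \<Rightarrow> real) \<Rightarrow>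
     real^'d \<Rightarrow> 'w measure \<Rightarrow> (real \<Rightarrow> 'w measure) \<Rightarrow>
     (real \<Rightarrow> 'w \<Rightarrow> real^'d) \<Rightarrow> (real \<Rightarrow> 'w \<Rightarrow> real) \<Rightarrow>
     (real \<Rightarrow> 'w \<Rightarrow> real^'d) \<Rightarrow> (real \<Rightarrow> 'w \<Rightarrow> real^'d) \<Rightarrow> bool" where
  "weak_solution \<Phi> \<mu> \<sigma> \<beta> \<Gamma> \<rho> x M F X L W B \<longleftrightarrow>
     prob_space M \<and> usual_filtration M F \<and>
     adapted F X \<and> continuous_paths M X \<and>
     (\<forall>t\<ge>0. \<forall>\<omega>\<in>space M. X t \<omega> \<in> closed_domain \<Phi>) \<and>
     bdry_local_time \<Phi> M F X L \<and>
     (AE \<omega> in M. \<forall>t\<ge>0.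
        set_integrable (path_measure L \<omega>) {0..t}
          (\<lambda>s. indicator (bdry_of \<Phi>) (X s \<omega>) * \<rho> (X s \<omega>))) \<and>
     continuous_paths M W \<and>
     (\<forall>i. martingale M F (\<lambda>t \<omega>. W t \<omega> $ i)) \<and>
     (\<forall>i j. bracket M F (\<lambda>t \<omega>. W t \<omega> $ i) (\<lambda>t \<omega>. W t \<omega> $ j)
        (\<lambda>t \<omega>. if i = j then t - bdry_clock \<Phi> \<rho> X L t \<omega> else 0)) \<and>
     std_brownian M B \<and>
     (\<forall>i j. bracket M F (\<lambda>t \<omega>. B (L t \<omega>) \<omega> $ i) (\<lambda>t \<omega>. B (L t \<omega>) \<omega> $ j)
        (\<lambda>t \<omega>. if i = j then L t \<omega> else 0)) \<and>
     (\<exists>I J :: 'd \<Rightarrow> 'd \<Rightarrow> real \<Rightarrow> 'w \<Rightarrow> real.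
        (\<forall>i j. ito_integral M F (\<lambda>t \<omega>. \<sigma> (X t \<omega>) $ i $ j) (\<lambda>t \<omega>. W t \<omega> $ j) (I i j)) \<and>
        (\<forall>i j. ito_integral M F
           (\<lambda>t \<omega>. indicator (bdry_of \<Phi>) (X t \<omega>) * \<Gamma> (X t \<omega>) $ i $ j)
           (\<lambda>t \<omega>. B (L t \<omega>) \<omega> $ j) (J i j)) \<and>
        (AE \<omega> in M. \<forall>t\<ge>0.
           X t \<omega> = x
             + (LINT s:{0..t}|lborel. \<mu> (X s \<omega>))
             - (LINT s:{0..t}|path_measure L \<omega>.
                  (indicator (bdry_of \<Phi>) (X s \<omega>) * \<rho> (X s \<omega>)) *\<^sub>R \<mu> (X s \<omega>))
             + (\<chi> i. \<Sum>j\<in>UNIV. I i j t \<omega>)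
             + (LINT s:{0..t}|path_measure L \<omega>. indicator (bdry_of \<Phi>) (X s \<omega>) *\<^sub>R \<beta> (X s \<omega>))
             + (\<chi> i. \<Sum>j\<in>UNIV. J i j t \<omega>)))"

definition sojourn_condition ::
  "(real^'d \<Rightarrow> real) \<Rightarrow> (real^'d \<Rightarrow> real) \<Rightarrow> 'w measure \<Rightarrow>
     (real \<Rightarrow> 'w \<Rightarrow> real^'d) \<Rightarrow> (real \<Rightarrow> 'w \<Rightarrow> real) \<Rightarrow> bool" where
  "sojourn_condition \<Phi> \<rho> M X L \<longleftrightarrow>
     (AE \<omega> in M. \<forall>t\<ge>0.
        (LINT s:{0..t}|lborel. indicator (bdry_of \<Phi>) (X s \<omega>)) = bdry_clock \<Phi> \<rho> X L t \<omega>)"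

definition transition_op ::
  "(real^'d \<Rightarrow> 'w measure) \<Rightarrow> (real^'d \<Rightarrow> real \<Rightarrow> 'w \<Rightarrow> real^'d) \<Rightarrow>
     real \<Rightarrow> (real^'d \<Rightarrow> real) \<Rightarrow> real^'d \<Rightarrow> real" where
  "transition_op \<Omega> X t f x = (\<integral>\<omega>. f (X x t \<omega>) \<partial>\<Omega> x)"

text \<open>Strongly continuous contraction semigroup on \<open>C0 S\<close> with its supremum norm.\<close>

definition feller_semigroup ::
  "(real^'d) set \<Rightarrow> (real \<Rightarrow> (real^'d \<Rightarrow> real) \<Rightarrow> real^'d \<Rightarrow> real) \<Rightarrow> bool" where
  "feller_semigroup S P \<longleftrightarrow>
     (\<forall>f\<in>C0 S.
        (\<forall>t\<ge>0. P t f \<in> C0 S) \<and>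
        (\<forall>x\<in>S. P 0 f x = f x) \<and>
        (\<forall>s\<ge>0. \<forall>t\<ge>0. \<forall>x\<in>S. P (s + t) f x = P s (P t f) x) \<and>
        (\<forall>t\<ge>0. \<forall>c. (\<forall>x\<in>S. \<bar>f x\<bar> \<le> c) \<longrightarrow> (\<forall>x\<in>S. \<bar>P t f x\<bar> \<le> c)) \<and>
        uniform_limit S (\<lambda>t. P t f) f (at_right 0))"

end

theory Submission imports Defs begin

text \<open>Ito's formula is proved directly on a grid, up to an exit time, for a diffusion driven by two families of
 martingales whose brackets are the clocks \<open>t - \<integral>\<rho>(X)dL\<close> and \<open>L\<close>. The two clocks charge complementary sets (the domain and the
 boundary), so the families are orthogonal. By the sojourn condition and the Wentzell condition both clocks contribute
 \<open>\<A>f dt\<close>, which gives Dynkin's formula \<open>P\<^sub>t f - f = \<integral>\<^sub>0\<^sup>t P\<^sub>s \<A>f ds\<close>; strong continuity of the semigroup turns it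
 into the uniform limit.\<close>

text \<open>Brackets are given within each of the two driving families only, so nothing is known at
  the outset about products across the families. An Ito integral is given through some approximating
  sequence and some bracket; a uniqueness theorem and an isometry inequality come before any
  computation. The function \<open>f\<close> is twice differentiable on the closed domain only,
  which need not be convex: its Taylor expansion up to the boundary rests on mean value estimates
  along detours into the domain. Coefficients are frozen at left ends of grid cells. The boundary
  integrands carry an indicator and jump in time, but at the times charged by their clock they agree
  with a continuous function of \<open>X\<close>. Only expectations are compared, so convergence in
  mean suffices, and one exit time bounds all processes involved. Uniformity in the starting point
  is free: the only rate in the final estimate is that of the semigroup acting on the limit
  function, which lies in \<open>C0\<close>.\<close>

section \<open>Derivatives and Taylor expansion up to the boundary\<close>

lemma partial_on_expand:
 fixes f :: "real^'d => real"
 assumes "f differentiable (at x within S)"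
 shows "(f has_derivative (\<lambda>v. \<Sum>i\<in>UNIV. partial_on S i f x * v $ i)) (at x within S)"
proof -
 let ?D = "frechet_derivative f (at x within S)"
 have D: "(f has_derivative ?D) (at x within S)"
  using assms frechet_derivative_works by blast
 then have lin: "linear ?D" by (rule has_derivative_linear)
 have "?D v = (\<Sum>i\<in>UNIV. partial_on S i f x * v $ i)" for v
 proof -
  have "?D v = ?D (\<Sum>i\<in>UNIV. v $ i *\<^sub>R axis i 1)"
   by (simp add: basis_expansion[of v, unfolded scalar_mult_eq_scaleR])
  also have "\<dots> = (\<Sum>i\<in>UNIV. v $ i *\<^sub>R ?D (axis i 1))"
   by (simp add: linear_sum[OF lin] linear_cmul[OF lin] del: scaleR_eq_0_iff real_scaleR_def)
  finally show ?thesis by (simp add: partial_on_def mult.commute)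
 qed
 then have "?D = (\<lambda>v. \<Sum>i\<in>UNIV. partial_on S i f x * v $ i)" by blast
 then show ?thesis using D by simp
qed

text \<open>The chain rule along the segment needs only derivatives within a set that contains the
  segment, so boundary points of \<open>S\<close> are allowed.\<close>

lemma segment_mean_value:
 fixes u :: "'a::real_normed_vector => real"
 assumes seg: "\<And>s. s \<in> {0..1} ==> x + s *\<^sub>R v \<in> S"
  and der: "\<And>s. s \<in> {0..1} ==> (u has_derivative D (x + s *\<^sub>R v)) (at (x + s *\<^sub>R v) within S)"
 obtains s where "0 < s" "s < 1" "u (x + v) - u x = D (x + s *\<^sub>R v) v"
proof -
 have d: "((\<lambda>s. u (x + s *\<^sub>R v)) has_derivative (\<lambda>h. D (x + s *\<^sub>R v) (h *\<^sub>R v))) (at s within {0..1})"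
  if "s \<in> {0..1}" for s
 proof -
  have "((\<lambda>s. x + s *\<^sub>R v) has_derivative (\<lambda>h. h *\<^sub>R v)) (at s within {0..1})"
   by (auto intro!: derivative_eq_intros)
  moreover have "(u has_derivative D (x + s *\<^sub>R v)) (at (x + s *\<^sub>R v) within (\<lambda>s. x + s *\<^sub>R v) ` {0..1})"
   by (rule has_derivative_subset[OF der[OF that]]) (use seg in auto)
  ultimately show ?thesis by (rule has_derivative_in_compose)
 qed
 have "\<exists>s\<in>{0<..<1}. u (x + 1 *\<^sub>R v) - u (x + 0 *\<^sub>R v) = D (x + s *\<^sub>R v) ((1 - 0) *\<^sub>R v)"
  using mvt_simple[of 0 1 "\<lambda>s. u (x + s *\<^sub>R v)" "\<lambda>s h. D (x + s *\<^sub>R v) (h *\<^sub>R v)"] d by simp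
 then show ?thesis using that by auto
qed

text \<open>Clairaut's theorem: both mixed partials are limits of the same second difference quotient.\<close>

lemma partial_on_symmetric_interior:
 fixes f :: "real^'d => real"
 assumes f: "C2_on S f" and x: "x \<in> interior S"
 shows "partial_on S i (partial_on S j f) x = partial_on S j (partial_on S i f) x"
proof -
 obtain e where e: "e > 0" "cball x e \<subseteq> S"
  using x by (meson mem_interior_cball)
 have df: "(f has_derivative (\<lambda>v. \<Sum>i\<in>UNIV. partial_on S i f z * v $ i)) (at z within S)" if "z \<in> S" for z
  using f that by (intro partial_on_expand) (auto simp: C2_on_def differentiable_on_def)
 have dp: "(partial_on S k f has_derivative (\<lambda>v. \<Sum>i\<in>UNIV. partial_on S i (partial_on S k f) z * v $ i)) (at z within S)"
  if "z \<in> S" for z k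
  using f that by (intro partial_on_expand) (auto simp: C2_on_def differentiable_on_def)
 have sd: "\<exists>z. dist z x <= 2 * h \<and>
   f (x + h *\<^sub>R axis k 1 + h *\<^sub>R axis l 1) - f (x + h *\<^sub>R axis k 1) - f (x + h *\<^sub>R axis l 1) + f x
    = h * (h * partial_on S l (partial_on S k f) z)"
  if h: "0 < h" "2 * h < e" for h and k l :: 'd
 proof -
  let ?v = "h *\<^sub>R axis k 1 :: real^'d" and ?ww = "h *\<^sub>R axis l 1 :: real^'d"
  have inS: "x + s *\<^sub>R ?v + t *\<^sub>R ?ww \<in> S \<and> dist (x + s *\<^sub>R ?v + t *\<^sub>R ?ww) x <= 2 * h"
   if "s \<in> {0..1}" "t \<in> {0..1}" for s t
  proof -
   have "norm (s *\<^sub>R ?v + t *\<^sub>R ?ww) <= s * h + t * h"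
    using norm_triangle_ineq[of "s *\<^sub>R ?v" "t *\<^sub>R ?ww"] that h by (simp add: norm_axis_1)
   also have "\<dots> <= 1 * h + 1 * h" using that h by (intro add_mono mult_right_mono) auto
   finally have *: "norm (s *\<^sub>R ?v + t *\<^sub>R ?ww) <= 2 * h" by simp
   then have "dist (x + s *\<^sub>R ?v + t *\<^sub>R ?ww) x <= 2 * h"
    by (simp add: dist_norm add.assoc)
   then show ?thesis using e(2) h by (auto simp: dist_commute)
  qed
  let ?D = "\<lambda>f z v. \<Sum>i\<in>UNIV. partial_on S i f z * (v::real^'d) $ i"
  \<comment> \<open>A translate of \<open>f\<close> is differentiable within the translate of
    \<open>S\<close> only; the difference of \<open>f\<close> and its translate is therefore handled
    within the intersection of both sets.\<close>
  have dw: "((\<lambda>z. f (z + ?ww)) has_derivative ?D f (z + ?ww)) (at z within (\<lambda>z. z - ?ww) ` S)" if "z + ?ww \<in> S" for z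
  proof -
   have a: "((\<lambda>z. z + ?ww) has_derivative (\<lambda>v. v)) (at z within (\<lambda>z. z - ?ww) ` S)"
    by (auto intro!: derivative_eq_intros)
   have b: "(f has_derivative ?D f (z + ?ww)) (at (z + ?ww) within (\<lambda>z. z + ?ww) ` (\<lambda>z. z - ?ww) ` S)"
    using df[OF that] by (simp add: image_image)
   show ?thesis using has_derivative_in_compose[OF a b] .
  qed
  obtain s where s: "0 < s" "s < 1" and s_eq:
   "(f (x + ?v + ?ww) - f (x + ?v)) - (f (x + ?ww) - f x)
     = ?D f (x + s *\<^sub>R ?v + ?ww) ?v - ?D f (x + s *\<^sub>R ?v) ?v"
  proof (rule segment_mean_value[of x ?v "S \<inter> (\<lambda>z. z - ?ww) ` S" "\<lambda>z. f (z + ?ww) - f z" "\<lambda>z v. ?D f (z + ?ww) v - ?D f z v"])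
   fix s :: real assume s: "s \<in> {0..1}"
   have 1: "x + s *\<^sub>R ?v \<in> S" and 2: "x + s *\<^sub>R ?v + ?ww \<in> S"
    using inS[OF s, of 0] inS[OF s, of 1] by auto
   then show "x + s *\<^sub>R ?v \<in> S \<inter> (\<lambda>z. z - ?ww) ` S"
    by (auto simp: image_iff intro!: bexI[of _ "x + s *\<^sub>R ?v + ?ww"])
   show "((\<lambda>z. f (z + ?ww) - f z) has_derivative (\<lambda>v. ?D f (x + s *\<^sub>R ?v + ?ww) v - ?D f (x + s *\<^sub>R ?v) v))
     (at (x + s *\<^sub>R ?v) within S \<inter> (\<lambda>z. z - ?ww) ` S)"
    by (intro has_derivative_diff has_derivative_subset[OF dw[OF 2]] has_derivative_subset[OF df[OF 1]]) auto
  qed (auto)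
  obtain t where t: "0 < t" "t < 1" and t_eq:
   "partial_on S k f (x + s *\<^sub>R ?v + ?ww) - partial_on S k f (x + s *\<^sub>R ?v)
    = ?D (partial_on S k f) (x + s *\<^sub>R ?v + t *\<^sub>R ?ww) ?ww"
   using inS s by (rule_tac segment_mean_value[of "x + s *\<^sub>R ?v" ?ww S "partial_on S k f" "?D (partial_on S k f)"])
    (auto intro!: dp)
  have ax: "(\<Sum>i\<in>UNIV. c i * (h *\<^sub>R axis m 1 :: real^'d) $ i) = h * c m" for c and m :: 'd
   by (simp add: axis_def if_distrib cong: if_cong)
  have "f (x + ?v + ?ww) - f (x + ?v) - f (x + ?ww) + f x
   = h * (h * partial_on S l (partial_on S k f) (x + s *\<^sub>R ?v + t *\<^sub>R ?ww))"
   using s_eq t_eq unfolding ax by (simp add: algebra_simps)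
  moreover have "dist (x + s *\<^sub>R ?v + t *\<^sub>R ?ww) x <= 2 * h"
   using inS s t by auto
  ultimately show ?thesis by blast
 qed
 \<comment> \<open>The corners and the intermediate points are at distance at most
   \<open>2 * h n\<close> from \<open>x\<close>, hence at most \<open>e / 2\<close>, which keeps
   them in the ball contained in \<open>S\<close>.\<close>
 define h where "h = (\<lambda>n::nat. e / 4 / real (Suc n))"
 have hpos: "0 < h n" "2 * h n < e" for n
 proof -
  show "0 < h n" using e by (simp add: h_def)
  have "h n <= e / 4 / 1" unfolding h_def using e by (intro divide_left_mono) auto
  then show "2 * h n < e" using e by simp
 qed
 have h0: "h \<longlonglongrightarrow> 0"
  unfolding h_def by (intro real_tendsto_divide_at_top[OF tendsto_const] filterlim_compose[OF filterlim_real_sequentially filterlim_Suc])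
 have lim: "(\<lambda>n. (f (x + h n *\<^sub>R axis k 1 + h n *\<^sub>R axis l 1) - f (x + h n *\<^sub>R axis k 1) - f (x + h n *\<^sub>R axis l 1) + f x) / (h n * h n))
   \<longlonglongrightarrow> partial_on S l (partial_on S k f) x" for k l :: 'd
 proof -
  obtain z where z: "dist (z n) x <= 2 * h n" and eq:
   "f (x + h n *\<^sub>R axis k 1 + h n *\<^sub>R axis l 1) - f (x + h n *\<^sub>R axis k 1) - f (x + h n *\<^sub>R axis l 1) + f x
    = h n * (h n * partial_on S l (partial_on S k f) (z n))" for n
   using sd[OF hpos, of _ k l] by metis
  have zx: "z \<longlonglongrightarrow> x"
  proof (rule metric_tendsto_imp_tendsto[OF h0[THEN tendsto_mult_left[of _ _ _ 2]]])
   show "\<forall>\<^sub>F n in sequentially. dist (z n) x <= dist (2 * h n) (2 * 0)"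
    using z hpos by (auto simp: less_imp_le)
  qed
  have zS: "z n \<in> S" for n using z[of n] hpos(2)[of n] e(2) by (auto simp: dist_commute)
  have "continuous_on S (partial_on S l (partial_on S k f))" using f by (simp add: C2_on_def)
  then have "(\<lambda>n. partial_on S l (partial_on S k f) (z n)) \<longlonglongrightarrow> partial_on S l (partial_on S k f) x"
   by (rule continuous_on_tendsto_compose[OF _ zx]) (use zS x interior_subset in auto)
  moreover have "(f (x + h n *\<^sub>R axis k 1 + h n *\<^sub>R axis l 1) - f (x + h n *\<^sub>R axis k 1) - f (x + h n *\<^sub>R axis l 1) + f x) / (h n * h n)
   = partial_on S l (partial_on S k f) (z n)" for n
   unfolding eq using hpos(1)[of n] by simp
  ultimately show ?thesis by simp
 qed
 have "x + h n *\<^sub>R axis i 1 + h n *\<^sub>R axis j 1 = x + h n *\<^sub>R axis j 1 + h n *\<^sub>R axis i 1" for n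
  by simp
 then have "(\<lambda>n. (f (x + h n *\<^sub>R axis j 1 + h n *\<^sub>R axis i 1) - f (x + h n *\<^sub>R axis j 1) - f (x + h n *\<^sub>R axis i 1) + f x) / (h n * h n))
   \<longlonglongrightarrow> partial_on S j (partial_on S i f) x"
  using lim[of i j] by (simp add: algebra_simps)
 with lim[of j i] show ?thesis by (rule LIMSEQ_unique)
qed

text \<open>Two sets are kept apart: derivatives are taken within \<open>S\<close>, while their
  bound is available only on the part of \<open>S\<close> inside \<open>G\<close>.\<close>

lemma segment_bound:
 fixes u :: "'a::real_normed_vector => real"
 assumes seg: "\<And>s. s \<in> {0..1} ==> x + s *\<^sub>R v \<in> S \<inter> G"
  and der: "\<And>z. z \<in> S \<inter> G ==> (u has_derivative D z) (at z within S)"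
  and b: "\<And>z v. z \<in> S \<inter> G ==> \<bar>D z v\<bar> <= b * norm v"
 shows "\<bar>u (x + v) - u x\<bar> <= b * norm v"
proof -
 obtain s where s: "0 < s" "s < 1" "u (x + v) - u x = D (x + s *\<^sub>R v) v"
  using segment_mean_value[of x v S u D] seg der by (metis IntD1)
 then show ?thesis using b[of "x + s *\<^sub>R v" v] seg[of s] by auto
qed

lemma C2_bounded_facts:
 fixes \<Phi> :: "real^'d => real"
 assumes "C2_bounded \<Phi>"
 shows "continuous_on UNIV \<Phi>"
  and "\<And>x. (\<Phi> has_derivative (\<lambda>v. \<Sum>i\<in>UNIV. partial_on UNIV i \<Phi> x * v $ i)) (at x)"
  and "\<And>i. continuous_on UNIV (partial_on UNIV i \<Phi>)"
  and "\<exists>B>0. \<forall>x v. \<bar>\<Sum>i\<in>UNIV. partial_on UNIV i \<Phi> x * v $ i\<bar> <= B * norm v"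
proof -
 have d: "\<Phi> differentiable_on UNIV" "\<And>i. partial_on UNIV i \<Phi> differentiable_on UNIV"
  and b: "\<And>i. bounded (range (partial_on UNIV i \<Phi>))"
  using assms by (auto simp: C2_bounded_def C2_on_def)
 show "continuous_on UNIV \<Phi>" "\<And>i. continuous_on UNIV (partial_on UNIV i \<Phi>)"
  using d differentiable_imp_continuous_on by blast+
 show "\<And>x. (\<Phi> has_derivative (\<lambda>v. \<Sum>i\<in>UNIV. partial_on UNIV i \<Phi> x * v $ i)) (at x)"
  using d(1) by (intro partial_on_expand) (auto simp: differentiable_on_def)
 have "\<forall>i. \<exists>c. \<forall>x. \<bar>partial_on UNIV i \<Phi> x\<bar> <= c"
  using b by (simp add: bounded_iff)
 then obtain c where c: "\<And>i x. \<bar>partial_on UNIV i \<Phi> x\<bar> <= c i" by metis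
 have "\<bar>\<Sum>i\<in>UNIV. partial_on UNIV i \<Phi> x * v $ i\<bar> <= (\<Sum>i\<in>UNIV. \<bar>c i\<bar> + 1) * norm v" for x v
 proof -
  have "\<bar>\<Sum>i\<in>UNIV. partial_on UNIV i \<Phi> x * v $ i\<bar> <= (\<Sum>i\<in>UNIV. (\<bar>c i\<bar> + 1) * norm v)"
  proof (rule order_trans[OF sum_abs sum_mono])
   fix i
   show "\<bar>partial_on UNIV i \<Phi> x * v $ i\<bar> <= (\<bar>c i\<bar> + 1) * norm v"
    unfolding abs_mult using c[of i x] component_le_norm_cart[of v i] by (intro mult_mono) auto
  qed
  then show ?thesis by (simp add: sum_distrib_right)
 qed
 moreover have "(\<Sum>i\<in>(UNIV::'d set). \<bar>c i\<bar> + 1) > 0"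
  by (intro sum_pos) (auto simp: add_nonneg_pos)
 ultimately show "\<exists>B>0. \<forall>x v. \<bar>\<Sum>i\<in>UNIV. partial_on UNIV i \<Phi> x * v $ i\<bar> <= B * norm v" by blast
qed

lemma closed_domain_eq: "closed_domain \<Phi> = {x. \<Phi> x \<ge> 0}"
 by (auto simp: closed_domain_def domain_of_def bdry_of_def)

text \<open>With \<open>\<nu>\<close> the normalised gradient at \<open>p\<close>, the directional
  derivative at \<open>p\<close> is the norm of the gradient. Half of that norm is left as a margin
  for continuity.\<close>

lemma grad_lower_bound_near:
 fixes \<Phi> :: "real^'d => real"
 assumes \<Phi>: "C2_bounded \<Phi>" and p: "(\<chi> i. partial_on UNIV i \<Phi> p) \<noteq> 0"
 obtains \<nu> m r where "norm \<nu> = 1" "m > 0" "r > 0"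
  "\<And>z. dist z p < r ==> (\<Sum>i\<in>UNIV. partial_on UNIV i \<Phi> z * \<nu> $ i) > m"
proof -
 define g where "g = (\<chi> i. partial_on UNIV i \<Phi> p)"
 define \<nu> where "\<nu> = (1 / norm g) *\<^sub>R g"
 have g0: "g \<noteq> 0" using p by (simp add: g_def)
 define Q where "Q z = (\<Sum>i\<in>UNIV. partial_on UNIV i \<Phi> z * \<nu> $ i)" for z
 have "Q p = g \<bullet> \<nu>" by (simp add: Q_def inner_vec_def g_def)
 also have "\<dots> = norm g" using g0 by (simp add: \<nu>_def dot_square_norm power2_eq_square)
 finally have Qp: "Q p > norm g / 2" using g0 by simp
 have "continuous_on UNIV Q" unfolding Q_def
  by (intro continuous_intros C2_bounded_facts(3)[OF \<Phi>])
 then have "(Q \<longlongrightarrow> Q p) (at p)" by (simp add: continuous_on_def)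
 then have "\<forall>\<^sub>F z in at p. Q z > norm g / 2" using Qp by (rule order_tendstoD)
 then obtain r where "r > 0" "\<And>z. z \<noteq> p ==> dist z p < r ==> Q z > norm g / 2"
  by (auto simp: eventually_at)
 moreover have "norm \<nu> = 1" "0 < norm g / 2" using g0 by (simp_all add: \<nu>_def)
 moreover have "norm g / 2 < Q z" if "dist z p < r" for z
  using that Qp \<open>\<And>z. z \<noteq> p ==> dist z p < r ==> Q z > norm g / 2\<close> by (cases "z = p") auto
 ultimately show ?thesis using that[of \<nu> "norm g / 2" r] \<open>r > 0\<close> unfolding Q_def by blast
qed

text \<open>The increment is taken along the segments \<open>x\<close>, \<open>x + a \<nu>\<close>, \<open>y + a \<nu>\<close>, \<open>y\<close>, where \<open>\<nu>\<close> is the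
 normal at the boundary point \<open>p\<close>; they stay in the domain when \<open>a\<close> is a large multiple of
 \<open>norm (y - x)\<close>.\<close>

lemma mean_value_near:
 fixes \<Phi> :: "real^'d => real"
 assumes \<Phi>: "C2_bounded \<Phi>" and nz: "\<And>x. \<Phi> x = 0 ==> (\<chi> i. partial_on UNIV i \<Phi> x) \<noteq> 0"
  and p: "p \<in> closed_domain \<Phi>"
 obtains c where "c \<ge> 1" "\<forall>R>0. \<exists>r>0. \<forall>x\<in>closed_domain \<Phi>. \<forall>y\<in>closed_domain \<Phi>. dist x p < r --> dist y p < r -->
   (\<forall>u D b. (\<forall>z\<in>closed_domain \<Phi>. dist z p < R --> dist z x <= c * dist y x -->
    (u has_derivative D z) (at z within closed_domain \<Phi>) \<and> (\<forall>v. \<bar>D z v\<bar> <= b * norm v)) -->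
    \<bar>u y - u x\<bar> <= c * b * dist y x)"
proof (cases "\<Phi> p = 0")
 case False
 let ?S = "closed_domain \<Phi>"
 have "\<Phi> p > 0" using p False by (simp add: closed_domain_eq)
 have "open {x. \<Phi> x > 0}" using C2_bounded_facts(1)[OF \<Phi>] by (simp add: open_Collect_less)
 then obtain r0 where r0: "r0 > 0" "ball p r0 \<subseteq> {x. \<Phi> x > 0}"
  using \<open>\<Phi> p > 0\<close> by (metis mem_Collect_eq openE)
 show thesis
 proof (rule that[of 1], simp, intro allI impI)
  fix R :: real assume R: "R > 0"
  show "\<exists>r>0. \<forall>x\<in>?S. \<forall>y\<in>?S. dist x p < r --> dist y p < r -->
   (\<forall>u D b. (\<forall>z\<in>?S. dist z p < R --> dist z x <= 1 * dist y x -->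
    (u has_derivative D z) (at z within ?S) \<and> (\<forall>v. \<bar>D z v\<bar> <= b * norm v)) -->
    \<bar>u y - u x\<bar> <= 1 * b * dist y x)"
  proof (intro exI[of _ "min r0 R"] conjI ballI impI allI)
   fix x y u D b assume x: "dist x p < min r0 R" and y: "dist y p < min r0 R"
    and H: "\<forall>z\<in>?S. dist z p < R --> dist z x <= 1 * dist y x -->
    (u has_derivative D z) (at z within ?S) \<and> (\<forall>v. \<bar>D z v\<bar> <= b * norm v)"
   have "\<bar>u (x + (y - x)) - u x\<bar> <= b * norm (y - x)"
   proof (rule segment_bound[where S="?S" and G="{z. dist z p < R \<and> dist z x <= dist y x}" and D=D])
    fix s :: real assume s: "s \<in> {0..1}"
    have "x + s *\<^sub>R (y - x) \<in> ball p (min r0 R)"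
     using convexD[OF convex_ball, of x p "min r0 R" y "1 - s" s] x y s
     by (simp add: dist_commute algebra_simps)
    moreover have "dist (x + s *\<^sub>R (y - x)) x <= dist y x"
     using s by (simp add: dist_norm mult_left_le_one_le)
    ultimately show "x + s *\<^sub>R (y - x) \<in> ?S \<inter> {z. dist z p < R \<and> dist z x <= dist y x}"
     using r0 by (auto simp: closed_domain_eq dist_commute subset_iff less_imp_le)
   qed (use H in auto)
   then show "\<bar>u y - u x\<bar> <= 1 * b * dist y x" by (simp add: dist_norm)
  qed (use r0 R in auto)
 qed
next
 case True
 let ?S = "closed_domain \<Phi>"
 obtain \<nu> m r0 where \<nu>: "norm \<nu> = 1" and m: "m > 0" and r0: "r0 > 0"
  and Q: "\<And>z. dist z p < r0 ==> (\<Sum>i\<in>UNIV. partial_on UNIV i \<Phi> z * \<nu> $ i) > m"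
  using grad_lower_bound_near[OF \<Phi> nz[OF True]] by blast
 obtain B where B: "B > 0" "\<And>x v. \<bar>\<Sum>i\<in>UNIV. partial_on UNIV i \<Phi> x * v $ i\<bar> <= B * norm v"
  using C2_bounded_facts(4)[OF \<Phi>] by blast
 \<comment> \<open>Along \<open>\<nu>\<close> the function \<open>\<Phi>\<close> rises at rate at
   least \<open>m\<close>, and over the middle segment it drops by at most
   \<open>B * norm (y - x)\<close>. A shift by \<open>k * norm (y - x)\<close> compensates exactly
   this drop.\<close>
 define k where "k = B / m"
 have k: "k > 0" using B m by (simp add: k_def)
 \<comment> \<open>The three segments have total length \<open>c * norm (y - x)\<close>, so the same
   \<open>c\<close> bounds the increment and the distance from \<open>x\<close> at which derivatives
   are required. It does not depend on \<open>R\<close>.\<close>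
 define c where "c = 2 * k + 1"
 have up: "\<Phi> (x + t *\<^sub>R \<nu>) \<ge> \<Phi> x + m * t" if "t \<ge> 0" "\<And>s. s \<in> {0..1} ==> dist (x + s *\<^sub>R t *\<^sub>R \<nu>) p < r0" for x t
 proof (cases "t = 0")
  case False
  obtain s where s: "0 < s" "s < 1" and s_eq: "\<Phi> (x + t *\<^sub>R \<nu>) - \<Phi> x = (\<Sum>i\<in>UNIV. partial_on UNIV i \<Phi> (x + s *\<^sub>R t *\<^sub>R \<nu>) * (t *\<^sub>R \<nu>) $ i)"
   by (rule segment_mean_value[of x "t *\<^sub>R \<nu>" UNIV \<Phi> "\<lambda>z v. \<Sum>i\<in>UNIV. partial_on UNIV i \<Phi> z * v $ i"])
    (auto intro!: C2_bounded_facts(2)[OF \<Phi>])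
  note s_eq
  also have "(\<Sum>i\<in>UNIV. partial_on UNIV i \<Phi> (x + s *\<^sub>R t *\<^sub>R \<nu>) * (t *\<^sub>R \<nu>) $ i) = t * (\<Sum>i\<in>UNIV. partial_on UNIV i \<Phi> (x + s *\<^sub>R t *\<^sub>R \<nu>) * \<nu> $ i)"
   by (simp add: sum_distrib_left algebra_simps)
  also have "\<dots> \<ge> t * m"
   using Q[OF that(2)[of s]] s that(1) by (intro mult_left_mono) auto
  finally show ?thesis by (simp add: mult.commute)
 qed simp
 have lip: "\<bar>\<Phi> (x + v) - \<Phi> x\<bar> <= B * norm v" for x v
  using segment_bound[of x v UNIV UNIV \<Phi> "\<lambda>z v. \<Sum>i\<in>UNIV. partial_on UNIV i \<Phi> z * v $ i" B]
   C2_bounded_facts(2)[OF \<Phi>] B by simp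
 show thesis
 proof (rule that[of c])
  show "1 <= c" using k by (simp add: c_def)
 next
  show "\<forall>R>0. \<exists>r>0. \<forall>x\<in>?S. \<forall>y\<in>?S. dist x p < r --> dist y p < r -->
   (\<forall>u D b. (\<forall>z\<in>?S. dist z p < R --> dist z x <= c * dist y x -->
    (u has_derivative D z) (at z within ?S) \<and> (\<forall>v. \<bar>D z v\<bar> <= b * norm v)) -->
    \<bar>u y - u x\<bar> <= c * b * dist y x)"
  proof (intro allI impI)
  fix R :: real assume R: "R > 0"
  \<comment> \<open>The detour stays within \<open>c * (2 * r)\<close>, that is half of
    \<open>min r0 R\<close>, of \<open>x\<close>, and \<open>x\<close> is within a quarter of it of
    \<open>p\<close>.\<close>
  define r where "r = min r0 R / (4 * c)"
  have c1: "c \<ge> 1" using k by (simp add: c_def)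
  have r: "r > 0" using r0 R c1 by (simp add: r_def)
  show "\<exists>r>0. \<forall>x\<in>?S. \<forall>y\<in>?S. dist x p < r --> dist y p < r -->
   (\<forall>u D b. (\<forall>z\<in>?S. dist z p < R --> dist z x <= c * dist y x -->
    (u has_derivative D z) (at z within ?S) \<and> (\<forall>v. \<bar>D z v\<bar> <= b * norm v)) -->
    \<bar>u y - u x\<bar> <= c * b * dist y x)"
  proof (intro exI[of _ r] conjI ballI impI allI r)
   fix x y u D b assume xS: "x \<in> ?S" and yS: "y \<in> ?S" and x: "dist x p < r" and y: "dist y p < r"
    and H: "\<forall>z\<in>?S. dist z p < R --> dist z x <= c * dist y x -->
    (u has_derivative D z) (at z within ?S) \<and> (\<forall>v. \<bar>D z v\<bar> <= b * norm v)"
   define l where "l = dist y x"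
   have l: "0 <= l" "l < 2 * r" unfolding l_def using x y dist_triangle[of y x p] by (auto simp: dist_commute)
   define a where "a = k * l"
   have a: "a \<ge> 0" using k l by (simp add: a_def)
   have cl: "c * l = 2 * a + l" by (simp add: c_def a_def algebra_simps)
   have nyx: "norm (y - x) = l" by (simp add: l_def dist_norm)
   let ?G = "{z. dist z p < R \<and> dist z x <= c * dist y x}"
   have near: "dist z p < min r0 R" if "dist z x <= c * l" for z
   proof -
    have "c * l <= c * (2 * r)" using l c1 by (intro mult_left_mono) auto
    also have "\<dots> = min r0 R / 2" using c1 by (simp add: r_def)
    finally have "dist z x <= min r0 R / 2" using that by simp
    moreover have "r <= min r0 R / 4" unfolding r_def using r0 R c1 by (intro divide_left_mono) auto
    ultimately show ?thesis using x dist_triangle[of z p x] r0 R by linarith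
   qed
   have sa: "s * a <= a" "s * l <= l" if "s \<in> {0..1}" for s
    using that a l by (auto intro: mult_left_le_one_le)
   have n1: "dist (x + s *\<^sub>R a *\<^sub>R \<nu>) x <= c * l" if "s \<in> {0..1}" for s
   proof -
    have "dist (x + s *\<^sub>R a *\<^sub>R \<nu>) x = s * a" using that a \<nu> by (simp add: dist_norm)
    then show ?thesis using sa[OF that] cl a l by linarith
   qed
   have n2: "dist (x + a *\<^sub>R \<nu> + s *\<^sub>R (y - x)) x <= c * l" if "s \<in> {0..1}" for s
   proof -
    have "dist (x + a *\<^sub>R \<nu> + s *\<^sub>R (y - x)) x = norm (a *\<^sub>R \<nu> + s *\<^sub>R (y - x))"
     by (simp add: dist_norm add.assoc)
    also have "\<dots> <= a + s * l"
     using norm_triangle_ineq[of "a *\<^sub>R \<nu>" "s *\<^sub>R (y - x)"] a \<nu> that by (simp add: nyx)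
    finally show ?thesis using sa[OF that] cl a by linarith
   qed
   have n3: "dist (y + s *\<^sub>R a *\<^sub>R \<nu>) x <= c * l" if "s \<in> {0..1}" for s
   proof -
    have "y + s *\<^sub>R a *\<^sub>R \<nu> - x = (y - x) + s *\<^sub>R (a *\<^sub>R \<nu>)" by simp
    then have "dist (y + s *\<^sub>R a *\<^sub>R \<nu>) x = norm ((y - x) + s *\<^sub>R (a *\<^sub>R \<nu>))"
     by (simp only: dist_norm)
    also have "\<dots> <= l + s * a"
     using norm_triangle_ineq[of "y - x" "s *\<^sub>R (a *\<^sub>R \<nu>)"] a \<nu> that by (simp add: nyx)
    finally show ?thesis using sa[OF that] cl a by linarith
   qed
   have up': "ww + s *\<^sub>R a *\<^sub>R \<nu> \<in> ?S \<and> \<Phi> (ww + s *\<^sub>R a *\<^sub>R \<nu>) \<ge> m * (s * a)"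
    if "ww \<in> ?S" "s \<in> {0..1}" "\<And>s. s \<in> {0..1} ==> dist (ww + s *\<^sub>R a *\<^sub>R \<nu>) x <= c * l" for ww s
   proof -
    have "\<Phi> ww + m * (s * a) <= \<Phi> (ww + (s * a) *\<^sub>R \<nu>)"
    proof (rule up)
     show "0 <= s * a" using that a by simp
     fix s' :: real assume "s' \<in> {0..1}"
     then have "s' * s \<in> {0..1}" using that(2) by (auto simp: mult_le_one)
     then show "dist (ww + s' *\<^sub>R (s * a) *\<^sub>R \<nu>) p < r0"
      using near[OF that(3)[of "s' * s"]] by (simp add: mult.assoc)
    qed
    moreover have "m * (s * a) \<ge> 0" using m that a by simp
    ultimately show ?thesis using that(1) by (auto simp: closed_domain_eq)
   qed
   have i1: "x + s *\<^sub>R a *\<^sub>R \<nu> \<in> ?S \<inter> ?G" if "s \<in> {0..1}" for s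
    using up'[OF xS that n1] near[OF n1[OF that]] n1[OF that] by (auto simp: l_def)
   have i3: "y + s *\<^sub>R a *\<^sub>R \<nu> \<in> ?S \<inter> ?G" if "s \<in> {0..1}" for s
    using up'[OF yS that n3] near[OF n3[OF that]] n3[OF that] by (auto simp: l_def)
   have i2: "x + a *\<^sub>R \<nu> + s *\<^sub>R (y - x) \<in> ?S \<inter> ?G" if "s \<in> {0..1}" for s
   proof -
    have "\<Phi> (x + a *\<^sub>R \<nu>) \<ge> m * a" using up'[OF xS _ n1, of 1] by simp
    moreover have "m * a = B * l" using m by (simp add: a_def k_def)
    moreover have "B * norm (s *\<^sub>R (y - x)) <= B * l"
     using that B(1) by (intro mult_left_mono) (auto simp: l_def dist_norm mult_left_le_one_le)
    ultimately have "\<Phi> (x + a *\<^sub>R \<nu> + s *\<^sub>R (y - x)) \<ge> 0"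
     using lip[of "x + a *\<^sub>R \<nu>" "s *\<^sub>R (y - x)"] by linarith
    then show ?thesis using near[OF n2[OF that]] n2[OF that] by (auto simp: l_def closed_domain_eq)
   qed
   have b1: "\<bar>u (x + a *\<^sub>R \<nu>) - u x\<bar> <= b * norm (a *\<^sub>R \<nu>)"
    by (rule segment_bound[where S="?S" and G="?G" and D=D]) (use i1 H in auto)
   have b2: "\<bar>u (x + a *\<^sub>R \<nu> + (y - x)) - u (x + a *\<^sub>R \<nu>)\<bar> <= b * norm (y - x)"
    by (rule segment_bound[where S="?S" and G="?G" and D=D]) (use i2 H in auto)
   have b3: "\<bar>u (y + a *\<^sub>R \<nu>) - u y\<bar> <= b * norm (a *\<^sub>R \<nu>)"
    by (rule segment_bound[where S="?S" and G="?G" and D=D]) (use i3 H in auto)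
   have b2': "\<bar>u (y + a *\<^sub>R \<nu>) - u (x + a *\<^sub>R \<nu>)\<bar> <= b * l"
    using b2 unfolding nyx by (simp add: algebra_simps)
   have na: "norm (a *\<^sub>R \<nu>) = a" using a \<nu> by simp
   have "\<bar>u y - u x\<bar> <= b * a + b * l + b * a"
    using b1 b2' b3 unfolding na by linarith
   also have "\<dots> = b * (c * l)" by (simp add: cl algebra_simps)
   finally show "\<bar>u y - u x\<bar> <= c * b * dist y x" by (simp add: l_def mult_ac)
  qed
  qed
 qed
qed

text \<open>A boundary point is approached from the interior along the direction in which
  \<open>\<Phi>\<close> grows. The mixed partials agree on the way and are continuous up to the
  boundary, so they agree in the limit.\<close>

lemma partial_on_symmetric:
 fixes \<Phi> f :: "real^'d => real"
 assumes \<Phi>: "C2_bounded \<Phi>" and nz: "\<And>x. \<Phi> x = 0 ==> (\<chi> i. partial_on UNIV i \<Phi> x) \<noteq> 0"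
  and f: "C2_on (closed_domain \<Phi>) f" and p: "p \<in> closed_domain \<Phi>"
 shows "partial_on (closed_domain \<Phi>) i (partial_on (closed_domain \<Phi>) j f) p
    = partial_on (closed_domain \<Phi>) j (partial_on (closed_domain \<Phi>) i f) p"
proof -
 let ?S = "closed_domain \<Phi>"
 let ?q = "\<lambda>i j. partial_on ?S i (partial_on ?S j f)"
 have int: "x \<in> interior ?S" if "\<Phi> x > 0" for x
 proof -
  have "open {x. \<Phi> x > 0}" using C2_bounded_facts(1)[OF \<Phi>] by (simp add: open_Collect_less)
  then show ?thesis using that by (intro interiorI[of "{x. \<Phi> x > 0}"]) (auto simp: closed_domain_eq)
 qed
 show ?thesis
 proof (cases "\<Phi> p > 0")
  case True then show ?thesis using partial_on_symmetric_interior[OF f int] by blast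
 next
  case False
  then have p0: "\<Phi> p = 0" using p by (simp add: closed_domain_eq)
  obtain \<nu> m r where \<nu>: "norm \<nu> = 1" and m: "m > 0" and r: "r > 0"
   and Q: "\<And>z. dist z p < r ==> (\<Sum>i\<in>UNIV. partial_on UNIV i \<Phi> z * \<nu> $ i) > m"
   using grad_lower_bound_near[OF \<Phi> nz[OF p0]] by blast
  have pos: "\<Phi> (p + t *\<^sub>R \<nu>) > 0" if t: "0 < t" "t < r" for t
  proof -
   obtain s where s: "0 < s" "s < 1" and s_eq: "\<Phi> (p + t *\<^sub>R \<nu>) - \<Phi> p = (\<Sum>i\<in>UNIV. partial_on UNIV i \<Phi> (p + s *\<^sub>R t *\<^sub>R \<nu>) * (t *\<^sub>R \<nu>) $ i)"
    by (rule segment_mean_value[of p "t *\<^sub>R \<nu>" UNIV \<Phi> "\<lambda>z v. \<Sum>i\<in>UNIV. partial_on UNIV i \<Phi> z * v $ i"])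
     (auto intro!: C2_bounded_facts(2)[OF \<Phi>])
   note s_eq
   also have "(\<Sum>i\<in>UNIV. partial_on UNIV i \<Phi> (p + s *\<^sub>R t *\<^sub>R \<nu>) * (t *\<^sub>R \<nu>) $ i)
     = t * (\<Sum>i\<in>UNIV. partial_on UNIV i \<Phi> (p + s *\<^sub>R t *\<^sub>R \<nu>) * \<nu> $ i)"
    by (simp add: sum_distrib_left algebra_simps)
   finally have eq: "\<Phi> (p + t *\<^sub>R \<nu>) - \<Phi> p = t * (\<Sum>i\<in>UNIV. partial_on UNIV i \<Phi> (p + s *\<^sub>R t *\<^sub>R \<nu>) * \<nu> $ i)" .
   have "s * t < 1 * r" using s t by (intro mult_strict_mono) auto
   then have "dist (p + s *\<^sub>R t *\<^sub>R \<nu>) p < r" using s t \<nu> by (simp add: dist_norm)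
   then have "(\<Sum>i\<in>UNIV. partial_on UNIV i \<Phi> (p + s *\<^sub>R t *\<^sub>R \<nu>) * \<nu> $ i) > 0" using Q m by fastforce
   then show ?thesis using eq p0 t by simp
  qed
  have lim: "((\<lambda>t. ?q i j (p + t *\<^sub>R \<nu>)) \<longlongrightarrow> ?q i j p) (at_right 0)" for i j
  proof -
   have "continuous_on ?S (?q i j)" using f by (simp add: C2_on_def)
   moreover have "((\<lambda>t. p + t *\<^sub>R \<nu>) \<longlongrightarrow> p) (at_right 0)"
    by (auto intro!: tendsto_eq_intros)
   moreover have "\<forall>\<^sub>F t in at_right 0. p + t *\<^sub>R \<nu> \<in> ?S"
    unfolding eventually_at_right_field using pos r by (intro exI[of _ r]) (auto simp: closed_domain_eq less_imp_le)
   ultimately show ?thesis using continuous_on_tendsto_compose p by blast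
  qed
  have "\<forall>\<^sub>F t in at_right 0. ?q i j (p + t *\<^sub>R \<nu>) = ?q j i (p + t *\<^sub>R \<nu>)"
   unfolding eventually_at_right_field
   by (intro exI[of _ r] conjI allI impI r partial_on_symmetric_interior[OF f int] pos) auto
  then have "((\<lambda>t. ?q j i (p + t *\<^sub>R \<nu>)) \<longlongrightarrow> ?q i j p) (at_right 0)"
   using lim[of i j] by (rule Lim_transform_eventually[rotated])
  then show ?thesis using lim[of j i] tendsto_unique trivial_limit_at_right_real by blast
 qed
qed

lemma sum_abs_component_le:
 fixes ww :: "real^'d"
 assumes "\<And>i. \<bar>a i\<bar> <= e"
 shows "\<bar>\<Sum>i\<in>UNIV. a i * ww $ i\<bar> <= real CARD('d) * e * norm ww"
proof -
 have e: "e \<ge> 0" using assms[of undefined] by linarith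
 have "\<bar>\<Sum>i\<in>UNIV. a i * ww $ i\<bar> <= (\<Sum>i\<in>(UNIV::'d set). e * norm ww)"
  by (rule order_trans[OF sum_abs sum_mono])
   (auto simp: abs_mult intro!: mult_mono assms component_le_norm_cart e)
 then show ?thesis by simp
qed

lemma taylor2_local:
 fixes \<Phi> f :: "real^'d => real"
 assumes \<Phi>: "C2_bounded \<Phi>" and nz: "\<And>x. \<Phi> x = 0 ==> (\<chi> i. partial_on UNIV i \<Phi> x) \<noteq> 0"
  and f: "C2_on (closed_domain \<Phi>) f" and p: "p \<in> closed_domain \<Phi>" and e: "\<epsilon> > 0"
 shows "\<exists>r>0. \<forall>x\<in>closed_domain \<Phi>. \<forall>y\<in>closed_domain \<Phi>. dist x p < r --> dist y p < r -->
  \<bar>f y - f x - (\<Sum>i\<in>UNIV. partial_on (closed_domain \<Phi>) i f x * (y - x) $ i)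
   - 1/2 * (\<Sum>i\<in>UNIV. \<Sum>j\<in>UNIV. partial_on (closed_domain \<Phi>) i (partial_on (closed_domain \<Phi>) j f) x * (y - x) $ i * (y - x) $ j)\<bar>
   <= \<epsilon> * (dist y x)\<^sup>2"
proof -
 let ?S = "closed_domain \<Phi>"
 let ?p = "\<lambda>i. partial_on ?S i f" and ?q = "\<lambda>i j. partial_on ?S i (partial_on ?S j f)"
 define H where "H i j = ?q i j p" for i j
 have Hs: "H i j = H j i" for i j unfolding H_def by (rule partial_on_symmetric[OF \<Phi> nz f p])
 obtain c where c: "c \<ge> 1" and mv: "\<forall>R>0. \<exists>r>0. \<forall>x\<in>closed_domain \<Phi>. \<forall>y\<in>closed_domain \<Phi>. dist x p < r --> dist y p < r -->
   (\<forall>u D b. (\<forall>z\<in>closed_domain \<Phi>. dist z p < R --> dist z x <= c * dist y x -->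
    (u has_derivative D z) (at z within closed_domain \<Phi>) \<and> (\<forall>v. \<bar>D z v\<bar> <= b * norm v)) -->
    \<bar>u y - u x\<bar> <= c * b * dist y x)"
  using mean_value_near[OF \<Phi> nz p] by blast
 define d where "d = real CARD('d)"
 have d: "d > 0" by (simp add: d_def)
 \<comment> \<open>The first part of the denominator comes from the two mean value estimates, the
   second from the final exchange of the Hessian at \<open>p\<close> for the one at
   \<open>x\<close>.\<close>
 define e' where "e' = \<epsilon> / (c ^ 3 * d ^ 2 + d ^ 2)"
 have cd: "c ^ 3 * d ^ 2 + d ^ 2 > 0" using c d by (simp add: add_pos_pos)
 have e': "e' > 0" using e cd by (simp add: e'_def)
 have "\<exists>R>0. \<forall>z\<in>?S. dist z p < R --> \<bar>?q i j z - H i j\<bar> <= e'" for i j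
 proof -
  have "continuous_on ?S (?q i j)" using f by (simp add: C2_on_def)
  then show ?thesis using p e' unfolding continuous_on_iff H_def dist_real_def by (meson less_imp_le)
 qed
 then obtain R0 where R0: "\<And>i j. R0 i j > 0" "\<And>i j z. z \<in> ?S ==> dist z p < R0 i j ==> \<bar>?q i j z - H i j\<bar> <= e'"
  by metis
 define R where "R = Min (range (\<lambda>(i, j). R0 i j))"
 have R: "R > 0" unfolding R_def using R0(1) by (subst Min_gr_iff) auto
 have RH: "\<bar>?q i j z - H i j\<bar> <= e'" if "z \<in> ?S" "dist z p < R" for i j z
 proof -
  have "R <= R0 i j" unfolding R_def by (rule Min_le) auto
  then show ?thesis using R0(2) that by force
 qed
 have fdiff: "f differentiable (at z within ?S)" "?p i differentiable (at z within ?S)" if "z \<in> ?S" for z i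
  using f that by (auto simp: C2_on_def differentiable_on_def)
 define P where "P i z = ?p i z - (\<Sum>j\<in>UNIV. H i j * (z - p) $ j)" for i z
 have dP: "(P i has_derivative (\<lambda>v. \<Sum>j\<in>UNIV. (?q j i z - H j i) * v $ j)) (at z within ?S)" if "z \<in> ?S" for i z
 proof -
  have "(P i has_derivative (\<lambda>v. (\<Sum>j\<in>UNIV. ?q j i z * v $ j) - (\<Sum>j\<in>UNIV. H i j * v $ j))) (at z within ?S)"
   unfolding P_def
   by (auto intro!: derivative_eq_intros partial_on_expand fdiff that has_derivative_eq_rhs[OF bounded_linear_imp_has_derivative[OF bounded_linear_vec_nth]])
  then show ?thesis
   by (rule has_derivative_eq_rhs) (auto simp: sum_subtractf[symmetric] algebra_simps Hs)
 qed
 obtain r1 where r1: "r1 > 0" and P1: "\<And>x y i. x \<in> ?S ==> y \<in> ?S ==> dist x p < r1 ==> dist y p < r1 ==>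
   \<bar>P i y - P i x\<bar> <= c * (d * e') * dist y x"
 proof -
  obtain r where r: "r > 0" and m: "\<forall>x\<in>?S. \<forall>y\<in>?S. dist x p < r --> dist y p < r -->
   (\<forall>u D b. (\<forall>z\<in>?S. dist z p < R --> dist z x <= c * dist y x -->
    (u has_derivative D z) (at z within ?S) \<and> (\<forall>v. \<bar>D z v\<bar> <= b * norm v)) -->
    \<bar>u y - u x\<bar> <= c * b * dist y x)" using mv R by blast
  have "\<bar>P i y - P i x\<bar> <= c * (d * e') * dist y x"
   if "x \<in> ?S" "y \<in> ?S" "dist x p < r" "dist y p < r" for x y i
  proof (rule m[rule_format, OF that(1,2,3,4)])
   fix z assume z: "z \<in> ?S" "dist z p < R"
   have "\<bar>\<Sum>j\<in>UNIV. (?q j i z - H j i) * v $ j\<bar> <= d * e' * norm v" for v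
    unfolding d_def by (rule sum_abs_component_le) (rule RH[OF z])
   then show "(P i has_derivative (\<lambda>v. \<Sum>j\<in>UNIV. (?q j i z - H j i) * v $ j)) (at z within ?S) \<and>
     (\<forall>v. \<bar>\<Sum>j\<in>UNIV. (?q j i z - H j i) * v $ j\<bar> <= d * e' * norm v)"
    using dP[OF z(1)] by blast
  qed
  then show ?thesis using that r by blast
 qed
 have m0: "0 < min r1 R" using r1 R by simp
 \<comment> \<open>The radius is asked for with \<open>min r1 R\<close> as the admissible region, so
   that the Lipschitz bound \<open>P1\<close> holds at every intermediate point of the second
   estimate.\<close>
 obtain r2 where r2: "r2 > 0" and m2: "\<forall>x\<in>?S. \<forall>y\<in>?S. dist x p < r2 --> dist y p < r2 -->
   (\<forall>u D b. (\<forall>z\<in>?S. dist z p < min r1 R --> dist z x <= c * dist y x -->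
    (u has_derivative D z) (at z within ?S) \<and> (\<forall>v. \<bar>D z v\<bar> <= b * norm v)) -->
    \<bar>u y - u x\<bar> <= c * b * dist y x)" using mv[rule_format, OF m0] by blast
 define h where "h z = f z - 1/2 * (\<Sum>i\<in>UNIV. \<Sum>j\<in>UNIV. H i j * (z - p) $ i * (z - p) $ j)" for z
 have dh: "(h has_derivative (\<lambda>v. \<Sum>i\<in>UNIV. P i z * v $ i)) (at z within ?S)" if "z \<in> ?S" for z
 proof -
  have "(h has_derivative (\<lambda>v. (\<Sum>i\<in>UNIV. ?p i z * v $ i)
    - 1/2 * (\<Sum>i\<in>UNIV. \<Sum>j\<in>UNIV. H i j * (z - p) $ i * v $ j + H i j * v $ i * (z - p) $ j))) (at z within ?S)"
   unfolding h_def
   by (auto intro!: derivative_eq_intros partial_on_expand fdiff that bounded_linear_imp_has_derivative[OF bounded_linear_vec_nth])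
  moreover have "(\<Sum>i\<in>UNIV. \<Sum>j\<in>UNIV. H i j * (z - p) $ i * v $ j + H i j * v $ i * (z - p) $ j)
    = 2 * (\<Sum>i\<in>UNIV. \<Sum>j\<in>UNIV. H i j * (z - p) $ j * v $ i)" for v
  proof -
   have "(\<Sum>i\<in>UNIV. \<Sum>j\<in>UNIV. H i j * (z - p) $ i * v $ j) = (\<Sum>i\<in>UNIV. \<Sum>j\<in>UNIV. H i j * (z - p) $ j * v $ i)"
    by (subst sum.swap) (simp add: Hs mult_ac cong: sum.cong)
   then show ?thesis by (simp add: sum.distrib mult_ac)
  qed
  ultimately show ?thesis
   by (elim has_derivative_eq_rhs) (auto simp: P_def sum_subtractf sum_distrib_right left_diff_distrib)
 qed
 show ?thesis
 proof (intro exI[of _ "Min {r1, r2, R}"] conjI ballI impI)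
  show "0 < Min {r1, r2, R}" using r1 r2 R by auto
  fix x y assume x: "x \<in> ?S" "dist x p < Min {r1, r2, R}" and y: "y \<in> ?S" "dist y p < Min {r1, r2, R}"
  let ?ww = "y - x"
  \<comment> \<open>Once the linear part at \<open>x\<close> is removed, the gradient is
    \<open>P i z - P i x\<close>. Intermediate points lie within \<open>c * dist y x\<close> of
    \<open>x\<close>, which gives this bound; a further factor \<open>c * dist y x\<close> yields
    \<open>c ^ 3\<close>.\<close>
  define b where "b = d * (c * (d * e') * (c * dist y x))"
  have "\<bar>(h y - (\<Sum>i\<in>UNIV. P i x * y $ i)) - (h x - (\<Sum>i\<in>UNIV. P i x * x $ i))\<bar> <= c * b * dist y x"
  proof (rule m2[rule_format, OF x(1) y(1)])
   fix z assume z: "z \<in> ?S" "dist z p < min r1 R" "dist z x <= c * dist y x"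
   have "((\<lambda>z. h z - (\<Sum>i\<in>UNIV. P i x * z $ i)) has_derivative (\<lambda>v. (\<Sum>i\<in>UNIV. P i z * v $ i) - (\<Sum>i\<in>UNIV. P i x * v $ i))) (at z within ?S)"
    by (auto intro!: derivative_eq_intros dh z bounded_linear_imp_has_derivative[OF bounded_linear_vec_nth])
   then have *: "((\<lambda>z. h z - (\<Sum>i\<in>UNIV. P i x * z $ i)) has_derivative (\<lambda>v. \<Sum>i\<in>UNIV. (P i z - P i x) * v $ i)) (at z within ?S)"
    by (simp add: sum_subtractf left_diff_distrib)
   have "\<bar>P i z - P i x\<bar> <= c * (d * e') * (c * dist y x)" for i
   proof -
    have "\<bar>P i z - P i x\<bar> <= c * (d * e') * dist z x" using P1 x z by simp
    also have "\<dots> <= c * (d * e') * (c * dist y x)" using z c d e' by (intro mult_left_mono) auto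
    finally show ?thesis .
   qed
   then have "\<bar>\<Sum>i\<in>UNIV. (P i z - P i x) * v $ i\<bar> <= b * norm v" for v
    unfolding b_def d_def by (rule sum_abs_component_le)
   then show "((\<lambda>z. h z - (\<Sum>i\<in>UNIV. P i x * z $ i)) has_derivative (\<lambda>v. \<Sum>i\<in>UNIV. (P i z - P i x) * v $ i)) (at z within ?S) \<and>
    (\<forall>v. \<bar>\<Sum>i\<in>UNIV. (P i z - P i x) * v $ i\<bar> <= b * norm v)" using * by blast
  qed (use x y in auto)
  also have "c * b * dist y x = c ^ 3 * d ^ 2 * e' * (dist y x)\<^sup>2"
   by (simp add: b_def power2_eq_square power3_eq_cube)
  also have "(h y - (\<Sum>i\<in>UNIV. P i x * y $ i)) - (h x - (\<Sum>i\<in>UNIV. P i x * x $ i))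
    = f y - f x - (\<Sum>i\<in>UNIV. ?p i x * ?ww $ i) - 1/2 * (\<Sum>i\<in>UNIV. \<Sum>j\<in>UNIV. H i j * ?ww $ i * ?ww $ j)"
  proof -
   have 1: "(\<Sum>i\<in>UNIV. \<Sum>j\<in>UNIV. H i j * (x - p) $ i * ?ww $ j) = (\<Sum>i\<in>UNIV. \<Sum>j\<in>UNIV. H i j * (x - p) $ j * ?ww $ i)"
    by (subst sum.swap) (simp add: Hs mult_ac cong: sum.cong)
   have "(\<Sum>i\<in>UNIV. \<Sum>j\<in>UNIV. H i j * (y - p) $ i * (y - p) $ j)
    = (\<Sum>i\<in>UNIV. \<Sum>j\<in>UNIV. H i j * (x - p) $ i * (x - p) $ j + H i j * (x - p) $ i * ?ww $ j
      + H i j * (x - p) $ j * ?ww $ i + H i j * ?ww $ i * ?ww $ j)"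
    by (intro sum.cong refl) (simp add: algebra_simps)
   also have "\<dots> = (\<Sum>i\<in>UNIV. \<Sum>j\<in>UNIV. H i j * (x - p) $ i * (x - p) $ j)
     + 2 * (\<Sum>i\<in>UNIV. \<Sum>j\<in>UNIV. H i j * (x - p) $ j * ?ww $ i)
     + (\<Sum>i\<in>UNIV. \<Sum>j\<in>UNIV. H i j * ?ww $ i * ?ww $ j)"
    unfolding sum.distrib 1 by simp
   finally have 2: "(\<Sum>i\<in>UNIV. \<Sum>j\<in>UNIV. H i j * (y - p) $ i * (y - p) $ j) = \<dots>" .
   have 3: "(\<Sum>i\<in>UNIV. P i x * y $ i) - (\<Sum>i\<in>UNIV. P i x * x $ i)
     = (\<Sum>i\<in>UNIV. ?p i x * ?ww $ i) - (\<Sum>i\<in>UNIV. \<Sum>j\<in>UNIV. H i j * (x - p) $ j * ?ww $ i)"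
   proof -
    have "(\<Sum>i\<in>UNIV. P i x * y $ i) - (\<Sum>i\<in>UNIV. P i x * x $ i) = (\<Sum>i\<in>UNIV. P i x * ?ww $ i)"
     by (simp add: sum_subtractf right_diff_distrib)
    also have "\<dots> = (\<Sum>i\<in>UNIV. ?p i x * ?ww $ i) - (\<Sum>i\<in>UNIV. (\<Sum>j\<in>UNIV. H i j * (x - p) $ j) * ?ww $ i)"
     by (simp only: P_def left_diff_distrib sum_subtractf)
    finally show ?thesis by (simp only: sum_distrib_right)
   qed
   have alg: "fy - 1/2 * (A + 2 * B + C) - Py - (fx - 1/2 * A - Px) = fy - fx - Sp - 1/2 * C"
    if "Py - Px = Sp - B" for A B C Py Px Sp fy fx :: real using that by (simp add: field_simps)
   show ?thesis unfolding h_def 2 by (rule alg[OF 3])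
  qed
  finally have A: "\<bar>f y - f x - (\<Sum>i\<in>UNIV. ?p i x * ?ww $ i) - 1/2 * (\<Sum>i\<in>UNIV. \<Sum>j\<in>UNIV. H i j * ?ww $ i * ?ww $ j)\<bar>
    <= c ^ 3 * d ^ 2 * e' * (dist y x)\<^sup>2" .
  have "\<bar>\<Sum>i\<in>UNIV. (\<Sum>j\<in>UNIV. (?q i j x - H i j) * ?ww $ j) * ?ww $ i\<bar> <= d * (d * e' * norm ?ww) * norm ?ww"
   unfolding d_def by (rule sum_abs_component_le, rule sum_abs_component_le, rule RH[OF x(1)]) (use x(2) in simp)
  moreover have "(\<Sum>i\<in>UNIV. (\<Sum>j\<in>UNIV. (?q i j x - H i j) * ?ww $ j) * ?ww $ i)
    = (\<Sum>i\<in>UNIV. \<Sum>j\<in>UNIV. ?q i j x * ?ww $ i * ?ww $ j) - (\<Sum>i\<in>UNIV. \<Sum>j\<in>UNIV. H i j * ?ww $ i * ?ww $ j)"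
   unfolding sum_distrib_right sum_subtractf[symmetric] by (intro sum.cong refl) (simp only: algebra_simps)
  moreover have "d * (d * e' * norm ?ww) * norm ?ww = d ^ 2 * e' * (dist y x)\<^sup>2"
   by (simp only: power2_eq_square dist_norm mult_ac)
  ultimately have B: "\<bar>(\<Sum>i\<in>UNIV. \<Sum>j\<in>UNIV. ?q i j x * ?ww $ i * ?ww $ j) - (\<Sum>i\<in>UNIV. \<Sum>j\<in>UNIV. H i j * ?ww $ i * ?ww $ j)\<bar>
    <= d ^ 2 * e' * (dist y x)\<^sup>2" by argo
  have "\<epsilon> = (c ^ 3 * d ^ 2 + d ^ 2) * e'"
   using cd unfolding e'_def by (subst times_divide_eq_right, subst nonzero_mult_div_cancel_left) auto
  then have "\<epsilon> * (dist y x)\<^sup>2 = c ^ 3 * d ^ 2 * e' * (dist y x)\<^sup>2 + d ^ 2 * e' * (dist y x)\<^sup>2"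
   by (simp only: distrib_right)
  then show "\<bar>f y - f x - (\<Sum>i\<in>UNIV. ?p i x * ?ww $ i)
   - 1/2 * (\<Sum>i\<in>UNIV. \<Sum>j\<in>UNIV. ?q i j x * ?ww $ i * ?ww $ j)\<bar> <= \<epsilon> * (dist y x)\<^sup>2"
   using A B by linarith
 qed
qed

text \<open>\<open>\<delta>\<close> is a Lebesgue number of the cover of \<open>K\<close> by the
  balls of the local statement: two points of \<open>K\<close> closer than that lie in a common
  ball.\<close>

lemma taylor2_uniform:
 fixes \<Phi> f :: "real^'d => real"
 assumes \<Phi>: "C2_bounded \<Phi>" and nz: "\<And>x. \<Phi> x = 0 ==> (\<chi> i. partial_on UNIV i \<Phi> x) \<noteq> 0"
  and f: "C2_on (closed_domain \<Phi>) f" and K: "compact K" "K \<subseteq> closed_domain \<Phi>" and e: "\<epsilon> > 0"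
 obtains \<delta> where "\<delta> > 0" "\<And>x y. x \<in> K ==> y \<in> K ==> dist y x < \<delta> ==>
  \<bar>f y - f x - (\<Sum>i\<in>UNIV. partial_on (closed_domain \<Phi>) i f x * (y - x) $ i)
   - 1/2 * (\<Sum>i\<in>UNIV. \<Sum>j\<in>UNIV. partial_on (closed_domain \<Phi>) i (partial_on (closed_domain \<Phi>) j f) x * (y - x) $ i * (y - x) $ j)\<bar>
   <= \<epsilon> * (dist y x)\<^sup>2"
proof -
 let ?S = "closed_domain \<Phi>"
 let ?R = "\<lambda>x y. f y - f x - (\<Sum>i\<in>UNIV. partial_on ?S i f x * (y - x) $ i)
   - 1/2 * (\<Sum>i\<in>UNIV. \<Sum>j\<in>UNIV. partial_on ?S i (partial_on ?S j f) x * (y - x) $ i * (y - x) $ j)"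
 let ?G = "\<lambda>p r. \<forall>x\<in>?S. \<forall>y\<in>?S. dist x p < r --> dist y p < r --> \<bar>?R x y\<bar> <= \<epsilon> * (dist y x)\<^sup>2"
 have "\<forall>p\<in>K. \<exists>r. r > 0 \<and> ?G p r"
  using taylor2_local[OF \<Phi> nz f _ e] K(2) by blast
 from bchoice[OF this] obtain r where r: "\<forall>p\<in>K. r p > 0 \<and> ?G p (r p)" ..
 obtain \<delta> where \<delta>: "0 < \<delta>" "\<And>x. x \<in> K ==> \<exists>G \<in> (\<lambda>p. ball p (r p)) ` K. ball x \<delta> \<subseteq> G"
  by (rule Heine_Borel_lemma[OF K(1), of "(\<lambda>p. ball p (r p)) ` K"]) (use r in force)+
 show ?thesis
 proof (rule that[OF \<delta>(1)])
  fix x y assume xy: "x \<in> K" "y \<in> K" "dist y x < \<delta>"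
  obtain p where p: "p \<in> K" "ball x \<delta> \<subseteq> ball p (r p)" using \<delta>(2)[OF xy(1)] by blast
  have "x \<in> ball x \<delta>" "y \<in> ball x \<delta>" using xy \<delta>(1) by (simp_all add: dist_commute)
  then have "x \<in> ball p (r p)" "y \<in> ball p (r p)" using p(2) by blast+
  then have "dist x p < r p" "dist y p < r p" by (simp_all add: dist_commute)
  then show "\<bar>?R x y\<bar> <= \<epsilon> * (dist y x)\<^sup>2" using r[rule_format, OF p(1)] xy K(2) by blast
 qed
qed

section \<open>Measurability up to null sets, and discretised random times\<close>

text \<open>\<open>N\<close> may be much smaller than \<open>M\<close> but contains every subset of
  a null set of \<open>M\<close>; the set where \<open>f\<close> and \<open>g\<close> differ is of
  this kind.\<close>

lemma measurable_AE_cong: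
 fixes f g :: "'w => 'b::topological_space"
 assumes sp: "space N = space M" and null: "\<forall>Z\<in>null_sets M. \<forall>A\<subseteq>Z. A \<in> sets N"
  and f: "f \<in> borel_measurable N" and ae: "AE w in M. f w = g w"
 shows "g \<in> borel_measurable N"
proof (rule measurableI)
 fix A :: "'b set" assume A: "A \<in> sets borel"
 obtain Z where Z: "{x \<in> space M. f x \<noteq> g x} \<subseteq> Z" "Z \<in> null_sets M"
  using ae by (auto simp: eventually_ae_filter)
 have ZN: "Z \<in> sets N" by (rule null[rule_format, OF Z(2)]) auto
 have eq: "g -` A \<inter> space N = ((f -` A \<inter> space N) - Z) \<union> (g -` A \<inter> space N \<inter> Z)"
  using Z(1) sp by force
 moreover have "f -` A \<inter> space N \<in> sets N" using f A by (rule measurable_sets)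
 moreover have "g -` A \<inter> space N \<inter> Z \<in> sets N" by (rule null[rule_format, OF Z(2)]) auto
 ultimately show "g -` A \<inter> space N \<in> sets N" by (subst eq) (intro sets.Un sets.Diff ZN)
qed simp

lemma measurable_AE_LIMSEQ:
 fixes f :: "nat => 'w => real"
 assumes sp: "space N = space M" and null: "\<forall>Z\<in>null_sets M. \<forall>A\<subseteq>Z. A \<in> sets N"
  and f: "\<And>n. f n \<in> borel_measurable N" and ae: "AE w in M. (\<lambda>n. f n w) \<longlonglongrightarrow> g w"
 shows "g \<in> borel_measurable N"
proof -
 have "(\<lambda>w. lim (\<lambda>n. f n w)) \<in> borel_measurable N"
  using f by (rule borel_measurable_lim_metric)
 moreover have "AE w in M. lim (\<lambda>n. f n w) = g w" using ae by eventually_elim (rule limI)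
 ultimately show ?thesis using measurable_AE_cong[OF sp null] by blast
qed

text \<open>The time \<open>t \<and> T\<close> is approximated from above by times from the grid of mesh \<open>1 / (k + 1)\<close>.\<close>

definition grid_time :: "nat => real => real => real" where
 "grid_time k t T = min t (real (nat \<lceil>real (Suc k) * T\<rceil>) / real (Suc k))"

lemma grid_time_bounds:
 assumes "0 <= t" "0 <= T"
 shows "min t T <= grid_time k t T" "grid_time k t T <= t" "0 <= grid_time k t T" "grid_time k t T <= min t (T + 1 / real (Suc k))"
proof -
 have a: "real (nat \<lceil>real (Suc k) * T\<rceil>) \<ge> real (Suc k) * T" by (rule real_nat_ceiling_ge)
 have b: "real (nat \<lceil>real (Suc k) * T\<rceil>) <= real (Suc k) * T + 1"
  using assms by (simp add: of_nat_nat del: of_nat_Suc)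
 have "T <= real (nat \<lceil>real (Suc k) * T\<rceil>) / real (Suc k)"
  using a by (subst pos_le_divide_eq) (auto simp: mult.commute)
 moreover have "real (nat \<lceil>real (Suc k) * T\<rceil>) / real (Suc k) <= T + 1 / real (Suc k)"
  using divide_right_mono[OF b, of "real (Suc k)"] by (simp add: add_divide_distrib)
 ultimately show "min t T <= grid_time k t T" "grid_time k t T <= t" "0 <= grid_time k t T" "grid_time k t T <= min t (T + 1 / real (Suc k))"
  using assms by (auto simp: grid_time_def)
qed

lemma grid_time_tendsto:
 assumes "0 <= t" "0 <= T"
 shows "(\<lambda>k. grid_time k t T) \<longlonglongrightarrow> min t T"
proof (rule tendsto_sandwich[OF _ _ tendsto_const])
 show "(\<lambda>k. min t (T + 1 / real (Suc k))) \<longlonglongrightarrow> min t T"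
  using tendsto_min[OF tendsto_const[of t] tendsto_add[OF tendsto_const[of T] LIMSEQ_Suc[OF lim_1_over_n]]]
  by (simp add: inverse_eq_divide)
qed (use grid_time_bounds[OF assms] in auto)

text \<open>A value at a random time becomes a finite sum over fixed times, so measurability and
  expectation can be settled term by term. The default is \<open>h t\<close>, the value once the
  grid time has reached \<open>t\<close>.\<close>

lemma grid_time_expand:
 fixes h :: "real => real"
 assumes "0 <= t" "0 <= T"
 shows "h (grid_time k t T) = h t + (\<Sum>j\<le>nat \<lceil>real (Suc k) * t\<rceil>.
   if nat \<lceil>real (Suc k) * T\<rceil> = j \<and> real j / real (Suc k) < t then h (real j / real (Suc k)) - h t else 0)"
proof -
 let ?j = "nat \<lceil>real (Suc k) * T\<rceil>"
 have eq: "(if ?j = j \<and> real j / real (Suc k) < t then h (real j / real (Suc k)) - h t else 0)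
   = (if j = ?j then (if real ?j / real (Suc k) < t then h (real ?j / real (Suc k)) - h t else 0) else 0)" for j
  by auto
 have "?j <= nat \<lceil>real (Suc k) * t\<rceil>" if "real ?j / real (Suc k) < t"
 proof -
  have "real ?j <= real (Suc k) * t" using that by (simp add: divide_less_eq mult.commute del: of_nat_Suc)
  also have "\<dots> <= real (nat \<lceil>real (Suc k) * t\<rceil>)" by (rule real_nat_ceiling_ge)
  finally show ?thesis by linarith
 qed
 then show ?thesis unfolding eq by (auto simp: grid_time_def min_def)
qed

locale usual_prob_space = prob_space M for M :: "'w measure" +
 fixes F :: "real => 'w measure"
 assumes usual: "usual_filtration M F"
begin

lemma subalg: "subalgebra M (F t)"
 using usual unfolding usual_filtration_def by (elim conjE) (rule spec)

lemma space_F [simp]: "space (F t) = space M"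
 using subalg by (auto simp: subalgebra_def)

lemma sets_F_mono: "s <= t ==> sets (F s) \<subseteq> sets (F t)"
proof -
 have "filtration (space M) F" using usual unfolding usual_filtration_def by (elim conjE)
 then show "s <= t ==> sets (F s) \<subseteq> sets (F t)" by (rule filtration.sets_F_mono)
qed

lemma meas_mono: "f \<in> borel_measurable (F s) ==> s <= t ==> f \<in> borel_measurable (F t)"
 using sets_F_mono[of s t] by (auto simp: measurable_def)

lemma meas_M: "f \<in> borel_measurable (F s) ==> f \<in> borel_measurable M"
 using subalg[of s] by (auto simp: measurable_def subalgebra_def)

lemma null_F: "0 <= t ==> \<forall>Z\<in>null_sets M. \<forall>A\<subseteq>Z. A \<in> sets (F t)"
proof -
 have "\<forall>Z\<in>null_sets M. \<forall>A\<subseteq>Z. A \<in> sets (F 0)"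
  using usual unfolding usual_filtration_def by (elim conjE)
 then show "0 <= t ==> \<forall>Z\<in>null_sets M. \<forall>A\<subseteq>Z. A \<in> sets (F t)" using sets_F_mono[of 0 t] by blast
qed

lemma null_M: "\<forall>Z\<in>null_sets M. \<forall>A\<subseteq>Z. A \<in> sets M"
proof -
 have "sets (F 0) \<subseteq> sets M" using subalg[of 0] by (simp add: subalgebra_def)
 then show ?thesis using null_F[of 0] by blast
qed

lemma F_AE_cong:
 fixes f g :: "'w => 'b::topological_space"
 assumes "0 <= t" "f \<in> borel_measurable (F t)" "AE w in M. f w = g w"
 shows "g \<in> borel_measurable (F t)"
 by (rule measurable_AE_cong[OF space_F null_F[OF assms(1)] assms(2,3)])

lemma F_AE_LIMSEQ:
 fixes g :: "'w => real"
 assumes "0 <= t" "\<And>n. f n \<in> borel_measurable (F t)" "AE w in M. (\<lambda>n. f n w) \<longlonglongrightarrow> g w"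
 shows "g \<in> borel_measurable (F t)"
 by (rule measurable_AE_LIMSEQ[OF space_F null_F[OF assms(1)] assms(2,3)])

lemma M_AE_LIMSEQ:
 fixes g :: "'w => real"
 assumes "\<And>n. f n \<in> borel_measurable M" "AE w in M. (\<lambda>n. f n w) \<longlonglongrightarrow> g w"
 shows "g \<in> borel_measurable M"
 by (rule measurable_AE_LIMSEQ[OF refl null_M assms])

lemma F_AE_pred:
 assumes "0 <= t" "Measurable.pred (F t) P" "AE w in M. P w \<longleftrightarrow> Q w"
 shows "Measurable.pred (F t) Q"
proof -
 obtain Z where Z: "{x \<in> space M. \<not> (P x \<longleftrightarrow> Q x)} \<subseteq> Z" "Z \<in> null_sets M"
  using assms(3) unfolding eventually_ae_filter by blast
 have P: "{x \<in> space M. P x} \<in> sets (F t)" using assms(2) unfolding pred_def space_F .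
 have Z': "Z \<in> sets (F t)" "{x \<in> space M. Q x} \<inter> Z \<in> sets (F t)"
  by (rule null_F[OF assms(1), rule_format, OF Z(2)], auto)+
 have "{x \<in> space M. Q x} = ({x \<in> space M. P x} - Z) \<union> ({x \<in> space M. Q x} \<inter> Z)"
  using Z(1) by blast
 then show ?thesis unfolding pred_def space_F using sets.Un[OF sets.Diff[OF P Z'(1)] Z'(2)] by simp
qed

lemma integrable_AE_bounded:
 fixes f :: "'w => real"
 assumes "f \<in> borel_measurable M" "AE w in M. \<bar>f w\<bar> <= c"
 shows "integrable M f"
 by (rule integrable_const_bound[where B=c]) (use assms in auto)

lemma integrable_bounded_mult:
 fixes f g :: "'w => real"
 assumes "integrable M g" "f \<in> borel_measurable M" "AE w in M. \<bar>f w\<bar> <= c"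
 shows "integrable M (\<lambda>w. f w * g w)"
proof (rule Bochner_Integration.integrable_bound)
 show "integrable M (\<lambda>w. c * g w)" using assms by simp
 show "AE w in M. norm (f w * g w) <= norm (c * g w)"
  using assms(3) by eventually_elim (auto simp: abs_mult intro!: mult_right_mono)
qed (use assms in auto)

subsection \<open>Martingales tested against bounded random variables\<close>

text \<open>The martingale property with the conditional expectation tested against bounded weights.
  In this form it passes to dominated limits and applies directly to sums over a grid.\<close>

definition mg :: "(real => 'w => real) => bool" where
 "mg Y \<longleftrightarrow> (\<forall>t\<ge>0. Y t \<in> borel_measurable (F t) \<and> integrable M (Y t)) \<and>
   (\<forall>s t \<phi>. 0 <= s --> s <= t --> \<phi> \<in> borel_measurable (F s) --> (\<exists>c. AE w in M. \<bar>\<phi> w\<bar> <= c) -->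
    (\<integral>w. \<phi> w * (Y t w - Y s w) \<partial>M) = 0)"

lemma mg_meas: "mg Y ==> 0 <= t ==> Y t \<in> borel_measurable (F t)"
 and mg_integrable: "mg Y ==> 0 <= t ==> integrable M (Y t)"
 and mg_orth: "mg Y ==> 0 <= s ==> s <= t ==> \<phi> \<in> borel_measurable (F s) ==> AE w in M. \<bar>\<phi> w\<bar> <= c ==>
  (\<integral>w. \<phi> w * (Y t w - Y s w) \<partial>M) = 0"
 unfolding mg_def by blast+

lemma martingale_mg: assumes Y: "martingale M F Y" shows "mg Y"
 unfolding mg_def
proof (intro conjI allI impI)
 fix t :: real assume t: "0 <= t"
 show "Y t \<in> borel_measurable (F t)" "integrable M (Y t)"
  using Y t by (auto simp: martingale_def adapted_def)
next
 fix s t :: real and \<phi> :: "'w => real" assume st: "0 <= s" "s <= t" and \<phi>: "\<phi> \<in> borel_measurable (F s)" "\<exists>c. AE w in M. \<bar>\<phi> w\<bar> <= c"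
 interpret finite_measure_subalgebra M "F s" by standard (rule subalg)
 obtain c where c: "AE w in M. \<bar>\<phi> w\<bar> <= c" using \<phi>(2) by blast
 have int: "integrable M (Y t)" "integrable M (Y s)" using Y st by (auto simp: martingale_def)
 have \<phi>M: "\<phi> \<in> borel_measurable M" using meas_M[OF \<phi>(1)] .
 have i: "integrable M (\<lambda>w. \<phi> w * Y t w)" "integrable M (\<lambda>w. \<phi> w * Y s w)"
  using integrable_bounded_mult[OF _ \<phi>M c] int by blast+
 have "(\<integral>w. \<phi> w * Y t w \<partial>M) = (\<integral>w. \<phi> w * real_cond_exp M (F s) (Y t) w \<partial>M)"
  using real_cond_exp_intg(2)[OF i(1) \<phi>(1)] int by simp
 also have "\<dots> = (\<integral>w. \<phi> w * Y s w \<partial>M)"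
 proof (rule integral_cong_AE)
  have "AE w in M. real_cond_exp M (F s) (Y t) w = Y s w" using Y st by (auto simp: martingale_def)
  then show "AE w in M. \<phi> w * real_cond_exp M (F s) (Y t) w = \<phi> w * Y s w" by auto
 qed (use \<phi>M int in auto)
 finally show "(\<integral>w. \<phi> w * (Y t w - Y s w) \<partial>M) = 0"
  using i by (simp add: right_diff_distrib)
qed

text \<open>Rounding up is what makes the event known at the grid time itself: it says that
  \<open>\<tau>\<close> lies in the cell that ends there. For \<open>j = 0\<close> the cell is
  everything up to \<open>0\<close>, as \<open>nat\<close> truncates.\<close>

lemma grid_event:
 assumes \<tau>: "stopping_time F \<tau>"
 shows "Measurable.pred (F (real j / real (Suc k))) (\<lambda>w. nat \<lceil>real (Suc k) * \<tau> w\<rceil> = j)"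
proof -
 have iff: "nat \<lceil>real (Suc k) * x\<rceil> <= i \<longleftrightarrow> x <= real i / real (Suc k)" for x i
  by (subst pos_le_divide_eq) (auto simp: nat_le_iff ceiling_le_iff mult.commute simp del: of_nat_Suc)
 have m: "Measurable.pred (F (real j / real (Suc k))) (\<lambda>w. nat \<lceil>real (Suc k) * \<tau> w\<rceil> <= i)" if "i <= j" for i
 proof -
  have "Measurable.pred (F (real i / real (Suc k))) (\<lambda>w. \<tau> w <= real i / real (Suc k))"
   using \<tau> by (rule stopping_timeD)
  then have "{w \<in> space (F (real i / real (Suc k))). \<tau> w <= real i / real (Suc k)} \<in> sets (F (real i / real (Suc k)))"
   by (rule predE)
  moreover have "real i / real (Suc k) <= real j / real (Suc k)" using that by (intro divide_right_mono) auto
  ultimately show ?thesis using sets_F_mono unfolding iff pred_def space_F by blast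
 qed
 show ?thesis
 proof (cases j)
  case 0
  then show ?thesis using m[of 0] by simp
 next
  case (Suc i)
  have "(nat \<lceil>real (Suc k) * \<tau> w\<rceil> = j) \<longleftrightarrow> nat \<lceil>real (Suc k) * \<tau> w\<rceil> <= j \<and> \<not> nat \<lceil>real (Suc k) * \<tau> w\<rceil> <= i" for w
   using Suc by linarith
  then show ?thesis using m[of j] m[of i] Suc by simp
 qed
qed

lemma grid_meas:
 fixes Y :: "real => 'w => real"
 assumes \<tau>: "stopping_time F \<tau>" "\<And>w. 0 <= \<tau> w" and Y: "adapted F Y" and t: "0 <= t"
 shows "(\<lambda>w. Y (grid_time k t (\<tau> w)) w) \<in> borel_measurable (F t)"
proof -
 have Yt: "Y t \<in> borel_measurable (F t)" using Y t by (simp add: adapted_def)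
 have piece: "(\<lambda>w. if nat \<lceil>real (Suc k) * \<tau> w\<rceil> = j \<and> real j / real (Suc k) < t
   then Y (real j / real (Suc k)) w - Y t w else 0) \<in> borel_measurable (F t)" for j
 proof (cases "real j / real (Suc k) < t")
  case True
  have Yj: "Y (real j / real (Suc k)) \<in> borel_measurable (F t)"
   by (rule meas_mono[OF Y[unfolded adapted_def, rule_format] less_imp_le[OF True]]) simp
  have "{w \<in> space (F t). nat \<lceil>real (Suc k) * \<tau> w\<rceil> = j} \<in> sets (F t)"
   using grid_event[OF \<tau>(1), of k j] sets_F_mono[OF less_imp_le[OF True]]
   unfolding pred_def space_F by (rule subsetD[rotated])
  from measurable_If[OF borel_measurable_diff[OF Yj Yt] borel_measurable_const[of 0] this]
  show ?thesis using True by simp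
 qed simp
 show ?thesis
  unfolding grid_time_expand[where h="\<lambda>u. Y u w" for w, OF t \<tau>(2)]
  using piece Yt by (intro borel_measurable_add borel_measurable_sum) auto
qed

lemma AE_cont_grid:
 fixes Y :: "real => 'w => real"
 assumes Y: "AE_continuous_paths M Y" and \<tau>: "\<And>w. 0 <= \<tau> w" and t: "0 <= t"
 shows "AE w in M. (\<lambda>k. Y (grid_time k t (\<tau> w)) w) \<longlonglongrightarrow> Y (min t (\<tau> w)) w"
 using Y unfolding AE_continuous_paths_def
proof eventually_elim
 case (elim w)
 then show ?case
  by (rule continuous_on_tendsto_compose[OF _ grid_time_tendsto[OF t \<tau>]])
   (use t \<tau> grid_time_bounds[OF t \<tau>] in auto)
qed

lemma stopped_meas:
 fixes Y :: "real => 'w => real"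
 assumes "adapted F Y" "AE_continuous_paths M Y" "stopping_time F \<tau>" "\<And>w. 0 <= \<tau> w" "0 <= t"
 shows "(\<lambda>w. Y (min t (\<tau> w)) w) \<in> borel_measurable (F t)"
 using F_AE_LIMSEQ[OF assms(5) grid_meas[OF assms(3,4,1,5)] AE_cont_grid[OF assms(2,4,5)]] .

text \<open>On the grid the claim is a finite sum of martingale increments with weights known at the
  left end. No uniform integrability is at hand for the passage to the limit; the values of
  \<open>Y\<close> at grid times are truncated instead, which is compatible with
  adaptedness.\<close>

lemma optional_sampling:
 assumes Y: "mg Y" "AE_continuous_paths M Y" and \<sigma>: "stopping_time F \<sigma>" "\<And>w. s <= \<sigma> w"
  and st: "0 <= s" "s <= t" and \<phi>: "\<phi> \<in> borel_measurable (F s)" "AE w in M. \<bar>\<phi> w\<bar> <= b"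
  and c: "AE w in M. \<phi> w \<noteq> 0 --> \<bar>Y (min t (\<sigma> w)) w\<bar> <= c"
 shows "(\<integral>w. \<phi> w * (Y (min t (\<sigma> w)) w - Y t w) \<partial>M) = 0"
proof -
 have t: "0 <= t" using st by simp
 have ad: "adapted F Y" using Y(1) by (auto simp: adapted_def mg_def)
 have \<sigma>0: "0 <= \<sigma> w" for w using \<sigma>(2)[of w] st by simp
 have \<phi>M: "\<phi> \<in> borel_measurable M" by (rule meas_M[OF \<phi>(1)])
 have YM: "Y u \<in> borel_measurable M" if "0 <= u" for u using mg_integrable[OF Y(1) that] by simp
 \<comment> \<open>The level \<open>c + 1\<close> leaves a strict margin over \<open>c\<close>, so
   by continuity the truncation is eventually inactive where \<open>\<phi>\<close> does not vanish.
   Subtracting \<open>Y t\<close> makes the default value \<open>h t\<close> zero.\<close>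
 define h where "h u w = \<phi> w * ((if \<bar>Y u w\<bar> <= c + 1 then 1 else 0) * (Y u w - Y t w))" for u w
 have gm: "(\<lambda>w. Y (grid_time k t (\<sigma> w)) w) \<in> borel_measurable M" for k
  using meas_M[OF grid_meas[OF \<sigma>(1) \<sigma>0 ad t]] .
 have sm: "(\<lambda>w. Y (min t (\<sigma> w)) w) \<in> borel_measurable M"
  using meas_M[OF stopped_meas[OF ad Y(2) \<sigma>(1) \<sigma>0 t]] .
 have zero: "(\<integral>w. h (grid_time k t (\<sigma> w)) w \<partial>M) = 0" for k
 proof -
  let ?g = "\<lambda>j w. if nat \<lceil>real (Suc k) * \<sigma> w\<rceil> = j \<and> real j / real (Suc k) < t
    then h (real j / real (Suc k)) w - h t w else 0"
  have g: "integrable M (?g j) \<and> (\<integral>w. ?g j w \<partial>M) = 0" for j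
  proof (cases "s <= real j / real (Suc k) \<and> real j / real (Suc k) < t")
   case False
   \<comment> \<open>Grid times before \<open>s\<close>, where \<open>\<phi>\<close> is not yet
     known, are never taken because \<open>s <= \<sigma> w\<close>.\<close>
   have "?g j w = 0" for w
   proof (cases "real j / real (Suc k) < t \<and> nat \<lceil>real (Suc k) * \<sigma> w\<rceil> = j")
    case True
    have "real (Suc k) * \<sigma> w <= real j" using True real_nat_ceiling_ge[of "real (Suc k) * \<sigma> w"] by simp
    then have "\<sigma> w <= real j / real (Suc k)" by (subst pos_le_divide_eq) (auto simp: mult.commute)
    then show ?thesis using False True \<sigma>(2)[of w] by auto
   qed auto
   then show ?thesis by simp
  next
   case True
   let ?u = "real j / real (Suc k)"
   let ?\<psi> = "\<lambda>w. if nat \<lceil>real (Suc k) * \<sigma> w\<rceil> = j then \<phi> w * (if \<bar>Y ?u w\<bar> <= c + 1 then 1 else 0) else 0"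
   have \<phi>u: "\<phi> \<in> borel_measurable (F ?u)" using True by (intro meas_mono[OF \<phi>(1)]) simp
   have Yu: "Y ?u \<in> borel_measurable (F ?u)" using mg_meas[OF Y(1)] by simp
   have m1: "(\<lambda>w. if \<bar>Y ?u w\<bar> <= c + 1 then 1 else (0::real)) \<in> borel_measurable (F ?u)"
    using Yu by measurable
   have \<psi>: "?\<psi> \<in> borel_measurable (F ?u)"
    using measurable_If[OF borel_measurable_times[OF \<phi>u m1] borel_measurable_const grid_event[OF \<sigma>(1), of k j, unfolded pred_def]] .
   have \<psi>b: "AE w in M. \<bar>?\<psi> w\<bar> <= b" using \<phi>(2) by eventually_elim auto
   have eq: "?g j = (\<lambda>w. - (?\<psi> w * (Y t w - Y ?u w)))"
    using True by (auto simp: h_def algebra_simps)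
   have "integrable M (\<lambda>w. ?\<psi> w * (Y t w - Y ?u w))"
    by (rule integrable_bounded_mult[OF _ meas_M[OF \<psi>] \<psi>b]) (use mg_integrable[OF Y(1)] t in auto)
   moreover have "(\<integral>w. ?\<psi> w * (Y t w - Y ?u w) \<partial>M) = 0"
    using True by (intro mg_orth[OF Y(1) _ _ \<psi> \<psi>b]) auto
   ultimately show ?thesis unfolding eq by simp
  qed
  have "h t = (\<lambda>w. 0)" by (auto simp: h_def)
  then have "(\<integral>w. h (grid_time k t (\<sigma> w)) w \<partial>M) = (\<integral>w. (\<Sum>j\<le>nat \<lceil>real (Suc k) * t\<rceil>. ?g j w) \<partial>M)"
   by (subst grid_time_expand[where h="\<lambda>u. h u w" for w, OF t \<sigma>0]) simp
  then show ?thesis using g by simp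
 qed
 have "(\<lambda>k. \<integral>w. h (grid_time k t (\<sigma> w)) w \<partial>M) \<longlonglongrightarrow> (\<integral>w. \<phi> w * (Y (min t (\<sigma> w)) w - Y t w) \<partial>M)"
 proof (rule integral_dominated_convergence[where w="\<lambda>w. \<bar>b\<bar> * (\<bar>c + 1\<bar> + \<bar>Y t w\<bar>)"])
  show "integrable M (\<lambda>w. \<bar>b\<bar> * (\<bar>c + 1\<bar> + \<bar>Y t w\<bar>))" using mg_integrable[OF Y(1) t] by simp
  show "(\<lambda>w. \<phi> w * (Y (min t (\<sigma> w)) w - Y t w)) \<in> borel_measurable M" using sm \<phi>M YM[OF t] by simp
  show "(\<lambda>w. h (grid_time k t (\<sigma> w)) w) \<in> borel_measurable M" for k
   unfolding h_def using gm[of k] \<phi>M YM[OF t] by measurable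
  show "AE w in M. norm (h (grid_time k t (\<sigma> w)) w) <= \<bar>b\<bar> * (\<bar>c + 1\<bar> + \<bar>Y t w\<bar>)" for k
   using \<phi>(2)
  proof eventually_elim
   case (elim w)
   have "norm (h (grid_time k t (\<sigma> w)) w) = \<bar>\<phi> w\<bar> * \<bar>(if \<bar>Y (grid_time k t (\<sigma> w)) w\<bar> <= c + 1 then 1 else 0) * (Y (grid_time k t (\<sigma> w)) w - Y t w)\<bar>"
    by (simp add: h_def abs_mult)
   also have "\<dots> <= \<bar>b\<bar> * (\<bar>c + 1\<bar> + \<bar>Y t w\<bar>)" using elim by (intro mult_mono) auto
   finally show ?case .
  qed
  show "AE w in M. (\<lambda>k. h (grid_time k t (\<sigma> w)) w) \<longlonglongrightarrow> \<phi> w * (Y (min t (\<sigma> w)) w - Y t w)"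
   using AE_cont_grid[where \<tau>=\<sigma>, OF Y(2) \<sigma>0 t] c
  proof eventually_elim
   case (elim w)
   show ?case
   proof (cases "\<phi> w = 0")
    case False
    then have "\<bar>Y (min t (\<sigma> w)) w\<bar> < c + 1" using elim(2) by simp
    with tendsto_rabs[OF elim(1)] have "\<forall>\<^sub>F k in sequentially. \<bar>Y (grid_time k t (\<sigma> w)) w\<bar> < c + 1"
     by (rule order_tendstoD)
    then have ev: "\<forall>\<^sub>F k in sequentially. \<phi> w * (Y (grid_time k t (\<sigma> w)) w - Y t w) = h (grid_time k t (\<sigma> w)) w"
     by eventually_elim (simp add: h_def)
    have "(\<lambda>k. \<phi> w * (Y (grid_time k t (\<sigma> w)) w - Y t w)) \<longlonglongrightarrow> \<phi> w * (Y (min t (\<sigma> w)) w - Y t w)"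
     by (intro tendsto_intros elim(1))
    then show ?thesis using ev by (rule Lim_transform_eventually)
   qed (simp add: h_def)
  qed
 qed
 then show ?thesis unfolding zero by (simp add: LIMSEQ_const_iff)
qed

end

section \<open>Uniform partitions and Stieltjes measures of paths\<close>

definition pt :: "real => nat => nat => real" where
 "pt T p k = T * real k / real (Suc p)"

lemma pt_simps:
 assumes "0 <= T"
 shows "pt T p 0 = 0" "pt T p (Suc p) = T" "0 <= pt T p k" "pt T p k <= pt T p (Suc k)"
  "pt T p (Suc k) - pt T p k = T / real (Suc p)" "k <= Suc p ==> pt T p k <= T" "i <= j ==> pt T p i <= pt T p j"
proof -
 show "pt T p 0 = 0" "pt T p (Suc p) = T" by (simp_all add: pt_def)
 show "0 <= pt T p k" using assms by (simp add: pt_def)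
 show m: "i <= j ==> pt T p i <= pt T p j" for i j
  using assms by (auto simp: pt_def intro!: divide_right_mono mult_left_mono)
 then show "pt T p k <= pt T p (Suc k)" by simp
 show "pt T p (Suc k) - pt T p k = T / real (Suc p)" by (simp add: pt_def diff_divide_distrib[symmetric] algebra_simps)
 show "k <= Suc p ==> pt T p k <= T" using m[of k "Suc p"] by (simp add: pt_def)
qed

lemma mesh_uniform:
 fixes d :: "real => 'a::metric_space"
 assumes d: "continuous_on {0..T} d" and T: "0 <= T" and e: "0 < e"
 shows "\<forall>\<^sub>F p in sequentially. \<forall>s\<in>{0..T}. \<forall>t\<in>{0..T}. \<bar>s - t\<bar> <= T / real (Suc p) --> dist (d s) (d t) < e"
proof -
 have "uniformly_continuous_on {0..T} d" by (rule compact_uniformly_continuous[OF d compact_Icc])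
 then obtain \<delta> where \<delta>: "\<delta> > 0" "\<And>s t. s \<in> {0..T} ==> t \<in> {0..T} ==> dist s t < \<delta> ==> dist (d s) (d t) < e"
  unfolding uniformly_continuous_on_def using e by metis
 have "(\<lambda>p. T / real (Suc p)) \<longlonglongrightarrow> 0"
  using tendsto_mult_right_zero[OF LIMSEQ_Suc[OF lim_1_over_n], of T] by simp
 then have "\<forall>\<^sub>F p in sequentially. T / real (Suc p) < \<delta>" using \<delta>(1) by (rule order_tendstoD)
 then show ?thesis by eventually_elim (auto intro!: \<delta>(2) simp: dist_real_def)
qed

text \<open>The product of a continuous path and a path of finite variation has no quadratic covariation.\<close>

lemma sum_continuous_times_variation:
 fixes d e v :: "real => real"
 assumes d: "continuous_on {0..T} d" and T: "0 <= T"
  and v: "\<And>s t. 0 <= s ==> s <= t ==> t <= T ==> \<bar>e t - e s\<bar> <= v t - v s"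
 shows "(\<lambda>p. \<Sum>k<Suc p. \<bar>d (pt T p (Suc k)) - d (pt T p k)\<bar> * \<bar>e (pt T p (Suc k)) - e (pt T p k)\<bar>) \<longlonglongrightarrow> 0"
proof (rule LIMSEQ_I)
 fix r :: real assume r: "0 < r"
 have v0: "0 <= v T - v 0" using v[of 0 T] T by simp
 define r' where "r' = r / (v T - v 0 + 1)"
 have r': "r' > 0" using r v0 by (simp add: r'_def)
 show "\<exists>no. \<forall>n\<ge>no. norm ((\<Sum>k<Suc n. \<bar>d (pt T n (Suc k)) - d (pt T n k)\<bar> * \<bar>e (pt T n (Suc k)) - e (pt T n k)\<bar>) - 0) < r"
 proof -
  obtain no where no: "\<And>p. p \<ge> no ==> \<forall>s\<in>{0..T}. \<forall>t\<in>{0..T}. \<bar>s - t\<bar> <= T / real (Suc p) --> dist (d s) (d t) < r'"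
   using mesh_uniform[OF d T r'] by (auto simp: eventually_sequentially)
  have "norm ((\<Sum>k<Suc n. \<bar>d (pt T n (Suc k)) - d (pt T n k)\<bar> * \<bar>e (pt T n (Suc k)) - e (pt T n k)\<bar>) - 0) < r" if "n \<ge> no" for n
  proof -
   let ?S = "\<Sum>k<Suc n. \<bar>d (pt T n (Suc k)) - d (pt T n k)\<bar> * \<bar>e (pt T n (Suc k)) - e (pt T n k)\<bar>"
   have "?S <= (\<Sum>k<Suc n. r' * (v (pt T n (Suc k)) - v (pt T n k)))"
   proof (rule sum_mono)
    fix k assume k: "k \<in> {..<Suc n}"
    have a: "pt T n k \<in> {0..T}" "pt T n (Suc k) \<in> {0..T}" using k pt_simps(3,6)[OF T] by auto
    have "dist (d (pt T n (Suc k))) (d (pt T n k)) < r'"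
     by (rule no[OF that, rule_format, OF a(2,1)]) (use pt_simps(5)[OF T, of n k] T in simp)
    then show "\<bar>d (pt T n (Suc k)) - d (pt T n k)\<bar> * \<bar>e (pt T n (Suc k)) - e (pt T n k)\<bar> <= r' * (v (pt T n (Suc k)) - v (pt T n k))"
     using v[of "pt T n k" "pt T n (Suc k)"] a pt_simps(4)[OF T, of n k] r'
     by (intro mult_mono) (auto simp: dist_real_def)
   qed
   also have "\<dots> = r' * (v T - v 0)"
    by (simp only: sum_distrib_left[symmetric] sum_lessThan_telescope[of "\<lambda>k. v (pt T n k)"] pt_simps(1,2)[OF T])
   also have "\<dots> < r" using r v0 by (simp add: r'_def field_simps)
   finally have "?S < r" .
   moreover have "0 <= ?S" by (intro sum_nonneg) simp
   ultimately show ?thesis by simp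
  qed
  then show ?thesis by blast
 qed
qed

lemma sets_path_measure [simp, measurable_cong]: "sets (path_measure V w) = sets borel"
 by (simp add: path_measure_def)

lemma path_measure_Ioc:
 assumes V: "mono_on {0..} (\<lambda>t. V t w)" "continuous_on {0..} (\<lambda>t. V t w)"
 shows "0 <= a ==> a <= b ==> emeasure (path_measure V w) {a<..b} = ennreal (V b w - V a w)"
  "0 <= a ==> a <= b ==> measure (path_measure V w) {a<..b} = V b w - V a w"
  "0 <= b ==> emeasure (path_measure V w) {0..b} = ennreal (V b w - V 0 w)"
proof -
 have mono: "V (max 0 x) w <= V (max 0 y) w" if "x <= y" for x y
  using that by (intro mono_onD[OF V(1)]) auto
 have cont: "continuous_on UNIV (\<lambda>s. V (max 0 s) w)"
  by (rule continuous_on_compose2[OF V(2)]) (auto intro!: continuous_intros)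
 have rc: "continuous (at_right a) (\<lambda>s. V (max 0 s) w)" for a
  using cont by (auto simp: continuous_on_eq_continuous_within intro: continuous_within_subset)
 show e: "0 <= a ==> a <= b ==> emeasure (path_measure V w) {a<..b} = ennreal (V b w - V a w)" for a b
  unfolding path_measure_def by (subst emeasure_interval_measure_Ioc[OF _ mono rc]) auto
 show "0 <= a ==> a <= b ==> measure (path_measure V w) {a<..b} = V b w - V a w"
  using e[of a b] mono_onD[OF V(1), of a b] by (simp add: measure_def)
 show "0 <= b ==> emeasure (path_measure V w) {0..b} = ennreal (V b w - V 0 w)"
  unfolding path_measure_def by (subst emeasure_interval_measure_Icc[OF _ mono cont]) auto
qed

lemma set_integral_step:
 fixes f :: "real => real"
 assumes \<mu>: "sets \<mu> = sets borel" and ww: "\<And>k. ww k <= ww (Suc k)"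
  and fin: "\<And>k. k < n ==> emeasure \<mu> {ww k<..ww (Suc k)} < \<infinity>"
  and f: "\<And>k x. k < n ==> ww k < x ==> x <= ww (Suc k) ==> f x = c k"
 shows "set_integrable \<mu> {ww 0<..ww n} f"
  and "(LINT x:{ww 0<..ww n}|\<mu>. f x) = (\<Sum>k<n. c k * measure \<mu> {ww k<..ww (Suc k)})"
 using fin f
proof (induction n)
 case 0
 { case 1 then show ?case by (simp add: set_integrable_def) next
  case 2 then show ?case by (simp add: set_lebesgue_integral_def) }
next
 case (Suc n)
 have m0: "ww 0 <= ww n" using lift_Suc_mono_le[of ww 0 n] ww by blast
 have un: "{ww 0<..ww (Suc n)} = {ww 0<..ww n} \<union> {ww n<..ww (Suc n)}" using m0 ww[of n] by auto
 have dis: "{ww 0<..ww n} \<inter> {ww n<..ww (Suc n)} = {}" by auto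
 have spc: "{ww n<..ww (Suc n)} \<in> sets \<mu>" by (simp add: \<mu>)
 have ic: "set_integrable \<mu> {ww n<..ww (Suc n)} (\<lambda>x. c n)" if "emeasure \<mu> {ww n<..ww (Suc n)} < \<infinity>"
  unfolding set_integrable_def using that spc by (intro integrable_scaleR_left integrable_real_indicator)
 {
  case 1
  have "set_integrable \<mu> {ww n<..ww (Suc n)} f"
   using ic[OF 1(1)[of n]] by (subst set_integrable_cong[OF refl refl, of _ f "\<lambda>x. c n"]) (use 1(2)[of n] in auto)
  moreover have "set_integrable \<mu> {ww 0<..ww n} f" by (rule Suc.IH(1)) (use 1 in auto)
  ultimately show ?case unfolding un by (intro set_integrable_Un) (auto simp: \<mu>)
 next
  case 2
  have a: "set_integrable \<mu> {ww n<..ww (Suc n)} f"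
   using ic[OF 2(1)[of n]] by (subst set_integrable_cong[OF refl refl, of _ f "\<lambda>x. c n"]) (use 2(2)[of n] in auto)
  have b: "set_integrable \<mu> {ww 0<..ww n} f" by (rule Suc.IH(1)) (use 2 in auto)
  have "(LINT x:{ww 0<..ww (Suc n)}|\<mu>. f x) = (LINT x:{ww 0<..ww n}|\<mu>. f x) + (LINT x:{ww n<..ww (Suc n)}|\<mu>. f x)"
   unfolding un by (rule set_integral_Un[OF dis b a])
  also have "(LINT x:{ww n<..ww (Suc n)}|\<mu>. f x) = (LINT x:{ww n<..ww (Suc n)}|\<mu>. c n)"
   by (rule set_lebesgue_integral_cong) (use 2(2)[of n] spc in auto)
  also have "\<dots> = c n * measure \<mu> {ww n<..ww (Suc n)}"
   using spc 2(1)[of n] by (simp add: set_lebesgue_integral_def)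
  also have "(LINT x:{ww 0<..ww n}|\<mu>. f x) = (\<Sum>k<n. c k * measure \<mu> {ww k<..ww (Suc k)})"
   by (rule Suc.IH(2)) (use 2 in auto)
  finally show ?case by simp
 }
qed

text \<open>Young's inequality bounds the difference of the squares pointwise by
  \<open>(1 + 1 / e) * (a - f)^2 + e * f^2\<close>. The first term vanishes in the limit for fixed
  \<open>e\<close>, the second is small with \<open>e\<close>.\<close>

lemma integral_power2_LIMSEQ:
 fixes f :: "'a => real" and a :: "nat => 'a => real"
 assumes a: "\<And>m. a m \<in> borel_measurable \<nu>" "\<And>m. integrable \<nu> (\<lambda>x. (a m x)\<^sup>2)"
  and f: "f \<in> borel_measurable \<nu>" "integrable \<nu> (\<lambda>x. (f x)\<^sup>2)"
  and D: "(\<lambda>m. \<integral>\<^sup>+x. ennreal ((a m x - f x)\<^sup>2) \<partial>\<nu>) \<longlonglongrightarrow> 0"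
 shows "(\<lambda>m. \<integral>x. (a m x)\<^sup>2 \<partial>\<nu>) \<longlonglongrightarrow> (\<integral>x. (f x)\<^sup>2 \<partial>\<nu>)"
proof -
 have sq: "(p - q)\<^sup>2 <= 2 * p\<^sup>2 + 2 * q\<^sup>2" for p q :: real
  using zero_le_power2[of "p + q"] by (simp add: power2_eq_square algebra_simps)
 have i: "integrable \<nu> (\<lambda>x. (a m x - f x)\<^sup>2)" for m
  by (rule Bochner_Integration.integrable_bound[of _ "\<lambda>x. 2 * (a m x)\<^sup>2 + 2 * (f x)\<^sup>2"])
   (use a f sq in auto)
 define d where "d m = (\<integral>x. (a m x - f x)\<^sup>2 \<partial>\<nu>)" for m
 have d0: "0 <= d m" for m unfolding d_def by simp
 have "(\<lambda>m. ennreal (d m)) \<longlonglongrightarrow> ennreal 0"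
  using D i by (simp add: d_def nn_integral_eq_integral)
 then have d: "d \<longlonglongrightarrow> 0" by (subst (asm) tendsto_ennreal_iff) (use d0 in auto)
 define B where "B = (\<integral>x. (f x)\<^sup>2 \<partial>\<nu>)"
 have B: "0 <= B" by (simp add: B_def)
 have le: "\<bar>(\<integral>x. (a m x)\<^sup>2 \<partial>\<nu>) - B\<bar> <= (1 + 1 / e) * d m + e * B" if "0 < e" for e m
 proof -
  have "\<bar>(\<integral>x. (a m x)\<^sup>2 \<partial>\<nu>) - B\<bar> = \<bar>\<integral>x. (a m x)\<^sup>2 - (f x)\<^sup>2 \<partial>\<nu>\<bar>"
   unfolding B_def using a f by simp
  also have "\<dots> <= (\<integral>x. \<bar>(a m x)\<^sup>2 - (f x)\<^sup>2\<bar> \<partial>\<nu>)" by (rule integral_abs_bound)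
  also have "\<dots> <= (\<integral>x. (1 + 1 / e) * (a m x - f x)\<^sup>2 + e * (f x)\<^sup>2 \<partial>\<nu>)"
  proof (rule integral_mono)
   fix x
   let ?g = "a m x - f x"
   have "(a m x)\<^sup>2 - (f x)\<^sup>2 = ?g\<^sup>2 + 2 * (f x * ?g)" by (simp add: power2_eq_square algebra_simps)
   moreover have "2 * \<bar>f x * ?g\<bar> <= e * (f x)\<^sup>2 + ?g\<^sup>2 / e"
   proof -
    have "0 <= (sqrt e * \<bar>f x\<bar> - \<bar>?g\<bar> / sqrt e)\<^sup>2" by simp
    also have "\<dots> = e * (f x)\<^sup>2 + ?g\<^sup>2 / e - 2 * \<bar>f x * ?g\<bar>"
     using that by (simp add: power2_diff power_mult_distrib power_divide abs_mult)
    finally show ?thesis by simp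
   qed
   ultimately show "\<bar>(a m x)\<^sup>2 - (f x)\<^sup>2\<bar> <= (1 + 1 / e) * ?g\<^sup>2 + e * (f x)\<^sup>2"
    by (simp add: distrib_right abs_le_iff) (smt (verit) zero_le_power2)
  qed (use a f i in auto)
  also have "\<dots> = (1 + 1 / e) * d m + e * B" using f i by (simp add: d_def B_def)
  finally show ?thesis .
 qed
 show ?thesis unfolding B_def[symmetric]
 proof (rule LIMSEQ_I)
  fix r :: real assume r: "0 < r"
  define e where "e = r / (2 * (B + 1))"
  have e: "0 < e" using r B by (simp add: e_def)
  have eB: "e * B < r / 2 + 0"
  proof -
   have "e * B < e * (B + 1)" using e by simp
   also have "\<dots> = r / 2" using B by (simp add: e_def field_simps)
   finally show ?thesis by simp
  qed
  have "(\<lambda>m. (1 + 1 / e) * d m) \<longlonglongrightarrow> 0" using tendsto_mult_right_zero[OF d] .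
  then have "\<forall>\<^sub>F m in sequentially. (1 + 1 / e) * d m < r / 2" by (rule order_tendstoD) (use r in simp)
  then obtain no where no: "\<And>m. no <= m ==> (1 + 1 / e) * d m < r / 2" by (auto simp: eventually_sequentially)
  show "\<exists>no. \<forall>m\<ge>no. norm ((\<integral>x. (a m x)\<^sup>2 \<partial>\<nu>) - B) < r"
  proof (intro exI[of _ no] allI impI)
   fix m assume "no <= m"
   from no[OF this] le[OF e, of m] eB show "norm ((\<integral>x. (a m x)\<^sup>2 \<partial>\<nu>) - B) < r"
    unfolding real_norm_def by linarith
  qed
 qed
qed

text \<open>With \<open>r\<close> a partition point, this turns the difference of two truncated sums
  into a sum over the partition clamped to the interval from \<open>s\<close> to
  \<open>t\<close>.\<close>

lemma clamp_diff:
 fixes y :: "real => real"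
 assumes "s <= t" shows "y (min t r) - y (min s r) = y (max s (min t r)) - y s"
 using assms by (cases "r <= s"; cases "r <= t") (auto simp: min_def max_def)

section \<open>Stopping and localisation of martingales\<close>

context usual_prob_space
begin

text \<open>Where \<open>\<tau> <= s\<close> the stopped increment vanishes, so the weight may be
  cut down to \<open>\<psi>\<close>, living on \<open>s < \<tau>\<close>. There
  \<open>\<tau>\<close> coincides with \<open>\<sigma> = max \<tau> s\<close>, and the increment is
  the sum of one handled by \<open>optional_sampling\<close> and an ordinary martingale
  increment.\<close>

lemma mg_stopped_bounded:
 assumes N: "mg N" "AE_continuous_paths M N" and \<tau>: "stopping_time F \<tau>" "\<And>w. 0 <= \<tau> w"
  and c: "\<And>t. 0 <= t ==> AE w in M. \<bar>N (min t (\<tau> w)) w\<bar> <= c"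
 shows "mg (\<lambda>t w. N (min t (\<tau> w)) w)"
 unfolding mg_def
proof (intro conjI allI impI)
 have ad: "adapted F N" using N(1) by (auto simp: adapted_def mg_def)
 have sm: "(\<lambda>w. N (min t (\<tau> w)) w) \<in> borel_measurable (F t)" if "0 <= t" for t
  by (rule stopped_meas[OF ad N(2) \<tau> that])
 fix t :: real assume t: "0 <= t"
 show "(\<lambda>w. N (min t (\<tau> w)) w) \<in> borel_measurable (F t)" by (rule sm[OF t])
 show "integrable M (\<lambda>w. N (min t (\<tau> w)) w)"
  by (rule integrable_AE_bounded[OF meas_M[OF sm[OF t]] c[OF t]])
next
 have ad: "adapted F N" using N(1) by (auto simp: adapted_def mg_def)
 fix s t :: real and \<phi> :: "'w => real"
 assume st: "0 <= s" "s <= t" and \<phi>: "\<phi> \<in> borel_measurable (F s)" and "\<exists>b. AE w in M. \<bar>\<phi> w\<bar> <= b"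
 then obtain b where b: "AE w in M. \<bar>\<phi> w\<bar> <= b" by blast
 have t: "0 <= t" using st by simp
 define \<psi> where "\<psi> w = (if s < \<tau> w then \<phi> w else 0)" for w
 define \<sigma> where "\<sigma> w = max (\<tau> w) s" for w
 have \<sigma>: "stopping_time F \<sigma>" "\<And>w. s <= \<sigma> w" "\<And>w. 0 <= \<sigma> w"
  unfolding \<sigma>_def using stopping_time_max[OF \<tau>(1) stopping_time_const] \<tau>(2) by (auto simp: le_max_iff_disj)
 have \<psi>: "\<psi> \<in> borel_measurable (F s)"
  unfolding \<psi>_def using measurable_If[OF \<phi> borel_measurable_const stopping_timeD2[OF \<tau>(1), unfolded pred_def]] .
 have \<psi>b: "AE w in M. \<bar>\<psi> w\<bar> <= b" using b by eventually_elim (auto simp: \<psi>_def)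
 have c': "AE w in M. \<psi> w \<noteq> 0 --> \<bar>N (min t (\<sigma> w)) w\<bar> <= c"
  using c[OF t] by eventually_elim (auto simp: \<psi>_def \<sigma>_def max_def split: if_splits)
 have 1: "(\<integral>w. \<psi> w * (N (min t (\<sigma> w)) w - N t w) \<partial>M) = 0"
  by (rule optional_sampling[OF N \<sigma>(1,2) st \<psi> \<psi>b c'])
 have 2: "(\<integral>w. \<psi> w * (N t w - N s w) \<partial>M) = 0"
  by (rule mg_orth[OF N(1) st \<psi> \<psi>b])
 have i2: "integrable M (\<lambda>w. \<psi> w * N t w)" "integrable M (\<lambda>w. \<psi> w * N s w)"
  using integrable_bounded_mult[OF mg_integrable[OF N(1)] meas_M[OF \<psi>] \<psi>b] st t by auto
 have i1: "integrable M (\<lambda>w. \<psi> w * N (min t (\<sigma> w)) w)"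
 proof (rule integrable_AE_bounded[where c="\<bar>b\<bar> * \<bar>c\<bar>"])
  show "(\<lambda>w. \<psi> w * N (min t (\<sigma> w)) w) \<in> borel_measurable M"
   using meas_M[OF \<psi>] meas_M[OF stopped_meas[OF ad N(2) \<sigma>(1,3) t]] by simp
  show "AE w in M. \<bar>\<psi> w * N (min t (\<sigma> w)) w\<bar> <= \<bar>b\<bar> * \<bar>c\<bar>"
   using \<psi>b c'
  proof eventually_elim
   case (elim w)
   then show ?case by (cases "\<psi> w = 0") (auto simp: abs_mult intro!: mult_mono)
  qed
 qed
 have "(\<integral>w. \<phi> w * (N (min t (\<tau> w)) w - N (min s (\<tau> w)) w) \<partial>M)
   = (\<integral>w. \<psi> w * (N (min t (\<sigma> w)) w - N t w) + \<psi> w * (N t w - N s w) \<partial>M)"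
  by (intro Bochner_Integration.integral_cong refl) (use st in \<open>auto simp: \<psi>_def \<sigma>_def algebra_simps min_def max_def\<close>)
 also have "\<dots> = 0"
  using i1 i2 1 2 by (subst Bochner_Integration.integral_add) (simp_all add: right_diff_distrib)
 finally show "(\<integral>w. \<phi> w * (N (min t (\<tau> w)) w - N (min s (\<tau> w)) w) \<partial>M) = 0" .
qed

lemma mg_LIMSEQ:
 assumes N: "\<And>m. mg (N m)" and lim: "\<And>t. 0 <= t ==> AE w in M. (\<lambda>m. N m t w) \<longlonglongrightarrow> X t w"
  and c: "\<And>m t. 0 <= t ==> AE w in M. \<bar>N m t w\<bar> <= c"
 shows "mg X"
 unfolding mg_def
proof (intro conjI allI impI)
 have XF: "X t \<in> borel_measurable (F t)" if "0 <= t" for t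
  by (rule F_AE_LIMSEQ[OF that mg_meas[OF N that] lim[OF that]])
 have Xc: "AE w in M. \<bar>X t w\<bar> <= c" if "0 <= t" for t
 proof -
  have "AE w in M. \<forall>m. \<bar>N m t w\<bar> <= c" using c[OF that] by (simp add: AE_all_countable)
  then show ?thesis using lim[OF that]
   by eventually_elim (rule LIMSEQ_le_const2[OF tendsto_rabs], auto)
 qed
 fix t :: real assume t: "0 <= t"
 show "X t \<in> borel_measurable (F t)" by (rule XF[OF t])
 show "integrable M (X t)" by (rule integrable_AE_bounded[OF meas_M[OF XF[OF t]] Xc[OF t]])
next
 fix s t :: real and \<phi> :: "'w => real"
 assume st: "0 <= s" "s <= t" and \<phi>: "\<phi> \<in> borel_measurable (F s)" and "\<exists>b. AE w in M. \<bar>\<phi> w\<bar> <= b"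
 then obtain b where b: "AE w in M. \<bar>\<phi> w\<bar> <= b" by blast
 have t: "0 <= t" using st by simp
 have NM: "N m u \<in> borel_measurable M" if "0 <= u" for m u by (rule meas_M[OF mg_meas[OF N that]])
 have XM: "X u \<in> borel_measurable M" if "0 <= u" for u
  by (rule M_AE_LIMSEQ[OF NM[OF that] lim[OF that]])
 have "(\<lambda>m. \<integral>w. \<phi> w * (N m t w - N m s w) \<partial>M) \<longlonglongrightarrow> (\<integral>w. \<phi> w * (X t w - X s w) \<partial>M)"
 proof (rule integral_dominated_convergence[where w="\<lambda>_. \<bar>b\<bar> * (\<bar>c\<bar> + \<bar>c\<bar>)"])
  show "AE w in M. (\<lambda>m. \<phi> w * (N m t w - N m s w)) \<longlonglongrightarrow> \<phi> w * (X t w - X s w)"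
   using lim[OF t] lim[OF st(1)] by eventually_elim (intro tendsto_intros)
  show "AE w in M. norm (\<phi> w * (N m t w - N m s w)) <= \<bar>b\<bar> * (\<bar>c\<bar> + \<bar>c\<bar>)" for m
   using b c[OF t, of m] c[OF st(1), of m]
   by eventually_elim (auto simp: abs_mult intro!: mult_mono)
  show "(\<lambda>w. \<phi> w * (N m t w - N m s w)) \<in> borel_measurable M" for m
   using meas_M[OF \<phi>] NM[OF t] NM[OF st(1)] by simp
  show "(\<lambda>w. \<phi> w * (X t w - X s w)) \<in> borel_measurable M"
   using meas_M[OF \<phi>] XM[OF t] XM[OF st(1)] by simp
 qed simp
 moreover have "(\<integral>w. \<phi> w * (N m t w - N m s w) \<partial>M) = 0" for m
  by (rule mg_orth[OF N st \<phi> b])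
 ultimately show "(\<integral>w. \<phi> w * (X t w - X s w) \<partial>M) = 0" by (simp add: LIMSEQ_const_iff)
qed

text \<open>The initial value is removed, as in the definition of a continuous local martingale,
  since \<open>Y 0\<close> need not be integrable.\<close>

definition sp :: "('w => real) => (real => 'w => real) => real => 'w => real" where
 "sp \<tau> Y t w = Y (min t (\<tau> w)) w - Y 0 w"

lemma sp_diff: "sp \<tau> Y t w - sp \<tau> Y s w = Y (min t (\<tau> w)) w - Y (min s (\<tau> w)) w"
 by (simp add: sp_def)

text \<open>Stopped at \<open>\<tau>\<close>, the localised processes are all bounded by the same
  \<open>c\<close>. This removes the localising times by dominated convergence.\<close>

lemma sp_mg:
 assumes Y: "cont_local_martingale M F Y" and \<tau>: "stopping_time F \<tau>" "\<And>w. 0 <= \<tau> w"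
  and c: "AE w in M. \<forall>t\<ge>0. \<bar>sp \<tau> Y t w\<bar> <= c"
 shows "mg (sp \<tau> Y)"
proof -
 obtain T :: "nat => 'w => real" where T: "\<And>n. stopping_time F (T n)" "\<And>n w. w \<in> space M ==> 0 <= T n w"
  "AE w in M. filterlim (\<lambda>n. T n w) at_top sequentially"
  "\<And>n. martingale M F (\<lambda>t w. Y (min t (T n w)) w - Y 0 w)"
  using Y unfolding cont_local_martingale_def by blast
 have cont: "AE w in M. continuous_on {0..} (\<lambda>t. Y t w)"
  using Y unfolding cont_local_martingale_def AE_continuous_paths_def by blast
 define N where "N n t w = Y (min t (T n w)) w - Y 0 w" for n t w
 have N: "mg (N n)" for n unfolding N_def by (rule martingale_mg[OF T(4)])
 have Ncont: "AE_continuous_paths M (N n)" for n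
  unfolding AE_continuous_paths_def using cont AE_space
 proof eventually_elim
  case (elim w)
  have "continuous_on {0..} (\<lambda>t. Y (min t (T n w)) w)"
   by (rule continuous_on_compose2[OF elim(1)]) (use T(2)[OF elim(2)] in \<open>auto intro!: continuous_intros\<close>)
  then show ?case unfolding N_def by (intro continuous_intros)
 qed
 have Nc: "AE w in M. \<bar>N n (min t (\<tau> w)) w\<bar> <= c" if "0 <= t" for n t
  using c AE_space
 proof eventually_elim
  case (elim w)
  have "N n (min t (\<tau> w)) w = sp \<tau> Y (min t (T n w)) w"
   by (simp add: N_def sp_def min.commute min.left_commute)
  then show ?case using elim(1) T(2)[OF elim(2), of n] that by simp
 qed
 show ?thesis
 proof (rule mg_LIMSEQ[where N="\<lambda>n t w. N n (min t (\<tau> w)) w" and c=c])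
  show "mg (\<lambda>t w. N n (min t (\<tau> w)) w)" for n
   by (rule mg_stopped_bounded[OF N Ncont \<tau> Nc])
  fix t :: real assume t: "0 <= t"
  show "AE w in M. (\<lambda>n. N n (min t (\<tau> w)) w) \<longlonglongrightarrow> sp \<tau> Y t w"
   using T(3)
  proof eventually_elim
   case (elim w)
   then have "\<forall>\<^sub>F n in sequentially. t <= T n w" by (simp add: filterlim_at_top)
   then have "\<forall>\<^sub>F n in sequentially. N n (min t (\<tau> w)) w = sp \<tau> Y t w"
    by eventually_elim (auto simp: N_def sp_def min_def)
   then show ?case by (rule tendsto_eventually)
  qed
 qed (rule Nc)
qed

subsection \<open>Hitting times\<close>

text \<open>Inserting \<open>T\<close> makes the set nonempty and caps the hitting time at the
  horizon, so that paths which never reach the level need no special value.\<close>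

definition hit :: "(real => 'w => real) => real => real => 'w => real" where
 "hit Z T c w = Inf (insert T {t \<in> {0..T}. c <= \<bar>Z t w\<bar>})"

lemma hit_bounds:
 assumes "0 <= T"
 shows "0 <= hit Z T c w" "hit Z T c w <= T"
proof -
 have "bdd_below (insert T {t \<in> {0..T}. c <= \<bar>Z t w\<bar>})" using assms by (intro bdd_belowI[of _ 0]) auto
 then show "hit Z T c w <= T" unfolding hit_def by (rule cInf_lower[rotated]) simp
 show "0 <= hit Z T c w" unfolding hit_def by (rule cInf_greatest) (use assms in auto)
qed

lemma less_hit:
 assumes "0 <= s" "s < hit Z T c w" "0 <= T" shows "\<bar>Z s w\<bar> < c"
proof (rule ccontr)
 assume n: "\<not> \<bar>Z s w\<bar> < c"
 have "bdd_below (insert T {t \<in> {0..T}. c <= \<bar>Z t w\<bar>})" using assms by (intro bdd_belowI[of _ 0]) auto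
 moreover have "s \<in> insert T {t \<in> {0..T}. c <= \<bar>Z t w\<bar>}" using n assms hit_bounds(2)[of T Z c w] by auto
 ultimately have "hit Z T c w <= s" unfolding hit_def by (rule cInf_lower[rotated])
 then show False using assms by simp
qed

text \<open>Continuity makes the set of times closed, so the infimum is attained;
  \<open>t < T\<close> excludes that it is merely the inserted horizon.\<close>

lemma hit_le_iff:
 assumes cont: "continuous_on {0..} (\<lambda>t. Z t w)" and t: "0 <= t" "t < T"
 shows "hit Z T c w <= t \<longleftrightarrow> (\<exists>s\<in>{0..t}. c <= \<bar>Z s w\<bar>)"
proof
 let ?A = "{s \<in> {0..T}. c <= \<bar>Z s w\<bar>}"
 assume le: "hit Z T c w <= t"
 have "continuous_on {0..T} (\<lambda>t. \<bar>Z t w\<bar>)"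
  by (intro continuous_intros continuous_on_subset[OF cont]) auto
 then have "closed ({0..T} \<inter> (\<lambda>t. \<bar>Z t w\<bar>) -` {c..})"
  by (rule continuous_closed_preimage) auto
 moreover have "{0..T} \<inter> (\<lambda>t. \<bar>Z t w\<bar>) -` {c..} = ?A" by auto
 ultimately have "closed ?A" by simp
 then have "closed (insert T ?A)" by (rule closed_insert)
 then have "hit Z T c w \<in> insert T ?A" unfolding hit_def
  using t by (intro closed_contains_Inf bdd_belowI[of _ 0]) auto
 then show "\<exists>s\<in>{0..t}. c <= \<bar>Z s w\<bar>" using le t by auto
next
 assume "\<exists>s\<in>{0..t}. c <= \<bar>Z s w\<bar>"
 then obtain s where "s \<in> {0..t}" "c <= \<bar>Z s w\<bar>" by blast
 then show "hit Z T c w <= t" using less_hit[of s Z T c w] t by force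
qed

text \<open>A countable description of an uncountable union. All sampling times are fractions of
  \<open>t\<close>, hence known at time \<open>t\<close>; the slack \<open>1 / real (Suc k)\<close>
  allows approximating the time of the maximum, and compactness recovers the exact level.\<close>

lemma ex_ge_iff_grid:
 assumes cont: "continuous_on {0..} (\<lambda>t. Z t w :: real)" and t: "0 <= t"
 shows "(\<exists>s\<in>{0..t}. c <= \<bar>Z s w\<bar>) \<longleftrightarrow>
  (\<forall>k. \<exists>j i. i <= Suc j \<and> c - 1 / real (Suc k) < \<bar>Z (t * (real i / real (Suc j))) w\<bar>)"
proof
 have cont': "continuous_on {0..t} (\<lambda>t. \<bar>Z t w\<bar>)"
  by (intro continuous_intros continuous_on_subset[OF cont]) auto
 {
  assume "\<exists>s\<in>{0..t}. c <= \<bar>Z s w\<bar>"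
  then obtain s where s: "s \<in> {0..t}" "c <= \<bar>Z s w\<bar>" by blast
  define x where "x = s / t"
  have x: "0 <= x" "x <= 1" "s = t * x" using s t by (auto simp: x_def divide_le_eq_1)
  define i where "i j = nat \<lfloor>x * real (Suc j)\<rfloor>" for j
  have i: "real (i j) <= x * real (Suc j)" "x * real (Suc j) - 1 <= real (i j)" for j
   using x by (auto simp: i_def of_nat_nat)
  have i1: "i j <= Suc j" for j
  proof -
   have "real (i j) <= 1 * real (Suc j)" using i(1)[of j] x by (meson mult_right_mono of_nat_0_le_iff order_trans)
   then have "real (i j) <= real (Suc j)" by (simp only: mult_1)
   then show ?thesis by (simp only: of_nat_le_iff)
  qed
  define q where "q j = real (i j) / real (Suc j)" for j
  have q1: "q j <= x" for j unfolding q_def using i(1)[of j] by (subst pos_divide_le_eq) auto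
  have q2: "x - 1 / real (Suc j) <= q j" for j
  proof -
   have "x - 1 / real (Suc j) = (x * real (Suc j) - 1) / real (Suc j)" by (simp add: diff_divide_distrib)
   also have "\<dots> <= q j" unfolding q_def by (intro divide_right_mono i(2)) simp
   finally show ?thesis .
  qed
  have "q \<longlonglongrightarrow> x"
  proof (rule tendsto_sandwich[OF _ _ _ tendsto_const])
   show "(\<lambda>j. x - 1 / real (Suc j)) \<longlonglongrightarrow> x"
    using tendsto_diff[OF tendsto_const[of x] LIMSEQ_Suc[OF lim_1_over_n]] by simp
  qed (use q1 q2 in auto)
  then have "(\<lambda>j. t * q j) \<longlonglongrightarrow> s" unfolding x(3) by (intro tendsto_intros)
  moreover have tq: "t * q j \<in> {0..t}" for j
  proof -
   have "0 <= q j" by (simp add: q_def)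
   moreover have "q j <= 1" using q1[of j] x(2) by linarith
   ultimately show ?thesis using t by (auto simp: mult_left_le)
  qed
  ultimately have lim: "(\<lambda>j. \<bar>Z (t * q j) w\<bar>) \<longlonglongrightarrow> \<bar>Z s w\<bar>"
   using continuous_on_tendsto_compose[OF cont', of "\<lambda>j. t * q j" s sequentially] s by auto
  show "\<forall>k. \<exists>j i. i <= Suc j \<and> c - 1 / real (Suc k) < \<bar>Z (t * (real i / real (Suc j))) w\<bar>"
  proof
   fix k
   have "c - 1 / real (Suc k) < \<bar>Z s w\<bar>" using s(2) by (smt (verit) divide_pos_pos of_nat_0_less_iff zero_less_Suc)
   with lim have "\<forall>\<^sub>F j in sequentially. c - 1 / real (Suc k) < \<bar>Z (t * q j) w\<bar>" by (rule order_tendstoD)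
   then obtain j where "c - 1 / real (Suc k) < \<bar>Z (t * q j) w\<bar>" by (meson eventually_sequentially le_refl)
   then show "\<exists>j i. i <= Suc j \<and> c - 1 / real (Suc k) < \<bar>Z (t * (real i / real (Suc j))) w\<bar>"
    using i1[of j] unfolding q_def by blast
  qed
 next
  assume H: "\<forall>k. \<exists>j i. i <= Suc j \<and> c - 1 / real (Suc k) < \<bar>Z (t * (real i / real (Suc j))) w\<bar>"
  have "\<exists>s\<in>{0..t}. \<forall>u\<in>{0..t}. \<bar>Z u w\<bar> <= \<bar>Z s w\<bar>"
   by (intro continuous_attains_sup cont') (use t in auto)
  then obtain s where s: "s \<in> {0..t}" "\<And>u. u \<in> {0..t} ==> \<bar>Z u w\<bar> <= \<bar>Z s w\<bar>" by blast
  have "c - 1 / real (Suc k) <= \<bar>Z s w\<bar>" for k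
  proof -
   obtain j i where ij: "i <= Suc j" "c - 1 / real (Suc k) < \<bar>Z (t * (real i / real (Suc j))) w\<bar>" using H by blast
   have "real i / real (Suc j) <= 1" using ij(1) by (simp add: divide_le_eq_1)
   then have "t * (real i / real (Suc j)) \<in> {0..t}" using t mult_left_mono[of "real i / real (Suc j)" 1 t] by auto
   then show ?thesis using s(2) ij(2) by force
  qed
  moreover have "(\<lambda>k. c - 1 / real (Suc k)) \<longlonglongrightarrow> c"
   using tendsto_diff[OF tendsto_const[of c] LIMSEQ_Suc[OF lim_1_over_n]] by simp
  ultimately have "c <= \<bar>Z s w\<bar>" by (intro LIMSEQ_le_const2) auto
  then show "\<exists>s\<in>{0..t}. c <= \<bar>Z s w\<bar>" using s(1) by blast
 }
qed

lemma stopping_time_hit: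
 assumes Z: "adapted F Z" "AE_continuous_paths M Z" and T: "0 <= T"
 shows "stopping_time F (hit Z T c)"
proof (rule stopping_timeI)
 fix t :: real
 consider "t < 0" | "T <= t" | "0 <= t" "t < T" by linarith
 then show "Measurable.pred (F t) (\<lambda>w. hit Z T c w <= t)"
 proof cases
  case 1
  then have "\<not> hit Z T c w <= t" for w using hit_bounds(1)[OF T, of Z c w] by linarith
  then show ?thesis by simp
 next
  case 2
  then have "hit Z T c w <= t" for w using hit_bounds(2)[OF T, of Z c w] by linarith
  then show ?thesis by simp
 next
  case 3
  show ?thesis
  proof (rule F_AE_pred[OF 3(1)])
   have Zm: "Z (t * (real i / real (Suc j))) \<in> borel_measurable (F t)" if "i <= Suc j" for i j
   proof (rule meas_mono[OF Z(1)[unfolded adapted_def, rule_format]])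
    have "real i / real (Suc j) <= 1" using that by (simp add: divide_le_eq_1)
    then show "t * (real i / real (Suc j)) <= t" "0 <= t * (real i / real (Suc j))"
     using 3 mult_left_mono[of "real i / real (Suc j)" 1 t] by auto
   qed
   have "Measurable.pred (F t) (\<lambda>w. i <= Suc j \<and> c - 1 / real (Suc k) < \<bar>Z (t * (real i / real (Suc j))) w\<bar>)" for i j k
   proof (cases "i <= Suc j")
    case True
    note [measurable] = Zm[OF True]
    have "Measurable.pred (F t) (\<lambda>w. c - 1 / real (Suc k) < \<bar>Z (t * (real i / real (Suc j))) w\<bar>)" by measurable
    then show ?thesis using True by (simp only: simp_thms)
   qed simp
   then show "Measurable.pred (F t) (\<lambda>w. \<forall>k. \<exists>j i. i <= Suc j \<and> c - 1 / real (Suc k) < \<bar>Z (t * (real i / real (Suc j))) w\<bar>)"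
    by (intro pred_intros_countable)
   show "AE w in M. (\<forall>k. \<exists>j i. i <= Suc j \<and> c - 1 / real (Suc k) < \<bar>Z (t * (real i / real (Suc j))) w\<bar>) \<longleftrightarrow> hit Z T c w <= t"
    using Z(2) unfolding AE_continuous_paths_def
    by eventually_elim (simp only: hit_le_iff[where Z=Z, OF _ 3] ex_ge_iff_grid[where Z=Z, OF _ 3(1)])
  qed
 qed
qed

lemma hit_eventually:
 assumes Z: "AE_continuous_paths M Z" and T: "0 <= T"
 shows "AE w in M. \<forall>\<^sub>F n in sequentially. hit Z T (real n) w = T"
 using Z unfolding AE_continuous_paths_def
proof eventually_elim
 case (elim w)
 have "continuous_on {0..T} (\<lambda>t. \<bar>Z t w\<bar>)"
  by (intro continuous_intros continuous_on_subset[OF elim]) auto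
 then have "\<exists>s\<in>{0..T}. \<forall>u\<in>{0..T}. \<bar>Z u w\<bar> <= \<bar>Z s w\<bar>"
  by (intro continuous_attains_sup) (use T in auto)
 then obtain s where s: "\<And>u. u \<in> {0..T} ==> \<bar>Z u w\<bar> <= \<bar>Z s w\<bar>" by blast
 have "hit Z T (real n) w = T" if "n \<ge> nat \<lceil>\<bar>Z s w\<bar> + 1\<rceil>" for n
 proof -
  have "real n > \<bar>Z s w\<bar>" using that by linarith
  then have "{t \<in> {0..T}. real n <= \<bar>Z t w\<bar>} = {}" using s by fastforce
  then show ?thesis unfolding hit_def by (simp only: cInf_singleton)
 qed
 then show ?case by (auto simp: eventually_sequentially)
qed

subsection \<open>Discrete stochastic integrals\<close>

lemma integrable_power2_AE_bounded:
 fixes f :: "'w => real"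
 assumes "f \<in> borel_measurable M" "AE w in M. \<bar>f w\<bar> <= c"
 shows "integrable M (\<lambda>w. (f w)\<^sup>2)"
proof (rule integrable_AE_bounded[where c="c\<^sup>2"])
 show "AE w in M. \<bar>(f w)\<^sup>2\<bar> <= c\<^sup>2"
  using assms(2)
 proof eventually_elim
  case (elim w)
  then have "\<bar>f w\<bar>\<^sup>2 <= c\<^sup>2" by (rule power_mono) simp
  then show ?case by simp
 qed
qed (use assms in simp)

text \<open>The partial sum up to \<open>n\<close> times \<open>\<eta> n\<close> is a bounded weight
  known at \<open>u n\<close>, so its product with the next increment has mean zero and the cross
  terms disappear.\<close>

lemma discrete_isometry:
 assumes N: "mg N" and c: "\<And>t. 0 <= t ==> AE w in M. \<bar>N t w\<bar> <= c"
  and u: "0 <= u 0" "\<And>k. u k <= u (Suc k)"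
  and \<eta>: "\<And>k. \<eta> k \<in> borel_measurable (F (u k))" "\<And>k. AE w in M. \<bar>\<eta> k w\<bar> <= b"
 defines "D k w \<equiv> \<eta> k w * (N (u (Suc k)) w - N (u k) w)"
 shows "\<And>k. D k \<in> borel_measurable M" "\<And>k. AE w in M. \<bar>D k w\<bar> <= \<bar>b\<bar> * (2 * c)"
  "(\<lambda>w. \<Sum>k<n. D k w) \<in> borel_measurable (F (u n))"
  "AE w in M. \<bar>\<Sum>k<n. D k w\<bar> <= real n * (\<bar>b\<bar> * (2 * c))"
  "(\<integral>w. (\<Sum>k<n. D k w)\<^sup>2 \<partial>M) = (\<Sum>k<n. \<integral>w. (D k w)\<^sup>2 \<partial>M)"
proof -
 have u0: "0 <= u k" for k by (induction k) (use u order_trans in blast)+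
 have um: "u i <= u j" if "i <= j" for i j using lift_Suc_mono_le[of u] u(2) that by blast
 have DF: "D k \<in> borel_measurable (F (u j))" if "Suc k <= j" for k j
  unfolding D_def
  by (intro borel_measurable_times borel_measurable_diff meas_mono[OF \<eta>(1)] meas_mono[OF mg_meas[OF N u0]] um)
   (use that in auto)
 show DM: "\<And>k. D k \<in> borel_measurable M" by (rule meas_M[OF DF[OF le_refl]])
 show Db: "\<And>k. AE w in M. \<bar>D k w\<bar> <= \<bar>b\<bar> * (2 * c)"
  subgoal for k
   using \<eta>(2)[of k] c[OF u0[of k]] c[OF u0[of "Suc k"]]
   by eventually_elim (auto simp: D_def abs_mult intro!: mult_mono)
  done
 have SF: "(\<lambda>w. \<Sum>k<n. D k w) \<in> borel_measurable (F (u n))" for n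
  by (intro borel_measurable_sum DF) auto
 then show "(\<lambda>w. \<Sum>k<n. D k w) \<in> borel_measurable (F (u n))" .
 have Sb: "AE w in M. \<bar>\<Sum>k<n. D k w\<bar> <= real n * (\<bar>b\<bar> * (2 * c))" for n
 proof -
  have "AE w in M. \<forall>k. \<bar>D k w\<bar> <= \<bar>b\<bar> * (2 * c)" using Db by (simp add: AE_all_countable)
  then show ?thesis
  proof eventually_elim
   case (elim w)
   have "\<bar>\<Sum>k<n. D k w\<bar> <= (\<Sum>k<n. \<bar>b\<bar> * (2 * c))"
    by (rule order_trans[OF sum_abs sum_mono]) (use elim in auto)
   then show ?case by simp
  qed
 qed
 then show "AE w in M. \<bar>\<Sum>k<n. D k w\<bar> <= real n * (\<bar>b\<bar> * (2 * c))" .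
 show "(\<integral>w. (\<Sum>k<n. D k w)\<^sup>2 \<partial>M) = (\<Sum>k<n. \<integral>w. (D k w)\<^sup>2 \<partial>M)"
 proof (induction n)
  case (Suc n)
  let ?S = "\<lambda>w. \<Sum>k<n. D k w"
  have i: "integrable M (\<lambda>w. (?S w)\<^sup>2)" "integrable M (\<lambda>w. (D n w)\<^sup>2)" "integrable M (\<lambda>w. ?S w * D n w)"
  proof -
   show "integrable M (\<lambda>w. (?S w)\<^sup>2)" by (rule integrable_power2_AE_bounded[OF _ Sb]) (use DM in simp)
   show "integrable M (\<lambda>w. (D n w)\<^sup>2)" by (rule integrable_power2_AE_bounded[OF DM Db])
   show "integrable M (\<lambda>w. ?S w * D n w)"
   proof (rule integrable_bounded_mult[OF _ _ Sb])
    show "integrable M (D n)" by (rule integrable_AE_bounded[OF DM Db])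
   qed (use DM in simp)
  qed
  have "(\<integral>w. ?S w * D n w \<partial>M) = (\<integral>w. (?S w * \<eta> n w) * (N (u (Suc n)) w - N (u n) w) \<partial>M)"
   by (simp add: D_def mult.assoc)
  also have "\<dots> = 0"
  proof (rule mg_orth[OF N u0 u(2)])
   show "(\<lambda>w. ?S w * \<eta> n w) \<in> borel_measurable (F (u n))" by (intro borel_measurable_times SF \<eta>(1))
   show "AE w in M. \<bar>?S w * \<eta> n w\<bar> <= \<bar>real n * (\<bar>b\<bar> * (2 * c))\<bar> * \<bar>b\<bar>"
    using Sb[of n] \<eta>(2)[of n] by eventually_elim (auto simp: abs_mult[of "?S _"] intro!: mult_mono)
  qed
  finally have cross: "(\<integral>w. ?S w * D n w \<partial>M) = 0" .
  have "(\<integral>w. (\<Sum>k<Suc n. D k w)\<^sup>2 \<partial>M) = (\<integral>w. (?S w)\<^sup>2 + (D n w)\<^sup>2 + 2 * (?S w * D n w) \<partial>M)"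
   by (simp add: power2_sum algebra_simps)
  also have "\<dots> = (\<integral>w. (?S w)\<^sup>2 \<partial>M) + (\<integral>w. (D n w)\<^sup>2 \<partial>M)"
   using i cross by simp
  finally show ?case using Suc by simp
 qed simp
qed

text \<open>The bounds are independent of the number of partition points. Telescoping the squares
  gives \<open>Q = N(u n)^2 - N(u 0)^2 - 2 * R\<close>, with \<open>R\<close> the discrete integral
  of \<open>N\<close> against itself. The isometry bounds the mean of \<open>R^2\<close> by
  \<open>c^2\<close> times the mean of \<open>Q\<close>, that is by \<open>4 * c ^ 4\<close>, whence
  \<open>34 = 2 + 8 * 4\<close>.\<close>

lemma discrete_quadratic_variation:
 assumes N: "mg N" and c: "\<And>t. 0 <= t ==> AE w in M. \<bar>N t w\<bar> <= c" "0 <= c"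
  and u: "0 <= u 0" "\<And>k. u k <= u (Suc k)"
 defines "Q n w \<equiv> \<Sum>k<n. (N (u (Suc k)) w - N (u k) w)\<^sup>2"
 shows "Q n \<in> borel_measurable M" "integrable M (Q n)" "(\<integral>w. Q n w \<partial>M) <= 4 * c\<^sup>2"
  "integrable M (\<lambda>w. (Q n w)\<^sup>2)" "(\<integral>w. (Q n w)\<^sup>2 \<partial>M) <= 34 * c ^ 4"
proof -
 have u0: "0 <= u k" for k by (induction k) (use u order_trans in blast)+
 have NM: "N (u k) \<in> borel_measurable M" for k by (rule meas_M[OF mg_meas[OF N u0]])
 have Nc: "AE w in M. \<forall>k. \<bar>N (u k) w\<bar> <= c" using c(1)[OF u0] by (simp add: AE_all_countable)
 let ?D = "\<lambda>k w. N (u (Suc k)) w - N (u k) w"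
 show QM: "Q n \<in> borel_measurable M" unfolding Q_def using NM by simp
 have Qb: "AE w in M. \<bar>Q n w\<bar> <= real n * (2 * c)\<^sup>2" using Nc
 proof eventually_elim
  case (elim w)
  have "(?D k w)\<^sup>2 <= (2 * c)\<^sup>2" for k
   using elim[rule_format, of k] elim[rule_format, of "Suc k"] c(2) by (intro power2_le_iff_abs_le[THEN iffD2]) auto
  then have "Q n w <= (\<Sum>k<n. (2 * c)\<^sup>2)" unfolding Q_def by (intro sum_mono)
  moreover have "0 <= Q n w" unfolding Q_def by (intro sum_nonneg) auto
  ultimately show ?case by simp
 qed
 show iQ: "integrable M (Q n)" by (rule integrable_AE_bounded[OF QM Qb])
 show "integrable M (\<lambda>w. (Q n w)\<^sup>2)" by (rule integrable_power2_AE_bounded[OF QM Qb])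
 have iso1: "(\<integral>w. (\<Sum>k<n. 1 * ?D k w)\<^sup>2 \<partial>M) = (\<Sum>k<n. \<integral>w. (1 * ?D k w)\<^sup>2 \<partial>M)"
  by (rule discrete_isometry(5)[OF N c(1) u, where b=1]) auto
 have iD: "integrable M (\<lambda>w. (?D k w)\<^sup>2)" for k
 proof (rule integrable_power2_AE_bounded[where c="2*c"])
  show "AE w in M. \<bar>?D k w\<bar> <= 2 * c"
   using Nc
  proof eventually_elim
   case (elim w)
   then show ?case using elim[rule_format, of k] elim[rule_format, of "Suc k"] by linarith
  qed
 qed (use NM in simp)
 have tele: "(\<Sum>k<n. 1 * ?D k w) = N (u n) w - N (u 0) w" for w
  using sum_lessThan_telescope[of "\<lambda>k. N (u k) w" n] by simp
 have EQ: "(\<integral>w. Q n w \<partial>M) = (\<integral>w. (N (u n) w - N (u 0) w)\<^sup>2 \<partial>M)"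
  unfolding tele[symmetric] iso1 Q_def using iD by simp
 have d2: "AE w in M. (N (u n) w - N (u 0) w)\<^sup>2 <= 4 * c\<^sup>2" using Nc
 proof eventually_elim
  case (elim w)
  have "(N (u n) w - N (u 0) w)\<^sup>2 <= (2 * c)\<^sup>2"
   using elim[rule_format, of 0] elim[rule_format, of n] c(2) by (intro power2_le_iff_abs_le[THEN iffD2]) auto
  then show ?case by (simp add: power_mult_distrib)
 qed
 show EQ4: "(\<integral>w. Q n w \<partial>M) <= 4 * c\<^sup>2" unfolding EQ
  by (rule integral_le_const[OF _ d2], rule integrable_AE_bounded[where c="4*c\<^sup>2"]) (use NM d2 in auto)
 define R where "R w = (\<Sum>k<n. N (u k) w * ?D k w)" for w
 have iso2: "(\<integral>w. (R w)\<^sup>2 \<partial>M) = (\<Sum>k<n. \<integral>w. (N (u k) w * ?D k w)\<^sup>2 \<partial>M)"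
  unfolding R_def by (rule discrete_isometry(5)[OF N c(1) u, where b=c]) (auto intro: mg_meas[OF N u0] c(1)[OF u0])
 have RM: "R \<in> borel_measurable M" unfolding R_def using NM by simp
 have Rb: "AE w in M. \<bar>R w\<bar> <= real n * (\<bar>c\<bar> * (2 * c))"
  unfolding R_def by (rule discrete_isometry(4)[OF N c(1) u, where b=c]) (auto intro: mg_meas[OF N u0] c(1)[OF u0])
 have iR: "integrable M (\<lambda>w. (R w)\<^sup>2)" by (rule integrable_power2_AE_bounded[OF RM Rb])
 have "(\<integral>w. (N (u k) w * ?D k w)\<^sup>2 \<partial>M) <= (\<integral>w. c\<^sup>2 * (?D k w)\<^sup>2 \<partial>M)" for k
 proof (rule integral_mono_AE)
  show ii: "integrable M (\<lambda>w. c\<^sup>2 * (?D k w)\<^sup>2)" using iD by simp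
  show le: "AE w in M. (N (u k) w * ?D k w)\<^sup>2 <= c\<^sup>2 * (?D k w)\<^sup>2"
   using Nc by eventually_elim (auto simp: power_mult_distrib c(2) intro!: mult_right_mono power2_le_iff_abs_le[THEN iffD2])
  show "integrable M (\<lambda>w. (N (u k) w * ?D k w)\<^sup>2)"
   by (rule Bochner_Integration.integrable_bound[OF ii]) (use NM le in auto)
 qed
 then have "(\<integral>w. (R w)\<^sup>2 \<partial>M) <= (\<Sum>k<n. \<integral>w. c\<^sup>2 * (?D k w)\<^sup>2 \<partial>M)"
  unfolding iso2 by (intro sum_mono) simp
 also have "\<dots> = c\<^sup>2 * (\<integral>w. Q n w \<partial>M)" unfolding Q_def using iD by (simp add: sum_distrib_left)
 also have "\<dots> <= c\<^sup>2 * (4 * c\<^sup>2)" by (intro mult_left_mono EQ4) auto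
 finally have ER: "(\<integral>w. (R w)\<^sup>2 \<partial>M) <= 4 * c ^ 4" by (simp add: power2_eq_square eval_nat_numeral)
 have "(\<integral>w. (Q n w)\<^sup>2 \<partial>M) <= (\<integral>w. 2 * c ^ 4 + 8 * (R w)\<^sup>2 \<partial>M)"
 proof (rule integral_mono_AE)
  show "integrable M (\<lambda>w. (Q n w)\<^sup>2)" by (rule integrable_power2_AE_bounded[OF QM Qb])
  show "integrable M (\<lambda>w. 2 * c ^ 4 + 8 * (R w)\<^sup>2)" using iR by simp
  show "AE w in M. (Q n w)\<^sup>2 <= 2 * c ^ 4 + 8 * (R w)\<^sup>2" using Nc
  proof eventually_elim
   case (elim w)
   have sq: "(N (u k) w)\<^sup>2 <= c\<^sup>2" for k using elim c(2) by (intro power2_le_iff_abs_le[THEN iffD2]) auto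
   have "(\<Sum>k<n. (N (u (Suc k)) w)\<^sup>2 - (N (u k) w)\<^sup>2) = (N (u n) w)\<^sup>2 - (N (u 0) w)\<^sup>2"
    by (rule sum_lessThan_telescope)
   moreover have "(\<Sum>k<n. (N (u (Suc k)) w)\<^sup>2 - (N (u k) w)\<^sup>2) = Q n w + 2 * R w"
    unfolding Q_def R_def by (simp add: sum.distrib[symmetric] sum_distrib_left power2_eq_square algebra_simps)
   ultimately have Q: "Q n w = ((N (u n) w)\<^sup>2 - (N (u 0) w)\<^sup>2) - 2 * R w" by simp
   let ?a = "(N (u n) w)\<^sup>2 - (N (u 0) w)\<^sup>2"
   have "\<bar>?a\<bar> <= c\<^sup>2"
    using sq[of n] sq[of 0] zero_le_power2[of "N (u n) w"] zero_le_power2[of "N (u 0) w"] by linarith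
   then have "\<bar>?a\<bar>\<^sup>2 <= (c\<^sup>2)\<^sup>2" by (rule power_mono) simp
   then have "?a\<^sup>2 <= c ^ 4" by simp
   moreover have "(?a - 2 * R w)\<^sup>2 <= 2 * ?a\<^sup>2 + 8 * (R w)\<^sup>2"
    using zero_le_power2[of "?a + 2 * R w"] by (simp add: power2_eq_square algebra_simps)
   ultimately show ?case unfolding Q by linarith
  qed
 qed
 also have "\<dots> <= 34 * c ^ 4" using ER iR by (simp add: prob_space)
 finally show "(\<integral>w. (Q n w)\<^sup>2 \<partial>M) <= 34 * c ^ 4" .
qed

text \<open>The increment of \<open>Y * Z\<close> is \<open>dY * dZ + Z s * dY + Y s * dZ\<close>,
  and the two mixed terms have mean zero. Their weights must be bounded, which is why
  \<open>\<phi>\<close> is supported where the process still runs at \<open>s\<close> and the values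
  at \<open>s\<close> are bounded by \<open>c\<close>.\<close>

lemma bracket_increment:
 assumes mg: "mg (sp \<tau> Y)" "mg (sp \<tau> Z)" "mg (sp \<tau> (\<lambda>t w. Y t w * Z t w - V t w))"
  and c: "\<And>t. 0 <= t ==> AE w in M. \<bar>sp \<tau> Y t w\<bar> <= c" "\<And>t. 0 <= t ==> AE w in M. \<bar>sp \<tau> Z t w\<bar> <= c"
  and st: "0 <= s" "s <= t" and \<phi>: "\<phi> \<in> borel_measurable (F s)" "AE w in M. \<bar>\<phi> w\<bar> <= b"
  and \<phi>0: "AE w in M. \<phi> w \<noteq> 0 --> s < \<tau> w \<and> \<bar>Y s w\<bar> <= c \<and> \<bar>Z s w\<bar> <= c"
  and ad: "adapted F Y" "adapted F Z"
 defines "dY w \<equiv> Y (min t (\<tau> w)) w - Y (min s (\<tau> w)) w"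
  and "dZ w \<equiv> Z (min t (\<tau> w)) w - Z (min s (\<tau> w)) w"
  and "dV w \<equiv> V (min t (\<tau> w)) w - V (min s (\<tau> w)) w"
 shows "integrable M (\<lambda>w. \<phi> w * (dY w * dZ w))" "integrable M (\<lambda>w. \<phi> w * dV w)"
  "(\<integral>w. \<phi> w * (dY w * dZ w) \<partial>M) = (\<integral>w. \<phi> w * dV w \<partial>M)"
proof -
 have t: "0 <= t" using st by simp
 let ?P = "\<lambda>t w. Y t w * Z t w - V t w"
 have dY: "dY = (\<lambda>w. sp \<tau> Y t w - sp \<tau> Y s w)" and dZ: "dZ = (\<lambda>w. sp \<tau> Z t w - sp \<tau> Z s w)"
  unfolding dY_def dZ_def sp_diff by (rule refl)+
 have dYM: "dY \<in> borel_measurable M" "dZ \<in> borel_measurable M"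
  unfolding dY dZ using mg_integrable[OF mg(1)] mg_integrable[OF mg(2)] st t by auto
 have dYb: "AE w in M. \<bar>dY w\<bar> <= 2 * c" using c(1)[OF st(1)] c(1)[OF t] by eventually_elim (auto simp: dY)
 have dZb: "AE w in M. \<bar>dZ w\<bar> <= 2 * c" using c(2)[OF st(1)] c(2)[OF t] by eventually_elim (auto simp: dZ)
 have YZF: "Y s \<in> borel_measurable (F s)" "Z s \<in> borel_measurable (F s)" using ad st by (auto simp: adapted_def)
 have idY: "integrable M dY" "integrable M dZ"
  using integrable_AE_bounded[OF dYM(1) dYb] integrable_AE_bounded[OF dYM(2) dZb] by auto
 have p1: "(\<lambda>w. \<phi> w * Y s w) \<in> borel_measurable (F s)" "(\<lambda>w. \<phi> w * Z s w) \<in> borel_measurable (F s)"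
  using \<phi>(1) YZF by auto
 have b1: "AE w in M. \<bar>\<phi> w * Y s w\<bar> <= \<bar>b\<bar> * \<bar>c\<bar>"
  using \<phi>(2) \<phi>0
 proof eventually_elim
  case (elim w) then show ?case by (cases "\<phi> w = 0") (auto simp: abs_mult intro!: mult_mono)
 qed
 have b2: "AE w in M. \<bar>\<phi> w * Z s w\<bar> <= \<bar>b\<bar> * \<bar>c\<bar>"
  using \<phi>(2) \<phi>0
 proof eventually_elim
  case (elim w) then show ?case by (cases "\<phi> w = 0") (auto simp: abs_mult intro!: mult_mono)
 qed
 have \<phi>M: "\<phi> \<in> borel_measurable M" by (rule meas_M[OF \<phi>(1)])
 have z1: "(\<integral>w. (\<phi> w * Z s w) * dY w \<partial>M) = 0" unfolding dY by (rule mg_orth[OF mg(1) st p1(2) b2])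
 have z2: "(\<integral>w. (\<phi> w * Y s w) * dZ w \<partial>M) = 0" unfolding dZ by (rule mg_orth[OF mg(2) st p1(1) b1])
 have z3: "(\<integral>w. \<phi> w * (sp \<tau> ?P t w - sp \<tau> ?P s w) \<partial>M) = 0" by (rule mg_orth[OF mg(3) st \<phi>])
 have i1: "integrable M (\<lambda>w. (\<phi> w * Z s w) * dY w)" by (rule integrable_bounded_mult[OF idY(1) meas_M[OF p1(2)] b2])
 have i2: "integrable M (\<lambda>w. (\<phi> w * Y s w) * dZ w)" by (rule integrable_bounded_mult[OF idY(2) meas_M[OF p1(1)] b1])
 have i3: "integrable M (\<lambda>w. \<phi> w * (sp \<tau> ?P t w - sp \<tau> ?P s w))"
  by (rule integrable_bounded_mult[OF _ \<phi>M \<phi>(2)]) (use mg_integrable[OF mg(3)] st t in auto)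
 show i4: "integrable M (\<lambda>w. \<phi> w * (dY w * dZ w))"
  by (rule integrable_bounded_mult[OF integrable_bounded_mult[OF idY(2) dYM(1) dYb] \<phi>M \<phi>(2)])
 have eq: "AE w in M. \<phi> w * dV w = \<phi> w * (dY w * dZ w) + (\<phi> w * Z s w) * dY w + (\<phi> w * Y s w) * dZ w
   - \<phi> w * (sp \<tau> ?P t w - sp \<tau> ?P s w)"
  using \<phi>0
 proof eventually_elim
  case (elim w)
  show ?case
  proof (cases "\<phi> w = 0")
   case False
   then have "min s (\<tau> w) = s" using elim by simp
   then show ?thesis unfolding sp_diff dY_def dZ_def dV_def by (simp add: algebra_simps)
  qed simp
 qed
 have i5: "integrable M (\<lambda>w. \<phi> w * (dY w * dZ w) + (\<phi> w * Z s w) * dY w + (\<phi> w * Y s w) * dZ w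
   - \<phi> w * (sp \<tau> ?P t w - sp \<tau> ?P s w))" (is "integrable M ?h")
  using i1 i2 i3 i4 by simp
 have dVM: "(\<lambda>w. \<phi> w * dV w) \<in> borel_measurable M"
  by (rule measurable_AE_cong[OF refl null_M, of ?h]) (use i5 eq in auto)
 show "integrable M (\<lambda>w. \<phi> w * dV w)"
  using integrable_cong_AE[OF dVM borel_measurable_integrable[OF i5] eq] i5 by simp
 have "(\<integral>w. \<phi> w * dV w \<partial>M) = (\<integral>w. ?h w \<partial>M)"
  by (rule integral_cong_AE[OF dVM borel_measurable_integrable[OF i5] eq])
 also have "\<dots> = (\<integral>w. \<phi> w * (dY w * dZ w) \<partial>M)"
  using i1 i2 i3 i4 z1 z2 z3 by simp
 finally show "(\<integral>w. \<phi> w * (dY w * dZ w) \<partial>M) = (\<integral>w. \<phi> w * dV w \<partial>M)" by simp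
qed

section \<open>Uniqueness of the bracket\<close>

lemma mg_cmult: assumes "mg Y" shows "mg (\<lambda>t w. a * Y t w)"
 unfolding mg_def
proof (intro conjI allI impI)
 fix t :: real assume t: "0 <= t"
 show "(\<lambda>w. a * Y t w) \<in> borel_measurable (F t)" using mg_meas[OF assms t] by simp
 show "integrable M (\<lambda>w. a * Y t w)" using mg_integrable[OF assms t] by simp
next
 fix s t :: real and \<phi> :: "'w => real"
 assume a: "0 <= s" "s <= t" "\<phi> \<in> borel_measurable (F s)" "\<exists>c. AE w in M. \<bar>\<phi> w\<bar> <= c"
 then obtain c where c: "AE w in M. \<bar>\<phi> w\<bar> <= c" by blast
 have "(\<integral>w. \<phi> w * (a * Y t w - a * Y s w) \<partial>M) = (\<integral>w. a * (\<phi> w * (Y t w - Y s w)) \<partial>M)"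
  by (intro Bochner_Integration.integral_cong refl) (simp add: algebra_simps)
 also have "\<dots> = 0" using mg_orth[OF assms a(1-3) c] by simp
 finally show "(\<integral>w. \<phi> w * (a * Y t w - a * Y s w) \<partial>M) = 0" .
qed

lemma mg_add: assumes Y: "mg Y" "mg Z" shows "mg (\<lambda>t w. Y t w + Z t w)"
 unfolding mg_def
proof (intro conjI allI impI)
 fix t :: real assume t: "0 <= t"
 show "(\<lambda>w. Y t w + Z t w) \<in> borel_measurable (F t)" using mg_meas[OF Y(1) t] mg_meas[OF Y(2) t] by simp
 show "integrable M (\<lambda>w. Y t w + Z t w)" using mg_integrable[OF Y(1) t] mg_integrable[OF Y(2) t] by simp
next
 fix s t :: real and \<phi> :: "'w => real"
 assume a: "0 <= s" "s <= t" "\<phi> \<in> borel_measurable (F s)" "\<exists>c. AE w in M. \<bar>\<phi> w\<bar> <= c"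
 then obtain c where c: "AE w in M. \<bar>\<phi> w\<bar> <= c" by blast
 have i: "integrable M (\<lambda>w. \<phi> w * (Y t w - Y s w))" if "mg Y" for Y
  by (rule integrable_bounded_mult[OF _ meas_M[OF a(3)] c]) (use mg_integrable[OF that] a in auto)
 have "(\<integral>w. \<phi> w * (Y t w + Z t w - (Y s w + Z s w)) \<partial>M)
   = (\<integral>w. \<phi> w * (Y t w - Y s w) + \<phi> w * (Z t w - Z s w) \<partial>M)"
  by (intro Bochner_Integration.integral_cong refl) (simp add: algebra_simps)
 also have "\<dots> = 0" using mg_orth[OF Y(1) a(1-3) c] mg_orth[OF Y(2) a(1-3) c] i[OF Y(1)] i[OF Y(2)] by simp
 finally show "(\<integral>w. \<phi> w * (Y t w + Z t w - (Y s w + Z s w)) \<partial>M) = 0" .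
qed

text \<open>The bound holds strictly before the hitting time and extends to the hitting time by
  continuity. A positive hitting time excludes a start at or above the level.\<close>

lemma le_hit_bound:
 assumes cont: "continuous_on {0..} (\<lambda>t. Y t w :: real)" and YZ: "\<And>t. 0 <= t ==> \<bar>Y t w\<bar> <= \<bar>Z t w\<bar>"
  and T: "0 <= T" and s: "0 <= s" "s <= hit Z T c w" "0 < hit Z T c w"
 shows "\<bar>Y s w\<bar> <= c"
proof -
 let ?h = "hit Z T c w"
 have cl: "closure {0..<?h} = {0..?h}" using s(3) by (rule closure_atLeastLessThan)
 show ?thesis
 proof (rule continuous_le_on_closure[of "{0..<?h}" "\<lambda>t. \<bar>Y t w\<bar>"])
  show "continuous_on (closure {0..<?h}) (\<lambda>t. \<bar>Y t w\<bar>)" unfolding cl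
   by (intro continuous_intros continuous_on_subset[OF cont]) auto
  show "s \<in> closure {0..<?h}" unfolding cl using s by simp
  fix t assume "t \<in> {0..<?h}"
  then show "\<bar>Y t w\<bar> <= c" using less_hit[of t Z T c w] YZ[of t] T by force
 qed
qed

text \<open>A difference of two values bounded by \<open>c\<close> accounts for
  \<open>2 * c\<close>. If the hitting time is \<open>0\<close>, the initial value may be large, but
  then the stopped increment vanishes.\<close>

lemma sp_hit_bound:
 assumes cont: "continuous_on {0..} (\<lambda>t. Y t w :: real)" and YZ: "\<And>t. 0 <= t ==> \<bar>Y t w\<bar> <= \<bar>Z t w\<bar>"
  and T: "0 <= T" and t: "0 <= t" and c: "0 <= c" and \<tau>: "0 <= \<tau> w" "\<tau> w <= hit Z T c w"
 shows "\<bar>sp \<tau> Y t w\<bar> <= 2 * c"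
proof (cases "hit Z T c w = 0")
 case True
 then show ?thesis using t c \<tau> by (simp add: sp_def)
next
 case False
 then have h: "0 < hit Z T c w" using hit_bounds(1)[OF T, of Z c w] by simp
 have "\<bar>Y (min t (\<tau> w)) w\<bar> <= c" "\<bar>Y 0 w\<bar> <= c"
  using le_hit_bound[where Y=Y and Z=Z and w=w, OF cont YZ T _ _ h] t \<tau> h by auto
 then show ?thesis by (simp add: sp_def)
qed

text \<open>Needed because \<open>ito_integral\<close> speaks of some bracket, while the computation
  needs the given one. The stopped difference \<open>D\<close> of the two is a bounded martingale,
  so the mean of \<open>(D T - D 0)^2\<close> is the mean of its sum of squared increments;
  \<open>D\<close> is also continuous of finite variation, so these sums tend to zero.\<close>

lemma bracket_unique:
 assumes V: "bracket M F Y Y V" "AE w in M. mono_on {0..} (\<lambda>t. V t w)"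
  and W: "bracket M F Y Y W" "AE w in M. mono_on {0..} (\<lambda>t. W t w)"
 shows "AE w in M. \<forall>t\<ge>0. V t w = W t w"
proof -
 let ?P = "\<lambda>t w. Y t w * Y t w - V t w" and ?Q = "\<lambda>t w. Y t w * Y t w - W t w"
 have P: "cont_local_martingale M F ?P" "cont_local_martingale M F ?Q"
  using V(1) W(1) by (auto simp: bracket_def)
 have ad: "adapted F ?P" "adapted F ?Q" "adapted F V" "adapted F W"
  using V(1) W(1) P by (auto simp: bracket_def cont_local_martingale_def)
 have cont: "AE_continuous_paths M ?P" "AE_continuous_paths M ?Q" "AE_continuous_paths M V" "AE_continuous_paths M W"
  using V(1) W(1) P by (auto simp: bracket_def cont_local_martingale_def)
 have zero: "AE w in M. V 0 w = 0" "AE w in M. W 0 w = 0"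
  using V(1) W(1) by (auto simp: bracket_def)
 \<comment> \<open>One process dominating all four, so that a single hitting time bounds them
   simultaneously.\<close>
 define Z where "Z t w = \<bar>?P t w\<bar> + \<bar>?Q t w\<bar> + \<bar>V t w\<bar> + \<bar>W t w\<bar>" for t w
 have Z: "adapted F Z" "AE_continuous_paths M Z"
 proof -
  show "adapted F Z" using ad unfolding adapted_def Z_def by (auto intro!: borel_measurable_add borel_measurable_abs)
  show "AE_continuous_paths M Z" using cont unfolding AE_continuous_paths_def
   by eventually_elim (auto simp: Z_def intro!: continuous_on_add continuous_on_rabs)
 qed
 have eq: "AE w in M. V T w = W T w" if T: "0 <= T" for T
 proof -
  have D0: "AE w in M. V (min T (hit Z T (real n) w)) w = W (min T (hit Z T (real n) w)) w" for n
  proof -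
   define \<tau> where "\<tau> = hit Z T (real n)"
   have \<tau>: "stopping_time F \<tau>" "\<And>w. 0 <= \<tau> w" unfolding \<tau>_def using stopping_time_hit[OF Z T] hit_bounds[OF T] by auto
   have spb: "AE w in M. \<forall>t\<ge>0. \<bar>sp \<tau> X t w\<bar> <= 2 * real n"
    if X: "AE_continuous_paths M X" "\<And>t w. \<bar>X t w\<bar> <= \<bar>Z t w\<bar>" for X
    using X(1) unfolding AE_continuous_paths_def
   proof eventually_elim
    case (elim w)
    show ?case unfolding \<tau>_def
     by (intro allI impI sp_hit_bound[where Y=X and Z=Z and w=w, OF elim X(2) T]) (use hit_bounds[OF T] in auto)
   qed
   have bP: "AE w in M. \<forall>t\<ge>0. \<bar>sp \<tau> ?P t w\<bar> <= 2 * real n" by (rule spb[OF cont(1)]) (simp add: Z_def)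
   have bQ: "AE w in M. \<forall>t\<ge>0. \<bar>sp \<tau> ?Q t w\<bar> <= 2 * real n" by (rule spb[OF cont(2)]) (simp add: Z_def)
   have bV: "AE w in M. \<forall>t\<ge>0. \<bar>sp \<tau> V t w\<bar> <= 2 * real n" by (rule spb[OF cont(3)]) (simp add: Z_def)
   have bW: "AE w in M. \<forall>t\<ge>0. \<bar>sp \<tau> W t w\<bar> <= 2 * real n" by (rule spb[OF cont(4)]) (simp add: Z_def)
   define D where "D t w = sp \<tau> ?Q t w + (-1) * sp \<tau> ?P t w" for t w
   have D: "mg D" unfolding D_def
    by (rule mg_add[OF sp_mg[OF P(2) \<tau> bQ] mg_cmult[OF sp_mg[OF P(1) \<tau> bP]]])
   have DV: "D t w = sp \<tau> V t w - sp \<tau> W t w" for t w by (simp add: D_def sp_def)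
   have Db: "AE w in M. \<bar>D t w\<bar> <= 4 * real n" if "0 <= t" for t
    using bV bW by eventually_elim (use that in \<open>auto simp: DV abs_le_iff\<close>, (smt (verit))+)
   have DM: "D t \<in> borel_measurable M" if "0 <= t" for t by (rule meas_M[OF mg_meas[OF D that]])
   let ?u = "pt T"
   have iso: "(\<integral>w. (D T w - D 0 w)\<^sup>2 \<partial>M) = (\<integral>w. (\<Sum>k<Suc p. (D (?u p (Suc k)) w - D (?u p k) w)\<^sup>2) \<partial>M)" for p
   proof -
    have "(\<Sum>k<Suc p. 1 * (D (?u p (Suc k)) w - D (?u p k) w)) = D T w - D 0 w" for w
     using sum_lessThan_telescope[of "\<lambda>k. D (?u p k) w" "Suc p"] pt_simps(1,2)[OF T, of p] by simp
    moreover have "(\<integral>w. (\<Sum>k<Suc p. 1 * (D (?u p (Suc k)) w - D (?u p k) w))\<^sup>2 \<partial>M)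
      = (\<Sum>k<Suc p. \<integral>w. (1 * (D (?u p (Suc k)) w - D (?u p k) w))\<^sup>2 \<partial>M)"
     by (rule discrete_isometry(5)[OF D Db, where b=1]) (use pt_simps[OF T] in auto)
    moreover have "integrable M (\<lambda>w. (D (?u p (Suc k)) w - D (?u p k) w)\<^sup>2)" for k
    proof (rule integrable_power2_AE_bounded[where c="8 * real n"])
     show "AE w in M. \<bar>D (?u p (Suc k)) w - D (?u p k) w\<bar> <= 8 * real n"
      using Db[OF pt_simps(3)[OF T, of p k]] Db[OF pt_simps(3)[OF T, of p "Suc k"]] by eventually_elim auto
    qed (use DM pt_simps(3)[OF T] in auto)
    ultimately show ?thesis by simp
   qed
   have "(\<lambda>p. \<integral>w. (\<Sum>k<Suc p. (D (?u p (Suc k)) w - D (?u p k) w)\<^sup>2) \<partial>M) \<longlonglongrightarrow> (\<integral>w. 0 \<partial>M)"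
   \<comment> \<open>The stopped brackets are bounded by \<open>2 * real n\<close> each, so their
     sum \<open>?v\<close> by \<open>4 * real n\<close>. An increment of \<open>D\<close> is at most
     \<open>8 * real n\<close>, and the increments of \<open>?v\<close> add up to at most
     \<open>4 * real n\<close>.\<close>
   proof (rule integral_dominated_convergence[where w="\<lambda>_. 8 * real n * (4 * real n)"])
    show "(\<lambda>w. \<Sum>k<Suc p. (D (?u p (Suc k)) w - D (?u p k) w)\<^sup>2) \<in> borel_measurable M" for p
     using DM pt_simps(3)[OF T] by (intro borel_measurable_sum borel_measurable_power borel_measurable_diff) auto
    have inc: "\<bar>D t w - D s w\<bar> <= (sp \<tau> V t w + sp \<tau> W t w) - (sp \<tau> V s w + sp \<tau> W s w)"
     if "mono_on {0..} (\<lambda>t. V t w)" "mono_on {0..} (\<lambda>t. W t w)" "0 <= s" "s <= t" for w s t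
    proof -
     have "V (min s (\<tau> w)) w <= V (min t (\<tau> w)) w" "W (min s (\<tau> w)) w <= W (min t (\<tau> w)) w"
      using that \<tau>(2)[of w] by (auto intro!: mono_onD[OF that(1)] mono_onD[OF that(2)])
     then show ?thesis unfolding DV sp_def by linarith
    qed
    show "AE w in M. (\<lambda>p. \<Sum>k<Suc p. (D (?u p (Suc k)) w - D (?u p k) w)\<^sup>2) \<longlonglongrightarrow> 0"
     using cont(3,4)[unfolded AE_continuous_paths_def] V(2) W(2)
    proof eventually_elim
     case (elim w)
     have c: "continuous_on {0..T} (\<lambda>t. D t w)"
     proof -
      have "continuous_on {0..T} (\<lambda>t. V (min t (\<tau> w)) w)" "continuous_on {0..T} (\<lambda>t. W (min t (\<tau> w)) w)"
       using \<tau>(2)[of w] by (auto intro!: continuous_on_compose2[OF elim(1)] continuous_on_compose2[OF elim(2)] continuous_intros)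
      then show ?thesis unfolding DV sp_def by (intro continuous_intros)
     qed
     show ?case
      using sum_continuous_times_variation[where v="\<lambda>t. sp \<tau> V t w + sp \<tau> W t w", OF c T inc[OF elim(3,4)]]
      by (simp add: power2_eq_square)
    qed
    show "AE w in M. norm (\<Sum>k<Suc p. (D (?u p (Suc k)) w - D (?u p k) w)\<^sup>2) <= 8 * real n * (4 * real n)" for p
     using V(2) W(2) bV bW
    proof eventually_elim
     case (elim w)
     let ?v = "\<lambda>t. sp \<tau> V t w + sp \<tau> W t w"
     have vb: "\<bar>?v t\<bar> <= 4 * real n" if "0 <= t" for t using elim(3)[rule_format, OF that] elim(4)[rule_format, OF that] by linarith
     have "(D (?u p (Suc k)) w - D (?u p k) w)\<^sup>2 <= 8 * real n * (?v (?u p (Suc k)) - ?v (?u p k))" for k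
     proof -
      note i = inc[OF elim(1,2) pt_simps(3)[OF T, of p k] pt_simps(4)[OF T, of p k]]
      have "\<bar>D (?u p (Suc k)) w - D (?u p k) w\<bar> <= 8 * real n"
       using i vb[OF pt_simps(3)[OF T, of p k]] vb[OF pt_simps(3)[OF T, of p "Suc k"]] by linarith
      then have "\<bar>D (?u p (Suc k)) w - D (?u p k) w\<bar> * \<bar>D (?u p (Suc k)) w - D (?u p k) w\<bar> <= 8 * real n * (?v (?u p (Suc k)) - ?v (?u p k))"
       using i by (intro mult_mono) auto
      then show ?thesis by (simp add: power2_eq_square)
     qed
     then have "(\<Sum>k<Suc p. (D (?u p (Suc k)) w - D (?u p k) w)\<^sup>2) <= (\<Sum>k<Suc p. 8 * real n * (?v (?u p (Suc k)) - ?v (?u p k)))"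
      by (intro sum_mono)
     also have "\<dots> = 8 * real n * (?v T - ?v 0)"
      by (simp only: sum_distrib_left[symmetric] sum_lessThan_telescope[of "\<lambda>k. ?v (pt T p k)"] pt_simps(1,2)[OF T])
     also have "\<dots> <= 8 * real n * (4 * real n)"
      using vb[OF T] \<tau>(2)[of w] by (intro mult_left_mono) (auto simp: sp_def)
     finally show ?case by (simp add: sum_nonneg)
    qed
   qed auto
   then have "(\<integral>w. (D T w - D 0 w)\<^sup>2 \<partial>M) = 0"
    unfolding iso[symmetric] by (simp add: LIMSEQ_const_iff)
   moreover have "integrable M (\<lambda>w. (D T w - D 0 w)\<^sup>2)"
   proof (rule integrable_power2_AE_bounded[where c="8 * real n"])
    show "AE w in M. \<bar>D T w - D 0 w\<bar> <= 8 * real n"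
     using Db[OF T] Db[of 0] by auto
   qed (use DM T in auto)
   ultimately have "AE w in M. (D T w - D 0 w)\<^sup>2 = 0"
    by (subst (asm) integral_nonneg_eq_0_iff_AE) auto
   then show ?thesis using zero
   proof eventually_elim
    case (elim w)
    then have "D T w = D 0 w" by simp
    then show ?case using elim \<tau>(2)[of w] by (simp add: DV sp_def \<tau>_def)
   qed
  qed
  have "AE w in M. \<forall>n. V (min T (hit Z T (real n) w)) w = W (min T (hit Z T (real n) w)) w"
   using D0 by (simp add: AE_all_countable)
  then show ?thesis using hit_eventually[OF Z(2) T]
  proof eventually_elim
   case (elim w)
   then obtain n where "hit Z T (real n) w = T" by (auto simp: eventually_sequentially)
   then show ?case using elim(1)[rule_format, of n] by simp
  qed
 qed
 \<comment> \<open>The exceptional null set depends on the time; countably many fractions are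
   treated at once and continuity does the rest.\<close>
 have "AE w in M. \<forall>i j. V (real i / real (Suc j)) w = W (real i / real (Suc j)) w"
  using eq by (simp add: AE_all_countable)
 then show ?thesis using cont(3,4)[unfolded AE_continuous_paths_def]
 proof eventually_elim
  case (elim w)
  show ?case
  proof (intro allI impI)
   fix t :: real assume t: "0 <= t"
   \<comment> \<open>The horizon \<open>t + 1\<close> is never reached by the rounded time, so every
     \<open>?q k\<close> is one of these fractions.\<close>
   let ?q = "\<lambda>k. grid_time k (t + 1) t"
   have q: "?q \<longlonglongrightarrow> t" using grid_time_tendsto[of "t + 1" t] t by simp
   have q0: "?q k \<in> {0..}" for k using grid_time_bounds(3)[of "t + 1" t k] t by simp
   have qe: "V (?q k) w = W (?q k) w" for k
   proof -
    have "real (nat \<lceil>real (Suc k) * t\<rceil>) / real (Suc k) <= t + 1 / real (Suc k)"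
     using divide_right_mono[of "real (nat \<lceil>real (Suc k) * t\<rceil>)" "real (Suc k) * t + 1" "real (Suc k)"] t
     by (simp add: add_divide_distrib of_nat_nat del: of_nat_Suc)
    moreover have "1 / real (Suc k) <= 1" by simp
    ultimately have "real (nat \<lceil>real (Suc k) * t\<rceil>) / real (Suc k) <= t + 1" by linarith
    then have "?q k = real (nat \<lceil>real (Suc k) * t\<rceil>) / real (Suc k)" by (simp add: grid_time_def)
    then show ?thesis using elim(1) by metis
   qed
   have "(\<lambda>k. V (?q k) w) \<longlonglongrightarrow> V t w"
    by (rule continuous_on_tendsto_compose[OF elim(2) q]) (use t q0 in auto)
   moreover have "(\<lambda>k. W (?q k) w) \<longlonglongrightarrow> W t w"
    by (rule continuous_on_tendsto_compose[OF elim(3) q]) (use t q0 in auto)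
   ultimately show "V t w = W t w" unfolding qe by (rule LIMSEQ_unique)
  qed
 qed
qed

subsection \<open>The Ito isometry\<close>

text \<open>The simple integral over \<open>(s, t]\<close>, minus \<open>\<xi>\<close> times the increment of \<open>Y\<close>, is a discrete stochastic
 integral along the partition clamped to \<open>[s, t]\<close> and completed by the end points \<open>s\<close> and \<open>t\<close>.\<close>

lemma simple_integral_isometry:
 assumes mg: "mg (sp \<tau> Y)" "mg (sp \<tau> (\<lambda>t w. Y t w * Y t w - V t w))"
  and c: "\<And>t. 0 <= t ==> AE w in M. \<bar>sp \<tau> Y t w\<bar> <= c"
  and Yc: "AE w in M. \<forall>s\<ge>0. s < \<tau> w --> \<bar>Y s w\<bar> <= c"
  and \<tau>: "stopping_time F \<tau>" "\<And>w. 0 <= \<tau> w" and ad: "adapted F Y"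
  and V: "AE w in M. mono_on {0..} (\<lambda>t. V t w)" "AE_continuous_paths M V"
  and simple: "simple_integrand M F n \<sigma> \<zeta>" and st: "0 <= s" "s <= t"
  and \<xi>: "\<xi> \<in> borel_measurable (F s)" "AE w in M. \<bar>\<xi> w\<bar> <= h"
 defines "X w \<equiv> simple_integral n \<sigma> \<zeta> Y (min t (\<tau> w)) w - simple_integral n \<sigma> \<zeta> Y (min s (\<tau> w)) w
   - \<xi> w * (Y (min t (\<tau> w)) w - Y (min s (\<tau> w)) w)"
  and "G w \<equiv> (LINT u:{min s (\<tau> w)<..min t (\<tau> w)}|path_measure V w. (simple_process n \<sigma> \<zeta> u w - \<xi> w)\<^sup>2)"
 shows "X \<in> borel_measurable M" "integrable M (\<lambda>w. (X w)\<^sup>2)" "integrable M G"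
  "(\<integral>w. (X w)\<^sup>2 \<partial>M) = (\<integral>w. G w \<partial>M)"
  "\<And>\<phi> b. \<phi> \<in> borel_measurable (F s) ==> AE w in M. \<bar>\<phi> w\<bar> <= b ==> (\<integral>w. \<phi> w * X w \<partial>M) = 0"
proof -
 have \<sigma>0: "0 <= \<sigma> 0" and \<sigma>1: "\<And>k. k < n ==> \<sigma> k <= \<sigma> (Suc k)"
  and \<zeta>m: "\<And>k. k < n ==> \<zeta> k \<in> borel_measurable (F (\<sigma> k))" and \<zeta>b: "\<And>k. k < n ==> bounded (\<zeta> k ` space M)"
  using simple by (auto simp: simple_integrand_def)
 have \<sigma>m: "\<sigma> i <= \<sigma> j" if "i <= j" "j <= n" for i j
  using that by (induction j) (auto simp: le_Suc_eq intro: order_trans[OF _ \<sigma>1])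
 have "\<forall>k. \<exists>b. k < n --> (\<forall>w\<in>space M. \<bar>\<zeta> k w\<bar> <= b)" using \<zeta>b by (auto simp: bounded_iff)
 then obtain b0 where b0: "\<And>k w. k < n ==> w \<in> space M ==> \<bar>\<zeta> k w\<bar> <= b0 k" by metis
 define b where "b = (\<Sum>k<n. \<bar>b0 k\<bar>)"
 have b: "\<bar>\<zeta> k w\<bar> <= b" if "k < n" "w \<in> space M" for k w
 proof -
  have "\<bar>b0 k\<bar> <= b" unfolding b_def using that by (intro member_le_sum) auto
  then show ?thesis using b0[OF that] by linarith
 qed
 have bn: "0 <= b" unfolding b_def by (intro sum_nonneg) auto
 define cl where "cl r = max s (min t r)" for r
 \<comment> \<open>An index shift by one makes room for the two end points: \<open>u 0 = s\<close>,
   then the clamped points of \<open>\<sigma>\<close>, then \<open>t\<close> from index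
   \<open>Suc (Suc n)\<close> on.\<close>
 define u where "u k = (if k = 0 then s else if k <= Suc n then cl (\<sigma> (k - 1)) else t)" for k
 \<comment> \<open>The two end cells carry no part of the simple integrand. Where
   \<open>\<sigma> (k - 1)\<close> exceeds \<open>t\<close>, the weight is not known at the clamped
   time; the clamped cell is empty there, so \<open>0\<close> can be taken.\<close>
 define \<zeta>' where "\<zeta>' k w = (if 0 < k \<and> k <= n \<and> \<sigma> (k - 1) <= t then \<zeta> (k - 1) w else 0)" for k w
 define \<eta> where "\<eta> k w = \<zeta>' k w - \<xi> w" for k w
 define n' where "n' = Suc (Suc n)"
 have u0: "u 0 = s" "u n' = t" by (simp_all add: u_def n'_def)
 have us: "s <= u k" for k using st by (simp add: u_def cl_def)
 have ut: "u k <= t" for k using st by (simp add: u_def cl_def)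
 have uS: "u k <= u (Suc k)" for k
 proof (cases k)
  case 0 then show ?thesis using u0 us by simp
 next
  case (Suc j)
  show ?thesis
  proof (cases "Suc k <= Suc n")
   case True
   then have "\<sigma> j <= \<sigma> (Suc j)" using Suc by (intro \<sigma>1) simp
   then show ?thesis using True Suc by (auto simp: u_def cl_def)
  next
   case False then show ?thesis using ut[of k] by (simp add: u_def)
  qed
 qed
 have un: "0 <= u k" for k using us[of k] st by simp
 have \<zeta>'m: "\<zeta>' k \<in> borel_measurable (F (u k))" for k
 proof (cases "0 < k \<and> k <= n \<and> \<sigma> (k - 1) <= t")
  case True
  then have "\<sigma> (k - 1) <= u k" by (auto simp: u_def cl_def)
  then have "\<zeta> (k - 1) \<in> borel_measurable (F (u k))" using True by (intro meas_mono[OF \<zeta>m]) auto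
  moreover have "\<zeta>' k = \<zeta> (k - 1)" using True by (auto simp: \<zeta>'_def)
  ultimately show ?thesis by simp
 next
  case False
  then have "\<zeta>' k = (\<lambda>_. 0)" by (auto simp: \<zeta>'_def)
  then show ?thesis by simp
 qed
 have \<eta>m: "\<eta> k \<in> borel_measurable (F (u k))" for k
  unfolding \<eta>_def by (intro borel_measurable_diff \<zeta>'m meas_mono[OF \<xi>(1) us])
 have \<eta>b: "AE w in M. \<bar>\<eta> k w\<bar> <= b + h" for k
  using \<xi>(2) AE_space
 proof eventually_elim
  case (elim w)
  have "\<bar>\<zeta>' k w\<bar> <= b" using b[of "k - 1" w] elim(2) bn by (auto simp: \<zeta>'_def)
  then show ?case using elim(1) by (simp add: \<eta>_def)
 qed
 define D where "D k w = \<eta> k w * (sp \<tau> Y (u (Suc k)) w - sp \<tau> Y (u k) w)" for k w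
 have XD: "X w = (\<Sum>k<n'. D k w)" for w
 proof -
  define y where "y r = Y (min r (\<tau> w)) w" for r
  have mm: "Y (min (min t (\<tau> w)) r) w = y (min t r)" "Y (min (min s (\<tau> w)) r) w = y (min s r)" for r
   by (simp_all add: y_def min.assoc min.commute[of "\<tau> w"])
  have "simple_integral n \<sigma> \<zeta> Y (min t (\<tau> w)) w - simple_integral n \<sigma> \<zeta> Y (min s (\<tau> w)) w
   = (\<Sum>k<n. \<zeta> k w * ((y (min t (\<sigma> (Suc k))) - y (min s (\<sigma> (Suc k)))) - (y (min t (\<sigma> k)) - y (min s (\<sigma> k)))))"
   unfolding simple_integral_def mm sum_subtractf[symmetric] by (intro sum.cong refl) (simp add: algebra_simps)
  also have "\<dots> = (\<Sum>k<n. \<zeta> k w * (y (cl (\<sigma> (Suc k))) - y (cl (\<sigma> k))))"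
   unfolding clamp_diff[OF st(2)] cl_def by simp
  also have "\<dots> = (\<Sum>k<n. \<zeta>' (Suc k) w * (y (u (Suc (Suc k))) - y (u (Suc k))))"
  proof (intro sum.cong refl)
   fix k assume k: "k \<in> {..<n}"
   have uu: "u (Suc (Suc k)) = cl (\<sigma> (Suc k))" "u (Suc k) = cl (\<sigma> k)" using k by (auto simp: u_def)
   show "\<zeta> k w * (y (cl (\<sigma> (Suc k))) - y (cl (\<sigma> k))) = \<zeta>' (Suc k) w * (y (u (Suc (Suc k))) - y (u (Suc k)))"
   proof (cases "\<sigma> k <= t")
    case True then show ?thesis using k uu by (simp add: \<zeta>'_def)
   next
    case False
    then have "cl (\<sigma> (Suc k)) = cl (\<sigma> k)" using \<sigma>1[of k] k by (auto simp: cl_def)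
    then show ?thesis using uu by simp
   qed
  qed
  also have "\<dots> = (\<Sum>k<Suc n. \<zeta>' k w * (y (u (Suc k)) - y (u k)))"
   unfolding sum.lessThan_Suc_shift by (simp add: \<zeta>'_def)
  also have "\<dots> = (\<Sum>k<n'. \<zeta>' k w * (y (u (Suc k)) - y (u k)))"
   by (simp add: n'_def \<zeta>'_def)
  finally have 1: "simple_integral n \<sigma> \<zeta> Y (min t (\<tau> w)) w - simple_integral n \<sigma> \<zeta> Y (min s (\<tau> w)) w = \<dots>" .
  have 2: "\<xi> w * (y t - y s) = (\<Sum>k<n'. \<xi> w * (y (u (Suc k)) - y (u k)))"
   unfolding sum_distrib_left[symmetric] sum_lessThan_telescope[of "\<lambda>k. y (u k)"] u0 by simp
  have "X w = (\<Sum>k<n'. \<zeta>' k w * (y (u (Suc k)) - y (u k))) - \<xi> w * (y t - y s)"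
   unfolding X_def 1 by (simp add: y_def)
  also have "\<dots> = (\<Sum>k<n'. \<zeta>' k w * (y (u (Suc k)) - y (u k)) - \<xi> w * (y (u (Suc k)) - y (u k)))"
   unfolding 2 sum_subtractf ..
  also have "\<dots> = (\<Sum>k<n'. D k w)"
   unfolding D_def sp_diff y_def \<eta>_def by (intro sum.cong refl) (simp add: algebra_simps)
  finally show ?thesis .
 qed
 note iso = discrete_isometry[where N="sp \<tau> Y" and u=u and \<eta>=\<eta>, OF mg(1) c un uS \<eta>m \<eta>b, folded D_def]
 have XD': "X = (\<lambda>w. \<Sum>k<n'. D k w)" by (rule ext) (rule XD)
 show XM: "X \<in> borel_measurable M" unfolding XD' using iso(1) by simp
 have Xb: "AE w in M. \<bar>X w\<bar> <= real n' * (\<bar>b + h\<bar> * (2 * c))" unfolding XD' by (rule iso(4))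
 show "integrable M (\<lambda>w. (X w)\<^sup>2)" by (rule integrable_power2_AE_bounded[OF XM Xb])
 define dV where "dV k w = V (min (u (Suc k)) (\<tau> w)) w - V (min (u k) (\<tau> w)) w" for k w
 have D2: "integrable M (\<lambda>w. (\<eta> k w)\<^sup>2 * dV k w) \<and> (\<integral>w. (D k w)\<^sup>2 \<partial>M) = (\<integral>w. (\<eta> k w)\<^sup>2 * dV k w \<partial>M)" for k
 proof -
  \<comment> \<open>Cutting off after \<open>\<tau>\<close> changes nothing, as the stopped
    increment is zero there, and it supplies the support that \<open>bracket_increment\<close>
    requires.\<close>
  define \<phi> where "\<phi> w = (if u k < \<tau> w then (\<eta> k w)\<^sup>2 else 0)" for w
  have \<phi>m: "\<phi> \<in> borel_measurable (F (u k))"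
   unfolding \<phi>_def using measurable_If[OF borel_measurable_power[OF \<eta>m] borel_measurable_const stopping_timeD2[OF \<tau>(1), unfolded pred_def]] .
  have \<phi>b: "AE w in M. \<bar>\<phi> w\<bar> <= (b + h)\<^sup>2"
   using \<eta>b[of k]
  proof eventually_elim
   case (elim w)
   then have "\<bar>\<eta> k w\<bar>\<^sup>2 <= (b + h)\<^sup>2" by (rule power_mono) simp
   then show ?case by (simp add: \<phi>_def)
  qed
  have \<phi>0: "AE w in M. \<phi> w \<noteq> 0 --> u k < \<tau> w \<and> \<bar>Y (u k) w\<bar> <= c \<and> \<bar>Y (u k) w\<bar> <= c"
   using Yc by eventually_elim (use un[of k] in \<open>auto simp: \<phi>_def split: if_splits\<close>)
  note bi = bracket_increment[OF mg(1) mg(1) mg(2) c c un uS \<phi>m \<phi>b \<phi>0 ad ad]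
  have e1: "(D k w)\<^sup>2 = \<phi> w * ((Y (min (u (Suc k)) (\<tau> w)) w - Y (min (u k) (\<tau> w)) w) * (Y (min (u (Suc k)) (\<tau> w)) w - Y (min (u k) (\<tau> w)) w))" for w
   using uS[of k] by (auto simp: D_def sp_diff \<phi>_def power_mult_distrib power2_eq_square min_def)
  have e2: "(\<eta> k w)\<^sup>2 * dV k w = \<phi> w * (V (min (u (Suc k)) (\<tau> w)) w - V (min (u k) (\<tau> w)) w)" for w
   using uS[of k] by (auto simp: dV_def \<phi>_def min_def)
  show ?thesis unfolding e1 e2 using bi(2,3) by blast
 qed
 have Geq: "AE w in M. (\<Sum>k<n'. (\<eta> k w)\<^sup>2 * dV k w) = G w"
  using V(1) V(2)[unfolded AE_continuous_paths_def]
 proof eventually_elim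
  case (elim w)
  let ?ww = "\<lambda>k. min (u k) (\<tau> w)"
  have w0: "0 <= ?ww k" for k using un \<tau>(2) by simp
  have wS: "?ww k <= ?ww (Suc k)" for k using uS[of k] by auto
  have val: "simple_process n \<sigma> \<zeta> x w = \<zeta>' k w" if k: "k < n'" and x: "u k < x" "x <= u (Suc k)" for k x
  proof -
   have xs: "s < x" "x <= t" using us[of k] ut[of "Suc k"] x by auto
   have low: "\<sigma> (k - 1) < x" if "0 < k"
    using x(1) that k xs by (auto simp: u_def cl_def n'_def min_def max_def split: if_splits)
   have high: "x <= \<sigma> k" if "k <= n"
    using x(2) that xs by (auto simp: u_def cl_def min_def max_def split: if_splits)
   have ind: "indicator {\<sigma> j<..\<sigma> (Suc j)} x = (if Suc j = k then 1 else (0::real))" if j: "j < n" for j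
   proof (cases "Suc j = k")
    case True
    then show ?thesis using low high j by auto
   next
    case False
    show ?thesis
    proof (cases "Suc j < k")
     case True
     have "\<sigma> (Suc j) <= \<sigma> (k - 1)" using True k by (intro \<sigma>m) (auto simp: n'_def)
     then show ?thesis using low True False by auto
    next
     case 2: False
     then have "k <= j" using False by simp
     then have "\<sigma> k <= \<sigma> j" using j by (intro \<sigma>m) auto
     then show ?thesis using high \<open>k <= j\<close> j False by auto
    qed
   qed
   have "simple_process n \<sigma> \<zeta> x w = (\<Sum>j<n. if Suc j = k then \<zeta> j w else 0)"
    unfolding simple_process_def by (intro sum.cong refl) (use ind in auto)
   also have "\<dots> = \<zeta>' k w"
   proof (cases "0 < k \<and> k <= n")
    case True
    then obtain j where j: "k = Suc j" "j < n" by (cases k) auto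
    then show ?thesis using low xs by (simp add: \<zeta>'_def)
   next
    case False
    then have "(\<Sum>j<n. if Suc j = k then \<zeta> j w else 0) = 0" by (intro sum.neutral) auto
    then show ?thesis using False by (auto simp: \<zeta>'_def)
   qed
   finally show ?thesis .
  qed
  have "G w = (LINT x:{?ww 0<..?ww n'}|path_measure V w. (simple_process n \<sigma> \<zeta> x w - \<xi> w)\<^sup>2)"
   unfolding G_def u0 ..
  also have "\<dots> = (\<Sum>k<n'. (\<eta> k w)\<^sup>2 * measure (path_measure V w) {?ww k<..?ww (Suc k)})"
  proof (rule set_integral_step(2)[where ww="?ww", OF sets_path_measure wS])
   show "emeasure (path_measure V w) {?ww k<..?ww (Suc k)} < \<infinity>" for k
    by (subst path_measure_Ioc(1)[where V=V and w=w, OF elim w0 wS]) simp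
   fix k x assume "k < n'" "?ww k < x" "x <= ?ww (Suc k)"
   then have "u k < x" "x <= u (Suc k)" by (auto simp: min_def split: if_splits)
   then show "(simple_process n \<sigma> \<zeta> x w - \<xi> w)\<^sup>2 = (\<eta> k w)\<^sup>2"
    using val[OF \<open>k < n'\<close>] by (simp add: \<eta>_def)
  qed
  also have "\<dots> = (\<Sum>k<n'. (\<eta> k w)\<^sup>2 * dV k w)"
   using path_measure_Ioc(2)[where V=V and w=w, OF elim w0 wS] by (simp add: dV_def)
  finally show ?case by simp
 qed
 have iS: "integrable M (\<lambda>w. \<Sum>k<n'. (\<eta> k w)\<^sup>2 * dV k w)" using D2 by simp
 have GM: "G \<in> borel_measurable M"
  by (rule measurable_AE_cong[OF refl null_M borel_measurable_integrable[OF iS] Geq])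
 show "integrable M G" using integrable_cong_AE[OF borel_measurable_integrable[OF iS] GM Geq] iS by simp
 have "(\<integral>w. (X w)\<^sup>2 \<partial>M) = (\<Sum>k<n'. \<integral>w. (D k w)\<^sup>2 \<partial>M)" unfolding XD' by (rule iso(5))
 also have "\<dots> = (\<integral>w. (\<Sum>k<n'. (\<eta> k w)\<^sup>2 * dV k w) \<partial>M)" using D2 by simp
 also have "\<dots> = (\<integral>w. G w \<partial>M)" by (rule integral_cong_AE[OF borel_measurable_integrable[OF iS] GM Geq])
 finally show "(\<integral>w. (X w)\<^sup>2 \<partial>M) = (\<integral>w. G w \<partial>M)" .
 fix \<phi> :: "'w => real" and b' :: real assume \<phi>: "\<phi> \<in> borel_measurable (F s)" "AE w in M. \<bar>\<phi> w\<bar> <= b'"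
 have z: "integrable M (\<lambda>w. \<phi> w * D k w) \<and> (\<integral>w. \<phi> w * D k w \<partial>M) = 0" for k
 proof
  show "integrable M (\<lambda>w. \<phi> w * D k w)"
   by (rule integrable_bounded_mult[where f=\<phi> and g="D k", OF integrable_AE_bounded[OF iso(1)[of k] iso(2)[of k]] meas_M[OF \<phi>(1)] \<phi>(2)])
  have "(\<integral>w. (\<phi> w * \<eta> k w) * (sp \<tau> Y (u (Suc k)) w - sp \<tau> Y (u k) w) \<partial>M) = 0"
  proof (rule mg_orth[OF mg(1) un uS])
   show "(\<lambda>w. \<phi> w * \<eta> k w) \<in> borel_measurable (F (u k))"
    by (intro borel_measurable_times \<eta>m meas_mono[OF \<phi>(1) us])
   show "AE w in M. \<bar>\<phi> w * \<eta> k w\<bar> <= \<bar>b'\<bar> * (b + h)"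
    using \<phi>(2) \<eta>b[of k] by eventually_elim (auto simp: abs_mult intro!: mult_mono)
  qed
  then show "(\<integral>w. \<phi> w * D k w \<partial>M) = 0" by (simp add: D_def mult.assoc)
 qed
 show "(\<integral>w. \<phi> w * X w \<partial>M) = 0" unfolding XD' sum_distrib_left using z by simp
qed

end

section \<open>Simple processes and their excess over a level\<close>

lemma simple_process_value:
 assumes \<sigma>: "\<And>k. k < n ==> \<sigma> k <= \<sigma> (Suc k)" and k: "k < n" "\<sigma> k < x" "x <= \<sigma> (Suc k)"
 shows "simple_process n \<sigma> \<zeta> x w = \<zeta> k w"
proof -
 have \<sigma>m: "\<sigma> i <= \<sigma> j" if "i <= j" "j <= n" for i j
  using that by (induction j) (auto simp: le_Suc_eq intro: order_trans[OF _ \<sigma>])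
 have "indicator {\<sigma> j<..\<sigma> (Suc j)} x = (if j = k then 1 else (0::real))" if j: "j < n" for j
 proof (cases j k rule: linorder_cases)
  case less
  then have "\<sigma> (Suc j) <= \<sigma> k" using k by (intro \<sigma>m) auto
  then show ?thesis using less k by auto
 next
  case greater
  then have "\<sigma> (Suc k) <= \<sigma> j" using j by (intro \<sigma>m) auto
  then show ?thesis using greater k by auto
 qed (use k in auto)
 then have "simple_process n \<sigma> \<zeta> x w = (\<Sum>j<n. if j = k then \<zeta> j w else 0)"
  unfolding simple_process_def by (intro sum.cong refl) auto
 then show ?thesis using k by simp
qed

lemma simple_process_outside:
 assumes \<sigma>: "\<And>k. k < n ==> \<sigma> k <= \<sigma> (Suc k)" and x: "x <= \<sigma> 0 \<or> \<sigma> n < x"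
 shows "simple_process n \<sigma> \<zeta> x w = 0"
proof -
 have \<sigma>m: "\<sigma> i <= \<sigma> j" if "i <= j" "j <= n" for i j
  using that by (induction j) (auto simp: le_Suc_eq intro: order_trans[OF _ \<sigma>])
 have "indicator {\<sigma> j<..\<sigma> (Suc j)} x = (0::real)" if j: "j < n" for j
  using \<sigma>m[of 0 j] \<sigma>m[of "Suc j" n] j x by auto
 then show ?thesis unfolding simple_process_def by (intro sum.neutral) auto
qed

lemma simple_process_measurable: "(\<lambda>u. simple_process n \<sigma> \<zeta> u w) \<in> borel_measurable borel"
 unfolding simple_process_def by measurable

lemma simple_process_bound: "\<bar>simple_process n \<sigma> \<zeta> u w\<bar> <= (\<Sum>k<n. \<bar>\<zeta> k w\<bar>)"
 unfolding simple_process_def by (rule order_trans[OF sum_abs sum_mono]) (auto simp: indicator_def)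

text \<open>The excess \<open>\<integral>\<^sub>0\<^sup>t (\<bar>simple\<bar> - h)\<^sub>+\<^sup>2 dV\<close> of a simple process over the level \<open>h\<close> is a finite sum, which
 makes it adapted without any measurability of integrals against random measures.\<close>

definition excess :: "nat => (nat => real) => (nat => 'w => real) => real => (real => 'w => real) => real => 'w => real" where
 "excess n \<sigma> \<zeta> h V t w = (\<Sum>k<n. (max 0 (\<bar>\<zeta> k w\<bar> - h))\<^sup>2 * (V (min t (\<sigma> (Suc k))) w - V (min t (\<sigma> k)) w))"

text \<open>The integrand is a step function, constant on the cells of the partition. Outside the
  cells the simple process is \<open>0\<close>, whose excess over a level \<open>h >= 0\<close> is
  \<open>0\<close> too.\<close>

lemma excess_eq_integral:
 assumes V: "mono_on {0..} (\<lambda>t. V t w)" "continuous_on {0..} (\<lambda>t. V t w)"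
  and \<sigma>: "0 <= \<sigma> 0" "\<And>k. k < n ==> \<sigma> k <= \<sigma> (Suc k)" and h: "0 <= h" and t: "0 <= t"
 shows "set_integrable (path_measure V w) {0..t} (\<lambda>u. (max 0 (\<bar>simple_process n \<sigma> \<zeta> u w\<bar> - h))\<^sup>2)"
  "excess n \<sigma> \<zeta> h V t w = (LINT u:{0..t}|path_measure V w. (max 0 (\<bar>simple_process n \<sigma> \<zeta> u w\<bar> - h))\<^sup>2)"
proof -
 have \<sigma>m: "\<sigma> i <= \<sigma> j" if "i <= j" "j <= n" for i j
  using that by (induction j) (auto simp: le_Suc_eq intro: order_trans[OF _ \<sigma>(2)])
 define ww where "ww k = min t (\<sigma> (min k n))" for k
 have wS: "ww k <= ww (Suc k)" for k
 proof -
  have "\<sigma> (min k n) <= \<sigma> (min (Suc k) n)" by (intro \<sigma>m) auto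
  then show ?thesis by (auto simp: ww_def)
 qed
 have w0: "0 <= ww k" for k
 proof -
  have "\<sigma> 0 <= \<sigma> (min k n)" by (intro \<sigma>m) auto
  then show ?thesis using t \<sigma>(1) by (simp add: ww_def)
 qed
 let ?f = "\<lambda>u. (max 0 (\<bar>simple_process n \<sigma> \<zeta> u w\<bar> - h))\<^sup>2"
 have fin: "emeasure (path_measure V w) {ww k<..ww (Suc k)} < \<infinity>" for k
  by (subst path_measure_Ioc(1)[where V=V and w=w, OF V w0 wS]) simp
 have val: "?f x = (max 0 (\<bar>\<zeta> k w\<bar> - h))\<^sup>2" if "k < n" "ww k < x" "x <= ww (Suc k)" for k x
 proof -
  have "\<sigma> k < x" "x <= \<sigma> (Suc k)" using that by (auto simp: ww_def min_def split: if_splits)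
  then show ?thesis using simple_process_value[where n=n and \<sigma>=\<sigma> and k=k and x=x and \<zeta>=\<zeta> and w=w] \<sigma>(2) that(1) by simp
 qed
 note st = set_integral_step[where ww=ww and f="?f" and c="\<lambda>k. (max 0 (\<bar>\<zeta> k w\<bar> - h))\<^sup>2" and n=n, OF sets_path_measure wS fin val]
 have ind: "indicator {0..t} x *\<^sub>R ?f x = indicator {ww 0<..ww n} x *\<^sub>R ?f x" for x
 proof (cases "x \<in> {0..t} \<and> x \<notin> {ww 0<..ww n}")
  case True
  then have "x <= \<sigma> 0 \<or> \<sigma> n < x" by (auto simp: ww_def min_def split: if_splits)
  then have "simple_process n \<sigma> \<zeta> x w = 0" by (intro simple_process_outside[where \<sigma>=\<sigma>] \<sigma>(2))
  then show ?thesis using h by simp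
 next
  case False
  have "{ww 0<..ww n} \<subseteq> {0..t}" using w0[of 0] by (auto simp: ww_def)
  then show ?thesis using False by (auto simp: indicator_def)
 qed
 show "set_integrable (path_measure V w) {0..t} ?f"
  using st(1) unfolding set_integrable_def ind .
 have "(LINT u:{0..t}|path_measure V w. ?f u) = (LINT x:{ww 0<..ww n}|path_measure V w. ?f x)"
  unfolding set_lebesgue_integral_def ind ..
 also have "\<dots> = (\<Sum>k<n. (max 0 (\<bar>\<zeta> k w\<bar> - h))\<^sup>2 * measure (path_measure V w) {ww k<..ww (Suc k)})" by (rule st(2))
 also have "\<dots> = excess n \<sigma> \<zeta> h V t w" unfolding excess_def
 proof (intro sum.cong refl)
  fix k assume "k \<in> {..<n}"
  then show "(max 0 (\<bar>\<zeta> k w\<bar> - h))\<^sup>2 * measure (path_measure V w) {ww k<..ww (Suc k)}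
   = (max 0 (\<bar>\<zeta> k w\<bar> - h))\<^sup>2 * (V (min t (\<sigma> (Suc k))) w - V (min t (\<sigma> k)) w)"
   unfolding path_measure_Ioc(2)[where V=V and w=w, OF V w0 wS] by (simp add: ww_def min_def)
 qed
 finally show "excess n \<sigma> \<zeta> h V t w = (LINT u:{0..t}|path_measure V w. ?f u)" by simp
qed

lemma excess_mono:
 assumes V: "mono_on {0..} (\<lambda>t. V t w)" "continuous_on {0..} (\<lambda>t. V t w)"
  and \<sigma>: "0 <= \<sigma> 0" "\<And>k. k < n ==> \<sigma> k <= \<sigma> (Suc k)" and h: "0 <= h" and st: "0 <= s" "s <= t"
 shows "0 <= excess n \<sigma> \<zeta> h V s w" "excess n \<sigma> \<zeta> h V s w <= excess n \<sigma> \<zeta> h V t w"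
proof -
 have t: "0 <= t" using st by simp
 let ?f = "\<lambda>u. (max 0 (\<bar>simple_process n \<sigma> \<zeta> u w\<bar> - h))\<^sup>2"
 note es = excess_eq_integral[where V=V and w=w and \<zeta>=\<zeta>, OF V \<sigma> h st(1)]
 note et = excess_eq_integral[where V=V and w=w and \<zeta>=\<zeta>, OF V \<sigma> h t]
 have "0 <= (LINT u:{0..s}|path_measure V w. ?f u)" unfolding set_lebesgue_integral_def by (rule Bochner_Integration.integral_nonneg) simp
 then show "0 <= excess n \<sigma> \<zeta> h V s w" by (simp only: es(2))
 have "(LINT u:{0..s}|path_measure V w. ?f u) <= (LINT u:{0..t}|path_measure V w. ?f u)"
  unfolding set_lebesgue_integral_def
  by (rule integral_mono[OF es(1)[unfolded set_integrable_def] et(1)[unfolded set_integrable_def]])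
   (use st in \<open>auto simp: indicator_def\<close>)
 then show "excess n \<sigma> \<zeta> h V s w <= excess n \<sigma> \<zeta> h V t w" by (simp only: es(2) et(2))
qed

context usual_prob_space
begin

text \<open>A weight that is not yet known at time \<open>t\<close> belongs to a cell beginning
  after \<open>t\<close>, over which the increment of \<open>V\<close> stopped at \<open>t\<close>
  is zero.\<close>

lemma excess_adapted:
 assumes V: "adapted F V" and simple: "simple_integrand M F n \<sigma> \<zeta>"
 shows "adapted F (excess n \<sigma> \<zeta> h V)"
 unfolding adapted_def
proof (intro allI impI)
 fix t :: real assume t: "0 <= t"
 have \<sigma>0: "0 <= \<sigma> 0" and \<sigma>1: "\<And>k. k < n ==> \<sigma> k <= \<sigma> (Suc k)"
  and \<zeta>m: "\<And>k. k < n ==> \<zeta> k \<in> borel_measurable (F (\<sigma> k))"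
  using simple by (auto simp: simple_integrand_def)
 have \<sigma>p: "0 <= \<sigma> k" if "k <= n" for k
  using that by (induction k) (auto intro: \<sigma>0 order_trans[OF _ \<sigma>1])
 show "excess n \<sigma> \<zeta> h V t \<in> borel_measurable (F t)"
  unfolding excess_def
 proof (rule borel_measurable_sum)
  fix k assume k: "k \<in> {..<n}"
  have Vm: "V (min t (\<sigma> j)) \<in> borel_measurable (F t)" if "j <= n" for j
   by (rule meas_mono[OF V[unfolded adapted_def, rule_format]]) (use t \<sigma>p[OF that] in auto)
  show "(\<lambda>w. (max 0 (\<bar>\<zeta> k w\<bar> - h))\<^sup>2 * (V (min t (\<sigma> (Suc k))) w - V (min t (\<sigma> k)) w)) \<in> borel_measurable (F t)"
  proof (cases "\<sigma> k <= t")
   case True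
   have "\<zeta> k \<in> borel_measurable (F t)" using k by (intro meas_mono[OF \<zeta>m True]) simp
   then show ?thesis using Vm[of k] Vm[of "Suc k"] k
    by (intro borel_measurable_times borel_measurable_diff borel_measurable_power borel_measurable_max borel_measurable_abs borel_measurable_const) auto
  next
   case False
   then have "min t (\<sigma> (Suc k)) = min t (\<sigma> k)" using \<sigma>1[of k] k by auto
   then show ?thesis by simp
  qed
 qed
qed

lemma excess_continuous:
 assumes V: "AE_continuous_paths M V" and simple: "simple_integrand M F n \<sigma> \<zeta>"
 shows "AE_continuous_paths M (excess n \<sigma> \<zeta> h V)"
proof -
 have \<sigma>0: "0 <= \<sigma> 0" and \<sigma>1: "\<And>k. k < n ==> \<sigma> k <= \<sigma> (Suc k)"
  using simple by (auto simp: simple_integrand_def)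
 have \<sigma>p: "0 <= \<sigma> k" if "k <= n" for k
  using that by (induction k) (auto intro: \<sigma>0 order_trans[OF _ \<sigma>1])
 show ?thesis using V unfolding AE_continuous_paths_def
 proof eventually_elim
  case (elim w)
  have c: "continuous_on {0..} (\<lambda>t. V (min t (\<sigma> k)) w)" if "k <= n" for k
   by (rule continuous_on_compose2[OF elim]) (use \<sigma>p[OF that] in \<open>auto intro!: continuous_intros\<close>)
  show ?case unfolding excess_def by (intro continuous_on_sum continuous_on_mult continuous_on_diff continuous_on_const c) auto
 qed
qed

text \<open>Bounded second moments stand in for uniform integrability: clipping at level
  \<open>a\<close> changes \<open>x\<close> by at most \<open>x^2 / a\<close>. Dominated convergence
  handles the clipped variables, and \<open>a\<close> then tends to infinity.\<close>

lemma zero_expectation_LIMSEQ: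
 fixes X :: "nat => 'w => real" and B b c :: real
 assumes X: "\<And>m. X m \<in> borel_measurable M" "\<And>m. integrable M (\<lambda>w. (X m w)\<^sup>2)" "\<And>m. (\<integral>w. (X m w)\<^sup>2 \<partial>M) <= B"
  and lim: "AE w in M. (\<lambda>m. X m w) \<longlonglongrightarrow> Y w" and Y: "Y \<in> borel_measurable M" "AE w in M. \<bar>Y w\<bar> <= c"
  and \<phi>: "\<phi> \<in> borel_measurable M" "AE w in M. \<bar>\<phi> w\<bar> <= b" and zero: "\<And>m. (\<integral>w. \<phi> w * X m w \<partial>M) = 0"
 shows "(\<integral>w. \<phi> w * Y w \<partial>M) = 0"
proof -
 define clip where "clip a x = max (- a) (min a x)" for a x :: real
 have cl1: "\<bar>clip a x\<bar> <= a" if "0 < a" for a x using that by (auto simp: clip_def)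
 have cl2: "\<bar>x - clip a x\<bar> <= x\<^sup>2 / a" if "0 < a" for a x
 proof (cases "\<bar>x\<bar> <= a")
  case True then have "clip a x = x" by (auto simp: clip_def)
  then show ?thesis using that by simp
 next
  case False
  then have "\<bar>x - clip a x\<bar> <= \<bar>x\<bar>" using that by (auto simp: clip_def)
  also have "\<dots> <= x\<^sup>2 / a"
  proof -
   have "a * \<bar>x\<bar> <= \<bar>x\<bar> * \<bar>x\<bar>" using False by (intro mult_right_mono) auto
   then show ?thesis using that by (simp add: pos_le_divide_eq power2_eq_square mult.commute)
  qed
  finally show ?thesis .
 qed
 have le: "\<bar>\<integral>w. \<phi> w * Y w \<partial>M\<bar> <= \<bar>b\<bar> * B / a" if a: "0 < a" "c <= a" for a
 proof -
  have "(\<lambda>m. \<integral>w. \<phi> w * clip a (X m w) \<partial>M) \<longlonglongrightarrow> (\<integral>w. \<phi> w * Y w \<partial>M)"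
  proof (rule integral_dominated_convergence[where w="\<lambda>_. \<bar>b\<bar> * a"])
   show "AE w in M. (\<lambda>m. \<phi> w * clip a (X m w)) \<longlonglongrightarrow> \<phi> w * Y w"
    using lim Y(2)
   proof eventually_elim
    case (elim w)
    have "(\<lambda>m. clip a (X m w)) \<longlonglongrightarrow> clip a (Y w)"
     unfolding clip_def by (intro tendsto_max tendsto_min tendsto_const elim(1))
    moreover have "clip a (Y w) = Y w" using elim(2) a by (auto simp: clip_def)
    ultimately show ?case by (intro tendsto_mult tendsto_const) simp
   qed
   show "AE w in M. norm (\<phi> w * clip a (X m w)) <= \<bar>b\<bar> * a" for m
    using \<phi>(2) by eventually_elim (use cl1[OF a(1)] in \<open>auto simp: abs_mult intro!: mult_mono\<close>)
  qed (use X(1) Y(1) \<phi>(1) in \<open>simp_all add: clip_def\<close>)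
  then have "(\<lambda>m. \<bar>\<integral>w. \<phi> w * clip a (X m w) \<partial>M\<bar>) \<longlonglongrightarrow> \<bar>\<integral>w. \<phi> w * Y w \<partial>M\<bar>" by (rule tendsto_rabs)
  moreover have "\<bar>\<integral>w. \<phi> w * clip a (X m w) \<partial>M\<bar> <= \<bar>b\<bar> * B / a" for m
  proof -
   have le1: "\<bar>x\<bar> <= 1 + x\<^sup>2" for x :: real
    using zero_le_power2[of "\<bar>x\<bar> - 1 / 2"] by (simp add: power2_eq_square algebra_simps)
   have iX: "integrable M (X m)"
    by (rule Bochner_Integration.integrable_bound[of _ "\<lambda>w. 1 + (X m w)\<^sup>2"])
     (use X(1,2) le1 in \<open>auto intro!: AE_I2 order_trans[OF le1]\<close>)
   have iC: "integrable M (\<lambda>w. clip a (X m w))"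
    by (rule integrable_AE_bounded[where c=a]) (use X(1) cl1[OF a(1)] in \<open>auto simp: clip_def\<close>)
   have i1: "integrable M (\<lambda>w. \<phi> w * X m w)" by (rule integrable_bounded_mult[OF iX \<phi>])
   have i2: "integrable M (\<lambda>w. \<phi> w * clip a (X m w))" by (rule integrable_bounded_mult[OF iC \<phi>])
   have "\<bar>\<integral>w. \<phi> w * clip a (X m w) \<partial>M\<bar> = \<bar>\<integral>w. \<phi> w * X m w - \<phi> w * clip a (X m w) \<partial>M\<bar>"
    using i1 i2 zero by simp
   also have "\<dots> <= (\<integral>w. \<bar>\<phi> w * X m w - \<phi> w * clip a (X m w)\<bar> \<partial>M)" by (rule integral_abs_bound)
   also have "\<dots> <= (\<integral>w. \<bar>b\<bar> * ((X m w)\<^sup>2 / a) \<partial>M)"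
   proof (rule integral_mono_AE)
    show "AE w in M. \<bar>\<phi> w * X m w - \<phi> w * clip a (X m w)\<bar> <= \<bar>b\<bar> * ((X m w)\<^sup>2 / a)"
     using \<phi>(2)
    proof eventually_elim
     case (elim w)
     have "\<bar>\<phi> w * X m w - \<phi> w * clip a (X m w)\<bar> = \<bar>\<phi> w\<bar> * \<bar>X m w - clip a (X m w)\<bar>"
      by (simp add: abs_mult[symmetric] right_diff_distrib)
     also have "\<dots> <= \<bar>b\<bar> * ((X m w)\<^sup>2 / a)" using elim cl2[OF a(1)] by (intro mult_mono) auto
     finally show ?case .
    qed
   qed (use i1 i2 X(2) in auto)
   also have "\<dots> = \<bar>b\<bar> * (\<integral>w. (X m w)\<^sup>2 \<partial>M) / a" by simp
   also have "\<dots> <= \<bar>b\<bar> * B / a" using X(3)[of m] a by (intro divide_right_mono mult_left_mono) auto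
   finally show ?thesis .
  qed
  ultimately show ?thesis by (intro LIMSEQ_le_const2) auto
 qed
 have "(\<lambda>n. \<bar>b\<bar> * B / (real n)) \<longlonglongrightarrow> 0"
  by (rule real_tendsto_divide_at_top[OF tendsto_const filterlim_real_sequentially])
 moreover have "\<exists>N. \<forall>n\<ge>N. \<bar>\<integral>w. \<phi> w * Y w \<partial>M\<bar> <= \<bar>b\<bar> * B / real n"
  by (intro exI[of _ "nat \<lceil>\<bar>c\<bar>\<rceil> + 1"] allI impI le) linarith+
 ultimately have "\<bar>\<integral>w. \<phi> w * Y w \<partial>M\<bar> <= 0" by (rule LIMSEQ_le_const)
 then show ?thesis by simp
qed

text \<open>The approximating simple integrands converge almost surely, without any bound in mean.
  Since \<open>\<bar>H\<bar> <= h\<close>, their excess over \<open>h\<close> is controlled by their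
  distance to \<open>H\<close> and tends to zero. Stopping in addition when the excess reaches
  \<open>1\<close> therefore bounds the simple isometries uniformly, and on almost every path this
  extra stopping is eventually inactive.\<close>

lemma ito_step:
 assumes br: "bracket M F Y Y V" "AE w in M. mono_on {0..} (\<lambda>t. V t w)" and ito: "ito_integral M F H Y K"
  and H: "\<And>s w. w \<in> space M ==> 0 <= s ==> \<bar>H s w\<bar> <= h" "0 <= h"
  and T: "0 <= T" and \<tau>: "stopping_time F \<tau>" "\<And>w. 0 <= \<tau> w" "\<And>w. \<tau> w <= T"
  and spY: "AE w in M. \<forall>t\<ge>0. \<bar>sp \<tau> Y t w\<bar> <= c"
  and spP: "AE w in M. \<forall>t\<ge>0. \<bar>sp \<tau> (\<lambda>t w. Y t w * Y t w - V t w) t w\<bar> <= c"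
  and spV: "AE w in M. \<forall>t\<ge>0. \<bar>sp \<tau> V t w\<bar> <= c"
  and spK: "AE w in M. \<forall>t\<ge>0. \<bar>sp \<tau> K t w\<bar> <= c"
  and Yc: "AE w in M. \<forall>s\<ge>0. s < \<tau> w --> \<bar>Y s w\<bar> <= c"
  and st: "0 <= s" "s <= t" "t <= T" and \<xi>: "\<xi> \<in> borel_measurable (F s)" "AE w in M. \<bar>\<xi> w\<bar> <= h"
 defines "X w \<equiv> K (min t (\<tau> w)) w - K (min s (\<tau> w)) w - \<xi> w * (Y (min t (\<tau> w)) w - Y (min s (\<tau> w)) w)"
  and "S w \<equiv> (LINT u:{min s (\<tau> w)<..min t (\<tau> w)}|path_measure V w. (H u w - \<xi> w)\<^sup>2)"
 shows "X \<in> borel_measurable M" "integrable M (\<lambda>w. (X w)\<^sup>2)" "integrable M S" "(\<integral>w. (X w)\<^sup>2 \<partial>M) <= (\<integral>w. S w \<partial>M)"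
  "\<And>\<phi> b. \<phi> \<in> borel_measurable (F s) ==> AE w in M. \<bar>\<phi> w\<bar> <= b ==> (\<integral>w. \<phi> w * X w \<partial>M) = 0"
proof -
 have t: "0 <= t" using st by simp
 obtain V0 n \<sigma> \<zeta> where V0: "bracket M F Y Y V0" "AE w in M. mono_on {0..} (\<lambda>t. V0 t w)"
  and simple: "\<And>m. simple_integrand M F (n m) (\<sigma> m) (\<zeta> m)"
  and conv: "AE w in M. \<forall>t\<ge>0.
       ((\<lambda>m. \<integral>\<^sup>+s\<in>{0..t}. ennreal ((simple_process (n m) (\<sigma> m) (\<zeta> m) s w - H s w)\<^sup>2)
         \<partial>path_measure V0 w) \<longlonglongrightarrow> 0) \<and>
       uniform_limit {0..t} (\<lambda>m s. simple_integral (n m) (\<sigma> m) (\<zeta> m) Y s w)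
        (\<lambda>s. K s w) sequentially"
  using ito unfolding ito_integral_def by blast
 have prog: "progressive F H" and adK: "adapted F K" and contK: "AE_continuous_paths M K"
  using ito unfolding ito_integral_def by blast+
 have adY: "adapted F Y" and adV: "adapted F V" and contV: "AE_continuous_paths M V" and contY: "AE_continuous_paths M Y"
  and lmY: "cont_local_martingale M F Y" and lmP: "cont_local_martingale M F (\<lambda>t w. Y t w * Y t w - V t w)"
  using br(1) unfolding bracket_def cont_local_martingale_def by blast+
 have VV0: "AE w in M. \<forall>t\<ge>0. V0 t w = V t w" by (rule bracket_unique[OF V0 br])
 have \<sigma>0: "0 <= \<sigma> m 0" and \<sigma>1: "\<And>k. k < n m ==> \<sigma> m k <= \<sigma> m (Suc k)" for m
  using simple[of m] by (auto simp: simple_integrand_def)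
 define e where "e m = excess (n m) (\<sigma> m) (\<zeta> m) h V" for m
 have e_ad: "adapted F (e m)" and e_cont: "AE_continuous_paths M (e m)" for m
  unfolding e_def by (rule excess_adapted[OF adV simple], rule excess_continuous[OF contV simple])
 \<comment> \<open>The level \<open>1\<close> is arbitrary; it keeps the excess bounded while
   leaving room for it to tend to zero.\<close>
 define R where "R m = hit (e m) T 1" for m
 have R: "stopping_time F (R m)" "0 <= R m w" "R m w <= T" for m w
  unfolding R_def using stopping_time_hit[OF e_ad e_cont T] hit_bounds[OF T] by auto
 define \<tau>m where "\<tau>m m w = min (\<tau> w) (R m w)" for m w
 have \<tau>m: "stopping_time F (\<tau>m m)" "0 <= \<tau>m m w" "\<tau>m m w <= \<tau> w" "\<tau>m m w <= T" for m w
  unfolding \<tau>m_def using stopping_time_min[OF \<tau>(1) R(1)] \<tau>(2,3)[of w] R(2)[of m w] by auto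
 have sp_le: "AE w in M. \<forall>t\<ge>0. \<bar>sp (\<tau>m m) Q t w\<bar> <= c" if "AE w in M. \<forall>t\<ge>0. \<bar>sp \<tau> Q t w\<bar> <= c" for Q m
  using that
 proof eventually_elim
  case (elim w)
  show ?case
  proof (intro allI impI)
   fix t :: real assume "0 <= t"
   then have "\<bar>sp \<tau> Q (min t (R m w)) w\<bar> <= c" using elim R(2)[of m w] by simp
   then show "\<bar>sp (\<tau>m m) Q t w\<bar> <= c" by (simp add: sp_def \<tau>m_def min.assoc min.commute[of "\<tau> w"])
  qed
 qed
 have mgY: "mg (sp (\<tau>m m) Y)" and mgP: "mg (sp (\<tau>m m) (\<lambda>t w. Y t w * Y t w - V t w))" for m
  by (rule sp_mg[OF lmY \<tau>m(1,2) sp_le[OF spY]], rule sp_mg[OF lmP \<tau>m(1,2) sp_le[OF spP]])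
 have spYm: "AE w in M. \<bar>sp (\<tau>m m) Y t w\<bar> <= c" if "0 <= t" for m t
  using sp_le[OF spY, of m] by eventually_elim (use that in auto)
 have Ycm: "AE w in M. \<forall>s\<ge>0. s < \<tau>m m w --> \<bar>Y s w\<bar> <= c" for m
  using Yc by eventually_elim (use \<tau>m(3)[of m] in \<open>auto dest: order.strict_trans2\<close>)
 define Xm where "Xm m w = simple_integral (n m) (\<sigma> m) (\<zeta> m) Y (min t (\<tau>m m w)) w - simple_integral (n m) (\<sigma> m) (\<zeta> m) Y (min s (\<tau>m m w)) w
   - \<xi> w * (Y (min t (\<tau>m m w)) w - Y (min s (\<tau>m m w)) w)" for m w
 define G where "G m w = (LINT u:{min s (\<tau>m m w)<..min t (\<tau>m m w)}|path_measure V w. (simple_process (n m) (\<sigma> m) (\<zeta> m) u w - \<xi> w)\<^sup>2)" for m w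
 have si: "Xm m \<in> borel_measurable M" "integrable M (\<lambda>w. (Xm m w)\<^sup>2)" "integrable M (G m)"
  "(\<integral>w. (Xm m w)\<^sup>2 \<partial>M) = (\<integral>w. G m w \<partial>M)" for m
  unfolding Xm_def[abs_def] G_def[abs_def]
  by (rule simple_integral_isometry[OF mgY mgP spYm Ycm \<tau>m(1) \<tau>m(2) adY br(2) contV simple st(1,2) \<xi>], assumption?)+
 have si5: "(\<integral>w. \<phi> w * Xm m w \<partial>M) = 0"
  if "\<phi> \<in> borel_measurable (F s)" "AE w in M. \<bar>\<phi> w\<bar> <= b" for m \<phi> b
  unfolding Xm_def[abs_def]
  by (rule simple_integral_isometry(5)[OF mgY mgP spYm Ycm \<tau>m(1) \<tau>m(2) adY br(2) contV simple st(1,2) \<xi> that])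
 have fin: "emeasure (path_measure V w) {a<..b} < \<infinity>"
  if "mono_on {0..} (\<lambda>t. V t w)" "continuous_on {0..} (\<lambda>t. V t w)" "0 <= a" "a <= b" for w a b
  by (subst path_measure_Ioc(1)[where V=V and w=w, OF that]) simp
 \<comment> \<open>With \<open>\<bar>\<xi>\<bar> <= h\<close>, the squared distance of the simple
   process to \<open>\<xi>\<close> is at most \<open>8 * h^2\<close> plus twice the squared excess.
   The increment of \<open>V\<close> is at most \<open>2 * c\<close> and the accumulated excess at
   most \<open>1\<close>.\<close>
 define B where "B = 8 * h\<^sup>2 * (2 * c) + 2"
 have Gb: "AE w in M. \<bar>G m w\<bar> <= B" for m
  using br(2) contV[unfolded AE_continuous_paths_def] e_cont[of m, unfolded AE_continuous_paths_def] spV \<xi>(2)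
 proof eventually_elim
  case (elim w)
  let ?a = "min s (\<tau>m m w)" and ?b = "min t (\<tau>m m w)"
  let ?sp = "\<lambda>u. simple_process (n m) (\<sigma> m) (\<zeta> m) u w"
  have ab: "0 <= ?a" "?a <= ?b" "0 <= ?b" using \<tau>m(2)[of m w] st by auto
  note exc = excess_eq_integral[where V=V and w=w and \<sigma>="\<sigma> m" and n="n m" and \<zeta>="\<zeta> m", OF elim(1,2) \<sigma>0 \<sigma>1 H(2) ab(3)]
  let ?x = "\<lambda>u. (max 0 (\<bar>?sp u\<bar> - h))\<^sup>2"
  have eb: "e m ?b w = (LINT u:{0..?b}|path_measure V w. ?x u)" using exc(2) by (simp only: e_def)
  have e1: "e m ?b w <= 1"
  proof (cases "0 < R m w")
   case True
   have "\<bar>e m ?b w\<bar> <= 1"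
    by (rule le_hit_bound[where Y="e m" and Z="e m" and T=T and w=w, OF elim(3) order_refl T ab(3)])
     (use True \<tau>m(3)[of m w] in \<open>auto simp: R_def[symmetric] \<tau>m_def\<close>)
   then show ?thesis by simp
  next
   case False
   then have "?b = 0" using R(2)[of m w] \<tau>(2)[of w] t by (auto simp: \<tau>m_def)
   have \<sigma>p: "0 <= \<sigma> m k" if "k <= n m" for k
    using that by (induction k) (auto intro: \<sigma>0 order_trans[OF _ \<sigma>1])
   have "e m 0 w = 0" unfolding e_def excess_def by (intro sum.neutral) (use \<sigma>p in auto)
   then show ?thesis using \<open>?b = 0\<close> by simp
  qed
  have iI: "set_integrable (path_measure V w) {?a<..?b} (\<lambda>u. 8 * h\<^sup>2)"
   unfolding set_integrable_def using fin[OF elim(1,2) ab(1,2)] by (intro integrable_scaleR_left integrable_real_indicator) auto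
  have ix: "set_integrable (path_measure V w) {?a<..?b} (\<lambda>u. 2 * ?x u)"
   by (rule set_integrable_subset[OF set_integrable_mult_right[OF exc(1)]]) (use ab in auto)
  have "G m w <= (LINT u:{?a<..?b}|path_measure V w. 8 * h\<^sup>2 + 2 * ?x u)"
   unfolding G_def
  proof (rule set_integral_mono)
   have ptw: "(?sp u - \<xi> w)\<^sup>2 <= 8 * h\<^sup>2 + 2 * ?x u" for u
   proof -
    let ?e = "max 0 (\<bar>?sp u\<bar> - h)"
    have "\<bar>?sp u - \<xi> w\<bar> <= 2 * h + ?e" using elim(5) by linarith
    then have "\<bar>?sp u - \<xi> w\<bar>\<^sup>2 <= (2 * h + ?e)\<^sup>2" by (rule power_mono) simp
    also have "\<dots> <= 8 * h\<^sup>2 + 2 * ?e\<^sup>2"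
     using zero_le_power2[of "2 * h - ?e"] by (simp add: power2_eq_square algebra_simps)
    finally show ?thesis by simp
   qed
   then show "(?sp u - \<xi> w)\<^sup>2 <= 8 * h\<^sup>2 + 2 * ?x u" for u .
   show iss: "set_integrable (path_measure V w) {?a<..?b} (\<lambda>u. 8 * h\<^sup>2 + 2 * ?x u)" using iI ix by simp
   have m1: "(\<lambda>u. (?sp u - \<xi> w)\<^sup>2) \<in> borel_measurable (path_measure V w)"
    using simple_process_measurable[of "n m" "\<sigma> m" "\<zeta> m" w] by (simp add: measurable_cong_sets[OF sets_path_measure refl])
   show "set_integrable (path_measure V w) {?a<..?b} (\<lambda>u. (?sp u - \<xi> w)\<^sup>2)"
    by (rule set_integrable_bound[OF iss]) (use m1 ptw in \<open>auto simp: set_borel_measurable_def intro!: borel_measurable_scaleR borel_measurable_indicator order_trans[OF ptw]\<close>)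
  qed
  also have "\<dots> = 8 * h\<^sup>2 * (V ?b w - V ?a w) + 2 * (LINT u:{?a<..?b}|path_measure V w. ?x u)"
   using iI ix path_measure_Ioc(2)[where V=V and w=w, OF elim(1,2) ab(1,2)]
   by (subst set_integral_add(2)) (simp_all add: set_lebesgue_integral_def)
  also have "(LINT u:{?a<..?b}|path_measure V w. ?x u) <= e m ?b w"
   unfolding eb set_lebesgue_integral_def
  proof (rule Bochner_Integration.integral_mono[OF _ exc(1)[unfolded set_integrable_def]])
   have "set_integrable (path_measure V w) {?a<..?b} ?x"
    by (rule set_integrable_subset[OF exc(1)]) (use ab in auto)
   then show "integrable (path_measure V w) (\<lambda>u. indicator {?a<..?b} u *\<^sub>R ?x u)" by (simp only: set_integrable_def)
   fix u
   show "indicator {?a<..?b} u *\<^sub>R ?x u <= indicator {0..?b} u *\<^sub>R ?x u"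
    using ab by (auto simp: indicator_def)
  qed
  also have "V ?b w - V ?a w <= 2 * c"
  proof -
   have *: "\<bar>sp \<tau> V (min r (R m w)) w\<bar> <= c" if "0 <= r" for r using elim(4) that R(2)[of m w] by simp
   have "sp \<tau> V (min t (R m w)) w - sp \<tau> V (min s (R m w)) w = V ?b w - V ?a w"
    by (simp add: sp_def \<tau>m_def min.assoc min.commute[of "\<tau> w"])
   then show ?thesis using *[OF t] *[OF st(1)] by linarith
  qed
  finally have "G m w <= 8 * h\<^sup>2 * (2 * c) + 2 * 1" using e1 by (simp add: mult_left_mono)
  moreover have "0 <= G m w" unfolding G_def set_lebesgue_integral_def by (intro Bochner_Integration.integral_nonneg) simp
  ultimately show ?case by (simp add: B_def)
 qed
 have lim: "AE w in M. (\<lambda>m. Xm m w) \<longlonglongrightarrow> X w \<and> (\<lambda>m. G m w) \<longlonglongrightarrow> S w"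
  using br(2) contV[unfolded AE_continuous_paths_def] VV0 conv AE_space
 proof eventually_elim
  case (elim w)
  let ?sp = "\<lambda>m u. simple_process (n m) (\<sigma> m) (\<zeta> m) u w"
  \<comment> \<open>Uniqueness of the bracket enters here: the two brackets give the same Stieltjes
    measure on this path.\<close>
  have pmV: "path_measure V0 w = path_measure V w"
  proof -
   have "(\<lambda>s. V0 (max 0 s) w) = (\<lambda>s. V (max 0 s) w)" using elim(3) by (intro ext) simp
   then show ?thesis by (simp add: path_measure_def)
  qed
  have D: "(\<lambda>m. \<integral>\<^sup>+s\<in>{0..T}. ennreal ((?sp m s - H s w)\<^sup>2) \<partial>path_measure V w) \<longlonglongrightarrow> 0"
   and unif: "uniform_limit {0..T} (\<lambda>m s. simple_integral (n m) (\<sigma> m) (\<zeta> m) Y s w) (\<lambda>s. K s w) sequentially"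
   using elim(4) T unfolding pmV by blast+
  have eD: "ennreal (e m T w) <= (\<integral>\<^sup>+s\<in>{0..T}. ennreal ((?sp m s - H s w)\<^sup>2) \<partial>path_measure V w)" for m
  proof -
   note exc = excess_eq_integral[where V=V and w=w and \<sigma>="\<sigma> m" and n="n m" and \<zeta>="\<zeta> m", OF elim(1,2) \<sigma>0 \<sigma>1 H(2) T]
   have eT: "e m T w = (LINT u:{0..T}|path_measure V w. (max 0 (\<bar>?sp m u\<bar> - h))\<^sup>2)" using exc(2) by (simp only: e_def)
   have "ennreal (e m T w) = (\<integral>\<^sup>+u. ennreal (indicator {0..T} u *\<^sub>R (max 0 (\<bar>?sp m u\<bar> - h))\<^sup>2) \<partial>path_measure V w)"
    unfolding eT set_lebesgue_integral_def
    by (rule nn_integral_eq_integral[symmetric, OF exc(1)[unfolded set_integrable_def]]) (auto intro!: AE_I2)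
   also have "\<dots> <= (\<integral>\<^sup>+s\<in>{0..T}. ennreal ((?sp m s - H s w)\<^sup>2) \<partial>path_measure V w)"
   proof (rule nn_integral_mono)
    fix u
    have "(max 0 (\<bar>?sp m u\<bar> - h))\<^sup>2 <= (?sp m u - H u w)\<^sup>2" if "0 <= u"
    proof -
     have "max 0 (\<bar>?sp m u\<bar> - h) <= \<bar>?sp m u - H u w\<bar>" using H(1)[OF elim(5) that] by linarith
     then have "(max 0 (\<bar>?sp m u\<bar> - h))\<^sup>2 <= \<bar>?sp m u - H u w\<bar>\<^sup>2" by (rule power_mono) simp
     then show ?thesis by simp
    qed
    then show "ennreal (indicator {0..T} u *\<^sub>R (max 0 (\<bar>?sp m u\<bar> - h))\<^sup>2) <= ennreal ((?sp m u - H u w)\<^sup>2) * indicator {0..T} u"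
     by (auto simp: indicator_def intro!: ennreal_leI)
   qed
   finally show ?thesis .
  qed
  have "(\<lambda>m. ennreal (e m T w)) \<longlonglongrightarrow> 0"
   by (rule tendsto_sandwich[OF _ _ tendsto_const D]) (use eD in auto)
  then have "\<forall>\<^sub>F m in sequentially. ennreal (e m T w) < 1" by (rule order_tendstoD) simp
  then have ev: "\<forall>\<^sub>F m in sequentially. \<tau>m m w = \<tau> w"
  proof eventually_elim
   case (elim m)
   have e1: "e m T w < 1" using elim by (simp add: ennreal_less_one_iff)
   have "{t \<in> {0..T}. 1 <= \<bar>e m t w\<bar>} = {}"
   proof -
    have "\<bar>e m t w\<bar> < 1" if "t \<in> {0..T}" for t
     using excess_mono[where V=V and w=w and \<sigma>="\<sigma> m" and n="n m" and \<zeta>="\<zeta> m", OF \<open>mono_on {0..} (\<lambda>t. V t w)\<close> \<open>continuous_on {0..} (\<lambda>t. V t w)\<close> \<sigma>0 \<sigma>1 H(2), where s=t and t=T] e1 that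
     by (auto simp: e_def)
    then show ?thesis by force
   qed
   then have "R m w = T" unfolding R_def hit_def by (simp only: cInf_singleton)
   then show ?case using \<tau>(3)[of w] by (simp add: \<tau>m_def)
  qed
  have KI: "(\<lambda>m. simple_integral (n m) (\<sigma> m) (\<zeta> m) Y r w) \<longlonglongrightarrow> K r w" if "r \<in> {0..T}" for r
   by (rule tendsto_uniform_limitI[OF unif that])
  have rT: "min t (\<tau> w) \<in> {0..T}" "min s (\<tau> w) \<in> {0..T}" using st \<tau>(2,3)[of w] by auto
  have "(\<lambda>m. simple_integral (n m) (\<sigma> m) (\<zeta> m) Y (min t (\<tau> w)) w - simple_integral (n m) (\<sigma> m) (\<zeta> m) Y (min s (\<tau> w)) w
   - \<xi> w * (Y (min t (\<tau> w)) w - Y (min s (\<tau> w)) w)) \<longlonglongrightarrow> X w"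
   unfolding X_def by (intro tendsto_diff tendsto_const KI rT)
  moreover have "\<forall>\<^sub>F m in sequentially. simple_integral (n m) (\<sigma> m) (\<zeta> m) Y (min t (\<tau> w)) w - simple_integral (n m) (\<sigma> m) (\<zeta> m) Y (min s (\<tau> w)) w
   - \<xi> w * (Y (min t (\<tau> w)) w - Y (min s (\<tau> w)) w) = Xm m w"
   using ev by eventually_elim (simp add: Xm_def)
  ultimately have L1: "(\<lambda>m. Xm m w) \<longlonglongrightarrow> X w" by (rule Lim_transform_eventually)
  let ?J = "{min s (\<tau> w)<..min t (\<tau> w)}"
  have J: "0 <= min s (\<tau> w)" "min s (\<tau> w) <= min t (\<tau> w)" "?J \<subseteq> {0..T}" using st \<tau>(2,3)[of w] by auto
  have finJ: "emeasure (path_measure V w) ?J < \<infinity>" by (rule fin[OF elim(1,2) J(1,2)])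
  \<comment> \<open>The pathwise integral needs \<open>H\<close> measurable in time for fixed
    \<open>w\<close>; this is a section of the joint measurability contained in
    \<open>progressive\<close>.\<close>
  have Hm: "(\<lambda>u. indicator ?J u * (H u w - \<xi> w)) \<in> borel_measurable borel"
  proof -
   have "(\<lambda>(s, w). H s w) \<in> borel_measurable (restrict_space borel {0..T} \<Otimes>\<^sub>M F T)"
    using prog T by (simp add: progressive_def)
   then have "(\<lambda>u. H u w) \<in> borel_measurable (restrict_space borel {0..T})"
    using measurable_Pair1[of "\<lambda>(s, w). H s w" "restrict_space borel {0..T}" "F T" borel w] elim(5) by simp
   then have *: "(\<lambda>u. indicator {0..T} u * H u w) \<in> borel_measurable borel"
    by (subst (asm) borel_measurable_restrict_space_iff) auto
   have "indicator ?J u * (H u w - \<xi> w) = indicator ?J u * (indicator {0..T} u * H u w - \<xi> w)" for u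
   proof (cases "u \<in> ?J")
    case True
    then have "u \<in> {0..T}" using J(3) by blast
    then show ?thesis by simp
   qed simp
   then have eq: "(\<lambda>u. indicator ?J u * (H u w - \<xi> w)) = (\<lambda>u. indicator ?J u * (indicator {0..T} u * H u w - \<xi> w))"
    by (rule ext)
   show ?thesis unfolding eq
    by (intro borel_measurable_times borel_measurable_diff * borel_measurable_indicator borel_measurable_const) simp
  qed
  have int_b: "integrable (path_measure V w) (\<lambda>u. (indicator ?J u * g u)\<^sup>2)"
   if g: "(\<lambda>u. indicator ?J u * g u) \<in> borel_measurable borel" and gb: "\<And>u. u \<in> ?J ==> \<bar>g u\<bar> <= b" for g :: "real => real" and b
  proof (rule Bochner_Integration.integrable_bound[of _ "\<lambda>u. b\<^sup>2 * indicator ?J u"])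
   show "integrable (path_measure V w) (\<lambda>u. b\<^sup>2 * indicator ?J u)"
    using finJ by (intro integrable_mult_right integrable_real_indicator) auto
   show "(\<lambda>u. (indicator ?J u * g u)\<^sup>2) \<in> borel_measurable (path_measure V w)"
    using g by (simp add: measurable_cong_sets[OF sets_path_measure refl])
   show "AE u in path_measure V w. norm ((indicator ?J u * g u)\<^sup>2) <= norm (b\<^sup>2 * indicator ?J u)"
   proof (rule AE_I2)
    fix u
    show "norm ((indicator ?J u * g u)\<^sup>2) <= norm (b\<^sup>2 * indicator ?J u)"
    proof (cases "u \<in> ?J")
     case True
     have "\<bar>g u\<bar>\<^sup>2 <= b\<^sup>2" by (rule power_mono[OF gb[OF True]]) simp
     then show ?thesis using True by simp
    qed simp
   qed
  qed
  have "(\<lambda>m. \<integral>u. (indicator ?J u * (?sp m u - \<xi> w))\<^sup>2 \<partial>path_measure V w) \<longlonglongrightarrow> (\<integral>u. (indicator ?J u * (H u w - \<xi> w))\<^sup>2 \<partial>path_measure V w)"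
  proof (rule integral_power2_LIMSEQ)
   show "(\<lambda>u. indicator ?J u * (?sp m u - \<xi> w)) \<in> borel_measurable (path_measure V w)" for m
    using simple_process_measurable[of "n m" "\<sigma> m" "\<zeta> m" w] by (simp add: measurable_cong_sets[OF sets_path_measure refl])
   show "integrable (path_measure V w) (\<lambda>u. (indicator ?J u * (?sp m u - \<xi> w))\<^sup>2)" for m
   proof (rule int_b[of "\<lambda>u. ?sp m u - \<xi> w" "(\<Sum>k<n m. \<bar>\<zeta> m k w\<bar>) + \<bar>\<xi> w\<bar>"])
    show "(\<lambda>u. indicator ?J u * (?sp m u - \<xi> w)) \<in> borel_measurable borel"
     using simple_process_measurable[of "n m" "\<sigma> m" "\<zeta> m" w] by simp
    show "\<bar>?sp m u - \<xi> w\<bar> <= (\<Sum>k<n m. \<bar>\<zeta> m k w\<bar>) + \<bar>\<xi> w\<bar>" for u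
     using simple_process_bound[of "n m" "\<sigma> m" "\<zeta> m" u w] by linarith
   qed
   show "(\<lambda>u. indicator ?J u * (H u w - \<xi> w)) \<in> borel_measurable (path_measure V w)"
    using Hm by (simp add: measurable_cong_sets[OF sets_path_measure refl])
   show "integrable (path_measure V w) (\<lambda>u. (indicator ?J u * (H u w - \<xi> w))\<^sup>2)"
   proof (rule int_b[of "\<lambda>u. H u w - \<xi> w" "h + \<bar>\<xi> w\<bar>", OF Hm])
    fix u assume "u \<in> ?J"
    then have "\<bar>H u w\<bar> <= h" using J(1) by (intro H(1)[OF elim(5)]) auto
    then show "\<bar>H u w - \<xi> w\<bar> <= h + \<bar>\<xi> w\<bar>" by linarith
   qed
   show "(\<lambda>m. \<integral>\<^sup>+x. ennreal ((indicator ?J x * (?sp m x - \<xi> w) - indicator ?J x * (H x w - \<xi> w))\<^sup>2) \<partial>path_measure V w) \<longlonglongrightarrow> 0"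
   proof (rule tendsto_sandwich[OF _ _ tendsto_const D])
    show "\<forall>\<^sub>F m in sequentially. (\<integral>\<^sup>+x. ennreal ((indicator ?J x * (?sp m x - \<xi> w) - indicator ?J x * (H x w - \<xi> w))\<^sup>2) \<partial>path_measure V w)
      <= (\<integral>\<^sup>+s\<in>{0..T}. ennreal ((?sp m s - H s w)\<^sup>2) \<partial>path_measure V w)"
    proof (intro always_eventually allI nn_integral_mono)
     fix m u
     show "ennreal ((indicator ?J u * (?sp m u - \<xi> w) - indicator ?J u * (H u w - \<xi> w))\<^sup>2) <= ennreal ((?sp m u - H u w)\<^sup>2) * indicator {0..T} u"
     proof (cases "u \<in> ?J")
      case True
      then have "u \<in> {0..T}" using J(3) by blast
      then show ?thesis using True by simp
     qed simp
    qed
   qed simp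
  qed
  moreover have sqi: "(indicator ?J u * g)\<^sup>2 = indicator ?J u *\<^sub>R g\<^sup>2" for u and g :: real by (auto simp: indicator_def)
  ultimately have "(\<lambda>m. LINT u:?J|path_measure V w. (?sp m u - \<xi> w)\<^sup>2) \<longlonglongrightarrow> S w"
   unfolding S_def set_lebesgue_integral_def by simp
  moreover have "\<forall>\<^sub>F m in sequentially. (LINT u:?J|path_measure V w. (?sp m u - \<xi> w)\<^sup>2) = G m w"
   using ev by eventually_elim (simp add: G_def)
  ultimately have L2: "(\<lambda>m. G m w) \<longlonglongrightarrow> S w" by (rule Lim_transform_eventually)
  show ?case using L1 L2 by blast
 qed
 have limX: "AE w in M. (\<lambda>m. Xm m w) \<longlonglongrightarrow> X w" and limG: "AE w in M. (\<lambda>m. G m w) \<longlonglongrightarrow> S w"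
  using lim by auto
 have GM: "G m \<in> borel_measurable M" for m by (rule borel_measurable_integrable[OF si(3)])
 have SM: "S \<in> borel_measurable M" by (rule M_AE_LIMSEQ[OF GM limG])
 show XM: "X \<in> borel_measurable M" by (rule M_AE_LIMSEQ[OF si(1) limX])
 have Sb: "AE w in M. \<bar>S w\<bar> <= B"
 proof -
  have "AE w in M. \<forall>m. \<bar>G m w\<bar> <= B" using Gb by (simp add: AE_all_countable)
  then show ?thesis using limG by eventually_elim (rule LIMSEQ_le_const2[OF tendsto_rabs], auto)
 qed
 show "integrable M S" by (rule integrable_AE_bounded[OF SM Sb])
 have Xb: "AE w in M. \<bar>X w\<bar> <= 2 * c + h * (2 * c)"
  using spK spY \<xi>(2)
 proof eventually_elim
  case (elim w)
  have "\<bar>sp \<tau> K t w\<bar> <= c" "\<bar>sp \<tau> K s w\<bar> <= c" "\<bar>sp \<tau> Y t w\<bar> <= c" "\<bar>sp \<tau> Y s w\<bar> <= c" using elim t st by auto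
  then have a: "\<bar>sp \<tau> K t w - sp \<tau> K s w\<bar> <= 2 * c" "\<bar>sp \<tau> Y t w - sp \<tau> Y s w\<bar> <= 2 * c" by linarith+
  have b: "\<bar>\<xi> w * (sp \<tau> Y t w - sp \<tau> Y s w)\<bar> <= h * (2 * c)"
   unfolding abs_mult using a elim(3) H(2) by (intro mult_mono) auto
  have "X w = (sp \<tau> K t w - sp \<tau> K s w) - \<xi> w * (sp \<tau> Y t w - sp \<tau> Y s w)"
   unfolding X_def sp_diff ..
  then show ?case using abs_triangle_ineq4 add_mono[OF a(1) b] by (metis order_trans)
 qed
 show "integrable M (\<lambda>w. (X w)\<^sup>2)" by (rule integrable_power2_AE_bounded[OF XM Xb])
 have EG: "(\<lambda>m. \<integral>w. G m w \<partial>M) \<longlonglongrightarrow> (\<integral>w. S w \<partial>M)"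
  by (rule integral_dominated_convergence[where w="\<lambda>_. B"]) (use GM SM limG Gb in auto)
 \<comment> \<open>The square of the almost sure bound of the limit \<open>X\<close>. Truncating the
   approximating squares there permits dominated convergence and costs only an inequality in the
   right direction.\<close>
 define A where "A = (2 * c + h * (2 * c))\<^sup>2"
 have "(\<lambda>m. \<integral>w. min A ((Xm m w)\<^sup>2) \<partial>M) \<longlonglongrightarrow> (\<integral>w. (X w)\<^sup>2 \<partial>M)"
 proof (rule integral_dominated_convergence[where w="\<lambda>_. A"])
  show "AE w in M. (\<lambda>m. min A ((Xm m w)\<^sup>2)) \<longlonglongrightarrow> (X w)\<^sup>2"
   using limX Xb
  proof eventually_elim
   case (elim w)
   have "(\<lambda>m. min A ((Xm m w)\<^sup>2)) \<longlonglongrightarrow> min A ((X w)\<^sup>2)" by (intro tendsto_min tendsto_const tendsto_power elim(1))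
   moreover have "\<bar>X w\<bar>\<^sup>2 <= A" unfolding A_def by (rule power_mono[OF elim(2)]) simp
   ultimately show ?case by (simp add: min_absorb2)
  qed
  show "AE w in M. norm (min A ((Xm m w)\<^sup>2)) <= A" for m by (rule AE_I2) (auto simp: A_def)
 qed (use si(1) XM in auto)
 moreover have "(\<integral>w. min A ((Xm m w)\<^sup>2) \<partial>M) <= (\<integral>w. G m w \<partial>M)" for m
 proof -
  have "(\<integral>w. min A ((Xm m w)\<^sup>2) \<partial>M) <= (\<integral>w. (Xm m w)\<^sup>2 \<partial>M)"
   by (rule Bochner_Integration.integral_mono[OF Bochner_Integration.integrable_bound[OF si(2)[of m]] si(2)[of m]]) (use si(1) in \<open>auto simp: A_def\<close>)
  then show ?thesis unfolding si(4) .
 qed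
 ultimately show "(\<integral>w. (X w)\<^sup>2 \<partial>M) <= (\<integral>w. S w \<partial>M)" using EG by (intro LIMSEQ_le) auto
 fix \<phi> :: "'w => real" and b :: real assume \<phi>: "\<phi> \<in> borel_measurable (F s)" "AE w in M. \<bar>\<phi> w\<bar> <= b"
 have "(\<integral>w. (Xm m w)\<^sup>2 \<partial>M) <= \<bar>B\<bar>" for m
  unfolding si(4) using Gb[of m] by (intro integral_le_const[OF si(3)]) auto
 then show "(\<integral>w. \<phi> w * X w \<partial>M) = 0"
  by (rule zero_expectation_LIMSEQ[OF si(1,2) _ limX XM Xb meas_M[OF \<phi>(1)] \<phi>(2) si5[OF \<phi>]])
qed
end

section \<open>Ito's formula for a diffusion driven by two clocks\<close>

lemma set_integral_partition:
 fixes f :: "real => real"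
 assumes \<mu>: "sets \<mu> = sets borel" and ww: "\<And>k. ww k <= ww (Suc k)"
  and f: "set_integrable \<mu> {ww 0<..ww n} f"
 shows "(LINT x:{ww 0<..ww n}|\<mu>. f x) = (\<Sum>k<n. LINT x:{ww k<..ww (Suc k)}|\<mu>. f x)"
 using f
proof (induction n)
 case 0 then show ?case by (simp add: set_lebesgue_integral_def)
next
 case (Suc n)
 have m0: "ww 0 <= ww n" using lift_Suc_mono_le[of ww 0 n] ww by blast
 have un: "{ww 0<..ww (Suc n)} = {ww 0<..ww n} \<union> {ww n<..ww (Suc n)}" using m0 ww[of n] by auto
 have a: "set_integrable \<mu> {ww 0<..ww n} f" "set_integrable \<mu> {ww n<..ww (Suc n)} f"
  by (rule set_integrable_subset[OF Suc.prems]; use m0 ww[of n] \<mu> in auto)+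
 have "(LINT x:{ww 0<..ww (Suc n)}|\<mu>. f x) = (LINT x:{ww 0<..ww n}|\<mu>. f x) + (LINT x:{ww n<..ww (Suc n)}|\<mu>. f x)"
  unfolding un by (rule set_integral_Un[OF _ a]) auto
 then show ?case using Suc.IH[OF a(1)] by simp
qed

lemma set_integral_abs_le:
 fixes f :: "real => real"
 assumes \<mu>: "sets \<mu> = sets borel" and fin: "emeasure \<mu> {a<..b} < \<infinity>"
  and f: "AE x in \<mu>. x \<in> {a<..b} --> \<bar>f x\<bar> <= B" and B: "0 <= B"
 shows "\<bar>LINT x:{a<..b}|\<mu>. f x\<bar> <= B * measure \<mu> {a<..b}"
proof -
 have i: "integrable \<mu> (\<lambda>x. indicator {a<..b} x *\<^sub>R B)"
  using fin \<mu> by (intro integrable_scaleR_left integrable_real_indicator) auto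
 have "norm (LINT x:{a<..b}|\<mu>. f x) <= (\<integral>x. norm (indicator {a<..b} x *\<^sub>R f x) \<partial>\<mu>)"
  unfolding set_lebesgue_integral_def by (rule integral_norm_bound)
 also have "\<dots> <= (\<integral>x. indicator {a<..b} x *\<^sub>R B \<partial>\<mu>)"
  by (rule integral_mono_AE'[OF i]) (use f B in \<open>auto simp: indicator_def\<close>)
 also have "\<dots> = B * measure \<mu> {a<..b}" using \<mu> fin by simp
 finally show ?thesis by simp
qed

lemma set_integrable_bounded_Ioc:
 fixes f :: "real => real"
 assumes \<mu>: "sets \<mu> = sets borel" and fin: "emeasure \<mu> {a<..b} < \<infinity>"
  and m: "(\<lambda>x. indicator {a<..b} x * f x) \<in> borel_measurable borel" and f: "\<And>x. x \<in> {a<..b} ==> \<bar>f x\<bar> <= B"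
 shows "set_integrable \<mu> {a<..b} f"
 unfolding set_integrable_def
proof (rule Bochner_Integration.integrable_bound[of _ "\<lambda>x. indicator {a<..b} x *\<^sub>R B"])
 show "integrable \<mu> (\<lambda>x. indicator {a<..b} x *\<^sub>R B)"
  using fin \<mu> by (intro integrable_scaleR_left integrable_real_indicator) auto
 show "(\<lambda>x. indicator {a<..b} x *\<^sub>R f x) \<in> borel_measurable \<mu>" using m by (simp add: measurable_cong_sets[OF \<mu> refl])
 show "AE x in \<mu>. norm (indicator {a<..b} x *\<^sub>R f x) <= norm (indicator {a<..b} x *\<^sub>R B)"
  using f by (intro AE_I2) (fastforce simp: indicator_def)
qed

text \<open>Only \<open>g\<close> is frozen at left end points. The factor \<open>b\<close> stays
  under the integral, so it may be a merely measurable bounded function, as the boundary drift is in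
  the application.\<close>

lemma riemann_sum_LIMSEQ:
 fixes g b :: "real => real"
 assumes \<mu>: "sets \<mu> = sets borel" and T: "0 <= T" and \<theta>: "0 <= \<theta>" "\<theta> <= T" and fin: "emeasure \<mu> {0<..\<theta>} < \<infinity>"
  and g: "continuous_on {0..T} g" and b: "(\<lambda>s. indicator {0..} s * b s) \<in> borel_measurable borel" "\<And>s. 0 <= s ==> \<bar>b s\<bar> <= B"
 shows "(\<lambda>p. \<Sum>r<Suc p. g (pt T p r) * (LINT s:{min (pt T p r) \<theta><..min (pt T p (Suc r)) \<theta>}|\<mu>. b s))
   \<longlonglongrightarrow> (LINT s:{0<..\<theta>}|\<mu>. g s * b s)"
proof (rule LIMSEQ_I)
 fix e :: real assume e: "0 < e"
 have B: "0 <= B" using b(2)[of 0] by simp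
 obtain G where G: "\<And>s. s \<in> {0..T} ==> \<bar>g s\<bar> <= G"
 proof -
  have "bounded (g ` {0..T})" by (intro compact_imp_bounded compact_continuous_image g compact_Icc)
  then obtain G where "\<forall>s\<in>{0..T}. \<bar>g s\<bar> <= G" by (auto simp: bounded_iff)
  then show ?thesis using that by blast
 qed
 let ?m = "measure \<mu> {0<..\<theta>}"
 define e' where "e' = e / (2 * (B * ?m + 1))"
 have Bm: "0 <= B * ?m" using B by simp
 have e': "0 < e'" using e Bm by (simp add: e'_def add_nonneg_pos)
 have small: "e' * (B * ?m) < e"
 proof -
  have "e' * (B * ?m) < e' * (2 * (B * ?m + 1))" using e' Bm by (intro mult_strict_left_mono) auto
  also have "\<dots> = e" using Bm by (simp add: e'_def field_simps)
  finally show ?thesis .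
 qed
 obtain no where no: "\<And>p. p \<ge> no ==> \<forall>s\<in>{0..T}. \<forall>t\<in>{0..T}. \<bar>s - t\<bar> <= T / real (Suc p) --> dist (g s) (g t) < e'"
  using mesh_uniform[OF g T e'] by (auto simp: eventually_sequentially)
 show "\<exists>no. \<forall>p\<ge>no. norm ((\<Sum>r<Suc p. g (pt T p r) * (LINT s:{min (pt T p r) \<theta><..min (pt T p (Suc r)) \<theta>}|\<mu>. b s))
   - (LINT s:{0<..\<theta>}|\<mu>. g s * b s)) < e"
 proof (intro exI[of _ no] allI impI)
  fix p assume p: "no <= p"
  define ww where "ww r = min (pt T p r) \<theta>" for r
  have w0: "ww 0 = 0" "ww (Suc p) = \<theta>" using pt_simps(1,2)[OF T, of p] \<theta> by (auto simp: ww_def)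
  have wS: "ww r <= ww (Suc r)" for r using pt_simps(4)[OF T, of p r] by (auto simp: ww_def)
  have wr: "0 <= ww r" "ww r <= \<theta>" for r using pt_simps(3)[OF T, of p r] \<theta> by (auto simp: ww_def)
  have sub: "{ww r<..ww (Suc r)} \<subseteq> {0<..\<theta>}" for r using wr(1)[of r] wr(2)[of "Suc r"] by auto
  have finr: "emeasure \<mu> {ww r<..ww (Suc r)} < \<infinity>" for r
   using le_less_trans[OF emeasure_mono[OF sub] fin] \<mu> by simp
  have mb: "(\<lambda>s. indicator {a<..c} s * b s) \<in> borel_measurable borel" if "0 <= a" for a c
  proof -
   have "(\<lambda>s. indicator {a<..c} s * b s) = (\<lambda>s. indicator {a<..c} s * (indicator {0..} s * b s))"
    using that by (auto simp: indicator_def fun_eq_iff)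
   then show ?thesis using b(1) by simp
  qed
  have mg: "(\<lambda>s. indicator {a<..c} s * (g s * b s)) \<in> borel_measurable borel" if "0 <= a" "c <= T" for a c
  proof -
   have gm: "(\<lambda>s. indicator {0..T} s *\<^sub>R g s) \<in> borel_measurable borel"
    by (rule borel_measurable_continuous_on_indicator[OF _ g]) simp
   have "(\<lambda>s. indicator {a<..c} s * (g s * b s)) = (\<lambda>s. (indicator {0..T} s *\<^sub>R g s) * (indicator {a<..c} s * b s))"
    using that by (auto simp: indicator_def fun_eq_iff)
   then show ?thesis using gm mb[OF that(1), of c] by simp
  qed
  have ib: "set_integrable \<mu> {ww r<..ww (Suc r)} b" for r
   by (rule set_integrable_bounded_Ioc[OF \<mu> finr mb[OF wr(1)], of _ B]) (use b(2) wr(1)[of r] in auto)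
  have gb: "\<bar>g s * b s\<bar> <= G * B" if "s \<in> {0<..\<theta>}" for s
   unfolding abs_mult using G[of s] b(2)[of s] that \<theta> by (intro mult_mono) auto
  have igb: "set_integrable \<mu> {0<..\<theta>} (\<lambda>s. g s * b s)"
   by (rule set_integrable_bounded_Ioc[OF \<mu> fin mg gb]) (use \<theta> in auto)
  have igbr: "set_integrable \<mu> {ww r<..ww (Suc r)} (\<lambda>s. g s * b s)" for r
   by (rule set_integrable_subset[OF igb _ sub]) (simp add: \<mu>)
  have "(LINT s:{0<..\<theta>}|\<mu>. g s * b s) = (\<Sum>r<Suc p. LINT s:{ww r<..ww (Suc r)}|\<mu>. g s * b s)"
   using set_integral_partition[where ww=ww and n="Suc p", OF \<mu> wS] igb unfolding w0 by simp
  then have "(\<Sum>r<Suc p. g (pt T p r) * (LINT s:{ww r<..ww (Suc r)}|\<mu>. b s)) - (LINT s:{0<..\<theta>}|\<mu>. g s * b s)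
   = (\<Sum>r<Suc p. (LINT s:{ww r<..ww (Suc r)}|\<mu>. g (pt T p r) * b s) - (LINT s:{ww r<..ww (Suc r)}|\<mu>. g s * b s))"
   by (simp add: sum_subtractf)
  also have "\<dots> = (\<Sum>r<Suc p. LINT s:{ww r<..ww (Suc r)}|\<mu>. g (pt T p r) * b s - g s * b s)"
   using ib igbr by (intro sum.cong refl set_integral_diff(2)[symmetric]) auto
  finally have eq: "(\<Sum>r<Suc p. g (pt T p r) * (LINT s:{ww r<..ww (Suc r)}|\<mu>. b s)) - (LINT s:{0<..\<theta>}|\<mu>. g s * b s) = \<dots>" .
  have "\<bar>\<dots>\<bar> <= (\<Sum>r<Suc p. (e' * B) * measure \<mu> {ww r<..ww (Suc r)})"
  proof (rule order_trans[OF sum_abs sum_mono])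
   fix r assume r: "r \<in> {..<Suc p}"
   show "\<bar>LINT s:{ww r<..ww (Suc r)}|\<mu>. g (pt T p r) * b s - g s * b s\<bar> <= (e' * B) * measure \<mu> {ww r<..ww (Suc r)}"
   proof (rule set_integral_abs_le[OF \<mu> finr])
    show "0 <= e' * B" using e' B by simp
    have "\<bar>g (pt T p r) * b s - g s * b s\<bar> <= e' * B" if s: "s \<in> {ww r<..ww (Suc r)}" for s
    proof -
     have s': "pt T p r < s" "s <= pt T p (Suc r)" "s \<in> {0..T}" using s \<theta> wr(1)[of r] by (auto simp: ww_def min_def split: if_splits)
     have "\<bar>pt T p r - s\<bar> <= T / real (Suc p)" using s' pt_simps(5)[OF T, of p r] by linarith
     then have "dist (g (pt T p r)) (g s) < e'"
      using no[OF p] s'(3) pt_simps(3)[OF T, of p r] pt_simps(6)[OF T, of r p] r by auto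
     then have "\<bar>g (pt T p r) - g s\<bar> * \<bar>b s\<bar> <= e' * B" using b(2)[of s] s'(3) by (intro mult_mono) (auto simp: dist_real_def)
     then show ?thesis by (simp add: abs_mult[symmetric] left_diff_distrib)
    qed
    then show "AE s in \<mu>. s \<in> {ww r<..ww (Suc r)} --> \<bar>g (pt T p r) * b s - g s * b s\<bar> <= e' * B" by auto
   qed
  qed
  also have "\<dots> = e' * (B * (\<Sum>r<Suc p. measure \<mu> {ww r<..ww (Suc r)}))" by (simp only: sum_distrib_left mult.assoc)
  also have "(\<Sum>r<Suc p. measure \<mu> {ww r<..ww (Suc r)}) = ?m"
  proof -
   have "set_integrable \<mu> {0<..\<theta>} (\<lambda>s. 1::real)" by (rule set_integrable_bounded_Ioc[OF \<mu> fin, of _ 1]) auto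
   then show ?thesis using set_integral_partition[where ww=ww and n="Suc p" and f="\<lambda>s. 1::real", OF \<mu> wS] \<mu> fin finr unfolding w0
    by (simp add: set_lebesgue_integral_def)
  qed
  finally show "norm ((\<Sum>r<Suc p. g (pt T p r) * (LINT s:{min (pt T p r) \<theta><..min (pt T p (Suc r)) \<theta>}|\<mu>. b s))
   - (LINT s:{0<..\<theta>}|\<mu>. g s * b s)) < e"
   using small eq unfolding ww_def by simp
 qed
qed

lemma sum_bool_fin_squared_le:
 fixes y :: "bool => 'd::finite => real"
 shows "(\<Sum>b\<in>UNIV. \<Sum>j\<in>UNIV. y b j)\<^sup>2 <= 2 * real CARD('d) * (\<Sum>b\<in>UNIV. \<Sum>j\<in>UNIV. (y b j)\<^sup>2)"
proof -
 have "(\<Sum>b\<in>UNIV. \<Sum>j\<in>UNIV. y b j)\<^sup>2 <= (\<Sum>b\<in>(UNIV::bool set). (\<Sum>j\<in>UNIV. y b j)\<^sup>2) * real (card (UNIV::bool set))"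
  by (rule sum_squared_le_sum_of_squares)
 also have "\<dots> <= (\<Sum>b\<in>(UNIV::bool set). (\<Sum>j\<in>UNIV. (y b j)\<^sup>2) * real CARD('d)) * real (card (UNIV::bool set))"
  by (intro mult_right_mono sum_mono sum_squared_le_sum_of_squares) auto
 finally show ?thesis by (simp only: sum_distrib_right[symmetric]) (simp add: mult_ac)
qed

lemma sum_squares_le_square_sum:
 fixes a :: "'a => real"
 assumes "finite I" "\<And>r. r \<in> I ==> \<bar>a r\<bar> <= b r"
 shows "(\<Sum>r\<in>I. (a r)\<^sup>2) <= (\<Sum>r\<in>I. b r)\<^sup>2"
proof -
 have b0: "0 <= b r" if "r \<in> I" for r using assms(2)[OF that] by linarith
 have "(\<Sum>r\<in>I. (a r)\<^sup>2) <= (\<Sum>r\<in>I. b r * (\<Sum>r\<in>I. b r))"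
 proof (rule sum_mono)
  fix r assume r: "r \<in> I"
  have "\<bar>a r\<bar> * \<bar>a r\<bar> <= b r * (\<Sum>r\<in>I. b r)"
   using assms(2)[OF r] member_le_sum[of r I b] b0 r assms(1) by (intro mult_mono) force+
  then show "(a r)\<^sup>2 <= b r * (\<Sum>r\<in>I. b r)" by (simp add: power2_eq_square)
 qed
 then show ?thesis by (simp add: sum_distrib_right power2_eq_square)
qed

text \<open>Index \<open>True\<close> stands for the bulk and \<open>False\<close> for the boundary
  \<open>E\<close>. The actual integrand \<open>H\<close> may jump in time; \<open>h\<close> is a
  continuous function of the state that agrees with \<open>H\<close> wherever the clock of the same
  index runs. The cut-offs \<open>\<psi>\<close> vanish on \<open>E\<close> and tend to
  \<open>1\<close> elsewhere. Brackets are prescribed within each family, not across.\<close>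

locale driven_diffusion = usual_prob_space M F
 for M :: "'w measure" and F +
 fixes X :: "real => 'w => real^'d" and x0 :: "real^'d" and S E :: "(real^'d) set"
  and V :: "bool => real => 'w => real" and N :: "bool => 'd => real => 'w => real"
  and H K :: "bool => 'd => 'd => real => 'w => real"
  and h :: "bool => 'd => 'd => real^'d => real" and \<beta> :: "bool => 'd => real^'d => real"
  and C :: real and \<psi> :: "nat => real^'d => real"
 assumes S: "closed S"
  and X_ad: "adapted F X" and X_cont: "continuous_paths M X"
  and X_S: "\<And>t w. w \<in> space M ==> 0 <= t ==> X t w \<in> S"
  and V_ad: "adapted F (V b)" and V_mono: "AE w in M. mono_on {0..} (\<lambda>t. V b t w)"
  and V_cont: "AE_continuous_paths M (V b)" and V_0: "AE w in M. V b 0 w = 0"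
  and V_supp: "AE w in M. AE s in path_measure (V b) w. 0 <= s --> (X s w \<in> E \<longleftrightarrow> \<not> b)"
  and N_br: "bracket M F (N b i) (N b j) (\<lambda>t w. if i = j then V b t w else 0)"
  and ito: "ito_integral M F (H b i j) (N b j) (K b i j)"
  and H_h: "\<And>w s. w \<in> space M ==> 0 <= s ==> (X s w \<in> E \<longleftrightarrow> \<not> b) ==> H b i j s w = h b i j (X s w)"
  and H_b: "\<And>w s. w \<in> space M ==> 0 <= s ==> \<bar>H b i j s w\<bar> <= C"
  and h_cont: "continuous_on S (h b i j)" and h_b: "\<And>x. x \<in> S ==> \<bar>h b i j x\<bar> <= C" and C: "0 <= C"
  and \<beta>_meas: "\<And>w. w \<in> space M ==> (\<lambda>s. indicator {0..} s * \<beta> b i (X s w)) \<in> borel_measurable borel"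
  and \<beta>_b: "\<And>x. x \<in> S ==> \<bar>\<beta> b i x\<bar> <= C"
  and decomposition: "AE w in M. \<forall>t\<ge>0. \<forall>i. X t w $ i = x0 $ i
    + (\<Sum>b\<in>UNIV. LINT s:{0..t}|path_measure (V b) w. \<beta> b i (X s w)) + (\<Sum>b\<in>UNIV. \<Sum>j\<in>UNIV. K b i j t w)"
  and \<psi>_cont: "continuous_on S (\<psi> m)" and \<psi>_b: "\<And>x. x \<in> S ==> 0 <= \<psi> m x \<and> \<psi> m x <= 1"
  and \<psi>_E: "\<And>x. x \<in> S ==> x \<in> E ==> \<psi> m x = 0"
  and \<psi>_lim: "\<And>x. x \<in> S ==> x \<notin> E ==> (\<lambda>m. \<psi> m x) \<longlonglongrightarrow> 1"
begin

definition P :: "bool => 'd => 'd => real => 'w => real" where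
 "P b i j t w = N b i t w * N b j t w - (if i = j then V b t w else 0)"

text \<open>A dominating process, so that one hitting time makes every process of the locale bounded
  after stopping.\<close>

definition Z :: "real => 'w => real" where
 "Z t w = (\<Sum>i\<in>UNIV. \<bar>X t w $ i\<bar>) + (\<Sum>b\<in>UNIV. \<bar>V b t w\<bar>) + (\<Sum>b\<in>UNIV. \<Sum>j\<in>UNIV. \<bar>N b j t w\<bar>)
   + (\<Sum>b\<in>UNIV. \<Sum>i\<in>UNIV. \<Sum>j\<in>UNIV. \<bar>P b i j t w\<bar>) + (\<Sum>b\<in>UNIV. \<Sum>i\<in>UNIV. \<Sum>j\<in>UNIV. \<bar>K b i j t w\<bar>)"

lemma Xi_ad: "adapted F (\<lambda>t w. X t w $ i)" and Xi_cont: "AE_continuous_paths M (\<lambda>t w. X t w $ i)"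
proof -
 show "adapted F (\<lambda>t w. X t w $ i)" unfolding adapted_def
 proof (intro allI impI)
  fix t :: real assume "0 <= t"
  then have "X t \<in> borel_measurable (F t)" using X_ad by (simp add: adapted_def)
  then show "(\<lambda>w. X t w $ i) \<in> borel_measurable (F t)"
   by (rule measurable_compose[OF _ borel_measurable_continuous_onI]) (auto intro!: continuous_on_component continuous_on_id)
 qed
 show "AE_continuous_paths M (\<lambda>t w. X t w $ i)"
  using X_cont unfolding AE_continuous_paths_def continuous_paths_def
  by (intro AE_I2) (auto intro!: continuous_on_component)
qed

lemma N_lm: "cont_local_martingale M F (N b i)" and P_lm: "cont_local_martingale M F (P b i j)"
 using N_br[of b i j] unfolding bracket_def P_def[abs_def] by blast+

lemma lm_ad: "cont_local_martingale M F Y ==> adapted F Y" and lm_cont: "cont_local_martingale M F Y ==> AE_continuous_paths M Y"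
 unfolding cont_local_martingale_def by blast+

lemma K_ad: "adapted F (K b i j)" and K_cont: "AE_continuous_paths M (K b i j)"
 using ito[of b i j] unfolding ito_integral_def by blast+

lemma Z_ad: "adapted F Z"
 using Xi_ad V_ad lm_ad[OF N_lm] lm_ad[OF P_lm] K_ad unfolding adapted_def Z_def
 by (auto intro!: borel_measurable_add borel_measurable_sum borel_measurable_abs)

lemma Z_cont: "AE_continuous_paths M Z"
proof -
 have "AE w in M. \<forall>i. continuous_on {0..} (\<lambda>t. X t w $ i)" "AE w in M. \<forall>b. continuous_on {0..} (\<lambda>t. V b t w)"
  "AE w in M. \<forall>b j. continuous_on {0..} (\<lambda>t. N b j t w)" "AE w in M. \<forall>b i j. continuous_on {0..} (\<lambda>t. P b i j t w)"
  "AE w in M. \<forall>b i j. continuous_on {0..} (\<lambda>t. K b i j t w)"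
  using Xi_cont V_cont lm_cont[OF N_lm] lm_cont[OF P_lm] K_cont
  by (simp_all add: AE_all_countable AE_continuous_paths_def)
 then show ?thesis unfolding AE_continuous_paths_def
  by eventually_elim (auto simp: Z_def intro!: continuous_on_add continuous_on_sum continuous_on_rabs)
qed

lemma le_Z:
 "\<bar>X t w $ i\<bar> <= \<bar>Z t w\<bar>" "\<bar>V b t w\<bar> <= \<bar>Z t w\<bar>" "\<bar>N b j t w\<bar> <= \<bar>Z t w\<bar>" "\<bar>P b i j t w\<bar> <= \<bar>Z t w\<bar>" "\<bar>K b i j t w\<bar> <= \<bar>Z t w\<bar>"
proof -
 have le1: "g i <= (\<Sum>i\<in>UNIV. g i)" if "\<And>i. 0 <= g i" for g :: "'e::finite => real" and i
  using that by (intro member_le_sum) auto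
 let ?x = "\<Sum>i\<in>UNIV. \<bar>X t w $ i\<bar>" and ?v = "\<Sum>b\<in>UNIV. \<bar>V b t w\<bar>" and ?n = "\<Sum>b\<in>UNIV. \<Sum>j\<in>UNIV. \<bar>N b j t w\<bar>"
  and ?p = "\<Sum>b\<in>UNIV. \<Sum>i\<in>UNIV. \<Sum>j\<in>UNIV. \<bar>P b i j t w\<bar>" and ?k = "\<Sum>b\<in>UNIV. \<Sum>i\<in>UNIV. \<Sum>j\<in>UNIV. \<bar>K b i j t w\<bar>"
 have nn: "0 <= ?x" "0 <= ?v" "0 <= ?n" "0 <= ?p" "0 <= ?k" by (intro sum_nonneg; simp)+
 have a: "\<bar>X t w $ i\<bar> <= ?x" by (rule le1) simp
 have b: "\<bar>V b t w\<bar> <= ?v" by (rule le1[of "\<lambda>b. \<bar>V b t w\<bar>"]) simp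
 have c: "\<bar>N b j t w\<bar> <= ?n"
  by (rule order_trans[OF le1[of "\<lambda>j. \<bar>N b j t w\<bar>"] le1[of "\<lambda>b. \<Sum>j\<in>UNIV. \<bar>N b j t w\<bar>"]]) (auto intro: sum_nonneg)
 have d: "\<bar>P b i j t w\<bar> <= ?p"
  by (rule order_trans[OF order_trans[OF le1[of "\<lambda>j. \<bar>P b i j t w\<bar>"] le1[of "\<lambda>i. \<Sum>j\<in>UNIV. \<bar>P b i j t w\<bar>"]]
   le1[of "\<lambda>b. \<Sum>i\<in>UNIV. \<Sum>j\<in>UNIV. \<bar>P b i j t w\<bar>"]]) (auto intro!: sum_nonneg)
 have e: "\<bar>K b i j t w\<bar> <= ?k"
  by (rule order_trans[OF order_trans[OF le1[of "\<lambda>j. \<bar>K b i j t w\<bar>"] le1[of "\<lambda>i. \<Sum>j\<in>UNIV. \<bar>K b i j t w\<bar>"]]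
   le1[of "\<lambda>b. \<Sum>i\<in>UNIV. \<Sum>j\<in>UNIV. \<bar>K b i j t w\<bar>"]]) (auto intro!: sum_nonneg)
 show "\<bar>X t w $ i\<bar> <= \<bar>Z t w\<bar>" "\<bar>V b t w\<bar> <= \<bar>Z t w\<bar>" "\<bar>N b j t w\<bar> <= \<bar>Z t w\<bar>" "\<bar>P b i j t w\<bar> <= \<bar>Z t w\<bar>" "\<bar>K b i j t w\<bar> <= \<bar>Z t w\<bar>"
  using a b c d e nn unfolding Z_def by linarith+
qed

lemma g_meas:
 assumes "continuous_on S g" "0 <= t" shows "(\<lambda>w. g (X t w) :: real) \<in> borel_measurable (F t)"
proof -
 have X: "X t \<in> borel_measurable (F t)" using X_ad assms(2) by (simp add: adapted_def)
 have "(\<lambda>x. indicator S x *\<^sub>R g x) \<in> borel_measurable borel"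
  by (rule borel_measurable_continuous_on_indicator[OF _ assms(1)]) (use S in auto)
 then have "(\<lambda>w. indicator S (X t w) *\<^sub>R g (X t w)) \<in> borel_measurable (F t)"
  using X by (rule measurable_compose[rotated])
 then show ?thesis
  by (rule F_AE_cong[OF assms(2)]) (use X_S assms(2) in \<open>auto intro!: AE_I2\<close>)
qed

end

locale stopped_diffusion = driven_diffusion +
 fixes T :: real and n :: nat
 assumes T: "0 <= T"
begin

definition \<tau> :: "'a => real" where "\<tau> = hit Z T (real n)"
text \<open>Twice the hitting level, because \<open>sp\<close> is a difference of two stopped
  values.\<close>

definition c :: real where "c = 2 * real n"

lemma c: "0 <= c" by (simp add: c_def)

lemma \<tau>: "stopping_time F \<tau>" "0 <= \<tau> w" "\<tau> w <= T"
 unfolding \<tau>_def using stopping_time_hit[OF Z_ad Z_cont T] hit_bounds[OF T] by auto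

lemma sp_bound:
 assumes "AE_continuous_paths M Q" "\<And>t w. \<bar>Q t w\<bar> <= \<bar>Z t w\<bar>"
 shows "AE w in M. \<forall>t\<ge>0. \<bar>sp \<tau> Q t w\<bar> <= c"
 using assms(1) unfolding AE_continuous_paths_def
proof eventually_elim
 case (elim w)
 show ?case unfolding c_def
  by (intro allI impI sp_hit_bound[where Y=Q and Z=Z and w=w, OF elim assms(2) T]) (use hit_bounds[OF T] in \<open>auto simp: \<tau>_def\<close>)
qed

lemma below_bound:
 assumes "\<And>t w. \<bar>Q t w\<bar> <= \<bar>Z t w\<bar>" "0 <= s" "s < \<tau> w" shows "\<bar>Q s w\<bar> <= c"
 using less_hit[of s Z T "real n" w] assms(1)[of s w] assms(2,3) T unfolding \<tau>_def c_def by linarith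

lemma spN: "AE w in M. \<forall>t\<ge>0. \<bar>sp \<tau> (N b i) t w\<bar> <= c" by (rule sp_bound[OF lm_cont[OF N_lm] le_Z(3)])
lemma spP: "AE w in M. \<forall>t\<ge>0. \<bar>sp \<tau> (P b i j) t w\<bar> <= c" by (rule sp_bound[OF lm_cont[OF P_lm] le_Z(4)])
lemma spV: "AE w in M. \<forall>t\<ge>0. \<bar>sp \<tau> (V b) t w\<bar> <= c" by (rule sp_bound[OF V_cont le_Z(2)])
lemma spK: "AE w in M. \<forall>t\<ge>0. \<bar>sp \<tau> (K b i j) t w\<bar> <= c" by (rule sp_bound[OF K_cont le_Z(5)])
lemma mgN: "mg (sp \<tau> (N b i))" by (rule sp_mg[OF N_lm \<tau>(1,2) spN])
lemma mgP: "mg (sp \<tau> (P b i j))" by (rule sp_mg[OF P_lm \<tau>(1,2) spP])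

definition inc :: "(real => 'a => real) => nat => nat => 'a => real" where
 "inc Q p r w = Q (min (pt T p (Suc r)) (\<tau> w)) w - Q (min (pt T p r) (\<tau> w)) w"

text \<open>Increments of stopped processes vanish on cells that begin after \<open>\<tau>\<close>.
  Carrying this as a factor of the weight provides the support condition of
  \<open>bracket_increment\<close>.\<close>

definition live :: "nat => nat => 'a => real" where
 "live p r w = (if pt T p r < \<tau> w then 1 else 0)"

lemma inc_meas: "adapted F Q ==> AE_continuous_paths M Q ==> inc Q p r \<in> borel_measurable M"
 unfolding inc_def[abs_def]
 by (intro borel_measurable_diff meas_M[OF stopped_meas[OF _ _ \<tau>(1,2)]] pt_simps(3)[OF T])

lemma inc_sp: "inc Q p r w = sp \<tau> Q (pt T p (Suc r)) w - sp \<tau> Q (pt T p r) w"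
 by (simp add: inc_def sp_def)

definition wt :: "(real^'b => real) => nat => nat => 'a => real" where
 "wt g p r w = g (X (pt T p r) w) * live p r w"

lemma wt_meas: "continuous_on S g ==> wt g p r \<in> borel_measurable (F (pt T p r))"
proof -
 assume g: "continuous_on S g"
 have "live p r \<in> borel_measurable (F (pt T p r))"
  unfolding live_def[abs_def]
  using measurable_If[OF borel_measurable_const borel_measurable_const stopping_timeD2[OF \<tau>(1), unfolded pred_def]] .
 then show ?thesis unfolding wt_def[abs_def] using g_meas[OF g pt_simps(3)[OF T]] by simp
qed

lemma wt_bound: "\<lbrakk>\<And>x. x \<in> S ==> \<bar>g x\<bar> <= B; w \<in> space M\<rbrakk> \<Longrightarrow> \<bar>wt g p r w\<bar> <= B"
 using X_S[OF _ pt_simps(3)[OF T], of w p r] by (fastforce simp: wt_def live_def)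

end

section \<open>Freezing the integrands on the grid\<close>

context stopped_diffusion
begin

lemma V_facts: "AE w in M. \<forall>b. mono_on {0..} (\<lambda>t. V b t w) \<and> continuous_on {0..} (\<lambda>t. V b t w) \<and> V b 0 w = 0
  \<and> (\<forall>t\<ge>0. \<bar>V b (min t (\<tau> w)) w\<bar> <= c) \<and> (AE s in path_measure (V b) w. 0 <= s --> (X s w \<in> E \<longleftrightarrow> \<not> b))"
proof -
 have "AE w in M. \<forall>b. mono_on {0..} (\<lambda>t. V b t w)" "AE w in M. \<forall>b. continuous_on {0..} (\<lambda>t. V b t w)"
  "AE w in M. \<forall>b. V b 0 w = 0" "AE w in M. \<forall>b. \<forall>t\<ge>0. \<bar>sp \<tau> (V b) t w\<bar> <= c"
  "AE w in M. \<forall>b. AE s in path_measure (V b) w. 0 <= s --> (X s w \<in> E \<longleftrightarrow> \<not> b)"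
  using V_mono V_cont V_0 spV V_supp by (simp_all add: AE_all_countable AE_continuous_paths_def)
 then show ?thesis by eventually_elim (auto simp: sp_def)
qed

lemma X_path: "w \<in> space M ==> continuous_on {0..} (\<lambda>t. X t w)"
 using X_cont by (simp add: continuous_paths_def)

lemma gX_path: "continuous_on S g ==> w \<in> space M ==> continuous_on {0..T} (\<lambda>t. g (X t w))"
 by (rule continuous_on_compose2[where t=S, OF _ continuous_on_subset[OF X_path]]) (use X_S in auto)

lemma window:
 "0 <= min (pt T p r) (\<tau> w)" "min (pt T p r) (\<tau> w) <= min (pt T p (Suc r)) (\<tau> w)" "min (pt T p r) (\<tau> w) <= T"
 using pt_simps(3,4)[OF T, of p r] \<tau>(2,3)[of w] by auto

lemma pm_window:
 assumes "mono_on {0..} (\<lambda>t. V b t w)" "continuous_on {0..} (\<lambda>t. V b t w)"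
 shows "emeasure (path_measure (V b) w) {min (pt T p r) (\<tau> w)<..min (pt T p (Suc r)) (\<tau> w)} < \<infinity>"
  "measure (path_measure (V b) w) {min (pt T p r) (\<tau> w)<..min (pt T p (Suc r)) (\<tau> w)} = inc (V b) p r w"
  "0 <= inc (V b) p r w"
  "emeasure (path_measure (V b) w) {0<..\<tau> w} < \<infinity>"
proof -
 note pm = path_measure_Ioc[where V="V b" and w=w, OF assms]
 show "emeasure (path_measure (V b) w) {min (pt T p r) (\<tau> w)<..min (pt T p (Suc r)) (\<tau> w)} < \<infinity>"
  by (subst pm(1)[OF window(1,2)]) simp
 show m: "measure (path_measure (V b) w) {min (pt T p r) (\<tau> w)<..min (pt T p (Suc r)) (\<tau> w)} = inc (V b) p r w"
  by (subst pm(2)[OF window(1,2)]) (simp add: inc_def)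
 show "0 <= inc (V b) p r w" unfolding m[symmetric] by simp
 show "emeasure (path_measure (V b) w) {0<..\<tau> w} < \<infinity>"
  by (subst pm(1)[OF order_refl \<tau>(2)]) simp
qed

lemma sum_inc: "(\<Sum>r<Suc p. inc Q p r w) = Q (\<tau> w) w - Q 0 w"
 using sum_lessThan_telescope[of "\<lambda>r. Q (min (pt T p r) (\<tau> w)) w" "Suc p"] pt_simps(1,2)[OF T, of p] \<tau>(2,3)[of w]
 unfolding inc_def by (simp add: min_absorb1 min_absorb2)

lemma sum_inc_V: "AE w in M. \<forall>b p. (\<Sum>r<Suc p. inc (V b) p r w) <= c"
 using V_facts
proof eventually_elim
 case (elim w)
 show ?case unfolding sum_inc
 proof (intro allI)
  fix b
  have "\<bar>V b (min T (\<tau> w)) w\<bar> <= c" "V b 0 w = 0" using elim T by blast+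
  then show "V b (\<tau> w) w - V b 0 w <= c" using \<tau>(3)[of w] by (simp add: min_absorb2)
 qed
qed

text \<open>The error made in one cell by freezing the integrand at the left end point.\<close>

definition err :: "bool => 'b => 'b => nat => nat => 'a => real" where
 "err b i j p r w = inc (K b i j) p r w - wt (h b i j) p r w * inc (N b j) p r w"

lemma K_step:
 fixes b :: bool and i j :: 'b
 assumes \<xi>: "\<xi> \<in> borel_measurable (F (pt T p r))" "AE w in M. \<bar>\<xi> w\<bar> <= C" and r: "r <= p"
 defines "Y w \<equiv> inc (K b i j) p r w - \<xi> w * inc (N b j) p r w"
  and "R w \<equiv> (LINT u:{min (pt T p r) (\<tau> w)<..min (pt T p (Suc r)) (\<tau> w)}|path_measure (V b) w. (H b i j u w - \<xi> w)\<^sup>2)"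
 shows "Y \<in> borel_measurable M" "integrable M (\<lambda>w. (Y w)\<^sup>2)" "integrable M R" "(\<integral>w. (Y w)\<^sup>2 \<partial>M) <= (\<integral>w. R w \<partial>M)"
  "\<And>\<phi> B. \<phi> \<in> borel_measurable (F (pt T p r)) ==> AE w in M. \<bar>\<phi> w\<bar> <= B ==> (\<integral>w. \<phi> w * Y w \<partial>M) = 0"
proof -
 have br: "bracket M F (N b j) (N b j) (V b)" using N_br[of b j j] by simp
 have spP': "AE w in M. \<forall>t\<ge>0. \<bar>sp \<tau> (\<lambda>t w. N b j t w * N b j t w - V b t w) t w\<bar> <= c"
  using spP[of b j j] by (simp add: P_def[abs_def])
 have Nc: "AE w in M. \<forall>s\<ge>0. s < \<tau> w --> \<bar>N b j s w\<bar> <= c"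
  by (intro AE_I2 allI impI below_bound[OF le_Z(3)])
 have r': "Suc r <= Suc p" using r by simp
 show "Y \<in> borel_measurable M" "integrable M (\<lambda>w. (Y w)\<^sup>2)" "integrable M R" "(\<integral>w. (Y w)\<^sup>2 \<partial>M) <= (\<integral>w. R w \<partial>M)"
  unfolding Y_def R_def inc_def
  using ito_step(1-4)[OF br V_mono ito H_b C T \<tau> spN spP' spV spK Nc pt_simps(3)[OF T] pt_simps(4)[OF T] pt_simps(6)[OF T r'] \<xi>, of i] by blast+
 show "\<And>\<phi> B. \<phi> \<in> borel_measurable (F (pt T p r)) ==> AE w in M. \<bar>\<phi> w\<bar> <= B ==> (\<integral>w. \<phi> w * Y w \<partial>M) = 0"
  unfolding Y_def inc_def
  by (rule ito_step(5)[OF br V_mono ito H_b C T \<tau> spN spP' spV spK Nc pt_simps(3)[OF T] pt_simps(4)[OF T] pt_simps(6)[OF T r'] \<xi>])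
qed

text \<open>Although \<open>H\<close> may jump, almost every time for the clock \<open>b\<close>
  sees the continuous function \<open>h b i j\<close> of the path. By uniform continuity of this
  function along a path, the squared error integrates to a small multiple of the total clock, which
  is bounded by \<open>c\<close>; the mean follows by domination.\<close>

lemma freeze_error:
 shows "err b i j p r \<in> borel_measurable M" "r <= p ==> integrable M (\<lambda>w. (err b i j p r w)\<^sup>2)"
  "(\<lambda>p. \<Sum>r<Suc p. \<integral>w. (err b i j p r w)\<^sup>2 \<partial>M) \<longlonglongrightarrow> 0"
proof -
 have wtb: "AE w in M. \<bar>wt (h b i j) p r w\<bar> <= C" for p r by (intro AE_I2 wt_bound h_b)
 show "err b i j p r \<in> borel_measurable M"
  unfolding err_def[abs_def]
  using inc_meas[OF K_ad K_cont] inc_meas[OF lm_ad[OF N_lm] lm_cont[OF N_lm]] meas_M[OF wt_meas[OF h_cont]] by simp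
 show i2: "r <= p ==> integrable M (\<lambda>w. (err b i j p r w)\<^sup>2)" for p r
  using K_step(2)[where b=b and i=i and j=j, OF wt_meas[OF h_cont[of b i j]] wtb, of r p] by (simp add: err_def)
 define R where "R p r w = (LINT u:{min (pt T p r) (\<tau> w)<..min (pt T p (Suc r)) (\<tau> w)}|path_measure (V b) w. (H b i j u w - wt (h b i j) p r w)\<^sup>2)" for p r w
 have iR: "integrable M (R p r)" and eR: "(\<integral>w. (err b i j p r w)\<^sup>2 \<partial>M) <= (\<integral>w. R p r w \<partial>M)" if "r <= p" for p r
  using K_step(3,4)[where b=b and i=i and j=j, OF wt_meas[OF h_cont[of b i j]] wtb that] by (simp_all add: err_def R_def[abs_def])
 have bound: "\<bar>R p r w\<bar> <= e\<^sup>2 * inc (V b) p r w"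
  if V: "mono_on {0..} (\<lambda>t. V b t w)" "continuous_on {0..} (\<lambda>t. V b t w)"
   "AE s in path_measure (V b) w. 0 <= s --> (X s w \<in> E \<longleftrightarrow> \<not> b)" and w: "w \<in> space M" and e: "0 <= e"
   and close: "\<And>s. pt T p r < s ==> s <= pt T p (Suc r) ==> s <= \<tau> w ==> \<bar>h b i j (X s w) - h b i j (X (pt T p r) w)\<bar> <= e" for p r w e
  unfolding R_def pm_window(2)[OF V(1,2), symmetric]
 proof (rule set_integral_abs_le[OF sets_path_measure pm_window(1)[OF V(1,2)]])
  show "AE s in path_measure (V b) w. s \<in> {min (pt T p r) (\<tau> w)<..min (pt T p (Suc r)) (\<tau> w)} --> \<bar>(H b i j s w - wt (h b i j) p r w)\<^sup>2\<bar> <= e\<^sup>2"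
   using V(3)
  proof eventually_elim
   case (elim s)
   show ?case
   proof
    assume s: "s \<in> {min (pt T p r) (\<tau> w)<..min (pt T p (Suc r)) (\<tau> w)}"
    then have s': "pt T p r < s" "s <= pt T p (Suc r)" "s <= \<tau> w" by auto
    then have s0: "0 <= s" using pt_simps(3)[OF T, of p r] by linarith
    have "H b i j s w = h b i j (X s w)" using elim s0 by (intro H_h[OF w s0]) simp
    moreover have "wt (h b i j) p r w = h b i j (X (pt T p r) w)" using s' by (simp add: wt_def live_def)
    ultimately have "\<bar>H b i j s w - wt (h b i j) p r w\<bar> <= e" using close[OF s'] by simp
    then have "\<bar>H b i j s w - wt (h b i j) p r w\<bar>\<^sup>2 <= e\<^sup>2" by (rule power_mono) simp
    then show "\<bar>(H b i j s w - wt (h b i j) p r w)\<^sup>2\<bar> <= e\<^sup>2" by simp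
   qed
  qed
 qed simp
 have "(\<lambda>p. \<integral>w. (\<Sum>r<Suc p. R p r w) \<partial>M) \<longlonglongrightarrow> (\<integral>w. 0 \<partial>M)"
 proof (rule integral_dominated_convergence[where w="\<lambda>_. (2 * C)\<^sup>2 * c"])
  show "AE w in M. (\<lambda>p. \<Sum>r<Suc p. R p r w) \<longlonglongrightarrow> 0"
   using V_facts sum_inc_V AE_space
  proof eventually_elim
   case (elim w)
   have V: "mono_on {0..} (\<lambda>t. V b t w)" "continuous_on {0..} (\<lambda>t. V b t w)"
    "AE s in path_measure (V b) w. 0 <= s --> (X s w \<in> E \<longleftrightarrow> \<not> b)" using elim(1) by blast+
   show ?case
   proof (rule LIMSEQ_I)
    fix e :: real assume e: "0 < e"
    define d where "d = sqrt (e / (c + 1))"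
    have d: "0 < d" using e c by (simp add: d_def)
    have dc: "d\<^sup>2 * c < e"
    proof -
     have "d\<^sup>2 * c = e * (c / (c + 1))" using e c by (simp add: d_def)
     also have "\<dots> < e * 1" using e c by (intro mult_strict_left_mono) auto
     finally show ?thesis by simp
    qed
    obtain no where no: "\<And>p. p \<ge> no ==> \<forall>s\<in>{0..T}. \<forall>t\<in>{0..T}. \<bar>s - t\<bar> <= T / real (Suc p) --> dist (h b i j (X s w)) (h b i j (X t w)) < d"
     using mesh_uniform[OF gX_path[OF h_cont[of b i j] elim(3)] T d, unfolded eventually_sequentially] by blast
    show "\<exists>no. \<forall>p\<ge>no. norm ((\<Sum>r<Suc p. R p r w) - 0) < e"
    proof (intro exI[of _ no] allI impI)
     fix p assume p: "no <= p"
     have "\<bar>\<Sum>r<Suc p. R p r w\<bar> <= (\<Sum>r<Suc p. d\<^sup>2 * inc (V b) p r w)"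
     proof (rule order_trans[OF sum_abs sum_mono])
      fix r assume r: "r \<in> {..<Suc p}"
      show "\<bar>R p r w\<bar> <= d\<^sup>2 * inc (V b) p r w"
      proof (rule bound[OF V elim(3)])
       fix s assume s: "pt T p r < s" "s <= pt T p (Suc r)" "s <= \<tau> w"
       have "s \<in> {0..T}" "pt T p r \<in> {0..T}" using s pt_simps(3)[OF T, of p r] \<tau>(3)[of w] by auto
       moreover have "\<bar>s - pt T p r\<bar> <= T / real (Suc p)" using s pt_simps(5)[OF T, of p r] by linarith
       ultimately have "dist (h b i j (X s w)) (h b i j (X (pt T p r) w)) < d" using no[OF p] by blast
       then show "\<bar>h b i j (X s w) - h b i j (X (pt T p r) w)\<bar> <= d" by (simp add: dist_real_def)
      qed (use d in simp)
     qed
     also have "\<dots> = d\<^sup>2 * (\<Sum>r<Suc p. inc (V b) p r w)" by (simp only: sum_distrib_left)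
     also have "\<dots> <= d\<^sup>2 * c" using elim(2) by (intro mult_left_mono) auto
     finally show "norm ((\<Sum>r<Suc p. R p r w) - 0) < e" using dc by simp
    qed
   qed
  qed
  show "AE w in M. norm (\<Sum>r<Suc p. R p r w) <= (2 * C)\<^sup>2 * c" for p
   using V_facts sum_inc_V AE_space
  proof eventually_elim
   case (elim w)
   have V: "mono_on {0..} (\<lambda>t. V b t w)" "continuous_on {0..} (\<lambda>t. V b t w)"
    "AE s in path_measure (V b) w. 0 <= s --> (X s w \<in> E \<longleftrightarrow> \<not> b)" using elim(1) by blast+
   have "\<bar>\<Sum>r<Suc p. R p r w\<bar> <= (\<Sum>r<Suc p. (2 * C)\<^sup>2 * inc (V b) p r w)"
   proof (rule order_trans[OF sum_abs sum_mono], rule bound[OF V elim(3)])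
    show "0 <= 2 * C" using C by simp
    fix r s assume "pt T p r < s"
    then have "X s w \<in> S" "X (pt T p r) w \<in> S" using X_S[OF elim(3)] pt_simps(3)[OF T, of p r] by auto
    then have "\<bar>h b i j (X s w)\<bar> <= C" "\<bar>h b i j (X (pt T p r) w)\<bar> <= C" by (simp_all add: h_b)
    then show "\<bar>h b i j (X s w) - h b i j (X (pt T p r) w)\<bar> <= 2 * C" by linarith
   qed
   also have "\<dots> = (2 * C)\<^sup>2 * (\<Sum>r<Suc p. inc (V b) p r w)" by (simp only: sum_distrib_left)
   also have "\<dots> <= (2 * C)\<^sup>2 * c" using elim(2) by (intro mult_left_mono) auto
   finally show ?case by simp
  qed
  show "(\<lambda>w. \<Sum>r<Suc p. R p r w) \<in> borel_measurable M" for p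
   using iR by (intro borel_measurable_sum borel_measurable_integrable) auto
 qed auto
 moreover have "(\<integral>w. (\<Sum>r<Suc p. R p r w) \<partial>M) = (\<Sum>r<Suc p. \<integral>w. R p r w \<partial>M)" for p
  by (rule Bochner_Integration.integral_sum) (use iR in auto)
 ultimately have lim: "(\<lambda>p. \<Sum>r<Suc p. \<integral>w. R p r w \<partial>M) \<longlonglongrightarrow> 0" by simp
 show "(\<lambda>p. \<Sum>r<Suc p. \<integral>w. (err b i j p r w)\<^sup>2 \<partial>M) \<longlonglongrightarrow> 0"
 proof (rule tendsto_sandwich[OF _ _ tendsto_const lim])
  show "\<forall>\<^sub>F p in sequentially. 0 <= (\<Sum>r<Suc p. \<integral>w. (err b i j p r w)\<^sup>2 \<partial>M)"
   by (intro always_eventually allI sum_nonneg Bochner_Integration.integral_nonneg) simp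
  show "\<forall>\<^sub>F p in sequentially. (\<Sum>r<Suc p. \<integral>w. (err b i j p r w)\<^sup>2 \<partial>M) <= (\<Sum>r<Suc p. \<integral>w. R p r w \<partial>M)"
   by (intro always_eventually allI sum_mono eR) auto
 qed
qed

lemma mgK: "mg (sp \<tau> (K b i j))"
 unfolding mg_def
proof (intro conjI allI impI)
 have sm: "sp \<tau> (K b i j) t \<in> borel_measurable (F t)" if "0 <= t" for t
  unfolding sp_def[abs_def]
  by (intro borel_measurable_diff stopped_meas[OF K_ad K_cont \<tau>(1,2) that]
   meas_mono[OF K_ad[unfolded adapted_def, rule_format] that]) simp
 fix t :: real assume t: "0 <= t"
 show "sp \<tau> (K b i j) t \<in> borel_measurable (F t)" by (rule sm[OF t])
 have "AE w in M. \<bar>sp \<tau> (K b i j) t w\<bar> <= c" using spK[of b i j] by eventually_elim (use t in auto)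
 then show "integrable M (sp \<tau> (K b i j) t)" by (rule integrable_AE_bounded[OF meas_M[OF sm[OF t]]])
next
 fix s t :: real and \<phi> :: "'a => real"
 assume st: "0 <= s" "s <= t" and \<phi>: "\<phi> \<in> borel_measurable (F s)" and "\<exists>B. AE w in M. \<bar>\<phi> w\<bar> <= B"
 then obtain B where B: "AE w in M. \<bar>\<phi> w\<bar> <= B" by blast
 show "(\<integral>w. \<phi> w * (sp \<tau> (K b i j) t w - sp \<tau> (K b i j) s w) \<partial>M) = 0"
 proof (cases "s <= T")
  case False
  then have "sp \<tau> (K b i j) t w = sp \<tau> (K b i j) s w" for w
   using st \<tau>(3)[of w] by (simp add: sp_def min_absorb2)
  then show ?thesis by simp
 next
  case True
  have tT: "sp \<tau> (K b i j) t w = sp \<tau> (K b i j) (min t T) w" for w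
   using \<tau>(3)[of w] by (simp add: sp_def min.assoc min_absorb2)
  have br: "bracket M F (N b j) (N b j) (V b)" using N_br[of b j j] by simp
  have spP': "AE w in M. \<forall>t\<ge>0. \<bar>sp \<tau> (\<lambda>t w. N b j t w * N b j t w - V b t w) t w\<bar> <= c"
   using spP[of b j j] by (simp add: P_def[abs_def])
  have Nc: "AE w in M. \<forall>s\<ge>0. s < \<tau> w --> \<bar>N b j s w\<bar> <= c"
   by (intro AE_I2 allI impI below_bound[OF le_Z(3)])
  have st': "s <= min t T" "min t T <= T" using st True by auto
  have z: "(\<lambda>_. 0) \<in> borel_measurable (F s)" "AE w in M. \<bar>0::real\<bar> <= C" using C by auto
  show ?thesis unfolding tT sp_diff
   using ito_step(5)[OF br V_mono ito H_b C T \<tau> spN spP' spV spK Nc st(1) st' z \<phi> B] by simp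
 qed
qed

end

context usual_prob_space
begin

lemma bounded_AE_LIMSEQ:
 fixes Y :: "nat => 'w => real"
 assumes Y: "\<And>p. Y p \<in> borel_measurable M" "\<And>p. AE w in M. \<bar>Y p w\<bar> <= B" and lim: "AE w in M. (\<lambda>p. Y p w) \<longlonglongrightarrow> Q w"
 shows "integrable M Q" "AE w in M. \<bar>Q w\<bar> <= B" "(\<lambda>p. \<integral>w. Y p w \<partial>M) \<longlonglongrightarrow> (\<integral>w. Q w \<partial>M)"
proof -
 have Q: "Q \<in> borel_measurable M" by (rule M_AE_LIMSEQ[OF Y(1) lim])
 have "AE w in M. \<forall>p. \<bar>Y p w\<bar> <= B" using Y(2) by (simp add: AE_all_countable)
 with lim show b: "AE w in M. \<bar>Q w\<bar> <= B"
 proof eventually_elim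
  case (elim w)
  show ?case by (rule LIMSEQ_le_const2[OF tendsto_rabs[OF elim(1)]]) (use elim(2) in blast)
 qed
 show "integrable M Q" by (rule integrable_AE_bounded[OF Q b])
 show "(\<lambda>p. \<integral>w. Y p w \<partial>M) \<longlonglongrightarrow> (\<integral>w. Q w \<partial>M)"
  by (rule integral_dominated_convergence[where w="\<lambda>_. B", OF Q Y(1) _ lim]) (use Y(2) in auto)
qed

end

section \<open>Limits of weighted sums of products of increments\<close>

context stopped_diffusion
begin

lemma inc_N_facts:
 shows "inc (N b j) p r \<in> borel_measurable M" "AE w in M. \<bar>inc (N b j) p r w\<bar> <= 2 * c"
proof -
 show "inc (N b j) p r \<in> borel_measurable M" by (rule inc_meas[OF lm_ad[OF N_lm] lm_cont[OF N_lm]])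
 show "AE w in M. \<bar>inc (N b j) p r w\<bar> <= 2 * c"
  using spN[of b j]
 proof eventually_elim
  case (elim w)
  have "\<bar>sp \<tau> (N b j) (pt T p (Suc r)) w\<bar> <= c" "\<bar>sp \<tau> (N b j) (pt T p r) w\<bar> <= c"
   using elim pt_simps(3)[OF T] by blast+
  then show ?case unfolding inc_sp by linarith
 qed
qed

lemma inc_K_facts:
 shows "inc (K b i j) p r \<in> borel_measurable M" "AE w in M. \<bar>inc (K b i j) p r w\<bar> <= 2 * c"
proof -
 show "inc (K b i j) p r \<in> borel_measurable M" by (rule inc_meas[OF K_ad K_cont])
 show "AE w in M. \<bar>inc (K b i j) p r w\<bar> <= 2 * c"
  using spK[of b i j]
 proof eventually_elim
  case (elim w)
  have "\<bar>sp \<tau> (K b i j) (pt T p (Suc r)) w\<bar> <= c" "\<bar>sp \<tau> (K b i j) (pt T p r) w\<bar> <= c"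
   using elim pt_simps(3)[OF T] by blast+
  then show ?case unfolding inc_sp by linarith
 qed
qed

lemma wt_M: "continuous_on S g ==> wt g p r \<in> borel_measurable M"
 by (rule meas_M[OF wt_meas])

lemma weighted_N_product:
 assumes g: "continuous_on S g" "\<And>x. x \<in> S ==> \<bar>g x\<bar> <= G"
 shows "integrable M (\<lambda>w. wt g p r w * (inc (N b k) p r w * inc (N b' l) p r w))"
proof (rule integrable_AE_bounded)
 show "(\<lambda>w. wt g p r w * (inc (N b k) p r w * inc (N b' l) p r w)) \<in> borel_measurable M"
  using wt_M[OF g(1)] inc_N_facts(1) by simp
 show "AE w in M. \<bar>wt g p r w * (inc (N b k) p r w * inc (N b' l) p r w)\<bar> <= G * ((2 * c) * (2 * c))"
  using inc_N_facts(2)[of b k p r] inc_N_facts(2)[of b' l p r] AE_space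
 proof eventually_elim
  case (elim w)
  have "\<bar>wt g p r w\<bar> <= G" by (rule wt_bound[OF g(2) elim(3)])
  with elim show ?case unfolding abs_mult using c by (intro mult_mono) auto
 qed
qed

lemma riemann_path:
 assumes g: "continuous_on S g" and bm: "\<And>w. w \<in> space M ==> (\<lambda>s. indicator {0..} s * a (X s w)) \<in> borel_measurable borel"
  and ab: "\<And>x. x \<in> S ==> \<bar>a x\<bar> <= (B :: real)"
 shows "AE w in M. (\<lambda>p. \<Sum>r<Suc p. wt g p r w * (LINT s:{min (pt T p r) (\<tau> w)<..min (pt T p (Suc r)) (\<tau> w)}|path_measure (V b) w. a (X s w)))
   \<longlonglongrightarrow> (LINT s:{0<..\<tau> w}|path_measure (V b) w. g (X s w) * a (X s w))"
 using V_facts AE_space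
proof eventually_elim
 case (elim w)
 have V: "mono_on {0..} (\<lambda>t. V b t w)" "continuous_on {0..} (\<lambda>t. V b t w)" using elim(1) by blast+
 have ww: "wt g p r w * (LINT s:{min (pt T p r) (\<tau> w)<..min (pt T p (Suc r)) (\<tau> w)}|path_measure (V b) w. a (X s w))
   = g (X (pt T p r) w) * (LINT s:{min (pt T p r) (\<tau> w)<..min (pt T p (Suc r)) (\<tau> w)}|path_measure (V b) w. a (X s w))" for p r
 proof (cases "pt T p r < \<tau> w")
  case False
  then have "min (pt T p (Suc r)) (\<tau> w) = min (pt T p r) (\<tau> w)" using pt_simps(4)[OF T, of p r] by auto
  then show ?thesis by (simp add: set_lebesgue_integral_def)
 qed (simp add: wt_def live_def)
 show ?case unfolding ww
  by (rule riemann_sum_LIMSEQ[where g="\<lambda>s. g (X s w)" and b="\<lambda>s. a (X s w)", OF sets_path_measure T \<tau>(2,3) pm_window(4)[OF V] gX_path[OF g elim(2)] bm[OF elim(2)] ab[OF X_S[OF elim(2)]]])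
qed

lemma sum_weighted_bound:
 assumes g: "\<And>x. x \<in> S ==> \<bar>g x\<bar> <= G" and w: "w \<in> space M"
  and a: "\<And>r. \<bar>a r\<bar> <= B * inc (V b) p r w" and B: "0 <= B" and V: "(\<Sum>r<Suc p. inc (V b) p r w) <= c"
 shows "\<bar>\<Sum>r<Suc p. wt g p r w * a r\<bar> <= G * (B * c)"
proof -
 have G: "0 <= G" using wt_bound[where g=g and p=0 and r=0, OF g w] by linarith
 have "\<bar>\<Sum>r<Suc p. wt g p r w * a r\<bar> <= (\<Sum>r<Suc p. G * (B * inc (V b) p r w))"
  by (rule order_trans[OF sum_abs sum_mono], unfold abs_mult, intro mult_mono wt_bound[OF g w] a) (use G in auto)
 also have "\<dots> = G * (B * (\<Sum>r<Suc p. inc (V b) p r w))" by (simp only: sum_distrib_left)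
 also have "\<dots> <= G * (B * c)" using G B V by (intro mult_left_mono) auto
 finally show ?thesis .
qed

lemma clock_sum_LIMSEQ:
 fixes b :: bool
 assumes g: "continuous_on S g" "\<And>x. x \<in> S ==> \<bar>g x\<bar> <= G"
 defines "I w \<equiv> LINT s:{0<..\<tau> w}|path_measure (V b) w. g (X s w)"
 shows "integrable M (\<lambda>w. wt g p r w * inc (V b) p r w)" "integrable M I" "AE w in M. \<bar>I w\<bar> <= G * c"
  "(\<lambda>p. \<Sum>r<Suc p. \<integral>w. wt g p r w * inc (V b) p r w \<partial>M) \<longlonglongrightarrow> (\<integral>w. I w \<partial>M)"
proof -
 have m: "(\<lambda>w. wt g p r w * inc (V b) p r w) \<in> borel_measurable M" for p r
  using wt_M[OF g(1)] inc_meas[OF V_ad V_cont] by simp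
 have inc0: "AE w in M. \<forall>p r. 0 <= inc (V b) p r w"
  using V_facts by eventually_elim (auto intro!: pm_window(3))
 show i: "integrable M (\<lambda>w. wt g p r w * inc (V b) p r w)" for p r
 proof (rule integrable_AE_bounded[OF m])
  show "AE w in M. \<bar>wt g p r w * inc (V b) p r w\<bar> <= G * (2 * c)"
   using spV[of b] AE_space
  proof eventually_elim
   case (elim w)
   have "\<bar>sp \<tau> (V b) (pt T p (Suc r)) w\<bar> <= c" "\<bar>sp \<tau> (V b) (pt T p r) w\<bar> <= c"
    using elim pt_simps(3)[OF T] by blast+
   then have "\<bar>inc (V b) p r w\<bar> <= 2 * c" unfolding inc_sp by linarith
   moreover have "\<bar>wt g p r w\<bar> <= G" by (rule wt_bound[OF g(2) elim(2)])
   ultimately show ?case unfolding abs_mult by (intro mult_mono) auto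
  qed
 qed
 have rp: "AE w in M. (\<lambda>p. \<Sum>r<Suc p. wt g p r w * (LINT s:{min (pt T p r) (\<tau> w)<..min (pt T p (Suc r)) (\<tau> w)}|path_measure (V b) w. 1))
   \<longlonglongrightarrow> (LINT s:{0<..\<tau> w}|path_measure (V b) w. g (X s w) * 1)"
  by (rule riemann_path[where a="\<lambda>_. 1" and B=1 and b=b, OF g(1)]) simp_all
 have lim: "AE w in M. (\<lambda>p. \<Sum>r<Suc p. wt g p r w * inc (V b) p r w) \<longlonglongrightarrow> I w"
  using V_facts rp
 proof eventually_elim
  case (elim w)
  have V: "mono_on {0..} (\<lambda>t. V b t w)" "continuous_on {0..} (\<lambda>t. V b t w)" using elim(1) by blast+
  have "(LINT s:{min (pt T p r) (\<tau> w)<..min (pt T p (Suc r)) (\<tau> w)}|path_measure (V b) w. 1::real) = inc (V b) p r w" for p r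
   unfolding pm_window(2)[OF V, symmetric] using pm_window(1)[OF V]
   by (simp add: set_lebesgue_integral_def sets_path_measure)
  then show ?case using elim(2) by (simp add: I_def del: sum.lessThan_Suc)
 qed
 have bd: "AE w in M. \<bar>\<Sum>r<Suc p. wt g p r w * inc (V b) p r w\<bar> <= G * c" for p
  using inc0 sum_inc_V AE_space
 proof eventually_elim
  case (elim w)
  have "\<bar>\<Sum>r<Suc p. wt g p r w * inc (V b) p r w\<bar> <= G * (1 * c)"
   by (rule sum_weighted_bound[where b=b, OF g(2) elim(3)]) (use elim in auto)
  then show ?case by simp
 qed
 note * = bounded_AE_LIMSEQ[OF _ bd lim]
 show "integrable M I" "AE w in M. \<bar>I w\<bar> <= G * c" by (rule *(1,2); use m in \<open>intro borel_measurable_sum\<close>; blast)+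
 have "(\<lambda>p. \<integral>w. (\<Sum>r<Suc p. wt g p r w * inc (V b) p r w) \<partial>M) \<longlonglongrightarrow> (\<integral>w. I w \<partial>M)"
  by (rule *(3), intro borel_measurable_sum m)
 moreover have "(\<integral>w. (\<Sum>r<Suc p. wt g p r w * inc (V b) p r w) \<partial>M) = (\<Sum>r<Suc p. \<integral>w. wt g p r w * inc (V b) p r w \<partial>M)" for p
  by (rule Bochner_Integration.integral_sum[OF i])
 ultimately show "(\<lambda>p. \<Sum>r<Suc p. \<integral>w. wt g p r w * inc (V b) p r w \<partial>M) \<longlonglongrightarrow> (\<integral>w. I w \<partial>M)" by simp
qed

lemma same_clock_product:
 assumes g: "continuous_on S g" "\<And>x. x \<in> S ==> \<bar>g x\<bar> <= G"
 shows "(\<integral>w. wt g p r w * (inc (N b k) p r w * inc (N b l) p r w) \<partial>M)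
   = (if k = l then \<integral>w. wt g p r w * inc (V b) p r w \<partial>M else 0)"
proof -
 have \<phi>0: "AE w in M. wt g p r w \<noteq> 0 --> pt T p r < \<tau> w \<and> \<bar>N b k (pt T p r) w\<bar> <= c \<and> \<bar>N b l (pt T p r) w\<bar> <= c"
  using below_bound[OF le_Z(3) pt_simps(3)[OF T]] by (intro AE_I2) (auto simp: wt_def live_def)
 have mg': "mg (sp \<tau> (\<lambda>t w. N b k t w * N b l t w - (if k = l then V b t w else 0)))"
  using mgP[of b k l] by (simp add: P_def[abs_def])
 have c': "AE w in M. \<bar>sp \<tau> (N b j) t w\<bar> <= c" if "0 <= t" for j t
  using spN[of b j] by eventually_elim (use that in blast)
 have "(\<integral>w. wt g p r w * (inc (N b k) p r w * inc (N b l) p r w) \<partial>M)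
   = (\<integral>w. wt g p r w * inc (\<lambda>t w. if k = l then V b t w else 0) p r w \<partial>M)"
  unfolding inc_def
  by (rule bracket_increment(3)[where V="\<lambda>t w. if k = l then V b t w else 0", OF mgN mgN mg' c' c' pt_simps(3,4)[OF T]
   wt_meas[OF g(1)] _ \<phi>0 lm_ad[OF N_lm] lm_ad[OF N_lm]]) (use wt_bound[OF g(2)] in \<open>auto intro!: AE_I2\<close>)
 also have "\<dots> = (if k = l then \<integral>w. wt g p r w * inc (V b) p r w \<partial>M else 0)" by (simp add: inc_def)
 finally show ?thesis .
qed

lemma same_clock_LIMSEQ:
 assumes g: "continuous_on S g" "\<And>x. x \<in> S ==> \<bar>g x\<bar> <= G"
 shows "(\<lambda>p. \<Sum>r<Suc p. \<integral>w. wt g p r w * (inc (N b k) p r w * inc (N b l) p r w) \<partial>M)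
   \<longlonglongrightarrow> (if k = l then \<integral>w. (LINT s:{0<..\<tau> w}|path_measure (V b) w. g (X s w)) \<partial>M else 0)"
proof -
 have eq: "(\<integral>w. wt g p r w * (inc (N b k) p r w * inc (N b l) p r w) \<partial>M)
   = (if k = l then \<integral>w. wt g p r w * inc (V b) p r w \<partial>M else 0)" for p r
  by (rule same_clock_product[OF g])
 show ?thesis
 proof (cases "k = l")
  case True
  then show ?thesis unfolding eq using clock_sum_LIMSEQ(4)[where b=b, OF g] by (simp del: sum.lessThan_Suc)
 next
  case False
  then show ?thesis unfolding eq by simp
 qed
qed

text \<open>The two clocks live on complementary sets, which makes the two families of martingales orthogonal:
 a continuous function separating the boundary from a compact part of the domain is small in \<open>L\<^sup>2\<close> of
 either one or the other clock.\<close>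

lemma cross_clock_LIMSEQ_aux:
 assumes g: "continuous_on S g" "\<And>x. x \<in> S ==> \<bar>g x\<bar> <= G"
 shows "(\<lambda>p. \<Sum>r<Suc p. \<integral>w. wt g p r w * (inc (N True k) p r w * inc (N False l) p r w) \<partial>M) \<longlonglongrightarrow> 0"
proof -
 let ?dN = "inc (N True k)" and ?dN' = "inc (N False l)"
 define a where "a p = (\<Sum>r<Suc p. \<integral>w. wt g p r w * (?dN p r w * ?dN' p r w) \<partial>M)" for p
 \<comment> \<open>The bulk clock's share of the region where the cut-off is not yet
   \<open>1\<close>. It tends to zero because the bulk clock almost never sees
   \<open>E\<close>.\<close>
 define \<kappa> where "\<kappa> m = (\<integral>w. (LINT s:{0<..\<tau> w}|path_measure (V True) w. (1 - \<psi> m (X s w))\<^sup>2) \<partial>M)" for m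
 have \<psi>2: "continuous_on S (\<lambda>x. (\<psi> m x)\<^sup>2)" "\<And>x. x \<in> S ==> \<bar>(\<psi> m x)\<^sup>2\<bar> <= 1" for m
  using \<psi>_b by (auto intro!: continuous_intros \<psi>_cont power_le_one)
 have \<psi>3: "continuous_on S (\<lambda>x. (1 - \<psi> m x)\<^sup>2)" "\<And>x. x \<in> S ==> \<bar>(1 - \<psi> m x)\<^sup>2\<bar> <= 1" for m
  using \<psi>_b by (auto intro!: continuous_intros \<psi>_cont power_le_one)
 have one: "continuous_on S (\<lambda>_. 1::real)" "\<And>x. x \<in> S ==> \<bar>1::real\<bar> <= 1" by auto
 have G: "0 <= G" if "w \<in> space M" for w using wt_bound[where g=g and p=0 and r=0, OF g(2) that] by linarith
 have G: "0 <= G" using G not_empty by blast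
 have \<kappa>_lim: "\<kappa> \<longlonglongrightarrow> 0"
 proof -
  have "\<kappa> \<longlonglongrightarrow> (\<integral>w. 0 \<partial>M)" unfolding \<kappa>_def[abs_def]
  proof (rule bounded_AE_LIMSEQ(3)[OF borel_measurable_integrable[OF clock_sum_LIMSEQ(2)[OF \<psi>3]] clock_sum_LIMSEQ(3)[OF \<psi>3]])
   show "AE w in M. (\<lambda>m. LINT s:{0<..\<tau> w}|path_measure (V True) w. (1 - \<psi> m (X s w))\<^sup>2) \<longlonglongrightarrow> 0"
    using V_facts AE_space
   proof eventually_elim
    case (elim w)
    have V: "mono_on {0..} (\<lambda>t. V True t w)" "continuous_on {0..} (\<lambda>t. V True t w)"
     and supp: "AE s in path_measure (V True) w. 0 <= s --> X s w \<notin> E" using spec[OF elim(1), of True] by simp_all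
    have fin: "emeasure (path_measure (V True) w) {0<..\<tau> w} < \<infinity>" by (rule pm_window(4)[OF V])
    have "(\<lambda>m. \<integral>s. indicator {0<..\<tau> w} s *\<^sub>R (1 - \<psi> m (X s w))\<^sup>2 \<partial>path_measure (V True) w) \<longlonglongrightarrow> (\<integral>s. 0 \<partial>path_measure (V True) w)"
    proof (rule integral_dominated_convergence[where w="\<lambda>s. indicator {0<..\<tau> w} s *\<^sub>R 1"])
     show "integrable (path_measure (V True) w) (\<lambda>s. indicator {0<..\<tau> w} s *\<^sub>R (1::real))"
      using fin by (intro integrable_scaleR_left integrable_real_indicator) (auto simp: sets_path_measure)
     show "(\<lambda>s. indicator {0<..\<tau> w} s *\<^sub>R (1 - \<psi> m (X s w))\<^sup>2) \<in> borel_measurable (path_measure (V True) w)" for m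
     proof -
      have "(\<lambda>s. indicator {0..T} s *\<^sub>R (1 - \<psi> m (X s w))\<^sup>2) \<in> borel_measurable borel"
       by (rule borel_measurable_continuous_on_indicator[OF _ gX_path[OF \<psi>3(1) elim(2)]]) simp
      then have "(\<lambda>s. indicator {0<..\<tau> w} s *\<^sub>R (indicator {0..T} s *\<^sub>R (1 - \<psi> m (X s w))\<^sup>2)) \<in> borel_measurable borel" by simp
      also have "(\<lambda>s. indicator {0<..\<tau> w} s *\<^sub>R (indicator {0..T} s *\<^sub>R (1 - \<psi> m (X s w))\<^sup>2)) = (\<lambda>s. indicator {0<..\<tau> w} s *\<^sub>R (1 - \<psi> m (X s w))\<^sup>2)"
       using \<tau>(3)[of w] by (auto simp: indicator_def fun_eq_iff)
      finally show ?thesis by (simp add: measurable_cong_sets[OF sets_path_measure refl])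
     qed
     show "AE s in path_measure (V True) w. (\<lambda>m. indicator {0<..\<tau> w} s *\<^sub>R (1 - \<psi> m (X s w))\<^sup>2) \<longlonglongrightarrow> 0"
      using supp
     proof eventually_elim
      case (elim s)
      show ?case
      proof (cases "s \<in> {0<..\<tau> w}")
       case True
       then have "(\<lambda>m. \<psi> m (X s w)) \<longlonglongrightarrow> 1" using elim X_S[OF \<open>w \<in> space M\<close>] by (intro \<psi>_lim) auto
       then have "(\<lambda>m. (1 - \<psi> m (X s w))\<^sup>2) \<longlonglongrightarrow> (1 - 1)\<^sup>2" by (intro tendsto_intros)
       then show ?thesis using True by simp
      qed simp
     qed
     show "AE s in path_measure (V True) w. norm (indicator {0<..\<tau> w} s *\<^sub>R (1 - \<psi> m (X s w))\<^sup>2) <= indicator {0<..\<tau> w} s *\<^sub>R 1" for m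
      using \<psi>3(2)[OF X_S[OF elim(2)], of _ m] by (intro AE_I2) (auto simp: indicator_def)
    qed simp
    then show ?case by (simp add: set_lebesgue_integral_def)
   qed
  qed
  then show ?thesis by simp
 qed
 \<comment> \<open>The cut-off vanishes on \<open>E\<close>, which carries the boundary
   clock.\<close>
 have zero: "(\<integral>w. (LINT s:{0<..\<tau> w}|path_measure (V False) w. (\<psi> m (X s w))\<^sup>2) \<partial>M) = 0" for m
 proof -
  have "AE w in M. (LINT s:{0<..\<tau> w}|path_measure (V False) w. (\<psi> m (X s w))\<^sup>2) = 0"
   using V_facts AE_space
  proof eventually_elim
   case (elim w)
   have supp: "AE s in path_measure (V False) w. 0 <= s --> X s w \<in> E" using spec[OF elim(1), of False] by simp
   show ?case unfolding set_lebesgue_integral_def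
   proof (rule integral_eq_zero_AE)
    show "AE s in path_measure (V False) w. indicator {0<..\<tau> w} s *\<^sub>R (\<psi> m (X s w))\<^sup>2 = 0"
     using supp by eventually_elim (use \<psi>_E X_S[OF elim(2)] in \<open>auto simp: indicator_def\<close>)
   qed
  qed
  then show ?thesis by (rule integral_eq_zero_AE)
 qed
 \<comment> \<open>The product is split by the weights \<open>\<psi>\<close> and
   \<open>1 - \<psi>\<close>. In the inequality of means the weight \<open>\<psi>\<close> goes to
   the boundary increment and \<open>1 - \<psi>\<close> to the bulk increment, so that each clock
   meets the factor that is small for it; the unweighted squares only get the small factor
   \<open>\<eta>\<close>.\<close>
 have step: "\<bar>a p\<bar> <= G * (\<eta> * (\<Sum>r<Suc p. \<integral>w. wt (\<lambda>_. 1) p r w * (?dN p r w * ?dN p r w) \<partial>M)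
    + 1 / (4 * \<eta>) * (\<Sum>r<Suc p. \<integral>w. wt (\<lambda>x. (\<psi> m x)\<^sup>2) p r w * (?dN' p r w * ?dN' p r w) \<partial>M)
    + \<eta> * (\<Sum>r<Suc p. \<integral>w. wt (\<lambda>_. 1) p r w * (?dN' p r w * ?dN' p r w) \<partial>M)
    + 1 / (4 * \<eta>) * (\<Sum>r<Suc p. \<integral>w. wt (\<lambda>x. (1 - \<psi> m x)\<^sup>2) p r w * (?dN p r w * ?dN p r w) \<partial>M))" (is "_ <= ?rhs")
  if \<eta>: "0 < \<eta>" for p m \<eta>
 proof -
  have "\<bar>a p\<bar> <= (\<Sum>r<Suc p. G * (\<eta> * (\<integral>w. wt (\<lambda>_. 1) p r w * (?dN p r w * ?dN p r w) \<partial>M)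
    + 1 / (4 * \<eta>) * (\<integral>w. wt (\<lambda>x. (\<psi> m x)\<^sup>2) p r w * (?dN' p r w * ?dN' p r w) \<partial>M)
    + \<eta> * (\<integral>w. wt (\<lambda>_. 1) p r w * (?dN' p r w * ?dN' p r w) \<partial>M)
    + 1 / (4 * \<eta>) * (\<integral>w. wt (\<lambda>x. (1 - \<psi> m x)\<^sup>2) p r w * (?dN p r w * ?dN p r w) \<partial>M)))"
   unfolding a_def
  proof (rule order_trans[OF sum_abs sum_mono])
   fix r
   note i = weighted_N_product[OF one] weighted_N_product[OF \<psi>2] weighted_N_product[OF \<psi>3] weighted_N_product[OF g]
   have "\<bar>\<integral>w. wt g p r w * (?dN p r w * ?dN' p r w) \<partial>M\<bar> <= (\<integral>w. \<bar>wt g p r w * (?dN p r w * ?dN' p r w)\<bar> \<partial>M)"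
    by (rule integral_abs_bound)
   also have "\<dots> <= (\<integral>w. G * (\<eta> * (wt (\<lambda>_. 1) p r w * (?dN p r w * ?dN p r w))
    + 1 / (4 * \<eta>) * (wt (\<lambda>x. (\<psi> m x)\<^sup>2) p r w * (?dN' p r w * ?dN' p r w))
    + \<eta> * (wt (\<lambda>_. 1) p r w * (?dN' p r w * ?dN' p r w))
    + 1 / (4 * \<eta>) * (wt (\<lambda>x. (1 - \<psi> m x)\<^sup>2) p r w * (?dN p r w * ?dN p r w))) \<partial>M)"
   proof (rule Bochner_Integration.integral_mono)
    show "integrable M (\<lambda>w. \<bar>wt g p r w * (?dN p r w * ?dN' p r w)\<bar>)" by (intro integrable_abs i)
    show "integrable M (\<lambda>w. G * (\<eta> * (wt (\<lambda>_. 1) p r w * (?dN p r w * ?dN p r w))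
    + 1 / (4 * \<eta>) * (wt (\<lambda>x. (\<psi> m x)\<^sup>2) p r w * (?dN' p r w * ?dN' p r w))
    + \<eta> * (wt (\<lambda>_. 1) p r w * (?dN' p r w * ?dN' p r w))
    + 1 / (4 * \<eta>) * (wt (\<lambda>x. (1 - \<psi> m x)\<^sup>2) p r w * (?dN p r w * ?dN p r w))))"
     by (intro Bochner_Integration.integrable_add integrable_mult_right i)
    fix w assume w: "w \<in> space M"
    let ?x = "?dN p r w" and ?y = "?dN' p r w" and ?ww = "\<psi> m (X (pt T p r) w)" and ?l = "live p r w"
    have xS: "X (pt T p r) w \<in> S" by (rule X_S[OF w pt_simps(3)[OF T]])
    have l: "0 <= ?l" by (simp add: live_def)
    have amgm: "u * v <= \<eta> * u\<^sup>2 + 1 / (4 * \<eta>) * v\<^sup>2" for u v :: real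
    proof -
     have "0 <= (2 * \<eta> * u - v)\<^sup>2 / (4 * \<eta>)" using \<eta> by simp
     then show ?thesis using \<eta> by (simp add: power2_eq_square field_simps)
    qed
    have "\<bar>?x * ?y\<bar> = \<bar>?x\<bar> * (?ww * \<bar>?y\<bar>) + \<bar>?y\<bar> * ((1 - ?ww) * \<bar>?x\<bar>)" by (simp add: abs_mult algebra_simps)
    also have "\<dots> <= (\<eta> * \<bar>?x\<bar>\<^sup>2 + 1 / (4 * \<eta>) * (?ww * \<bar>?y\<bar>)\<^sup>2) + (\<eta> * \<bar>?y\<bar>\<^sup>2 + 1 / (4 * \<eta>) * ((1 - ?ww) * \<bar>?x\<bar>)\<^sup>2)"
     by (intro add_mono amgm)
    finally have xy: "\<bar>?x * ?y\<bar> <= (\<eta> * \<bar>?x\<bar>\<^sup>2 + 1 / (4 * \<eta>) * (?ww * \<bar>?y\<bar>)\<^sup>2) + (\<eta> * \<bar>?y\<bar>\<^sup>2 + 1 / (4 * \<eta>) * ((1 - ?ww) * \<bar>?x\<bar>)\<^sup>2)" .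
    have "\<bar>wt g p r w * (?x * ?y)\<bar> = \<bar>g (X (pt T p r) w)\<bar> * (?l * \<bar>?x * ?y\<bar>)"
     using l by (simp add: wt_def abs_mult)
    also have "\<dots> <= G * (?l * ((\<eta> * \<bar>?x\<bar>\<^sup>2 + 1 / (4 * \<eta>) * (?ww * \<bar>?y\<bar>)\<^sup>2) + (\<eta> * \<bar>?y\<bar>\<^sup>2 + 1 / (4 * \<eta>) * ((1 - ?ww) * \<bar>?x\<bar>)\<^sup>2)))"
     using g(2)[OF xS] l xy G by (intro mult_mono mult_left_mono) auto
    also have "\<dots> = G * (\<eta> * (wt (\<lambda>_. 1) p r w * (?x * ?x)) + 1 / (4 * \<eta>) * (wt (\<lambda>x. (\<psi> m x)\<^sup>2) p r w * (?y * ?y))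
     + \<eta> * (wt (\<lambda>_. 1) p r w * (?y * ?y)) + 1 / (4 * \<eta>) * (wt (\<lambda>x. (1 - \<psi> m x)\<^sup>2) p r w * (?x * ?x)))"
     unfolding wt_def by (simp add: power2_eq_square algebra_simps)
    finally show "\<bar>wt g p r w * (?x * ?y)\<bar> <= \<dots>" .
   qed
   also have "\<dots> = G * (\<eta> * (\<integral>w. wt (\<lambda>_. 1) p r w * (?dN p r w * ?dN p r w) \<partial>M)
    + 1 / (4 * \<eta>) * (\<integral>w. wt (\<lambda>x. (\<psi> m x)\<^sup>2) p r w * (?dN' p r w * ?dN' p r w) \<partial>M)
    + \<eta> * (\<integral>w. wt (\<lambda>_. 1) p r w * (?dN' p r w * ?dN' p r w) \<partial>M)
    + 1 / (4 * \<eta>) * (\<integral>w. wt (\<lambda>x. (1 - \<psi> m x)\<^sup>2) p r w * (?dN p r w * ?dN p r w) \<partial>M))"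
    by (simp only: integral_mult_right_zero Bochner_Integration.integral_add integrable_mult_right Bochner_Integration.integrable_add i)
   finally show "\<bar>\<integral>w. wt g p r w * (?dN p r w * ?dN' p r w) \<partial>M\<bar> <= \<dots>" .
  qed
  also have "\<dots> = ?rhs" by (simp only: sum_distrib_left[symmetric] sum.distrib)
  finally show ?thesis .
 qed
 let ?one = "\<lambda>b. \<integral>w. (LINT s:{0<..\<tau> w}|path_measure (V b) w. 1) \<partial>M"
 have lim: "(\<lambda>p. G * (\<eta> * (\<Sum>r<Suc p. \<integral>w. wt (\<lambda>_. 1) p r w * (?dN p r w * ?dN p r w) \<partial>M)
    + 1 / (4 * \<eta>) * (\<Sum>r<Suc p. \<integral>w. wt (\<lambda>x. (\<psi> m x)\<^sup>2) p r w * (?dN' p r w * ?dN' p r w) \<partial>M)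
    + \<eta> * (\<Sum>r<Suc p. \<integral>w. wt (\<lambda>_. 1) p r w * (?dN' p r w * ?dN' p r w) \<partial>M)
    + 1 / (4 * \<eta>) * (\<Sum>r<Suc p. \<integral>w. wt (\<lambda>x. (1 - \<psi> m x)\<^sup>2) p r w * (?dN p r w * ?dN p r w) \<partial>M)))
   \<longlonglongrightarrow> G * (\<eta> * ?one True + 1 / (4 * \<eta>) * 0 + \<eta> * ?one False + 1 / (4 * \<eta>) * \<kappa> m)" for \<eta> m
 proof -
  have 1: "(\<lambda>p. \<Sum>r<Suc p. \<integral>w. wt (\<lambda>_. 1) p r w * (?dN p r w * ?dN p r w) \<partial>M) \<longlonglongrightarrow> ?one True"
   using same_clock_LIMSEQ[where b=True and k=k and l=k, OF one] by (simp only: simp_thms if_True)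
  have 2: "(\<lambda>p. \<Sum>r<Suc p. \<integral>w. wt (\<lambda>_. 1) p r w * (?dN' p r w * ?dN' p r w) \<partial>M) \<longlonglongrightarrow> ?one False"
   using same_clock_LIMSEQ[where b=False and k=l and l=l, OF one] by (simp only: simp_thms if_True)
  have 3: "(\<lambda>p. \<Sum>r<Suc p. \<integral>w. wt (\<lambda>x. (\<psi> m x)\<^sup>2) p r w * (?dN' p r w * ?dN' p r w) \<partial>M) \<longlonglongrightarrow> 0"
   using same_clock_LIMSEQ[where b=False and k=l and l=l, OF \<psi>2(1)[of m] \<psi>2(2)[of _ m]] by (simp only: simp_thms if_True zero)
  have 4: "(\<lambda>p. \<Sum>r<Suc p. \<integral>w. wt (\<lambda>x. (1 - \<psi> m x)\<^sup>2) p r w * (?dN p r w * ?dN p r w) \<partial>M) \<longlonglongrightarrow> \<kappa> m"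
   using same_clock_LIMSEQ[where b=True and k=k and l=k, OF \<psi>3(1)[of m] \<psi>3(2)[of _ m]] by (simp only: simp_thms if_True \<kappa>_def)
  show ?thesis by (intro tendsto_mult tendsto_add tendsto_const 1 2 3 4)
 qed
 have oneb: "?one b <= c" for b
 proof -
  have "?one b <= (\<integral>w. c \<partial>M)"
  proof (rule integral_mono_AE)
   show "integrable M (\<lambda>w. LINT s:{0<..\<tau> w}|path_measure (V b) w. (1::real))"
    by (rule clock_sum_LIMSEQ(2)[where g="\<lambda>_. 1" and G=1]) auto
   have "AE w in M. \<bar>LINT s:{0<..\<tau> w}|path_measure (V b) w. 1\<bar> <= 1 * c"
    by (rule clock_sum_LIMSEQ(3)[where g="\<lambda>_. 1" and G=1]) auto
   then show "AE w in M. (LINT s:{0<..\<tau> w}|path_measure (V b) w. 1) <= c" by eventually_elim linarith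
  qed simp
  then show ?thesis by (simp add: prob_space)
 qed
 show ?thesis unfolding a_def[symmetric]
 proof (rule LIMSEQ_I)
  fix e :: real assume e: "0 < e"
  \<comment> \<open>Order of choices: \<open>\<eta>\<close> against the total mass of both clocks,
    then \<open>m\<close> to make \<open>\<kappa> m / \<eta>\<close> small, and the mesh
    last.\<close>
  define \<eta> where "\<eta> = e / (4 * (G * c + 1))"
  have \<eta>: "0 < \<eta>" using e G c by (simp add: \<eta>_def add_nonneg_pos)
  have 1: "\<eta> * (2 * (G * c)) < e"
  proof -
   define q where "q = G * c"
   have q: "0 <= q" using G c by (simp add: q_def)
   have "\<eta> * (2 * q) < \<eta> * (4 * (q + 1))" by (rule mult_strict_left_mono[OF _ \<eta>]) (use q in simp)
   also have "\<dots> = e" using q by (simp add: \<eta>_def q_def)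
   finally show ?thesis by (simp add: q_def)
  qed
  have "(\<lambda>m. G * (\<eta> * ?one True + 1 / (4 * \<eta>) * 0 + \<eta> * ?one False + 1 / (4 * \<eta>) * \<kappa> m))
    \<longlonglongrightarrow> G * (\<eta> * ?one True + 1 / (4 * \<eta>) * 0 + \<eta> * ?one False + 1 / (4 * \<eta>) * 0)"
   by (intro tendsto_mult tendsto_add tendsto_const \<kappa>_lim)
  moreover have "G * (\<eta> * ?one True + 1 / (4 * \<eta>) * 0 + \<eta> * ?one False + 1 / (4 * \<eta>) * 0) < e"
  proof -
   have "G * (\<eta> * ?one True + 1 / (4 * \<eta>) * 0 + \<eta> * ?one False + 1 / (4 * \<eta>) * 0) <= G * (\<eta> * c + \<eta> * c)"
    using mult_left_mono[OF oneb[of True] less_imp_le[OF \<eta>]] mult_left_mono[OF oneb[of False] less_imp_le[OF \<eta>]]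
    by (intro mult_left_mono[OF _ G]) (simp only: mult_zero_right add_0_right add_mono)
   then show ?thesis using 1 by (simp add: algebra_simps)
  qed
  ultimately have "\<forall>\<^sub>F m in sequentially. G * (\<eta> * ?one True + 1 / (4 * \<eta>) * 0 + \<eta> * ?one False + 1 / (4 * \<eta>) * \<kappa> m) < e"
   by (rule order_tendstoD(2))
  from eventually_happens'[OF sequentially_bot this] obtain m where m: "G * (\<eta> * ?one True + 1 / (4 * \<eta>) * 0 + \<eta> * ?one False + 1 / (4 * \<eta>) * \<kappa> m) < e"
   by (elim exE)
  have "\<forall>\<^sub>F p in sequentially. norm (a p - 0) < e"
   using order_tendstoD(2)[OF lim m]
  proof eventually_elim
   case (elim p)
   show ?case using le_less_trans[OF step[OF \<eta>, of p m] elim] by simp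
  qed
  then show "\<exists>no. \<forall>p\<ge>no. norm (a p - 0) < e" by (simp only: eventually_sequentially)
 qed
qed

lemma cross_clock_LIMSEQ:
 assumes g: "continuous_on S g" "\<And>x. x \<in> S ==> \<bar>g x\<bar> <= G"
 shows "(\<lambda>p. \<Sum>r<Suc p. \<integral>w. wt g p r w * (inc (N b k) p r w * inc (N b' l) p r w) \<partial>M)
   \<longlonglongrightarrow> (if b = b' \<and> k = l then \<integral>w. (LINT s:{0<..\<tau> w}|path_measure (V b) w. g (X s w)) \<partial>M else 0)"
proof (cases "b = b'")
 case True
 then show ?thesis using same_clock_LIMSEQ[OF g, of b k l] by simp
next
 case False
 show ?thesis
 proof (cases b)
  case True
  then show ?thesis using False cross_clock_LIMSEQ_aux[OF g, of k l] by simp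
 next
  case b: False
  then have "(\<lambda>p. \<Sum>r<Suc p. \<integral>w. wt g p r w * (inc (N b' l) p r w * inc (N b k) p r w) \<partial>M) \<longlonglongrightarrow> 0"
   using False cross_clock_LIMSEQ_aux[OF g, of l k] by simp
  then show ?thesis using False by (simp add: mult.commute)
 qed
qed

end

section \<open>The finite variation part and the discrete quadratic variation\<close>

lemma sum_fin_squared_le:
 fixes y :: "'d::finite => real" shows "(\<Sum>i\<in>UNIV. y i)\<^sup>2 <= real CARD('d) * (\<Sum>i\<in>UNIV. (y i)\<^sup>2)"
 using sum_squared_le_sum_of_squares[of y UNIV] by (simp add: mult.commute)

lemma dist_vec_power2: "(dist x y)\<^sup>2 = (\<Sum>i\<in>UNIV. (x $ i - y $ i)\<^sup>2)" for x y :: "real^'d"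
 by (simp add: dist_norm norm_vec_def L2_set_def sum_nonneg)

context stopped_diffusion
begin

text \<open>What remains of a coordinate once its stochastic integrals are removed: the starting
  value plus the drift integrals against the two clocks, hence a process of finite
  variation.\<close>

definition D :: "'b => real => 'a => real" where
 "D i t w = X t w $ i - (\<Sum>b\<in>UNIV. \<Sum>j\<in>UNIV. K b i j t w)"

abbreviation dX :: "'b => nat => nat => 'a => real" where
 "dX i \<equiv> inc (\<lambda>t w. X t w $ i)"

lemma D_ad: "adapted F (D i)"
 using Xi_ad[of i] K_ad unfolding adapted_def D_def by (auto intro!: borel_measurable_diff borel_measurable_sum)

lemma D_cont: "AE_continuous_paths M (D i)"
proof -
 have "AE w in M. continuous_on {0..} (\<lambda>t. X t w $ i)" "AE w in M. \<forall>b j. continuous_on {0..} (\<lambda>t. K b i j t w)"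
  using Xi_cont K_cont by (simp_all add: AE_all_countable AE_continuous_paths_def)
 then show ?thesis unfolding AE_continuous_paths_def
  by eventually_elim (auto simp: D_def intro!: continuous_on_diff continuous_on_sum)
qed

lemma dX_split: "dX i p r w = inc (D i) p r w + (\<Sum>b\<in>UNIV. \<Sum>j\<in>UNIV. inc (K b i j) p r w)"
 by (simp add: inc_def D_def sum_subtractf)

lemma D_diff:
 "AE w in M. \<forall>i s t. 0 <= s --> s <= t --> D i t w - D i s w = (\<Sum>b\<in>UNIV. LINT u:{s<..t}|path_measure (V b) w. \<beta> b i (X u w))
   \<and> \<bar>D i t w - D i s w\<bar> <= C * (\<Sum>b\<in>UNIV. V b t w - V b s w)"
 using V_facts decomposition AE_space
proof eventually_elim
 case (elim w)
 have V: "mono_on {0..} (\<lambda>t. V b t w)" "continuous_on {0..} (\<lambda>t. V b t w)" for b using spec[OF elim(1), of b] by simp_all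
 show ?case
 proof (intro allI impI)
  fix i and s t :: real assume s: "0 <= s" and st: "s <= t"
  then have t: "0 <= t" by simp
  have D: "D i t w = x0 $ i + (\<Sum>b\<in>UNIV. LINT s:{0..t}|path_measure (V b) w. \<beta> b i (X s w))" if "0 <= t" for t
   using elim(2) that by (simp add: D_def)
  have split: "(LINT s:{0..t}|path_measure (V b) w. \<beta> b i (X s w))
    = (LINT s:{0..s}|path_measure (V b) w. \<beta> b i (X s w)) + (LINT s:{s<..t}|path_measure (V b) w. \<beta> b i (X s w))" for b
  proof -
   have fin: "emeasure (path_measure (V b) w) {0..t} < \<infinity>" by (simp add: path_measure_Ioc(3)[where V="V b" and w=w, OF V t])
   have i: "set_integrable (path_measure (V b) w) {0..t} (\<lambda>s. \<beta> b i (X s w))"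
    unfolding set_integrable_def
   proof (rule Bochner_Integration.integrable_bound[of _ "\<lambda>s. indicator {0..t} s *\<^sub>R C"])
    show "integrable (path_measure (V b) w) (\<lambda>s. indicator {0..t} s *\<^sub>R C)"
     using fin by (intro integrable_scaleR_left integrable_real_indicator) (auto simp: sets_path_measure)
    have "(\<lambda>s. indicator {0..t} s * (indicator {0..} s * \<beta> b i (X s w))) \<in> borel_measurable borel"
     using \<beta>_meas[OF elim(3), of b i] by simp
    also have "(\<lambda>s. indicator {0..t} s * (indicator {0..} s * \<beta> b i (X s w))) = (\<lambda>s. indicator {0..t} s *\<^sub>R \<beta> b i (X s w))"
     by (auto simp: indicator_def fun_eq_iff)
    finally show "(\<lambda>s. indicator {0..t} s *\<^sub>R \<beta> b i (X s w)) \<in> borel_measurable (path_measure (V b) w)"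
     by (simp add: measurable_cong_sets[OF sets_path_measure refl])
    show "AE s in path_measure (V b) w. norm (indicator {0..t} s *\<^sub>R \<beta> b i (X s w)) <= norm (indicator {0..t} s *\<^sub>R C)"
     using \<beta>_b[OF X_S[OF elim(3)]] C by (intro AE_I2) (auto simp: indicator_def)
   qed
   have un: "{0..t} = {0..s} \<union> {s<..t}" using s st by auto
   have "set_integrable (path_measure (V b) w) {0..s} (\<lambda>s. \<beta> b i (X s w))"
    "set_integrable (path_measure (V b) w) {s<..t} (\<lambda>s. \<beta> b i (X s w))"
    by (rule set_integrable_subset[OF i]; use s st in \<open>auto simp: sets_path_measure\<close>)+
   then show ?thesis unfolding un by (intro set_integral_Un) auto
  qed
  have bd: "\<bar>LINT u:{s<..t}|path_measure (V b) w. \<beta> b i (X u w)\<bar> <= C * (V b t w - V b s w)" for b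
   unfolding path_measure_Ioc(2)[where V="V b" and w=w, OF V s st, symmetric]
  proof (rule set_integral_abs_le[OF sets_path_measure _ _ C])
   show "emeasure (path_measure (V b) w) {s<..t} < \<infinity>"
    by (subst path_measure_Ioc(1)[where V="V b" and w=w, OF V s st]) simp
   show "AE u in path_measure (V b) w. u \<in> {s<..t} --> \<bar>\<beta> b i (X u w)\<bar> <= C"
    using s by (intro AE_I2 impI \<beta>_b X_S[OF elim(3)]) auto
  qed
  have eq: "D i t w - D i s w = (\<Sum>b\<in>UNIV. LINT u:{s<..t}|path_measure (V b) w. \<beta> b i (X u w))"
   unfolding D[OF s] D[OF t] split sum.distrib by simp
  have "\<bar>\<Sum>b\<in>UNIV. LINT u:{s<..t}|path_measure (V b) w. \<beta> b i (X u w)\<bar> <= (\<Sum>b\<in>UNIV. C * (V b t w - V b s w))"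
   by (rule order_trans[OF sum_abs sum_mono[OF bd]])
  also have "\<dots> = C * (\<Sum>b\<in>UNIV. V b t w - V b s w)" by (simp only: sum_distrib_left)
  finally show "D i t w - D i s w = (\<Sum>b\<in>UNIV. LINT u:{s<..t}|path_measure (V b) w. \<beta> b i (X u w))
   \<and> \<bar>D i t w - D i s w\<bar> <= C * (\<Sum>b\<in>UNIV. V b t w - V b s w)" using eq by simp
 qed
qed

lemma D_inc:
 "AE w in M. \<forall>i p r. inc (D i) p r w
   = (\<Sum>b\<in>UNIV. LINT s:{min (pt T p r) (\<tau> w)<..min (pt T p (Suc r)) (\<tau> w)}|path_measure (V b) w. \<beta> b i (X s w))"
 "AE w in M. \<forall>i p r. \<bar>inc (D i) p r w\<bar> <= C * (\<Sum>b\<in>UNIV. inc (V b) p r w)"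
 unfolding inc_def using D_diff by (eventually_elim, use window(1,2) in blast)+

lemma D_total: "AE w in M. \<forall>i p. (\<Sum>r<Suc p. \<bar>inc (D i) p r w\<bar>) <= C * (2 * c)"
 using D_inc(2) sum_inc_V
proof eventually_elim
 case (elim w)
 show ?case
 proof (intro allI)
  fix i p
  have "(\<Sum>r<Suc p. \<bar>inc (D i) p r w\<bar>) <= (\<Sum>r<Suc p. C * (\<Sum>b\<in>UNIV. inc (V b) p r w))"
   by (rule sum_mono) (use elim(1) in blast)
  also have "\<dots> = C * (\<Sum>b\<in>UNIV. \<Sum>r<Suc p. inc (V b) p r w)"
   unfolding sum_distrib_left[symmetric] by (subst sum.swap) (rule refl)
  also have "\<dots> <= C * (\<Sum>b\<in>(UNIV::bool set). c)"
   by (intro mult_left_mono sum_mono C) (use elim(2) in blast)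
  finally show "(\<Sum>r<Suc p. \<bar>inc (D i) p r w\<bar>) <= C * (2 * c)" by (simp add: mult_ac)
 qed
qed

lemma D_squares_bound: "AE w in M. \<forall>i p. (\<Sum>r<Suc p. (inc (D i) p r w)\<^sup>2) <= (C * (2 * c))\<^sup>2"
 using D_total
proof eventually_elim
 case (elim w)
 show ?case
 proof (intro allI)
  fix i p
  have "(\<Sum>r<Suc p. (inc (D i) p r w)\<^sup>2) <= (\<Sum>r<Suc p. \<bar>inc (D i) p r w\<bar>)\<^sup>2"
   by (rule sum_squares_le_square_sum) auto
  also have "\<dots> <= (C * (2 * c))\<^sup>2" by (rule power_mono) (use elim in \<open>blast intro: sum_nonneg abs_ge_zero\<close>)+
  finally show "(\<Sum>r<Suc p. (inc (D i) p r w)\<^sup>2) <= (C * (2 * c))\<^sup>2" .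
 qed
qed

lemma inc_D_M: "inc (D i) p r \<in> borel_measurable M" by (rule inc_meas[OF D_ad D_cont])
lemma dX_M: "dX i p r \<in> borel_measurable M" by (rule inc_meas[OF Xi_ad Xi_cont])

lemma D_squares_LIMSEQ:
 "integrable M (\<lambda>w. \<Sum>r<Suc p. (inc (D i) p r w)\<^sup>2)"
 "(\<lambda>p. \<integral>w. (\<Sum>r<Suc p. (inc (D i) p r w)\<^sup>2) \<partial>M) \<longlonglongrightarrow> 0"
proof -
 have m: "(\<lambda>w. \<Sum>r<Suc p. (inc (D i) p r w)\<^sup>2) \<in> borel_measurable M" for p
  by (intro borel_measurable_sum borel_measurable_power inc_D_M)
 have b: "AE w in M. \<bar>\<Sum>r<Suc p. (inc (D i) p r w)\<^sup>2\<bar> <= (C * (2 * c))\<^sup>2" for p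
  using D_squares_bound
 proof eventually_elim
  case (elim w)
  have "0 <= (\<Sum>r<Suc p. (inc (D i) p r w)\<^sup>2)" by (rule sum_nonneg) simp
  then show ?case using spec[OF spec[OF elim, of i], of p] by linarith
 qed
 show "integrable M (\<lambda>w. \<Sum>r<Suc p. (inc (D i) p r w)\<^sup>2)" by (rule integrable_AE_bounded[OF m b])
 have "AE w in M. (\<lambda>p. \<Sum>r<Suc p. (inc (D i) p r w)\<^sup>2) \<longlonglongrightarrow> 0"
  using D_cont[of i, unfolded AE_continuous_paths_def] D_diff
 proof eventually_elim
  case (elim w)
  define d where "d t = D i (min t (\<tau> w)) w" for t
  define v where "v t = C * (\<Sum>b\<in>UNIV. V b (min t (\<tau> w)) w)" for t
  have dc: "continuous_on {0..T} d" unfolding d_def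
   by (rule continuous_on_compose2[OF elim(1)]) (use \<tau>(2)[of w] in \<open>auto intro!: continuous_intros\<close>)
  have Dv: "\<bar>d t - d s\<bar> <= v t - v s" if st: "0 <= s" "s <= t" "t <= T" for s t
  proof -
   have "0 <= min s (\<tau> w)" "min s (\<tau> w) <= min t (\<tau> w)" using st \<tau>(2)[of w] by auto
   then have "\<bar>d t - d s\<bar> <= C * (\<Sum>b\<in>UNIV. V b (min t (\<tau> w)) w - V b (min s (\<tau> w)) w)"
    using elim(2) unfolding d_def by blast
   also have "\<dots> = v t - v s" unfolding v_def by (simp only: sum_subtractf right_diff_distrib)
   finally show ?thesis .
  qed
  have "(\<lambda>p. \<Sum>k<Suc p. \<bar>d (pt T p (Suc k)) - d (pt T p k)\<bar> * \<bar>d (pt T p (Suc k)) - d (pt T p k)\<bar>) \<longlonglongrightarrow> 0"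
   by (rule sum_continuous_times_variation[OF dc T Dv])
  also have "(\<lambda>p. \<Sum>k<Suc p. \<bar>d (pt T p (Suc k)) - d (pt T p k)\<bar> * \<bar>d (pt T p (Suc k)) - d (pt T p k)\<bar>)
    = (\<lambda>p. \<Sum>r<Suc p. (inc (D i) p r w)\<^sup>2)"
   unfolding inc_def[abs_def] d_def abs_mult_self_eq power2_eq_square ..
  finally show ?case .
 qed
 then have "(\<lambda>p. \<integral>w. (\<Sum>r<Suc p. (inc (D i) p r w)\<^sup>2) \<partial>M) \<longlonglongrightarrow> (\<integral>w. 0 \<partial>M)"
  by (rule bounded_AE_LIMSEQ(3)[OF m b])
 then show "(\<lambda>p. \<integral>w. (\<Sum>r<Suc p. (inc (D i) p r w)\<^sup>2) \<partial>M) \<longlonglongrightarrow> 0" by simp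
qed

end
lemma amgm_weighted: "0 < \<eta> ==> \<bar>u * v\<bar> <= \<eta> * u\<^sup>2 + 1 / (4 * \<eta>) * v\<^sup>2" for u v \<eta> :: real
proof -
 assume \<eta>: "0 < \<eta>"
 have "0 <= (2 * \<eta> * \<bar>u\<bar> - \<bar>v\<bar>)\<^sup>2 / (4 * \<eta>)" using \<eta> by simp
 also have "\<dots> = \<eta> * \<bar>u\<bar>\<^sup>2 + 1 / (4 * \<eta>) * \<bar>v\<bar>\<^sup>2 - \<bar>u\<bar> * \<bar>v\<bar>" using \<eta> by (simp add: power2_eq_square field_simps)
 finally show ?thesis by (simp add: abs_mult)
qed

text \<open>With \<open>e = u - y\<close> the difference of products is
  \<open>u i * e j + u j * e i - e i * e j\<close>. Weighted means put a small factor on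
  \<open>u\<close> and a large one on \<open>e\<close>; later \<open>u\<close> has bounded square
  sums and the square sums of \<open>e\<close> tend to zero in mean.\<close>

lemma quadratic_form_diff:
 fixes u y :: "'d::finite => real"
 assumes q: "\<And>i j. \<bar>q i j\<bar> <= G" and \<eta>: "0 < \<eta>"
 shows "\<bar>\<Sum>i\<in>UNIV. \<Sum>j\<in>UNIV. q i j * (u i * u j - y i * y j)\<bar>
   <= 2 * real CARD('d) * G * (\<eta> * (\<Sum>i\<in>UNIV. (u i)\<^sup>2) + (1 / (4 * \<eta>) + 1) * (\<Sum>i\<in>UNIV. (u i - y i)\<^sup>2))"
proof -
 define k where "k = 1 / (4 * \<eta>) + 1"
 have G: "0 <= G" using q[of undefined undefined] by linarith
 have "\<bar>\<Sum>i\<in>UNIV. \<Sum>j\<in>UNIV. q i j * (u i * u j - y i * y j)\<bar>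
   <= (\<Sum>i\<in>UNIV. \<Sum>j\<in>UNIV. G * ((\<eta> * (u i)\<^sup>2 + k * (u i - y i)\<^sup>2) + (\<eta> * (u j)\<^sup>2 + k * (u j - y j)\<^sup>2)))"
 proof (rule order_trans[OF sum_abs sum_mono], rule order_trans[OF sum_abs sum_mono])
  fix i j
  let ?e = "u i - y i" and ?e' = "u j - y j"
  have "u i * u j - y i * y j = u j * ?e + u i * ?e' - ?e * ?e'" by (simp add: algebra_simps)
  then have "\<bar>u i * u j - y i * y j\<bar> <= \<bar>u j * ?e\<bar> + \<bar>u i * ?e'\<bar> + \<bar>?e * ?e'\<bar>" by linarith
  moreover have "\<bar>u j * ?e\<bar> <= \<eta> * (u j)\<^sup>2 + 1 / (4 * \<eta>) * ?e\<^sup>2" "\<bar>u i * ?e'\<bar> <= \<eta> * (u i)\<^sup>2 + 1 / (4 * \<eta>) * ?e'\<^sup>2"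
   by (rule amgm_weighted[OF \<eta>])+
  moreover have "\<bar>?e * ?e'\<bar> <= ?e\<^sup>2 + ?e'\<^sup>2"
   using sum_squares_bound[of "\<bar>?e\<bar>" "\<bar>?e'\<bar>"] mult_nonneg_nonneg[OF abs_ge_zero[of ?e] abs_ge_zero[of ?e']]
   unfolding abs_mult power2_abs by linarith
  ultimately have "\<bar>u i * u j - y i * y j\<bar> <= (\<eta> * (u i)\<^sup>2 + k * ?e\<^sup>2) + (\<eta> * (u j)\<^sup>2 + k * ?e'\<^sup>2)"
   unfolding k_def distrib_right by linarith
  then show "\<bar>q i j * (u i * u j - y i * y j)\<bar> <= G * ((\<eta> * (u i)\<^sup>2 + k * ?e\<^sup>2) + (\<eta> * (u j)\<^sup>2 + k * ?e'\<^sup>2))"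
   unfolding abs_mult using q G by (intro mult_mono) auto
 qed
 also have "\<dots> = 2 * real CARD('d) * G * (\<eta> * (\<Sum>i\<in>UNIV. (u i)\<^sup>2) + k * (\<Sum>i\<in>UNIV. (u i - y i)\<^sup>2))"
  by (simp add: sum.distrib sum_distrib_left[symmetric] algebra_simps)
 finally show ?thesis unfolding k_def .
qed

context stopped_diffusion
begin

text \<open>The discrete quadratic variation of the stopped path, summed over coordinates.\<close>

definition D2 :: "nat => 'a => real" where "D2 p w = (\<Sum>r<Suc p. \<Sum>i\<in>UNIV. (dX i p r w)\<^sup>2)"

lemma D2_nonneg: "0 <= D2 p w" unfolding D2_def by (intro sum_nonneg) simp

lemma D2_M: "D2 p \<in> borel_measurable M"
 unfolding D2_def[abs_def] by (intro borel_measurable_sum borel_measurable_power dX_M)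

text \<open>A first moment would suffice for the term \<open>\<epsilon> * D2\<close> of the Taylor
  error, but the event of a long step has small probability only, and its product with
  \<open>D2\<close> calls for a second moment uniform in the mesh. Fourth powers of the bounded
  martingales \<open>K\<close> supply it through
  \<open>discrete_quadratic_variation\<close>.\<close>

lemma D2_second_moment: "\<exists>B\<ge>0. \<forall>p. integrable M (\<lambda>w. (D2 p w)\<^sup>2) \<and> (\<integral>w. (D2 p w)\<^sup>2 \<partial>M) <= B"
proof -
 let ?d = "real CARD('b)"
 define Q where "Q i b j p w = (\<Sum>r<Suc p. (inc (K b i j) p r w)\<^sup>2)" for i j b p w
 define a where "a = (C * (2 * c))\<^sup>2"
 have Qe: "Q i b j p = (\<lambda>w. \<Sum>r<Suc p. (sp \<tau> (K b i j) (pt T p (Suc r)) w - sp \<tau> (K b i j) (pt T p r) w)\<^sup>2)" for i b j p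
  by (simp add: Q_def[abs_def] inc_sp)
 have cK: "AE w in M. \<bar>sp \<tau> (K b i j) t w\<bar> <= c" if "0 <= t" for b i j t
  using spK[of b i j] by eventually_elim (use that in blast)
 have u: "0 <= pt T p 0" "pt T p k <= pt T p (Suc k)" for p k using pt_simps(3,4)[OF T] by auto
 have Qi: "integrable M (\<lambda>w. (Q i b j p w)\<^sup>2)" "(\<integral>w. (Q i b j p w)\<^sup>2 \<partial>M) <= 34 * c ^ 4" for i b j p
  unfolding Qe using discrete_quadratic_variation(4,5)[where u="pt T p" and n="Suc p", OF mgK cK c u, of b i j] by blast+
 define R where "R p w = 8 * ?d\<^sup>2 * a\<^sup>2 + 64 * ?d ^ 4 * (\<Sum>i\<in>UNIV. \<Sum>b\<in>UNIV. \<Sum>j\<in>UNIV. (Q i b j p w)\<^sup>2)" for p w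
 have iR: "integrable M (R p)" for p unfolding R_def[abs_def] using Qi(1) by simp
 have bound: "AE w in M. (D2 p w)\<^sup>2 <= R p w" for p
  using D_squares_bound
 proof eventually_elim
  case (elim w)
  let ?S = "\<lambda>i. \<Sum>b\<in>UNIV. \<Sum>j\<in>UNIV. Q i b j p w" and ?S2 = "\<lambda>i. \<Sum>b\<in>UNIV. \<Sum>j\<in>UNIV. (Q i b j p w)\<^sup>2"
  have 1: "(\<Sum>r<Suc p. (dX i p r w)\<^sup>2) <= 2 * a + 4 * ?d * ?S i" for i
  proof -
   have "(\<Sum>r<Suc p. (dX i p r w)\<^sup>2) <= (\<Sum>r<Suc p. 2 * (inc (D i) p r w)\<^sup>2 + 4 * ?d * (\<Sum>b\<in>UNIV. \<Sum>j\<in>UNIV. (inc (K b i j) p r w)\<^sup>2))"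
   proof (rule sum_mono)
    fix r
    let ?x = "inc (D i) p r w" and ?y = "\<Sum>b\<in>UNIV. \<Sum>j\<in>UNIV. inc (K b i j) p r w"
    have "(?x + ?y)\<^sup>2 <= 2 * ?x\<^sup>2 + 2 * ?y\<^sup>2" using zero_le_power2[of "?x - ?y"] by (simp add: power2_eq_square algebra_simps)
    moreover have "?y\<^sup>2 <= 2 * ?d * (\<Sum>b\<in>UNIV. \<Sum>j\<in>UNIV. (inc (K b i j) p r w)\<^sup>2)" by (rule sum_bool_fin_squared_le)
    ultimately show "(dX i p r w)\<^sup>2 <= 2 * ?x\<^sup>2 + 4 * ?d * (\<Sum>b\<in>UNIV. \<Sum>j\<in>UNIV. (inc (K b i j) p r w)\<^sup>2)"
     unfolding dX_split by linarith
   qed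
   also have "\<dots> = 2 * (\<Sum>r<Suc p. (inc (D i) p r w)\<^sup>2) + 4 * ?d * ?S i"
    unfolding Q_def sum.distrib sum_distrib_left[symmetric]
    by (simp only: sum.swap[of _ "{..<Suc p}"])
   also have "\<dots> <= 2 * a + 4 * ?d * ?S i" using elim unfolding a_def by (intro add_right_mono mult_left_mono) auto
   finally show ?thesis .
  qed
  have "(D2 p w)\<^sup>2 <= (\<Sum>i\<in>UNIV. 2 * a + 4 * ?d * ?S i)\<^sup>2"
  proof (rule power_mono[OF _ D2_nonneg])
   have "D2 p w = (\<Sum>i\<in>UNIV. \<Sum>r<Suc p. (dX i p r w)\<^sup>2)" unfolding D2_def by (rule sum.swap)
   also have "\<dots> <= (\<Sum>i\<in>UNIV. 2 * a + 4 * ?d * ?S i)" by (rule sum_mono[OF 1])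
   finally show "D2 p w <= \<dots>" .
  qed
  also have "\<dots> <= ?d * (\<Sum>i\<in>UNIV. (2 * a + 4 * ?d * ?S i)\<^sup>2)" by (rule sum_fin_squared_le)
  also have "\<dots> <= ?d * (\<Sum>i\<in>UNIV. 8 * a\<^sup>2 + 64 * ?d ^ 3 * ?S2 i)"
  proof (intro mult_left_mono sum_mono)
   fix i
   have "(2 * a + 4 * ?d * ?S i)\<^sup>2 <= 2 * (2 * a)\<^sup>2 + 2 * (4 * ?d * ?S i)\<^sup>2"
    using zero_le_power2[of "2 * a - 4 * ?d * ?S i"] by (simp add: power2_eq_square algebra_simps)
   also have "\<dots> = 8 * a\<^sup>2 + 32 * ?d\<^sup>2 * (?S i)\<^sup>2" by (simp add: power_mult_distrib)
   also have "\<dots> <= 8 * a\<^sup>2 + 32 * ?d\<^sup>2 * (2 * ?d * ?S2 i)"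
    by (intro add_left_mono mult_left_mono sum_bool_fin_squared_le) simp
   also have "\<dots> = 8 * a\<^sup>2 + 64 * ?d ^ 3 * ?S2 i" by (simp add: power2_eq_square power3_eq_cube)
   finally show "(2 * a + 4 * ?d * ?S i)\<^sup>2 <= 8 * a\<^sup>2 + 64 * ?d ^ 3 * ?S2 i" .
  qed simp
  also have "\<dots> = R p w"
   unfolding R_def sum.distrib sum_distrib_left[symmetric] by (simp add: power2_eq_square power3_eq_cube power4_eq_xxxx algebra_simps)
  finally show ?case .
 qed
 define B where "B = 8 * ?d\<^sup>2 * a\<^sup>2 + 64 * ?d ^ 4 * (\<Sum>i\<in>(UNIV::'b set). \<Sum>b\<in>(UNIV::bool set). \<Sum>j\<in>(UNIV::'b set). 34 * c ^ 4)"
 have i: "integrable M (\<lambda>w. (D2 p w)\<^sup>2)" for p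
 proof (rule Bochner_Integration.integrable_bound[OF iR[of p]])
  show "(\<lambda>w. (D2 p w)\<^sup>2) \<in> borel_measurable M" using D2_M by simp
  show "AE w in M. norm ((D2 p w)\<^sup>2) <= norm (R p w)" using bound[of p]
  proof eventually_elim
   case (elim w)
   then show ?case using abs_ge_self[of "R p w"] by (simp only: real_norm_def abs_power2)
  qed
 qed
 have "(\<integral>w. (D2 p w)\<^sup>2 \<partial>M) <= B" for p
 proof -
  have "(\<integral>w. (D2 p w)\<^sup>2 \<partial>M) <= (\<integral>w. R p w \<partial>M)" by (rule integral_mono_AE[OF i iR bound])
  also have "\<dots> = 8 * ?d\<^sup>2 * a\<^sup>2 + 64 * ?d ^ 4 * (\<Sum>i\<in>UNIV. \<Sum>b\<in>UNIV. \<Sum>j\<in>UNIV. \<integral>w. (Q i b j p w)\<^sup>2 \<partial>M)"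
   unfolding R_def using Qi(1) by (simp add: prob_space)
  also have "\<dots> <= B" unfolding B_def by (intro add_left_mono mult_left_mono sum_mono Qi(2)) simp
  finally show ?thesis .
 qed
 moreover have "0 <= B" unfolding B_def using c by (intro add_nonneg_nonneg mult_nonneg_nonneg sum_nonneg) auto
 ultimately show ?thesis using i by blast
qed

text \<open>The leading part of a coordinate increment: drift dropped and coefficients frozen at the
  left end point.\<close>

definition Y :: "'b => nat => nat => 'a => real" where
 "Y i p r w = (\<Sum>b\<in>UNIV. \<Sum>j\<in>UNIV. wt (h b i j) p r w * inc (N b j) p r w)"

text \<open>An upper bound for the squared distance between the increments of \<open>X\<close> and
  their leading parts. The factors \<open>2\<close> and \<open>4 * CARD\<close> come from squaring a
  sum of a drift term and \<open>2 * CARD\<close> martingale terms.\<close>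

definition Er :: "nat => 'a => real" where
 "Er p w = (\<Sum>i\<in>UNIV. 2 * (\<Sum>r<Suc p. (inc (D i) p r w)\<^sup>2)
   + 4 * real CARD('b) * (\<Sum>b\<in>UNIV. \<Sum>j\<in>UNIV. \<Sum>r<Suc p. (err b i j p r w)\<^sup>2))"

lemma residual: "(\<Sum>r<Suc p. \<Sum>i\<in>UNIV. (dX i p r w - Y i p r w)\<^sup>2) <= Er p w"
proof -
 let ?d = "real CARD('b)"
 have "(\<Sum>r<Suc p. (dX i p r w - Y i p r w)\<^sup>2) <= 2 * (\<Sum>r<Suc p. (inc (D i) p r w)\<^sup>2)
   + 4 * ?d * (\<Sum>b\<in>UNIV. \<Sum>j\<in>UNIV. \<Sum>r<Suc p. (err b i j p r w)\<^sup>2)" for i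
 proof -
  have "(\<Sum>r<Suc p. (dX i p r w - Y i p r w)\<^sup>2) <= (\<Sum>r<Suc p. 2 * (inc (D i) p r w)\<^sup>2 + 4 * ?d * (\<Sum>b\<in>UNIV. \<Sum>j\<in>UNIV. (err b i j p r w)\<^sup>2))"
  proof (rule sum_mono)
   fix r
   let ?x = "inc (D i) p r w" and ?y = "\<Sum>b\<in>UNIV. \<Sum>j\<in>UNIV. err b i j p r w"
   have eq: "dX i p r w - Y i p r w = ?x + ?y" unfolding dX_split Y_def err_def by (simp add: sum_subtractf)
   have "(?x + ?y)\<^sup>2 <= 2 * ?x\<^sup>2 + 2 * ?y\<^sup>2" using zero_le_power2[of "?x - ?y"] by (simp add: power2_eq_square algebra_simps)
   moreover have "?y\<^sup>2 <= 2 * ?d * (\<Sum>b\<in>UNIV. \<Sum>j\<in>UNIV. (err b i j p r w)\<^sup>2)" by (rule sum_bool_fin_squared_le)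
   ultimately show "(dX i p r w - Y i p r w)\<^sup>2 <= 2 * ?x\<^sup>2 + 4 * ?d * (\<Sum>b\<in>UNIV. \<Sum>j\<in>UNIV. (err b i j p r w)\<^sup>2)"
    unfolding eq by linarith
  qed
  also have "\<dots> = 2 * (\<Sum>r<Suc p. (inc (D i) p r w)\<^sup>2) + 4 * ?d * (\<Sum>b\<in>UNIV. \<Sum>j\<in>UNIV. \<Sum>r<Suc p. (err b i j p r w)\<^sup>2)"
   unfolding sum.distrib sum_distrib_left[symmetric] by (simp only: sum.swap[of _ "{..<Suc p}"])
  finally show ?thesis .
 qed
 then show ?thesis unfolding Er_def by (subst sum.swap) (rule sum_mono)
qed

lemma Er_LIMSEQ: "integrable M (Er p)" "(\<lambda>p. \<integral>w. Er p w \<partial>M) \<longlonglongrightarrow> 0"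
proof -
 let ?d = "real CARD('b)"
 have ie: "integrable M (\<lambda>w. \<Sum>r<Suc p. (err b i j p r w)\<^sup>2)" for b i j p
  by (intro Bochner_Integration.integrable_sum freeze_error(2)) auto
 have i1: "integrable M (\<lambda>w. 2 * (\<Sum>r<Suc p. (inc (D i) p r w)\<^sup>2))" for i p by (intro integrable_mult_right D_squares_LIMSEQ(1))
 have i2: "integrable M (\<lambda>w. 4 * ?d * (\<Sum>b\<in>UNIV. \<Sum>j\<in>UNIV. \<Sum>r<Suc p. (err b i j p r w)\<^sup>2))" for i p
  by (intro integrable_mult_right Bochner_Integration.integrable_sum ie)
 show "integrable M (Er p)" for p unfolding Er_def[abs_def]
  by (intro Bochner_Integration.integrable_sum Bochner_Integration.integrable_add i1 i2)
 have eq: "(\<integral>w. Er p w \<partial>M) = (\<Sum>i\<in>UNIV. 2 * (\<integral>w. (\<Sum>r<Suc p. (inc (D i) p r w)\<^sup>2) \<partial>M)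
   + 4 * ?d * (\<Sum>b\<in>UNIV. \<Sum>j\<in>UNIV. \<Sum>r<Suc p. \<integral>w. (err b i j p r w)\<^sup>2 \<partial>M))" for p
 proof -
  have a: "(\<integral>w. Er p w \<partial>M) = (\<Sum>i\<in>UNIV. (\<integral>w. 2 * (\<Sum>r<Suc p. (inc (D i) p r w)\<^sup>2) \<partial>M)
    + (\<integral>w. 4 * ?d * (\<Sum>b\<in>UNIV. \<Sum>j\<in>UNIV. \<Sum>r<Suc p. (err b i j p r w)\<^sup>2) \<partial>M))"
   unfolding Er_def
   by (rule trans[OF Bochner_Integration.integral_sum sum.cong[OF refl]])
    (rule Bochner_Integration.integrable_add[OF i1 i2] Bochner_Integration.integral_add[OF i1 i2])+
  have b: "(\<integral>w. (\<Sum>b\<in>UNIV. \<Sum>j\<in>UNIV. \<Sum>r<Suc p. (err b i j p r w)\<^sup>2) \<partial>M) = (\<Sum>b\<in>UNIV. \<Sum>j\<in>UNIV. \<Sum>r<Suc p. \<integral>w. (err b i j p r w)\<^sup>2 \<partial>M)" for i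
  proof -
   have "(\<integral>w. (\<Sum>b\<in>UNIV. \<Sum>j\<in>UNIV. \<Sum>r<Suc p. (err b i j p r w)\<^sup>2) \<partial>M) = (\<Sum>b\<in>UNIV. \<Sum>j\<in>UNIV. \<integral>w. (\<Sum>r<Suc p. (err b i j p r w)\<^sup>2) \<partial>M)"
    by (rule trans[OF Bochner_Integration.integral_sum sum.cong[OF refl]], intro Bochner_Integration.integrable_sum ie,
      rule Bochner_Integration.integral_sum, rule ie)
   also have "\<dots> = (\<Sum>b\<in>UNIV. \<Sum>j\<in>UNIV. \<Sum>r<Suc p. \<integral>w. (err b i j p r w)\<^sup>2 \<partial>M)"
    by (intro sum.cong refl Bochner_Integration.integral_sum freeze_error(2)) auto
   finally show ?thesis .
  qed
  show ?thesis unfolding a integral_mult_right_zero b ..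
 qed
 have "(\<lambda>p. \<integral>w. Er p w \<partial>M) \<longlonglongrightarrow> (\<Sum>i\<in>(UNIV::'b set). 2 * 0 + 4 * ?d * (\<Sum>b\<in>(UNIV::bool set). \<Sum>j\<in>(UNIV::'b set). 0))"
  unfolding eq by (intro tendsto_sum tendsto_add tendsto_mult tendsto_const D_squares_LIMSEQ(2) freeze_error(3))
 then show "(\<lambda>p. \<integral>w. Er p w \<partial>M) \<longlonglongrightarrow> 0" by simp
qed

definition bad :: "real => nat => 'a => real" where
 "bad \<delta> p w = (if \<exists>r<Suc p. \<delta>\<^sup>2 <= (\<Sum>i\<in>UNIV. (dX i p r w)\<^sup>2) then 1 else 0)"

lemma dist_dX: "(dist (X (min (pt T p (Suc r)) (\<tau> w)) w) (X (min (pt T p r) (\<tau> w)) w))\<^sup>2 = (\<Sum>i\<in>UNIV. (dX i p r w)\<^sup>2)"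
 unfolding dist_vec_power2 inc_def ..

lemma bad_LIMSEQ:
 assumes \<delta>: "0 < \<delta>"
 shows "integrable M (bad \<delta> p)" "(\<lambda>p. \<integral>w. bad \<delta> p w \<partial>M) \<longlonglongrightarrow> 0"
proof -
 have m: "bad \<delta> p \<in> borel_measurable M" for p
 proof -
  have "(\<lambda>w. \<Sum>i\<in>UNIV. (dX i p r w)\<^sup>2) \<in> borel_measurable M" for r by (intro borel_measurable_sum borel_measurable_power dX_M)
  then have "{w \<in> space M. \<exists>r\<in>{..<Suc p}. \<delta>\<^sup>2 <= (\<Sum>i\<in>UNIV. (dX i p r w)\<^sup>2)} \<in> sets M"
   by (intro sets.sets_Collect_finite_Ex borel_measurable_le) auto
  then have A: "{w \<in> space M. \<exists>r<Suc p. \<delta>\<^sup>2 <= (\<Sum>i\<in>UNIV. (dX i p r w)\<^sup>2)} \<in> sets M" by (simp only: Bex_def lessThan_iff)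
  show ?thesis unfolding bad_def[abs_def] by (rule measurable_If[OF _ _ A]) (rule borel_measurable_const)+
 qed
 have b: "AE w in M. \<bar>bad \<delta> p w\<bar> <= 1" for p by (simp add: bad_def)
 show "integrable M (bad \<delta> p)" by (rule integrable_AE_bounded[OF m b])
 have "AE w in M. (\<lambda>p. bad \<delta> p w) \<longlonglongrightarrow> 0"
  using AE_space
 proof eventually_elim
  case (elim w)
  have cX: "continuous_on {0..T} (\<lambda>t. X t w)" by (rule continuous_on_subset[OF X_path[OF elim]]) auto
  have "\<forall>\<^sub>F p in sequentially. bad \<delta> p w = 0"
   using mesh_uniform[OF cX T \<delta>]
  proof eventually_elim
   case (elim p)
   have "(\<Sum>i\<in>UNIV. (dX i p r w)\<^sup>2) < \<delta>\<^sup>2" for r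
   proof -
    let ?a = "min (pt T p r) (\<tau> w)" and ?b = "min (pt T p (Suc r)) (\<tau> w)"
    have "\<bar>?b - ?a\<bar> <= pt T p (Suc r) - pt T p r" using pt_simps(4)[OF T, of p r] by (auto simp: min_def)
    then have "\<bar>?b - ?a\<bar> <= T / real (Suc p)" by (simp only: pt_simps(5)[OF T])
    moreover have "?b \<in> {0..T}" "?a \<in> {0..T}" using window(1,3) by simp_all
    ultimately have "dist (X ?b w) (X ?a w) < \<delta>" using elim by blast
    then show ?thesis unfolding dist_dX[symmetric] by (intro power_strict_mono) auto
   qed
   then show ?case by (simp add: bad_def not_le)
  qed
  then show ?case by (rule tendsto_eventually)
 qed
 then have "(\<lambda>p. \<integral>w. bad \<delta> p w \<partial>M) \<longlonglongrightarrow> (\<integral>w. 0 \<partial>M)" by (rule bounded_AE_LIMSEQ(3)[OF m b])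
 then show "(\<lambda>p. \<integral>w. bad \<delta> p w \<partial>M) \<longlonglongrightarrow> 0" by simp
qed

end

section \<open>Dynkin's formula up to an exit time\<close>

context stopped_diffusion
begin

lemma first_order_sum:
 assumes p: "\<And>i. continuous_on S (p i)" "\<And>i x. x \<in> S ==> \<bar>p i x\<bar> <= G"
 defines "I w \<equiv> \<Sum>i\<in>UNIV. \<Sum>b\<in>UNIV. LINT s:{0<..\<tau> w}|path_measure (V b) w. p i (X s w) * \<beta> b i (X s w)"
 shows "integrable M (\<lambda>w. \<Sum>r<Suc m. \<Sum>i\<in>UNIV. wt (p i) m r w * inc (D i) m r w)" "integrable M I"
  "(\<lambda>m. \<integral>w. (\<Sum>r<Suc m. \<Sum>i\<in>UNIV. wt (p i) m r w * inc (D i) m r w) \<partial>M) \<longlonglongrightarrow> (\<integral>w. I w \<partial>M)"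
proof -
 let ?A = "\<lambda>m w. \<Sum>r<Suc m. \<Sum>i\<in>UNIV. wt (p i) m r w * inc (D i) m r w"
 have G: "0 <= G" if "w \<in> space M" for w using wt_bound[where g="p undefined" and p=0 and r=0, OF p(2) that] by linarith
 have G: "0 <= G" using G not_empty by blast
 have m: "?A m \<in> borel_measurable M" for m
  by (intro borel_measurable_sum borel_measurable_times wt_M p(1) inc_D_M)
 have bd: "AE w in M. \<bar>?A m w\<bar> <= real CARD('b) * (G * (C * (2 * c)))" for m
  using D_total AE_space
 proof eventually_elim
  case (elim w)
  have sw: "?A m w = (\<Sum>i\<in>UNIV. \<Sum>r<Suc m. wt (p i) m r w * inc (D i) m r w)" by (rule sum.swap)
  have "\<bar>?A m w\<bar> <= (\<Sum>i\<in>(UNIV::'b set). G * (C * (2 * c)))" unfolding sw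
  proof (rule order_trans[OF sum_abs sum_mono])
   fix i
   have "\<bar>\<Sum>r<Suc m. wt (p i) m r w * inc (D i) m r w\<bar> <= (\<Sum>r<Suc m. G * \<bar>inc (D i) m r w\<bar>)"
    by (rule order_trans[OF sum_abs sum_mono]) (auto simp: abs_mult intro!: mult_right_mono wt_bound[OF p(2) elim(2)])
   also have "\<dots> = G * (\<Sum>r<Suc m. \<bar>inc (D i) m r w\<bar>)" by (simp only: sum_distrib_left)
   also have "\<dots> <= G * (C * (2 * c))" by (rule mult_left_mono[OF _ G]) (use elim(1) in blast)
   finally show "\<bar>\<Sum>r<Suc m. wt (p i) m r w * inc (D i) m r w\<bar> <= G * (C * (2 * c))" .
  qed
  then show ?case by (simp only: sum_constant)
 qed
 have lim: "AE w in M. (\<lambda>m. ?A m w) \<longlonglongrightarrow> I w"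
 proof -
  let ?L = "\<lambda>b i m r w. LINT s:{min (pt T m r) (\<tau> w)<..min (pt T m (Suc r)) (\<tau> w)}|path_measure (V b) w. \<beta> b i (X s w)"
  have "AE w in M. (\<lambda>m. \<Sum>r<Suc m. wt (p i) m r w * ?L b i m r w)
    \<longlonglongrightarrow> (LINT s:{0<..\<tau> w}|path_measure (V b) w. p i (X s w) * \<beta> b i (X s w))" for i b
   by (rule riemann_path[OF p(1) \<beta>_meas \<beta>_b])
  then have "AE w in M. \<forall>i b. (\<lambda>m. \<Sum>r<Suc m. wt (p i) m r w * ?L b i m r w)
    \<longlonglongrightarrow> (LINT s:{0<..\<tau> w}|path_measure (V b) w. p i (X s w) * \<beta> b i (X s w))" by (simp only: AE_all_countable simp_thms)
  then show ?thesis using D_inc(1)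
  proof eventually_elim
   case (elim w)
   have eq: "?A m w = (\<Sum>i\<in>UNIV. \<Sum>b\<in>UNIV. \<Sum>r<Suc m. wt (p i) m r w * ?L b i m r w)" for m
   proof -
    have "inc (D i) m r w = (\<Sum>b\<in>UNIV. ?L b i m r w)" for i r using elim(2) by blast
    then have "?A m w = (\<Sum>r<Suc m. \<Sum>i\<in>UNIV. \<Sum>b\<in>UNIV. wt (p i) m r w * ?L b i m r w)" by (simp only: sum_distrib_left)
    then show ?thesis by (simp only: sum.swap[of _ "{..<Suc m}"])
   qed
   show ?case unfolding eq I_def by (intro tendsto_sum) (use elim(1) in blast)
  qed
 qed
 show "integrable M (?A m)" by (rule integrable_AE_bounded[OF m bd])
 show "integrable M I" by (rule bounded_AE_LIMSEQ(1)[OF m bd lim])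
 show "(\<lambda>m. \<integral>w. ?A m w \<partial>M) \<longlonglongrightarrow> (\<integral>w. I w \<partial>M)" by (rule bounded_AE_LIMSEQ(3)[OF m bd lim])
qed

lemma martingale_sum:
 assumes p: "\<And>i. continuous_on S (p i)" "\<And>i x. x \<in> S ==> \<bar>p i x\<bar> <= G"
 shows "integrable M (\<lambda>w. \<Sum>r<Suc m. \<Sum>i\<in>UNIV. wt (p i) m r w * (\<Sum>b\<in>UNIV. \<Sum>j\<in>UNIV. inc (K b i j) m r w))"
  "(\<integral>w. (\<Sum>r<Suc m. \<Sum>i\<in>UNIV. wt (p i) m r w * (\<Sum>b\<in>UNIV. \<Sum>j\<in>UNIV. inc (K b i j) m r w)) \<partial>M) = 0"
proof -
 have wb: "AE w in M. \<bar>wt (p i) m r w\<bar> <= G" for i m r by (intro AE_I2 wt_bound p(2))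
 have i: "integrable M (\<lambda>w. wt (p i) m r w * inc (K b i j) m r w)" for i r b j
  by (rule integrable_bounded_mult[OF integrable_AE_bounded[OF inc_K_facts] wt_M[OF p(1)] wb])
 have z: "(\<integral>w. wt (p i) m r w * inc (K b i j) m r w \<partial>M) = 0" for i r b j
  using mgK[of b i j] wt_meas[OF p(1)] wb pt_simps(3,4)[OF T, of m r] unfolding mg_def inc_sp by blast
 have eq: "wt (p i) m r w * (\<Sum>b\<in>UNIV. \<Sum>j\<in>UNIV. inc (K b i j) m r w) = (\<Sum>b\<in>UNIV. \<Sum>j\<in>UNIV. wt (p i) m r w * inc (K b i j) m r w)" for i r w
  by (simp only: sum_distrib_left)
 show "integrable M (\<lambda>w. \<Sum>r<Suc m. \<Sum>i\<in>UNIV. wt (p i) m r w * (\<Sum>b\<in>UNIV. \<Sum>j\<in>UNIV. inc (K b i j) m r w))"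
  unfolding eq by (intro Bochner_Integration.integrable_sum i)
 have "(\<integral>w. (\<Sum>r<Suc m. \<Sum>i\<in>UNIV. \<Sum>b\<in>UNIV. \<Sum>j\<in>UNIV. wt (p i) m r w * inc (K b i j) m r w) \<partial>M)
   = (\<Sum>r<Suc m. \<Sum>i\<in>UNIV. \<Sum>b\<in>UNIV. \<Sum>j\<in>UNIV. \<integral>w. wt (p i) m r w * inc (K b i j) m r w \<partial>M)"
  by (simp only: Bochner_Integration.integral_sum Bochner_Integration.integrable_sum i)
 then show "(\<integral>w. (\<Sum>r<Suc m. \<Sum>i\<in>UNIV. wt (p i) m r w * (\<Sum>b\<in>UNIV. \<Sum>j\<in>UNIV. inc (K b i j) m r w)) \<partial>M) = 0"
  unfolding eq by (simp only: z sum.neutral_const)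
qed

text \<open>Expanding both factors \<open>Y\<close> gives products of increments over all pairs of
  driving martingales. In the limit only equal clocks and equal indices survive, which leaves the
  product of the coefficient matrix with its transpose for each clock.\<close>

lemma second_order_sum:
 assumes q: "\<And>i j. continuous_on S (q i j)" "\<And>i j x. x \<in> S ==> \<bar>q i j x\<bar> <= G"
 defines "I w \<equiv> \<Sum>i\<in>UNIV. \<Sum>j\<in>UNIV. \<Sum>b\<in>UNIV. \<Sum>k\<in>UNIV. LINT s:{0<..\<tau> w}|path_measure (V b) w. q i j (X s w) * (h b i k (X s w) * h b j k (X s w))"
 shows "integrable M (\<lambda>w. \<Sum>r<Suc m. \<Sum>i\<in>UNIV. \<Sum>j\<in>UNIV. wt (q i j) m r w * (Y i m r w * Y j m r w))" "integrable M I"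
  "(\<lambda>m. \<integral>w. (\<Sum>r<Suc m. \<Sum>i\<in>UNIV. \<Sum>j\<in>UNIV. wt (q i j) m r w * (Y i m r w * Y j m r w)) \<partial>M) \<longlonglongrightarrow> (\<integral>w. I w \<partial>M)"
proof -
 define g where "g i j b k b' l x = q i j x * (h b i k x * h b' j l x)" for i j b k b' l x
 have gc: "continuous_on S (g i j b k b' l)" for i j b k b' l
  unfolding g_def[abs_def] by (intro continuous_on_mult q(1) h_cont)
 have gb: "\<bar>g i j b k b' l x\<bar> <= G * (C * C)" if "x \<in> S" for i j b k b' l x
 proof -
  have "0 <= G" using q(2)[OF that, of i j] by linarith
  then show ?thesis unfolding g_def abs_mult using q(2)[OF that] h_b[OF that] C by (intro mult_mono) auto
 qed
 let ?P = "\<lambda>i j b k b' l m r w. wt (g i j b k b' l) m r w * (inc (N b k) m r w * inc (N b' l) m r w)"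
 have i: "integrable M (?P i j b k b' l m r)" for i j b k b' l m r by (rule weighted_N_product[OF gc gb])
 have eq: "wt (q i j) m r w * (Y i m r w * Y j m r w) = (\<Sum>b\<in>UNIV. \<Sum>k\<in>UNIV. \<Sum>b'\<in>UNIV. \<Sum>l\<in>UNIV. ?P i j b k b' l m r w)" for i j m r w
 proof -
  have P: "?P i j b k b' l m r w = wt (q i j) m r w * ((wt (h b i k) m r w * inc (N b k) m r w) * (wt (h b' j l) m r w * inc (N b' l) m r w))" for b k b' l
   by (simp add: wt_def g_def live_def)
  show ?thesis unfolding P Y_def by (simp only: sum_distrib_right, simp only: sum_distrib_left)
 qed
 show "integrable M (\<lambda>w. \<Sum>r<Suc m. \<Sum>i\<in>UNIV. \<Sum>j\<in>UNIV. wt (q i j) m r w * (Y i m r w * Y j m r w))" for m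
  unfolding eq by (intro Bochner_Integration.integrable_sum i)
 have "(\<integral>w. (\<Sum>r<Suc m. \<Sum>i\<in>UNIV. \<Sum>j\<in>UNIV. wt (q i j) m r w * (Y i m r w * Y j m r w)) \<partial>M)
   = (\<Sum>i\<in>UNIV. \<Sum>j\<in>UNIV. \<Sum>b\<in>UNIV. \<Sum>k\<in>UNIV. \<Sum>b'\<in>UNIV. \<Sum>l\<in>UNIV. \<Sum>r<Suc m. \<integral>w. ?P i j b k b' l m r w \<partial>M)" for m
  unfolding eq by (simp only: Bochner_Integration.integral_sum Bochner_Integration.integrable_sum i sum.swap[of _ "{..<Suc m}"])
 note e = this
 let ?J = "\<lambda>i j b k b' l. if b = b' \<and> k = l then \<integral>w. (LINT s:{0<..\<tau> w}|path_measure (V b) w. g i j b k b' l (X s w)) \<partial>M else 0"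
 have lim: "(\<lambda>m. \<integral>w. (\<Sum>r<Suc m. \<Sum>i\<in>UNIV. \<Sum>j\<in>UNIV. wt (q i j) m r w * (Y i m r w * Y j m r w)) \<partial>M)
   \<longlonglongrightarrow> (\<Sum>i\<in>UNIV. \<Sum>j\<in>UNIV. \<Sum>b\<in>UNIV. \<Sum>k\<in>UNIV. \<Sum>b'\<in>UNIV. \<Sum>l\<in>UNIV. ?J i j b k b' l)"
  unfolding e by (intro tendsto_sum cross_clock_LIMSEQ[OF gc gb])
 have iI: "integrable M (\<lambda>w. LINT s:{0<..\<tau> w}|path_measure (V b) w. g i j b k b k (X s w))" for i j b k
  by (rule clock_sum_LIMSEQ(2)[OF gc gb])
 show "integrable M I" unfolding I_def
  by (intro Bochner_Integration.integrable_sum iI[unfolded g_def])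
 have "(\<Sum>b'\<in>UNIV. \<Sum>l\<in>UNIV. ?J i j b k b' l) = (\<integral>w. (LINT s:{0<..\<tau> w}|path_measure (V b) w. g i j b k b k (X s w)) \<partial>M)" for i j b k
 proof -
  have "(\<Sum>b'\<in>UNIV. \<Sum>l\<in>UNIV. ?J i j b k b' l) = (\<Sum>b'\<in>UNIV. \<Sum>l\<in>UNIV. if b' = b then (if l = k then \<integral>w. (LINT s:{0<..\<tau> w}|path_measure (V b) w. g i j b k b k (X s w)) \<partial>M else 0) else 0)"
   by (intro sum.cong refl) auto
  also have "\<dots> = (\<Sum>b'\<in>UNIV. if b' = b then (\<integral>w. (LINT s:{0<..\<tau> w}|path_measure (V b) w. g i j b k b k (X s w)) \<partial>M) else 0)"
   by (intro sum.cong refl) (simp add: sum.delta)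
  finally show ?thesis by (simp add: sum.delta)
 qed
 moreover have "(\<integral>w. I w \<partial>M) = (\<Sum>i\<in>UNIV. \<Sum>j\<in>UNIV. \<Sum>b\<in>UNIV. \<Sum>k\<in>UNIV. \<integral>w. (LINT s:{0<..\<tau> w}|path_measure (V b) w. g i j b k b k (X s w)) \<partial>M)"
  unfolding I_def g_def[symmetric] by (simp only: Bochner_Integration.integral_sum Bochner_Integration.integrable_sum iI)
 ultimately show "(\<lambda>m. \<integral>w. (\<Sum>r<Suc m. \<Sum>i\<in>UNIV. \<Sum>j\<in>UNIV. wt (q i j) m r w * (Y i m r w * Y j m r w)) \<partial>M) \<longlonglongrightarrow> (\<integral>w. I w \<partial>M)"
  using lim by simp
qed

text \<open>Up to a positive exit time each coordinate is at most \<open>real n\<close>, so the norm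
  is at most the sum of these bounds. On this compact set the Taylor estimate is uniform.\<close>

definition Kn :: "(real^'b) set" where "Kn = S \<inter> cball 0 (real CARD('b) * real n)"

lemma Kn: "compact Kn" "Kn \<subseteq> S"
 unfolding Kn_def using S by (auto intro: closed_Int_compact)

lemma X_Kn:
 assumes w: "w \<in> space M" and Z: "continuous_on {0..} (\<lambda>t. Z t w)" and s: "0 <= s" "s <= \<tau> w" "0 < \<tau> w"
 shows "X s w \<in> Kn"
proof -
 have "\<bar>X s w $ i\<bar> <= real n" for i
  by (rule le_hit_bound[where Y="\<lambda>t w. X t w $ i" and Z=Z and w=w, OF _ le_Z(1) T s[unfolded \<tau>_def]])
   (intro continuous_on_component X_path w)
 then have "norm (X s w) <= (\<Sum>i\<in>(UNIV::'b set). real n)" by (intro order_trans[OF norm_le_l1_cart sum_mono])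
 then show ?thesis unfolding Kn_def using X_S[OF w s(1)] by simp
qed

text \<open>Short steps use the uniform Taylor estimate. On a step of length at least
  \<open>\<delta>\<close> the crude bounds of the three Taylor terms are converted into multiples of
  the squared length, at the price of \<open>1 / \<delta>^2\<close>, \<open>1 / \<delta>\<close> and
  \<open>1\<close> respectively; \<open>k\<close> is their sum, and \<open>bad\<close> pays for
  it.\<close>

lemma taylor_remainder:
 assumes f: "\<And>x. x \<in> S ==> \<bar>f x\<bar> <= G" and p: "\<And>i x. x \<in> S ==> \<bar>p i x\<bar> <= G" and q: "\<And>i j x. x \<in> S ==> \<bar>q i j x\<bar> <= G"
  and \<delta>: "0 < \<delta>" and \<epsilon>: "0 < \<epsilon>"
  and taylor: "\<And>x y. x \<in> Kn ==> y \<in> Kn ==> dist y x < \<delta> ==>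
   \<bar>f y - f x - (\<Sum>i\<in>UNIV. p i x * (y - x) $ i) - 1/2 * (\<Sum>i\<in>UNIV. \<Sum>j\<in>UNIV. q i j x * (y - x) $ i * (y - x) $ j)\<bar> <= \<epsilon> * (dist y x)\<^sup>2"
 defines "k \<equiv> 2 * G / \<delta>\<^sup>2 + real CARD('b) * G / \<delta> + real CARD('b) * real CARD('b) * G"
 shows "AE w in M. \<forall>m. \<bar>f (X (\<tau> w) w) - f (X 0 w) - (\<Sum>r<Suc m. \<Sum>i\<in>UNIV. wt (p i) m r w * dX i m r w)
   - 1/2 * (\<Sum>r<Suc m. \<Sum>i\<in>UNIV. \<Sum>j\<in>UNIV. wt (q i j) m r w * (dX i m r w * dX j m r w))\<bar> <= (\<epsilon> + k * bad \<delta> m w) * D2 m w"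
 using Z_cont[unfolded AE_continuous_paths_def] AE_space
proof eventually_elim
 case (elim w)
 have x0: "X 0 w \<in> S" using X_S[OF elim(2)] by simp
 have G: "0 <= G" using f[OF x0] by linarith
 have k: "0 <= k" unfolding k_def using G \<delta> by (intro add_nonneg_nonneg divide_nonneg_nonneg mult_nonneg_nonneg) auto
 show ?case
 proof
  fix m
  let ?x = "\<lambda>r. X (min (pt T m r) (\<tau> w)) w"
  let ?R = "\<lambda>x y. f y - f x - (\<Sum>i\<in>UNIV. p i x * (y - x) $ i) - 1/2 * (\<Sum>i\<in>UNIV. \<Sum>j\<in>UNIV. q i j x * (y - x) $ i * (y - x) $ j)"
  have d: "(?x (Suc r) - ?x r) $ i = dX i m r w" for r i by (simp add: inc_def)
  have ww: "wt g m r w * dX i m r w = g (?x r) * dX i m r w" for g r i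
  proof (cases "pt T m r < \<tau> w")
   case True
   then show ?thesis by (simp add: wt_def live_def min_absorb1)
  next
   case False
   then have "min (pt T m (Suc r)) (\<tau> w) = min (pt T m r) (\<tau> w)" using pt_simps(4)[OF T, of m r] by auto
   then show ?thesis by (simp add: inc_def)
  qed
  have tele: "f (X (\<tau> w) w) - f (X 0 w) = (\<Sum>r<Suc m. f (?x (Suc r)) - f (?x r))"
   unfolding sum_lessThan_telescope[of "\<lambda>r. f (?x r)" "Suc m"]
   using pt_simps(1,2)[OF T, of m] \<tau>(2,3)[of w] by (simp add: min_absorb1 min_absorb2)
  have R: "?R (?x r) (?x (Suc r)) = f (?x (Suc r)) - f (?x r) - (\<Sum>i\<in>UNIV. wt (p i) m r w * dX i m r w)
    - 1/2 * (\<Sum>i\<in>UNIV. \<Sum>j\<in>UNIV. wt (q i j) m r w * (dX i m r w * dX j m r w))" for r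
  proof -
   have "wt (q i j) m r w * (dX i m r w * dX j m r w) = q i j (?x r) * dX i m r w * dX j m r w" for i j
    unfolding mult.assoc[symmetric] ww ..
   then show ?thesis unfolding d by (simp only: ww)
  qed
  have Rb: "\<bar>?R (?x r) (?x (Suc r))\<bar> <= (\<epsilon> + k * bad \<delta> m w) * (\<Sum>i\<in>UNIV. (dX i m r w)\<^sup>2)" if r: "r < Suc m" for r
  proof (cases "\<tau> w = 0")
   \<comment> \<open>If the exit is immediate, the starting point may lie outside \<open>Kn\<close>,
     but all increments are zero.\<close>
   case True
   then have "?x (Suc r) = ?x r" using pt_simps(3)[OF T, of m] by (simp add: min_absorb2)
   moreover have "0 <= (\<epsilon> + k * bad \<delta> m w) * (\<Sum>i\<in>UNIV. (dX i m r w)\<^sup>2)"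
    using \<epsilon> k by (intro mult_nonneg_nonneg sum_nonneg add_nonneg_nonneg) (auto simp: bad_def)
   ultimately show ?thesis by simp
  next
   case False
   then have \<tau>0: "0 < \<tau> w" using \<tau>(2)[of w] by simp
   have K: "?x r \<in> Kn" "?x (Suc r) \<in> Kn"
    by (rule X_Kn[OF elim(2,1) _ _ \<tau>0]; use window(1)[of m r w] window(1)[of m "Suc r" w] in simp)+
   then have xS: "?x r \<in> S" "?x (Suc r) \<in> S" using Kn(2) by blast+
   let ?e = "dist (?x (Suc r)) (?x r)"
   show ?thesis
   proof (cases "?e < \<delta>")
    case True
    have "\<bar>?R (?x r) (?x (Suc r))\<bar> <= \<epsilon> * ?e\<^sup>2" by (rule taylor[OF K True])
    also have "\<dots> <= (\<epsilon> + k * bad \<delta> m w) * ?e\<^sup>2" using k by (intro mult_right_mono) (auto simp: bad_def)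
    finally show ?thesis unfolding dist_dX .
   next
    case far: False
    then have de: "\<delta> <= ?e" by simp
    have "\<delta>\<^sup>2 <= ?e\<^sup>2" by (rule power_mono[OF de]) (use \<delta> in simp)
    then have bad1: "bad \<delta> m w = 1" unfolding bad_def dist_dX using r by auto
    have comp: "\<bar>(?x (Suc r) - ?x r) $ i\<bar> <= ?e" for i unfolding dist_norm by (rule component_le_norm_cart)
    have 1: "\<bar>f (?x (Suc r)) - f (?x r)\<bar> <= 2 * G / \<delta>\<^sup>2 * ?e\<^sup>2"
    proof -
     have "\<bar>f (?x (Suc r)) - f (?x r)\<bar> <= 2 * G" using f[OF xS(1)] f[OF xS(2)] by linarith
     also have "2 * G = 2 * G / \<delta>\<^sup>2 * \<delta>\<^sup>2" using \<delta> by simp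
     also have "\<dots> <= 2 * G / \<delta>\<^sup>2 * ?e\<^sup>2" using G \<open>\<delta>\<^sup>2 <= ?e\<^sup>2\<close> by (intro mult_left_mono) auto
     finally show ?thesis .
    qed
    have 2: "\<bar>\<Sum>i\<in>UNIV. p i (?x r) * (?x (Suc r) - ?x r) $ i\<bar> <= real CARD('b) * G / \<delta> * ?e\<^sup>2"
    proof -
     have "\<bar>\<Sum>i\<in>UNIV. p i (?x r) * (?x (Suc r) - ?x r) $ i\<bar> <= (\<Sum>i\<in>(UNIV::'b set). G * ?e)"
      by (rule order_trans[OF sum_abs sum_mono]) (unfold abs_mult, intro mult_mono p xS comp, use G in auto)
     also have "\<dots> = real CARD('b) * G / \<delta> * (\<delta> * ?e)" using \<delta> by simp
     also have "\<dots> <= real CARD('b) * G / \<delta> * ?e\<^sup>2"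
      unfolding power2_eq_square using G \<delta> de by (intro mult_left_mono mult_right_mono) auto
     finally show ?thesis .
    qed
    have 3: "\<bar>\<Sum>i\<in>UNIV. \<Sum>j\<in>UNIV. q i j (?x r) * (?x (Suc r) - ?x r) $ i * (?x (Suc r) - ?x r) $ j\<bar> <= real CARD('b) * real CARD('b) * G * ?e\<^sup>2"
    proof -
     have "\<bar>\<Sum>i\<in>UNIV. \<Sum>j\<in>UNIV. q i j (?x r) * (?x (Suc r) - ?x r) $ i * (?x (Suc r) - ?x r) $ j\<bar> <= (\<Sum>i\<in>(UNIV::'b set). \<Sum>j\<in>(UNIV::'b set). G * ?e * ?e)"
      by (rule order_trans[OF sum_abs sum_mono], rule order_trans[OF sum_abs sum_mono]) (unfold abs_mult, intro mult_mono q xS comp, use G in auto)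
     then show ?thesis by (simp add: power2_eq_square mult_ac)
    qed
    have half: "\<bar>1/2 * z\<bar> <= \<bar>z\<bar>" for z :: real by simp
    have tri: "\<bar>a - b - 1/2 * z\<bar> <= \<bar>a\<bar> + \<bar>b\<bar> + \<bar>z\<bar>" for a b z :: real by linarith
    have "\<bar>?R (?x r) (?x (Suc r))\<bar> <= k * ?e\<^sup>2"
     unfolding k_def distrib_right using 1 2 3 by (intro order_trans[OF tri] add_mono)
    also have "\<dots> <= (\<epsilon> + k * bad \<delta> m w) * ?e\<^sup>2" unfolding bad1 using \<epsilon> by (intro mult_right_mono) auto
    finally show ?thesis unfolding dist_dX .
   qed
  qed
  have eq: "f (X (\<tau> w) w) - f (X 0 w) - (\<Sum>r<Suc m. \<Sum>i\<in>UNIV. wt (p i) m r w * dX i m r w)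
   - 1/2 * (\<Sum>r<Suc m. \<Sum>i\<in>UNIV. \<Sum>j\<in>UNIV. wt (q i j) m r w * (dX i m r w * dX j m r w)) = (\<Sum>r<Suc m. ?R (?x r) (?x (Suc r)))"
   unfolding tele R by (simp only: sum_subtractf sum_distrib_left)
  have "\<bar>\<Sum>r<Suc m. ?R (?x r) (?x (Suc r))\<bar> <= (\<Sum>r<Suc m. (\<epsilon> + k * bad \<delta> m w) * (\<Sum>i\<in>UNIV. (dX i m r w)\<^sup>2))"
   by (rule order_trans[OF sum_abs sum_mono]) (use Rb in simp)
  also have "\<dots> = (\<epsilon> + k * bad \<delta> m w) * D2 m w" unfolding D2_def by (simp only: sum_distrib_left)
  finally show "\<bar>f (X (\<tau> w) w) - f (X 0 w) - (\<Sum>r<Suc m. \<Sum>i\<in>UNIV. wt (p i) m r w * dX i m r w)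
   - 1/2 * (\<Sum>r<Suc m. \<Sum>i\<in>UNIV. \<Sum>j\<in>UNIV. wt (q i j) m r w * (dX i m r w * dX j m r w))\<bar> <= (\<epsilon> + k * bad \<delta> m w) * D2 m w" unfolding eq .
 qed
qed

end

context stopped_diffusion
begin

text \<open>For fixed \<open>\<epsilon>\<close> the terms with \<open>bad\<close> and
  \<open>Er\<close> vanish in mean as the mesh tends to zero, however large their constants are. The
  rest is \<open>\<epsilon>\<close> times a constant independent of \<open>\<epsilon>\<close>,
  thanks to the uniform second moment of \<open>D2\<close>.\<close>

lemma stopped_dynkin:
 fixes f :: "real^'b => real" and p :: "'b => real^'b => real" and q :: "'b => 'b => real^'b => real"
 assumes f: "continuous_on S f" "\<And>x. x \<in> S ==> \<bar>f x\<bar> <= G"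
  and p: "\<And>i. continuous_on S (p i)" "\<And>i x. x \<in> S ==> \<bar>p i x\<bar> <= G"
  and q: "\<And>i j. continuous_on S (q i j)" "\<And>i j x. x \<in> S ==> \<bar>q i j x\<bar> <= G"
  and taylor: "\<And>A \<epsilon>. compact A ==> A \<subseteq> S ==> 0 < \<epsilon> ==> \<exists>\<delta>>0. \<forall>x\<in>A. \<forall>y\<in>A. dist y x < \<delta> -->
   \<bar>f y - f x - (\<Sum>i\<in>UNIV. p i x * (y - x) $ i) - 1/2 * (\<Sum>i\<in>UNIV. \<Sum>j\<in>UNIV. q i j x * (y - x) $ i * (y - x) $ j)\<bar> <= \<epsilon> * (dist y x)\<^sup>2"
 defines "I w \<equiv> (\<Sum>i\<in>UNIV. \<Sum>b\<in>UNIV. LINT s:{0<..\<tau> w}|path_measure (V b) w. p i (X s w) * \<beta> b i (X s w))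
  + 1/2 * (\<Sum>i\<in>UNIV. \<Sum>j\<in>UNIV. \<Sum>b\<in>UNIV. \<Sum>k\<in>UNIV. LINT s:{0<..\<tau> w}|path_measure (V b) w. q i j (X s w) * (h b i k (X s w) * h b j k (X s w)))"
 shows "integrable M (\<lambda>w. f (X (\<tau> w) w))" "integrable M I"
  "(\<integral>w. f (X (\<tau> w) w) \<partial>M) - (\<integral>w. f (X 0 w) \<partial>M) = (\<integral>w. I w \<partial>M)"
proof -
 let ?d = "real CARD('b)"
 have G: "0 <= G" if "w \<in> space M" for w using f(2)[OF X_S[OF that, of 0]] by simp
 have G: "0 <= G" using G not_empty by blast
 have fX: "integrable M (\<lambda>w. f (X (\<tau> w) w))"
 proof (rule integrable_AE_bounded)
  have "(\<lambda>w. f (X (min T (\<tau> w)) w)) \<in> borel_measurable (F T)"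
  proof (rule stopped_meas[OF _ _ \<tau>(1,2) T])
   show "adapted F (\<lambda>t w. f (X t w))" using g_meas[OF f(1)] by (simp add: adapted_def)
   show "AE_continuous_paths M (\<lambda>t w. f (X t w))" unfolding AE_continuous_paths_def
    by (intro AE_I2 continuous_on_compose2[where t=S, OF f(1) X_path]) (use X_S in auto)
  qed
  then show "(\<lambda>w. f (X (\<tau> w) w)) \<in> borel_measurable M" using meas_M \<tau>(3) by (simp add: min_absorb2)
  show "AE w in M. \<bar>f (X (\<tau> w) w)\<bar> <= G" by (intro AE_I2 f(2) X_S \<tau>(2))
 qed
 have f0: "integrable M (\<lambda>w. f (X 0 w))"
 proof (rule integrable_AE_bounded)
  show "(\<lambda>w. f (X 0 w)) \<in> borel_measurable M" by (rule meas_M[OF g_meas[OF f(1)]]) simp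
  show "AE w in M. \<bar>f (X 0 w)\<bar> <= G" by (intro AE_I2 f(2) X_S) simp_all
 qed
 define S1 where "S1 m w = (\<Sum>r<Suc m. \<Sum>i\<in>UNIV. wt (p i) m r w * inc (D i) m r w)" for m w
 define S2 where "S2 m w = (\<Sum>r<Suc m. \<Sum>i\<in>UNIV. wt (p i) m r w * (\<Sum>b\<in>UNIV. \<Sum>j\<in>UNIV. inc (K b i j) m r w))" for m w
 define S3 where "S3 m w = (\<Sum>r<Suc m. \<Sum>i\<in>UNIV. \<Sum>j\<in>UNIV. wt (q i j) m r w * (Y i m r w * Y j m r w))" for m w
 let ?I1 = "\<lambda>w. \<Sum>i\<in>UNIV. \<Sum>b\<in>UNIV. LINT s:{0<..\<tau> w}|path_measure (V b) w. p i (X s w) * \<beta> b i (X s w)"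
 let ?I3 = "\<lambda>w. \<Sum>i\<in>UNIV. \<Sum>j\<in>UNIV. \<Sum>b\<in>UNIV. \<Sum>k\<in>UNIV. LINT s:{0<..\<tau> w}|path_measure (V b) w. q i j (X s w) * (h b i k (X s w) * h b j k (X s w))"
 have s1: "integrable M (S1 m)" "integrable M ?I1" "(\<lambda>m. \<integral>w. S1 m w \<partial>M) \<longlonglongrightarrow> (\<integral>w. ?I1 w \<partial>M)" for m
  unfolding S1_def[abs_def] by (rule first_order_sum[where p=p and G=G]; use p in blast)+
 have s2: "integrable M (S2 m)" "(\<integral>w. S2 m w \<partial>M) = 0" for m
  unfolding S2_def[abs_def] by (rule martingale_sum[where p=p and G=G]; use p in blast)+
 have s3: "integrable M (S3 m)" "integrable M ?I3" "(\<lambda>m. \<integral>w. S3 m w \<partial>M) \<longlonglongrightarrow> (\<integral>w. ?I3 w \<partial>M)" for m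
  unfolding S3_def[abs_def] by (rule second_order_sum[where q=q and G=G]; use q in blast)+
 show iI: "integrable M I" unfolding I_def by (intro Bochner_Integration.integrable_add integrable_mult_right s1(2) s3(2))
 define R where "R m w = f (X (\<tau> w) w) - f (X 0 w) - S1 m w - S2 m w - 1/2 * S3 m w" for m w
 have iR: "integrable M (R m)" for m unfolding R_def[abs_def]
  by (intro Bochner_Integration.integrable_diff integrable_mult_right fX f0 s1(1) s2(1) s3(1))
 have eR: "(\<integral>w. R m w \<partial>M) = (\<integral>w. f (X (\<tau> w) w) \<partial>M) - (\<integral>w. f (X 0 w) \<partial>M) - (\<integral>w. S1 m w \<partial>M) - 1/2 * (\<integral>w. S3 m w \<partial>M)" for m
  unfolding R_def using fX f0 s1(1)[of m] s2(1)[of m] s3(1)[of m] s2(2)[of m] by simp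
 have limR: "(\<lambda>m. \<integral>w. R m w \<partial>M) \<longlonglongrightarrow> (\<integral>w. f (X (\<tau> w) w) \<partial>M) - (\<integral>w. f (X 0 w) \<partial>M) - (\<integral>w. I w \<partial>M)"
 proof -
  have eI: "(\<integral>w. I w \<partial>M) = (\<integral>w. (\<Sum>i\<in>UNIV. \<Sum>b\<in>UNIV. LINT s:{0<..\<tau> w}|path_measure (V b) w. p i (X s w) * \<beta> b i (X s w)) \<partial>M)
   + 1/2 * (\<integral>w. (\<Sum>i\<in>UNIV. \<Sum>j\<in>UNIV. \<Sum>b\<in>UNIV. \<Sum>k\<in>UNIV. LINT s:{0<..\<tau> w}|path_measure (V b) w. q i j (X s w) * (h b i k (X s w) * h b j k (X s w))) \<partial>M)" (is "_ = ?i1 + 1/2 * ?i3")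
   unfolding I_def by (subst Bochner_Integration.integral_add[OF s1(2) integrable_mult_right[OF s3(2)]]) (simp only: integral_mult_right_zero)
  have "(\<lambda>m. \<integral>w. R m w \<partial>M) \<longlonglongrightarrow> (\<integral>w. f (X (\<tau> w) w) \<partial>M) - (\<integral>w. f (X 0 w) \<partial>M) - ?i1 - 1/2 * ?i3"
   unfolding eR by (intro tendsto_diff tendsto_mult tendsto_const s1(3) s3(3))
  then show ?thesis unfolding eI diff_diff_eq add.assoc .
 qed
 obtain B where B: "0 <= B" and iD: "\<And>m. integrable M (\<lambda>w. (D2 m w)\<^sup>2)" and eD: "\<And>m. (\<integral>w. (D2 m w)\<^sup>2 \<partial>M) <= B"
  using D2_second_moment by blast
 let ?k = "2 * B + 1 + ?d * G * (B + 1)"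
 have key: "\<bar>(\<integral>w. f (X (\<tau> w) w) \<partial>M) - (\<integral>w. f (X 0 w) \<partial>M) - (\<integral>w. I w \<partial>M)\<bar> <= \<epsilon> * ?k" if \<epsilon>: "0 < \<epsilon>" for \<epsilon>
 proof -
  obtain \<delta> where \<delta>: "0 < \<delta>" and tay: "\<forall>x\<in>Kn. \<forall>y\<in>Kn. dist y x < \<delta> -->
   \<bar>f y - f x - (\<Sum>i\<in>UNIV. p i x * (y - x) $ i) - 1/2 * (\<Sum>i\<in>UNIV. \<Sum>j\<in>UNIV. q i j x * (y - x) $ i * (y - x) $ j)\<bar> <= \<epsilon> * (dist y x)\<^sup>2"
   using taylor[OF Kn \<epsilon>] by (elim exE conjE)
  define k where "k = 2 * G / \<delta>\<^sup>2 + ?d * G / \<delta> + ?d * ?d * G"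
  define e where "e = 1 / (4 * \<epsilon>) + 1"
  have TR: "AE w in M. \<forall>m. \<bar>f (X (\<tau> w) w) - f (X 0 w) - (\<Sum>r<Suc m. \<Sum>i\<in>UNIV. wt (p i) m r w * dX i m r w)
    - 1/2 * (\<Sum>r<Suc m. \<Sum>i\<in>UNIV. \<Sum>j\<in>UNIV. wt (q i j) m r w * (dX i m r w * dX j m r w))\<bar> <= (\<epsilon> + k * bad \<delta> m w) * D2 m w"
   unfolding k_def by (rule taylor_remainder[OF f(2) p(2) q(2) \<delta> \<epsilon>]) (use tay in blast)+
  \<comment> \<open>Integrable majorant: \<open>D2 <= 1 + D2^2\<close>, and the product of
    \<open>bad\<close> and \<open>D2\<close> is split by weighted means, using that
    \<open>bad\<close> takes only the values \<open>0\<close> and \<open>1\<close>. The last summand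
    is the price of replacing \<open>dX\<close> by \<open>Y\<close>.\<close>
  let ?U = "\<lambda>m w. \<epsilon> * (1 + (D2 m w)\<^sup>2) + \<epsilon> * (D2 m w)\<^sup>2 + k\<^sup>2 / (4 * \<epsilon>) * bad \<delta> m w + ?d * G * (\<epsilon> * (1 + (D2 m w)\<^sup>2) + e * Er m w)"
  have bound: "AE w in M. \<bar>R m w\<bar> <= ?U m w" for m
   using TR AE_space
  proof eventually_elim
   case (elim w)
   let ?Q = "\<Sum>r<Suc m. \<Sum>i\<in>UNIV. \<Sum>j\<in>UNIV. wt (q i j) m r w * (dX i m r w * dX j m r w - Y i m r w * Y j m r w)"
   have alg: "u - v - a - b - 1/2 * s = (u - v - P - 1/2 * z) + 1/2 * y" if "a + b = P" "s + y = z" for u v a b s P z y :: real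
    unfolding that[symmetric] by (simp add: algebra_simps)
   have "S1 m w + S2 m w = (\<Sum>r<Suc m. \<Sum>i\<in>UNIV. wt (p i) m r w * dX i m r w)"
    unfolding S1_def S2_def dX_split distrib_left sum.distrib ..
   moreover have "S3 m w + ?Q = (\<Sum>r<Suc m. \<Sum>i\<in>UNIV. \<Sum>j\<in>UNIV. wt (q i j) m r w * (dX i m r w * dX j m r w))"
    unfolding S3_def right_diff_distrib sum_subtractf by (simp only: add_diff_cancel_left' diff_add_cancel add.commute)
   ultimately have Re: "R m w = (f (X (\<tau> w) w) - f (X 0 w) - (\<Sum>r<Suc m. \<Sum>i\<in>UNIV. wt (p i) m r w * dX i m r w)
    - 1/2 * (\<Sum>r<Suc m. \<Sum>i\<in>UNIV. \<Sum>j\<in>UNIV. wt (q i j) m r w * (dX i m r w * dX j m r w))) + 1/2 * ?Q"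
    unfolding R_def by (rule alg)
   have T1: "\<bar>f (X (\<tau> w) w) - f (X 0 w) - (\<Sum>r<Suc m. \<Sum>i\<in>UNIV. wt (p i) m r w * dX i m r w)
    - 1/2 * (\<Sum>r<Suc m. \<Sum>i\<in>UNIV. \<Sum>j\<in>UNIV. wt (q i j) m r w * (dX i m r w * dX j m r w))\<bar> <= (\<epsilon> + k * bad \<delta> m w) * D2 m w"
    using elim(1) by blast
   have sq: "D2 m w <= 1 + (D2 m w)\<^sup>2" using sum_squares_bound[of "D2 m w" 1] D2_nonneg[of m w] by simp
   have T2: "k * bad \<delta> m w * D2 m w <= \<epsilon> * (D2 m w)\<^sup>2 + k\<^sup>2 / (4 * \<epsilon>) * bad \<delta> m w"
   proof (cases "bad \<delta> m w = 1")
    case True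
    then show ?thesis using amgm_weighted[OF \<epsilon>, of "D2 m w" k] by (simp add: mult.commute)
   next
    case False
    then have "bad \<delta> m w = 0" by (simp add: bad_def split: if_splits)
    then show ?thesis using \<epsilon> by simp
   qed
   have Qb: "\<bar>?Q\<bar> <= 2 * ?d * G * (\<epsilon> * D2 m w + e * Er m w)"
   proof -
    have "\<bar>?Q\<bar> <= (\<Sum>r<Suc m. 2 * ?d * G * (\<epsilon> * (\<Sum>i\<in>UNIV. (dX i m r w)\<^sup>2) + e * (\<Sum>i\<in>UNIV. (dX i m r w - Y i m r w)\<^sup>2)))"
     unfolding e_def
     by (rule order_trans[OF sum_abs sum_mono], rule quadratic_form_diff[OF wt_bound[OF q(2) elim(2)] \<epsilon>])
    also have "\<dots> = 2 * ?d * G * (\<epsilon> * D2 m w + e * (\<Sum>r<Suc m. \<Sum>i\<in>UNIV. (dX i m r w - Y i m r w)\<^sup>2))"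
     unfolding D2_def by (simp only: sum_distrib_left[symmetric] sum.distrib)
    also have "\<dots> <= 2 * ?d * G * (\<epsilon> * D2 m w + e * Er m w)"
     using G \<epsilon> by (intro mult_left_mono add_left_mono residual) (auto simp: e_def)
    finally show ?thesis .
   qed
   have "\<epsilon> * D2 m w <= \<epsilon> * (1 + (D2 m w)\<^sup>2)" using sq \<epsilon> by (intro mult_left_mono) auto
   moreover from this have "?d * G * (\<epsilon> * D2 m w + e * Er m w) <= ?d * G * (\<epsilon> * (1 + (D2 m w)\<^sup>2) + e * Er m w)"
    by (rule mult_left_mono[OF add_right_mono]) (use G in simp)
   moreover have "\<bar>R m w\<bar> <= (\<epsilon> + k * bad \<delta> m w) * D2 m w + 1/2 * (2 * ?d * G * (\<epsilon> * D2 m w + e * Er m w))"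
    unfolding Re using T1 Qb by (intro order_trans[OF abs_triangle_ineq add_mono]) (auto simp: abs_mult)
   ultimately show ?case using T2 unfolding distrib_right by linarith
  qed
  have iU: "integrable M (?U m)" for m
   by (intro Bochner_Integration.integrable_add integrable_mult_right iD Er_LIMSEQ(1) bad_LIMSEQ(1)[OF \<delta>] integrable_const)
  have eU: "(\<integral>w. ?U m w \<partial>M) = \<epsilon> * (1 + (\<integral>w. (D2 m w)\<^sup>2 \<partial>M)) + \<epsilon> * (\<integral>w. (D2 m w)\<^sup>2 \<partial>M) + k\<^sup>2 / (4 * \<epsilon>) * (\<integral>w. bad \<delta> m w \<partial>M)
    + ?d * G * (\<epsilon> * (1 + (\<integral>w. (D2 m w)\<^sup>2 \<partial>M)) + e * (\<integral>w. Er m w \<partial>M))" for m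
   using iD[of m] Er_LIMSEQ(1)[of m] bad_LIMSEQ(1)[OF \<delta>, of m] by (simp add: prob_space)
  have le: "\<bar>\<integral>w. R m w \<partial>M\<bar> <= \<epsilon> * ?k + (k\<^sup>2 / (4 * \<epsilon>) * (\<integral>w. bad \<delta> m w \<partial>M) + ?d * G * (e * (\<integral>w. Er m w \<partial>M)))" for m
  proof -
   have "\<bar>\<integral>w. R m w \<partial>M\<bar> <= (\<integral>w. \<bar>R m w\<bar> \<partial>M)" by (rule integral_abs_bound)
   also have "\<dots> <= (\<integral>w. ?U m w \<partial>M)" by (rule integral_mono_AE[OF integrable_abs[OF iR] iU bound])
   also have "\<dots> <= \<epsilon> * (1 + B) + \<epsilon> * B + k\<^sup>2 / (4 * \<epsilon>) * (\<integral>w. bad \<delta> m w \<partial>M) + ?d * G * (\<epsilon> * (1 + B) + e * (\<integral>w. Er m w \<partial>M))"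
    unfolding eU using \<epsilon> G by (intro add_mono mult_left_mono eD order_refl) auto
   also have "\<dots> = \<epsilon> * ?k + (k\<^sup>2 / (4 * \<epsilon>) * (\<integral>w. bad \<delta> m w \<partial>M) + ?d * G * (e * (\<integral>w. Er m w \<partial>M)))"
    by (simp add: algebra_simps)
   finally show ?thesis .
  qed
  have "(\<lambda>m. \<epsilon> * ?k + (k\<^sup>2 / (4 * \<epsilon>) * (\<integral>w. bad \<delta> m w \<partial>M) + ?d * G * (e * (\<integral>w. Er m w \<partial>M))))
    \<longlonglongrightarrow> \<epsilon> * ?k + (k\<^sup>2 / (4 * \<epsilon>) * 0 + ?d * G * (e * 0))"
   by (intro tendsto_add tendsto_mult tendsto_const bad_LIMSEQ(2)[OF \<delta>] Er_LIMSEQ(2))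
  then have lim: "(\<lambda>m. \<epsilon> * ?k + (k\<^sup>2 / (4 * \<epsilon>) * (\<integral>w. bad \<delta> m w \<partial>M) + ?d * G * (e * (\<integral>w. Er m w \<partial>M)))) \<longlonglongrightarrow> \<epsilon> * ?k" by simp
  show ?thesis by (rule LIMSEQ_le[OF tendsto_rabs[OF limR] lim]) (use le in blast)
 qed
 have "(\<lambda>m. inverse (real (Suc m)) * ?k) \<longlonglongrightarrow> 0 * ?k" by (intro tendsto_mult tendsto_const LIMSEQ_inverse_real_of_nat)
 then have "\<bar>(\<integral>w. f (X (\<tau> w) w) \<partial>M) - (\<integral>w. f (X 0 w) \<partial>M) - (\<integral>w. I w \<partial>M)\<bar> <= 0 * ?k"
  by (rule LIMSEQ_le_const) (use key in \<open>auto simp del: of_nat_Suc\<close>)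
 then show "(\<integral>w. f (X (\<tau> w) w) \<partial>M) - (\<integral>w. f (X 0 w) \<partial>M) = (\<integral>w. I w \<partial>M)" by simp
 show "integrable M (\<lambda>w. f (X (\<tau> w) w))" by (rule fX)
qed

end

section \<open>The sticky diffusion as a diffusion driven by two clocks\<close>

text \<open>Equality of running integrals for all times is upgraded to equality of measures, as half
  lines form a stable generator. In this form the sojourn condition applies to arbitrary integrands,
  and not only to the indicator.\<close>

lemma density_eqI_Icc:
 fixes g1 g2 :: "real => real"
 assumes \<nu>: "sets \<nu>1 = sets borel" "sets \<nu>2 = sets borel"
  and g: "g1 \<in> borel_measurable borel" "g2 \<in> borel_measurable borel" "\<And>s. 0 <= g1 s" "\<And>s. 0 <= g2 s"
  and neg: "\<And>s. s < 0 ==> g1 s = 0" "\<And>s. s < 0 ==> g2 s = 0"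
  and int: "\<And>t. 0 <= t ==> set_integrable \<nu>1 {0..t} g1" "\<And>t. 0 <= t ==> set_integrable \<nu>2 {0..t} g2"
  and eq: "\<And>t. 0 <= t ==> (LINT s:{0..t}|\<nu>1. g1 s) = (LINT s:{0..t}|\<nu>2. g2 s)"
 shows "density \<nu>1 (\<lambda>s. ennreal (g1 s)) = density \<nu>2 (\<lambda>s. ennreal (g2 s))"
proof -
 have em: "emeasure (density \<nu> (\<lambda>s. ennreal (g s))) {..t} = (if 0 <= t then ennreal (LINT s:{0..t}|\<nu>. g s) else 0)"
  if \<nu>: "sets \<nu> = sets borel" and g: "g \<in> borel_measurable borel" "\<And>s. 0 <= g s" "\<And>s. s < 0 ==> g s = 0"
   and int: "\<And>t. 0 <= t ==> set_integrable \<nu> {0..t} g" for \<nu> and g :: "real => real" and t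
 proof -
  have gm: "g \<in> borel_measurable \<nu>" using g(1) by (simp add: measurable_cong_sets[OF \<nu> refl])
  have "emeasure (density \<nu> (\<lambda>s. ennreal (g s))) {..t} = (\<integral>\<^sup>+s. ennreal (g s) * indicator {..t} s \<partial>\<nu>)"
   using gm \<nu> by (intro emeasure_density) auto
  also have "\<dots> = (\<integral>\<^sup>+s. ennreal (indicator {0..t} s *\<^sub>R g s) \<partial>\<nu>)"
   using g(3) by (intro nn_integral_cong) (auto simp: indicator_def not_le)
  also have "\<dots> = (if 0 <= t then ennreal (LINT s:{0..t}|\<nu>. g s) else 0)"
  proof (cases "0 <= t")
   case True
   then show ?thesis
    using nn_integral_eq_integral[OF int[OF True, unfolded set_integrable_def]] g(2) by (simp add: set_lebesgue_integral_def)
  qed simp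
  finally show ?thesis .
 qed
 have e1: "emeasure (density \<nu>1 (\<lambda>s. ennreal (g1 s))) {..t} = (if 0 <= t then ennreal (LINT s:{0..t}|\<nu>1. g1 s) else 0)" for t
  by (rule em[OF \<nu>(1) g(1,3) neg(1) int(1)])
 have e2: "emeasure (density \<nu>2 (\<lambda>s. ennreal (g2 s))) {..t} = (if 0 <= t then ennreal (LINT s:{0..t}|\<nu>2. g2 s) else 0)" for t
  by (rule em[OF \<nu>(2) g(2,4) neg(2) int(2)])
 show ?thesis
 proof (rule measure_eqI_generator_eq[where E="range (\<lambda>a::real. {..a})" and \<Omega>=UNIV and A="\<lambda>i. {..real i}"])
  show "Int_stable (range (\<lambda>a::real. {..a}))"
  proof (rule Int_stableI)
   fix A B :: "real set" assume "A \<in> range (\<lambda>a. {..a})" "B \<in> range (\<lambda>a. {..a})"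
   then obtain a b where "A = {..a}" "B = {..b}" by blast
   then have "A \<inter> B = {..min a b}" by auto
   then show "A \<inter> B \<in> range (\<lambda>a. {..a})" by blast
  qed
  fix X assume "X \<in> range (\<lambda>a::real. {..a})"
  then obtain t where X: "X = {..t}" by blast
  show "emeasure (density \<nu>1 (\<lambda>s. ennreal (g1 s))) X = emeasure (density \<nu>2 (\<lambda>s. ennreal (g2 s))) X"
   unfolding X e1 e2 by (simp add: eq)
 next
  show "sets (density \<nu>1 (\<lambda>s. ennreal (g1 s))) = sigma_sets UNIV (range (\<lambda>a::real. {..a}))"
   "sets (density \<nu>2 (\<lambda>s. ennreal (g2 s))) = sigma_sets UNIV (range (\<lambda>a::real. {..a}))"
   unfolding sets_density \<nu> by (subst borel_eq_atMost, simp)+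
  show "(\<Union>i. {..real i}) = (UNIV :: real set)" by (auto simp: real_arch_simple)
  show "emeasure (density \<nu>1 (\<lambda>s. ennreal (g1 s))) {..real i} \<noteq> \<infinity>" for i unfolding e1 by simp
 qed auto
qed

lemma set_integral_density_transfer:
 fixes g1 g2 k :: "real => real"
 assumes \<nu>: "sets \<nu>1 = sets borel" "sets \<nu>2 = sets borel"
  and g: "g1 \<in> borel_measurable borel" "g2 \<in> borel_measurable borel" "\<And>s. 0 <= g1 s" "\<And>s. 0 <= g2 s"
  and eq: "density \<nu>1 (\<lambda>s. ennreal (g1 s)) = density \<nu>2 (\<lambda>s. ennreal (g2 s))"
  and k: "(\<lambda>s. indicator A s * k s) \<in> borel_measurable borel"
 shows "(LINT s:A|\<nu>1. g1 s * k s) = (LINT s:A|\<nu>2. g2 s * k s)"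
proof -
 have "(LINT s:A|\<nu>. g s * k s) = integral\<^sup>L (density \<nu> (\<lambda>s. ennreal (g s))) (\<lambda>s. indicator A s * k s)"
  if \<nu>: "sets \<nu> = sets borel" and g: "g \<in> borel_measurable borel" "\<And>s. 0 <= g s" for \<nu> and g :: "real => real"
 proof -
  have "integral\<^sup>L (density \<nu> (\<lambda>s. ennreal (g s))) (\<lambda>s. indicator A s * k s) = (\<integral>s. g s *\<^sub>R (indicator A s * k s) \<partial>\<nu>)"
   using k g \<nu> by (intro integral_density) (auto simp: measurable_cong_sets[OF \<nu> refl])
  then show ?thesis by (simp add: set_lebesgue_integral_def mult.left_commute)
 qed
 from this[OF \<nu>(1) g(1,3)] this[OF \<nu>(2) g(2,4)] show ?thesis unfolding eq by simp
qed

lemma path_measure_neg: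
 assumes V: "mono_on {0..} (\<lambda>t. V t w)" "continuous_on {0..} (\<lambda>t. V t w)"
 shows "AE s in path_measure V w. 0 <= s"
proof -
 have mono: "V (max 0 x) w <= V (max 0 y) w" if "x <= y" for x y
  using V(1) that by (intro mono_onD[OF V(1)]) auto
 have "continuous_on UNIV (\<lambda>s. V (max 0 s) w)"
  by (rule continuous_on_compose2[OF V(2)]) (auto intro!: continuous_intros)
 then have cont: "continuous (at_right a) (\<lambda>s. V (max 0 s) w)" for a
  by (auto simp: continuous_on_eq_continuous_within intro: continuous_at_imp_continuous_at_within)
 have e: "emeasure (path_measure V w) {a<..b} = ennreal (V (max 0 b) w - V (max 0 a) w)" if "a <= b" for a b
  unfolding path_measure_def by (rule emeasure_interval_measure_Ioc[OF that mono cont])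
 have "{x \<in> space (path_measure V w). \<not> 0 <= x} \<subseteq> (\<Union>n::nat. {- real n<..0})"
 proof
  fix x assume "x \<in> {x \<in> space (path_measure V w). \<not> 0 <= x}"
  then have "x < 0" by auto
  moreover obtain n :: nat where "- x < real n" using reals_Archimedean2 by blast
  ultimately show "x \<in> (\<Union>n::nat. {- real n<..0})" by (intro UN_I[of n]) auto
 qed
 moreover have "(\<Union>n::nat. {- real n<..0}) \<in> null_sets (path_measure V w)"
  by (intro null_sets_UN null_setsI) (auto simp: e sets_path_measure)
 ultimately show ?thesis by (intro AE_I') auto
qed

locale sticky_solution =
 fixes \<Phi> :: "real^'d => real" and \<mu> \<beta> :: "real^'d => real^'d" and \<sigma> \<Gamma> :: "real^'d => real^'d^'d" and \<rho> :: "real^'d => real"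
  and C :: real
  and x :: "real^'d" and M :: "'w measure" and F :: "real => 'w measure" and X :: "real => 'w => real^'d" and L :: "real => 'w => real"
  and W B :: "real => 'w => real^'d"
 assumes Phi: "continuous_on UNIV \<Phi>"
  and \<mu>: "continuous_on (closed_domain \<Phi>) \<mu>" "\<And>y i. y \<in> closed_domain \<Phi> ==> \<bar>\<mu> y $ i\<bar> <= C"
  and \<sigma>: "continuous_on (closed_domain \<Phi>) \<sigma>" "\<And>y i j. y \<in> closed_domain \<Phi> ==> \<bar>\<sigma> y $ i $ j\<bar> <= C"
  and \<beta>: "continuous_on (bdry_of \<Phi>) \<beta>" "\<And>y i. y \<in> bdry_of \<Phi> ==> \<bar>\<beta> y $ i\<bar> <= C"
  and \<Gamma>: "continuous_on (bdry_of \<Phi>) \<Gamma>" "\<And>y i j. y \<in> bdry_of \<Phi> ==> \<bar>\<Gamma> y $ i $ j\<bar> <= C"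
  and \<rho>: "\<rho> \<in> borel_measurable (restrict_space borel (bdry_of \<Phi>))" "\<And>y. y \<in> bdry_of \<Phi> ==> 0 < \<rho> y" and C: "0 <= C"
  and sol: "weak_solution \<Phi> \<mu> \<sigma> \<beta> \<Gamma> \<rho> x M F X L W B" and sojourn: "sojourn_condition \<Phi> \<rho> M X L"

sublocale sticky_solution \<subseteq> usual_prob_space M F
 using sol unfolding weak_solution_def usual_prob_space_def usual_prob_space_axioms_def by blast

context sticky_solution
begin

abbreviation "S \<equiv> closed_domain \<Phi>"
abbreviation "E \<equiv> bdry_of \<Phi>"

lemma closed_sets: "closed S" "closed E" "E \<subseteq> S"
proof -
 show "closed S" unfolding closed_domain_eq by (rule closed_Collect_le[OF _ Phi]) simp
 show "closed E" unfolding bdry_of_def by (rule closed_Collect_eq[OF Phi]) simp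
 show "E \<subseteq> S" by (auto simp: closed_domain_def)
qed

definition V :: "bool => real => 'w => real" where
 "V b t w = (if b then t - bdry_clock \<Phi> \<rho> X L t w else L t w)"

lemma X_paths: "w \<in> space M ==> continuous_on {0..} (\<lambda>t. X t w)" "w \<in> space M ==> 0 <= t ==> X t w \<in> S"
 using sol unfolding weak_solution_def continuous_paths_def by blast+

lemma path_meas:
 fixes k :: "real^'d => real"
 assumes w: "w \<in> space M" and k: "k \<in> borel_measurable borel"
 shows "(\<lambda>s. indicator {0..} s * k (X s w)) \<in> borel_measurable borel"
proof -
 have "continuous_on UNIV (\<lambda>s. X (max 0 s) w)"
  by (rule continuous_on_compose2[OF X_paths(1)[OF w]]) (auto intro!: continuous_intros)
 then have "(\<lambda>s. indicator {0..} s * k (X (max 0 s) w)) \<in> borel_measurable borel"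
  using measurable_compose[OF borel_measurable_continuous_onI k] by (intro borel_measurable_times) auto
 also have "(\<lambda>s. indicator {0..} s * k (X (max 0 s) w)) = (\<lambda>s. indicator {0..} s * k (X s w))"
  by (auto simp: indicator_def fun_eq_iff max_def)
 finally show ?thesis .
qed

lemma cont_S_borel: "continuous_on S g ==> (\<lambda>y. indicator S y * g y :: real) \<in> borel_measurable borel"
 using borel_measurable_continuous_on_indicator[of S g] closed_sets(1) by simp

lemma path_meas_S:
 fixes g :: "real^'d => real"
 assumes w: "w \<in> space M" and g: "continuous_on S g"
 shows "(\<lambda>s. indicator {0..} s * g (X s w)) \<in> borel_measurable borel"
proof -
 have "(\<lambda>s. indicator {0..} s * (indicator S (X s w) * g (X s w))) = (\<lambda>s. indicator {0..} s * g (X s w))"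
  using X_paths(2)[OF w] by (auto simp: indicator_def fun_eq_iff)
 then show ?thesis using path_meas[OF w cont_S_borel[OF g]] by simp
qed

lemma E_borel: "indicator E \<in> borel_measurable (borel :: (real^'d) measure)"
 using closed_sets(2) by (intro borel_measurable_indicator) auto

lemma \<rho>_borel: "(\<lambda>y. indicator E y * \<rho> y) \<in> borel_measurable borel"
 using \<rho>(1) closed_sets(2) by (subst (asm) borel_measurable_restrict_space_iff) auto

lemma \<beta>_borel: "(\<lambda>y. indicator E y * \<beta> y $ i) \<in> borel_measurable borel"
 using borel_measurable_continuous_on_indicator[of E "\<lambda>y. \<beta> y $ i"] closed_sets(2) \<beta>(1) by (auto intro: continuous_on_component)

lemma L_facts:
 "AE w in M. mono_on {0..} (\<lambda>t. L t w) \<and> continuous_on {0..} (\<lambda>t. L t w) \<and> L 0 w = 0"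
 "AE w in M. \<forall>t\<ge>0. L t w = (LINT s:{0..t}|path_measure L w. indicator E (X s w))"
 "AE w in M. \<forall>t\<ge>0. set_integrable (path_measure L w) {0..t} (\<lambda>s. indicator E (X s w) * \<rho> (X s w))"
 "AE w in M. \<forall>t\<ge>0. (LINT s:{0..t}|lborel. indicator E (X s w)) = bdry_clock \<Phi> \<rho> X L t w"
 using sol sojourn unfolding weak_solution_def bdry_local_time_def continuous_paths_def sojourn_condition_def
 by (auto intro!: AE_I2)

text \<open>By the sojourn condition the bulk clock is the Lebesgue time spent off \<open>E\<close>:
  hence it is nondecreasing and Lipschitz, and its measure is \<open>dt\<close> restricted to those
  times. The same condition reads \<open>dt = \<rho> dL\<close> on \<open>E\<close>. That
  \<open>L\<close> charges only times on the boundary follows from its own integral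
  equation.\<close>

lemma clock_paths:
 "AE w in M. (\<forall>b. mono_on {0..} (\<lambda>t. V b t w) \<and> continuous_on {0..} (\<lambda>t. V b t w) \<and> V b 0 w = 0)
  \<and> (\<forall>b. AE s in path_measure (V b) w. 0 <= s --> (X s w \<in> E \<longleftrightarrow> \<not> b))
  \<and> (\<forall>A k. A \<in> sets borel --> A \<subseteq> {0..} --> (\<lambda>s. indicator A s * k s) \<in> borel_measurable borel -->
    (LINT s:A|path_measure (V True) w. k s) = (LINT s:A|lborel. (1 - indicator E (X s w)) * k s)
   \<and> (LINT s:A|lborel. indicator E (X s w) * k s) = (LINT s:A|path_measure L w. (indicator E (X s w) * \<rho> (X s w)) * (k s :: real)))"
 using L_facts AE_space
proof eventually_elim
 case (elim w)
 note Lm = elim(1)[THEN conjunct1] and Lc = elim(1)[THEN conjunct2, THEN conjunct1] and L0 = elim(1)[THEN conjunct2, THEN conjunct2]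
 note w = elim(5)
 have eE: "(\<lambda>s. indicator {0..} s * indicator E (X s w) :: real) \<in> borel_measurable borel" by (rule path_meas[OF w E_borel])
 have e\<rho>: "(\<lambda>s. indicator {0..} s * (indicator E (X s w) * \<rho> (X s w))) \<in> borel_measurable borel" by (rule path_meas[OF w \<rho>_borel])
 have cmp: "(\<lambda>s. indicator {0..} s * (1 - indicator E (X s w)) :: real) \<in> borel_measurable borel"
 proof -
  have "(\<lambda>s. indicator {0..} s - indicator {0..} s * indicator E (X s w) :: real) \<in> borel_measurable borel" using eE by simp
  then show ?thesis by (simp add: right_diff_distrib)
 qed
 have fin: "set_integrable lborel {a..b} (\<lambda>s. k s :: real)" if "0 <= a" "(\<lambda>s. indicator {0..} s * k s) \<in> borel_measurable borel" "\<And>s. \<bar>k s\<bar> <= 1" for a b :: real and k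
  unfolding set_integrable_def
 proof (rule Bochner_Integration.integrable_bound[of _ "\<lambda>s. indicator {a..b} s *\<^sub>R 1"])
  show "integrable lborel (\<lambda>s. indicator {a..b} s *\<^sub>R (1::real))"
   using emeasure_lborel_cbox_finite[of a b] by (intro integrable_scaleR_left integrable_real_indicator) (auto simp: cbox_interval)
  have "(\<lambda>s. indicator {a..b} s * (indicator {0..} s * k s)) \<in> borel_measurable borel" using that(2) by simp
  also have "(\<lambda>s. indicator {a..b} s * (indicator {0..} s * k s)) = (\<lambda>s. indicator {a..b} s *\<^sub>R k s)"
   using that(1) by (auto simp: indicator_def fun_eq_iff)
  finally show "(\<lambda>s. indicator {a..b} s *\<^sub>R k s) \<in> borel_measurable lborel" by simp
  show "AE s in lborel. norm (indicator {a..b} s *\<^sub>R k s) <= norm (indicator {a..b} s *\<^sub>R (1::real))"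
   using that(3) by (auto simp: indicator_def)
 qed
 have iE: "set_integrable lborel {0..t} (\<lambda>s. indicator E (X s w) :: real)" for t
  by (rule fin[OF _ eE]) (auto simp: indicator_def)
 have iC: "set_integrable lborel {0..t} (\<lambda>s. 1 - indicator E (X s w) :: real)" for t
  by (rule fin[OF _ cmp]) (auto simp: indicator_def)
 have VT: "V True t w = (LINT s:{0..t}|lborel. 1 - indicator E (X s w))" if "0 <= t" for t
 proof -
  have "(LINT s:{0..t}|lborel. 1 - indicator E (X s w)) = (LINT s:{0..t}|lborel. 1::real) - (LINT s:{0..t}|lborel. indicator E (X s w))"
   by (rule set_integral_diff(2)[OF fin iE]) auto
  then show ?thesis using elim(4) that by (simp add: V_def set_lebesgue_integral_def)
 qed
 have diff: "0 <= V True t w - V True s w \<and> V True t w - V True s w <= t - s" if "0 <= s" "s <= t" for s t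
 proof -
  have un: "{0..t} = {0..s} \<union> {s<..t}" using that by auto
  have i: "set_integrable lborel {s<..t} (\<lambda>s. 1 - indicator E (X s w) :: real)"
   by (rule set_integrable_subset[OF iC[of t]]) (use that in auto)
  have "(LINT s:{0..t}|lborel. 1 - indicator E (X s w) :: real) = (LINT s:{0..s}|lborel. 1 - indicator E (X s w)) + (LINT s:{s<..t}|lborel. 1 - indicator E (X s w))"
   unfolding un by (rule set_integral_Un[OF _ iC i]) auto
  then have e: "V True t w - V True s w = (LINT s:{s<..t}|lborel. 1 - indicator E (X s w))" using VT that by simp
  have "0 <= (LINT s:{s<..t}|lborel. 1 - indicator E (X s w) :: real)"
   unfolding set_lebesgue_integral_def by (rule Bochner_Integration.integral_nonneg) (auto simp: indicator_def)
  moreover have "\<bar>LINT s:{s<..t}|lborel. 1 - indicator E (X s w) :: real\<bar> <= 1 * measure lborel {s<..t}"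
   by (rule set_integral_abs_le) (use that in \<open>auto simp: indicator_def\<close>)
  ultimately show ?thesis unfolding e using that by simp
 qed
 have VTm: "mono_on {0..} (\<lambda>t. V True t w)" using diff by (intro mono_onI) force
 have "1-lipschitz_on {0..} (\<lambda>t. V True t w)"
 proof (rule lipschitz_onI)
  fix s t :: real assume st: "s \<in> {0..}" "t \<in> {0..}"
  show "dist (V True s w) (V True t w) <= 1 * dist s t"
   using diff[of s t] diff[of t s] st by (cases "s <= t") (auto simp: dist_real_def)
 qed simp
 then have VTc: "continuous_on {0..} (\<lambda>t. V True t w)" by (rule lipschitz_on_continuous_on)
 have VT0: "V True 0 w = 0"
 proof -
  have "(LINT s:{0..0}|lborel. 1 - indicator E (X s w) :: real) = 0" unfolding set_lebesgue_integral_def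
  proof (rule integral_eq_zero_AE)
   show "AE s in lborel. indicator {0..0} s *\<^sub>R (1 - indicator E (X s w)) = (0::real)"
    using AE_lborel_singleton[of "0::real"] by eventually_elim auto
  qed
  then show ?thesis using VT[of 0] by simp
 qed
 have V: "mono_on {0..} (\<lambda>t. V b t w) \<and> continuous_on {0..} (\<lambda>t. V b t w) \<and> V b 0 w = 0" for b
  using VTm VTc VT0 Lm Lc L0 by (cases b) (auto simp: V_def[abs_def])
 \<comment> \<open>Negative times are null for a path measure; with the indicator the measure has
   the form that \<open>density_eqI_Icc\<close> compares.\<close>
 have pmT: "path_measure (V b) w = density (path_measure (V b) w) (\<lambda>s. ennreal (indicator {0..} s))" for b
 proof -
  have "AE s in path_measure (V b) w. (1::ennreal) = ennreal (indicator {0..} s)"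
   using path_measure_neg[where V="V b" and w=w] V[of b] by (auto elim!: eventually_mono)
  then have "density (path_measure (V b) w) (\<lambda>s. 1) = density (path_measure (V b) w) (\<lambda>s. ennreal (indicator {0..} s))"
   by (rule density_cong[rotated 2]) (auto simp: measurable_cong_sets[OF sets_path_measure refl])
  then show ?thesis by (simp add: density_1)
 qed
 have cg: "(LINT s:A|\<nu>. indicator {0..} s * a s * k s) = (LINT s:A|\<nu>. a s * (k s :: real))" if "A \<subseteq> {0..}" for A \<nu> a k
  unfolding set_lebesgue_integral_def by (intro Bochner_Integration.integral_cong refl) (use that in \<open>auto simp: indicator_def\<close>)
 have cg1: "(LINT s:A|\<nu>. indicator {0..} s * a s) = (LINT s:A|\<nu>. a s :: real)" if "A \<subseteq> {0..}" for A \<nu> a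
  using cg[OF that, of \<nu> a "\<lambda>_. 1"] by simp
 have full: "set_integrable (path_measure (V b) w) {0..t} (\<lambda>s. indicator {0..} s :: real)"
  "(LINT s:{0..t}|path_measure (V b) w. indicator {0..} s) = V b t w" if t: "0 <= t" for b t
 proof -
  have e: "emeasure (path_measure (V b) w) {0..t} = ennreal (V b t w)"
   using path_measure_Ioc(3)[where V="V b" and w=w, OF _ _ t] V[of b] by simp
  have eq: "(\<lambda>s. indicator {0..t} s *\<^sub>R indicator {0..} s) = (\<lambda>s. indicator {0..t} s :: real)"
   using t by (auto simp: indicator_def fun_eq_iff)
  show "set_integrable (path_measure (V b) w) {0..t} (\<lambda>s. indicator {0..} s :: real)"
   unfolding set_integrable_def eq by (rule integrable_real_indicator) (auto simp: sets_path_measure e)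
  have "0 <= V b t w" using V[of b] t mono_onD[of "{0..}" "\<lambda>t. V b t w" 0 t] by auto
  then show "(LINT s:{0..t}|path_measure (V b) w. indicator {0..} s) = V b t w"
   unfolding set_lebesgue_integral_def eq by (simp add: sets_path_measure measure_def e)
 qed
 let ?T = "path_measure (V True) w" and ?L = "path_measure L w"
 let ?c = "\<lambda>s. indicator {0..} s * (1 - indicator E (X s w)) :: real" and ?e = "\<lambda>s. indicator {0..} s * indicator E (X s w) :: real"
  and ?r = "\<lambda>s. indicator {0..} s * (indicator E (X s w) * \<rho> (X s w))"
 have VL: "V False = L" by (simp add: V_def[abs_def])
 have dT: "density ?T (\<lambda>s. ennreal (indicator {0..} s)) = density lborel (\<lambda>s. ennreal (?c s))"
 proof (rule density_eqI_Icc[OF sets_path_measure sets_lborel _ cmp])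
  fix t :: real assume t: "0 <= t"
  show "set_integrable lborel {0..t} ?c" by (rule fin[OF _ ]) (use cmp in \<open>auto simp: indicator_def\<close>)
  show "(LINT s:{0..t}|?T. indicator {0..} s) = (LINT s:{0..t}|lborel. ?c s)"
   using full(2)[OF t, of True] VT[OF t] cg1[of "{0..t}" lborel "\<lambda>s. 1 - indicator E (X s w)"] by simp
 qed (use full(1)[of _ True] in \<open>auto simp: indicator_def\<close>)
 have dS: "density lborel (\<lambda>s. ennreal (?e s)) = density ?L (\<lambda>s. ennreal (?r s))"
 proof (rule density_eqI_Icc[OF sets_lborel sets_path_measure eE e\<rho>])
  fix t :: real assume t: "0 <= t"
  show "set_integrable lborel {0..t} ?e" by (rule fin) (use eE in \<open>auto simp: indicator_def\<close>)
  have "set_integrable ?L {0..t} (\<lambda>s. indicator E (X s w) * \<rho> (X s w))" using elim(3) t by blast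
  also have "?this = set_integrable ?L {0..t} ?r"
   unfolding set_integrable_def by (intro arg_cong[where f="integrable ?L"]) (auto simp: indicator_def fun_eq_iff)
  finally show "set_integrable ?L {0..t} ?r" .
  show "(LINT s:{0..t}|lborel. ?e s) = (LINT s:{0..t}|?L. ?r s)"
   using elim(4) t cg1[of "{0..t}" lborel "\<lambda>s. indicator E (X s w)"] cg1[of "{0..t}" ?L "\<lambda>s. indicator E (X s w) * \<rho> (X s w)"]
   by (simp add: bdry_clock_def)
 qed (use \<rho>(2) in \<open>auto simp: indicator_def intro: less_imp_le\<close>)
 have transfer: "(LINT s:A|?T. k s) = (LINT s:A|lborel. (1 - indicator E (X s w)) * k s)"
  "(LINT s:A|lborel. indicator E (X s w) * k s) = (LINT s:A|?L. (indicator E (X s w) * \<rho> (X s w)) * (k s :: real))"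
  if A: "A \<in> sets borel" "A \<subseteq> {0..}" and k: "(\<lambda>s. indicator A s * k s) \<in> borel_measurable borel" for A k
 proof -
  have "(LINT s:A|?T. indicator {0..} s * k s) = (LINT s:A|lborel. ?c s * k s)"
   by (rule set_integral_density_transfer[OF sets_path_measure sets_lborel _ cmp _ _ dT k]) (auto simp: indicator_def)
  then show "(LINT s:A|?T. k s) = (LINT s:A|lborel. (1 - indicator E (X s w)) * k s)"
   unfolding cg[OF A(2)] cg1[OF A(2)] .
  have "(LINT s:A|lborel. ?e s * k s) = (LINT s:A|?L. ?r s * k s)"
   by (rule set_integral_density_transfer[OF sets_lborel sets_path_measure eE e\<rho> _ _ dS k]) (use \<rho>(2) in \<open>auto simp: indicator_def intro: less_imp_le\<close>)
  then show "(LINT s:A|lborel. indicator E (X s w) * k s) = (LINT s:A|?L. (indicator E (X s w) * \<rho> (X s w)) * k s)"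
   unfolding cg[OF A(2)] .
 qed
 have suppT: "AE s in ?T. 0 <= s --> X s w \<notin> E"
  by (subst pmT[of True], unfold dT, subst AE_density) (use cmp in \<open>auto simp: indicator_def\<close>)
 \<comment> \<open>Both \<open>1\<close> and the indicator of \<open>E\<close> integrate to
   \<open>L (real n) w\<close> over \<open>{0..real n}\<close>, so the nonnegative difference
   integrates to zero.\<close>
 have suppL: "AE s in ?L. 0 <= s --> X s w \<in> E"
 proof -
  have "AE s in ?L. s \<in> {0..real n} --> X s w \<in> E" for n
  proof -
   let ?k = "\<lambda>s. indicator {0..real n} s * (1 - indicator E (X s w)) :: real"
   have mk: "?k \<in> borel_measurable borel"
   proof -
    have "(\<lambda>s. indicator {0..real n} s * ?c s) \<in> borel_measurable borel" using cmp by simp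
    also have "(\<lambda>s. indicator {0..real n} s * ?c s) = ?k" by (auto simp: indicator_def fun_eq_iff)
    finally show ?thesis .
   qed
   have eL: "emeasure ?L {0..real n} = ennreal (L (real n) w)"
    using path_measure_Ioc(3)[where V=L and w=w, OF Lm Lc, of "real n"] L0 by simp
   have i1: "integrable ?L (\<lambda>s. indicator {0..real n} s :: real)"
   proof (rule integrable_real_indicator)
    show "{0..real n} \<in> sets ?L" unfolding sets_path_measure by simp
    show "emeasure ?L {0..real n} < \<infinity>" unfolding eL by simp
   qed
   have ik: "integrable ?L ?k"
   proof (rule Bochner_Integration.integrable_bound[OF i1])
    show "?k \<in> borel_measurable ?L" by (subst measurable_cong_sets[OF sets_path_measure refl]) (rule mk)
    show "AE s in ?L. norm (?k s) <= norm (indicator {0..real n} s :: real)"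
    proof (intro AE_I2)
     fix s show "norm (?k s) <= norm (indicator {0..real n} s :: real)"
      by (cases "s \<in> {0..real n}"; cases "X s w \<in> E") simp_all
    qed
   qed
   have ie: "integrable ?L (\<lambda>s. indicator {0..real n} s * indicator E (X s w) :: real)"
    using Bochner_Integration.integrable_diff[OF i1 ik] by (simp add: right_diff_distrib)
   have "(\<integral>s. ?k s \<partial>?L) = (\<integral>s. indicator {0..real n} s \<partial>?L) - (\<integral>s. indicator {0..real n} s * indicator E (X s w) \<partial>?L)"
    unfolding right_diff_distrib mult_1_right by (rule Bochner_Integration.integral_diff[OF i1 ie])
   also have "(\<integral>s. indicator {0..real n} s * indicator E (X s w) \<partial>?L) = L (real n) w"
    using elim(2)[rule_format, of "real n"] by (simp add: set_lebesgue_integral_def)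
   also have "(\<integral>s. indicator {0..real n} s \<partial>?L) = L (real n) w"
    using full(2)[of "real n" False] cg1[of "{0..real n}" ?L "\<lambda>_. 1"] unfolding VL by (simp add: set_lebesgue_integral_def)
   finally have "(\<integral>s. ?k s \<partial>?L) = 0" by simp
   then have "AE s in ?L. ?k s = 0"
    using integral_nonneg_eq_0_iff_AE[OF ik] by (auto simp: indicator_def)
   then show ?thesis by eventually_elim (auto simp: indicator_def split: if_splits)
  qed
  then have "AE s in ?L. \<forall>n. s \<in> {0..real n} --> X s w \<in> E" by (simp only: AE_all_countable simp_thms)
  then show ?thesis
  proof eventually_elim
   case (elim s)
   obtain n :: nat where "s <= real n" using real_arch_simple by blast
   then show ?case using elim by auto
  qed
 qed
 have supp: "AE s in path_measure (V b) w. 0 <= s --> (X s w \<in> E \<longleftrightarrow> \<not> b)" for b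
 proof -
  have "AE s in path_measure (V True) w. 0 <= s --> (X s w \<in> E \<longleftrightarrow> \<not> True)" using suppT by simp
  moreover have "AE s in path_measure (V False) w. 0 <= s --> (X s w \<in> E \<longleftrightarrow> \<not> False)" unfolding VL using suppL by simp
  ultimately show ?thesis by (rule bool.induct)
 qed
 show ?case
 proof (rule conjI, use V in blast, rule conjI, use supp in blast, intro allI impI)
  fix A :: "real set" and k assume "A \<in> sets borel" "A \<subseteq> {0..}" "(\<lambda>s. indicator A s * k s :: real) \<in> borel_measurable borel"
  then show "(LINT s:A|?T. k s) = (LINT s:A|lborel. (1 - indicator E (X s w)) * k s)
   \<and> (LINT s:A|lborel. indicator E (X s w) * k s) = (LINT s:A|?L. (indicator E (X s w) * \<rho> (X s w)) * k s)"
   using transfer by blast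
 qed
qed

end

section \<open>Removal of the exit time, and averages over time\<close>

context driven_diffusion
begin

text \<open>The level and the horizon leave the locale parameters here, so that the level can tend
  to infinity.\<close>

lemma stopped_dynkin_hit:
 fixes f :: "real^'d => real" and p :: "'d => real^'d => real" and q :: "'d => 'd => real^'d => real" and n :: nat
 assumes T: "0 <= T" and f: "continuous_on S f" "\<And>x. x \<in> S ==> \<bar>f x\<bar> <= G"
  and p: "\<And>i. continuous_on S (p i)" "\<And>i x. x \<in> S ==> \<bar>p i x\<bar> <= G"
  and q: "\<And>i j. continuous_on S (q i j)" "\<And>i j x. x \<in> S ==> \<bar>q i j x\<bar> <= G"
  and taylor: "\<And>A \<epsilon>. compact A ==> A \<subseteq> S ==> 0 < \<epsilon> ==> \<exists>\<delta>>0. \<forall>x\<in>A. \<forall>y\<in>A. dist y x < \<delta> -->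
   \<bar>f y - f x - (\<Sum>i\<in>UNIV. p i x * (y - x) $ i) - 1/2 * (\<Sum>i\<in>UNIV. \<Sum>j\<in>UNIV. q i j x * (y - x) $ i * (y - x) $ j)\<bar> <= \<epsilon> * (dist y x)\<^sup>2"
 defines "\<theta> \<equiv> hit Z T (real n)"
 defines "I w \<equiv> (\<Sum>i\<in>UNIV. \<Sum>b\<in>UNIV. LINT s:{0<..\<theta> w}|path_measure (V b) w. p i (X s w) * \<beta> b i (X s w))
  + 1/2 * (\<Sum>i\<in>UNIV. \<Sum>j\<in>UNIV. \<Sum>b\<in>UNIV. \<Sum>k\<in>UNIV. LINT s:{0<..\<theta> w}|path_measure (V b) w. q i j (X s w) * (h b i k (X s w) * h b j k (X s w)))"
 shows "integrable M (\<lambda>w. f (X (\<theta> w) w))" "integrable M I"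
  "(\<integral>w. f (X (\<theta> w) w) \<partial>M) - (\<integral>w. f (X 0 w) \<partial>M) = (\<integral>w. I w \<partial>M)"
proof -
 interpret stopped_diffusion M F X x0 S E V N H K h \<beta> C \<psi> T n by unfold_locales (rule T)
 note * = stopped_dynkin[OF f p q taylor, unfolded \<tau>_def]
 show "integrable M (\<lambda>w. f (X (\<theta> w) w))" "integrable M I"
  "(\<integral>w. f (X (\<theta> w) w) \<partial>M) - (\<integral>w. f (X 0 w) \<partial>M) = (\<integral>w. I w \<partial>M)"
  unfolding \<theta>_def I_def by (rule *; assumption)+
qed

lemma lborel_Ioc_finite: "emeasure lborel {0<..t::real} < \<infinity>"
 by (rule le_less_trans[OF emeasure_mono emeasure_lborel_cbox_finite[of 0 t]]) (auto simp: cbox_interval)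

lemma time_integral_bound:
 assumes g: "\<And>x. x \<in> S ==> \<bar>g x\<bar> <= G" and w: "w \<in> space M" and t: "0 <= t"
 shows "\<bar>LINT s:{0<..t}|lborel. g (X s w)\<bar> <= G * t"
proof -
 have "0 <= G" using g[OF X_S[OF w, of 0]] by simp
 then have "\<bar>LINT s:{0<..t}|lborel. g (X s w)\<bar> <= G * measure lborel {0<..t}"
  by (intro set_integral_abs_le lborel_Ioc_finite) (use g X_S[OF w] in auto)
 then show ?thesis using t by simp
qed

text \<open>The clocks need not be bounded, so the stopped right-hand side has no evident majorant
  as the exit level grows. The hypothesis \<open>clocks\<close> first turns it into a time integral
  of the bounded function \<open>g\<close>, after which domination by \<open>G' * T\<close>
  applies.\<close>

lemma dynkin:
 fixes f g :: "real^'d => real" and p :: "'d => real^'d => real" and q :: "'d => 'd => real^'d => real"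
 assumes T: "0 <= T" and f: "continuous_on S f" "\<And>x. x \<in> S ==> \<bar>f x\<bar> <= G"
  and p: "\<And>i. continuous_on S (p i)" "\<And>i x. x \<in> S ==> \<bar>p i x\<bar> <= G"
  and q: "\<And>i j. continuous_on S (q i j)" "\<And>i j x. x \<in> S ==> \<bar>q i j x\<bar> <= G"
  and taylor: "\<And>A \<epsilon>. compact A ==> A \<subseteq> S ==> 0 < \<epsilon> ==> \<exists>\<delta>>0. \<forall>x\<in>A. \<forall>y\<in>A. dist y x < \<delta> -->
   \<bar>f y - f x - (\<Sum>i\<in>UNIV. p i x * (y - x) $ i) - 1/2 * (\<Sum>i\<in>UNIV. \<Sum>j\<in>UNIV. q i j x * (y - x) $ i * (y - x) $ j)\<bar> <= \<epsilon> * (dist y x)\<^sup>2"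
  and g: "\<And>x. x \<in> S ==> \<bar>g x\<bar> <= G'"
  and clocks: "AE w in M. \<forall>t\<ge>0. (\<Sum>i\<in>UNIV. \<Sum>b\<in>UNIV. LINT s:{0<..t}|path_measure (V b) w. p i (X s w) * \<beta> b i (X s w))
   + 1/2 * (\<Sum>i\<in>UNIV. \<Sum>j\<in>UNIV. \<Sum>b\<in>UNIV. \<Sum>k\<in>UNIV. LINT s:{0<..t}|path_measure (V b) w. q i j (X s w) * (h b i k (X s w) * h b j k (X s w)))
   = (LINT s:{0<..t}|lborel. g (X s w))"
 shows "(\<integral>w. f (X T w) \<partial>M) - (\<integral>w. f (X 0 w) \<partial>M) = (\<integral>w. (LINT s:{0<..T}|lborel. g (X s w)) \<partial>M)"
proof -
 define \<theta> where "\<theta> n w = hit Z T (real n) w" for n w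
 have \<theta>: "0 <= \<theta> n w" "\<theta> n w <= T" for n w unfolding \<theta>_def using hit_bounds[OF T] by auto
 define I where "I n w = (\<Sum>i\<in>UNIV. \<Sum>b\<in>UNIV. LINT s:{0<..\<theta> n w}|path_measure (V b) w. p i (X s w) * \<beta> b i (X s w))
  + 1/2 * (\<Sum>i\<in>UNIV. \<Sum>j\<in>UNIV. \<Sum>b\<in>UNIV. \<Sum>k\<in>UNIV. LINT s:{0<..\<theta> n w}|path_measure (V b) w. q i j (X s w) * (h b i k (X s w) * h b j k (X s w)))" for n w
 have d: "integrable M (\<lambda>w. f (X (\<theta> n w) w))" "integrable M (I n)"
  "(\<integral>w. f (X (\<theta> n w) w) \<partial>M) - (\<integral>w. f (X 0 w) \<partial>M) = (\<integral>w. I n w \<partial>M)" for n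
  unfolding I_def[abs_def] \<theta>_def by (rule stopped_dynkin_hit[OF T f p q taylor]; assumption)+
 have ev: "AE w in M. \<forall>\<^sub>F n in sequentially. \<theta> n w = T" unfolding \<theta>_def by (rule hit_eventually[OF Z_cont T])
 have "(\<lambda>n. \<integral>w. f (X (\<theta> n w) w) \<partial>M) \<longlonglongrightarrow> (\<integral>w. f (X T w) \<partial>M)"
 proof (rule bounded_AE_LIMSEQ(3))
  show "(\<lambda>w. f (X (\<theta> n w) w)) \<in> borel_measurable M" for n by (rule borel_measurable_integrable[OF d(1)])
  show "AE w in M. \<bar>f (X (\<theta> n w) w)\<bar> <= G" for n by (intro AE_I2 f(2) X_S \<theta>(1))
  show "AE w in M. (\<lambda>n. f (X (\<theta> n w) w)) \<longlonglongrightarrow> f (X T w)"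
   using ev by eventually_elim (rule tendsto_eventually, elim eventually_mono, simp)
 qed
 then have 1: "(\<lambda>n. (\<integral>w. f (X (\<theta> n w) w) \<partial>M) - (\<integral>w. f (X 0 w) \<partial>M)) \<longlonglongrightarrow> (\<integral>w. f (X T w) \<partial>M) - (\<integral>w. f (X 0 w) \<partial>M)"
  by (intro tendsto_intros)
 have Ig: "AE w in M. \<forall>n. I n w = (LINT s:{0<..\<theta> n w}|lborel. g (X s w))"
  using clocks by eventually_elim (use \<theta>(1) in \<open>simp add: I_def\<close>)
 have 2: "(\<lambda>n. \<integral>w. I n w \<partial>M) \<longlonglongrightarrow> (\<integral>w. (LINT s:{0<..T}|lborel. g (X s w)) \<partial>M)"
 proof (rule bounded_AE_LIMSEQ(3))
  show "I n \<in> borel_measurable M" for n by (rule borel_measurable_integrable[OF d(2)])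
  show "AE w in M. \<bar>I n w\<bar> <= G' * T" for n using Ig AE_space
  proof eventually_elim
   case (elim w)
   have "0 <= G'" using g[OF X_S[OF elim(2), of 0]] by simp
   then show ?case unfolding spec[OF elim(1), of n]
    using time_integral_bound[where g=g and G=G', OF g elim(2) \<theta>(1)[of n w]] mult_left_mono[OF \<theta>(2)[of n w], of G'] by linarith
  qed
  show "AE w in M. (\<lambda>n. I n w) \<longlonglongrightarrow> (LINT s:{0<..T}|lborel. g (X s w))" using Ig ev
  proof eventually_elim
   case (elim w)
   have "\<forall>\<^sub>F n in sequentially. I n w = (LINT s:{0<..T}|lborel. g (X s w))"
    using elim(2) by (rule eventually_mono) (simp add: elim(1))
   then show ?case by (rule tendsto_eventually)
  qed
 qed
 show ?thesis by (rule LIMSEQ_unique[OF 1 2[folded d(3)]])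
qed

text \<open>Riemann sums take the place of Fubini's theorem: the time integral is their limit on
  every path, and the expectation of each sum is an average of the expectations in
  \<open>close\<close>.\<close>

lemma time_average:
 fixes g :: "real^'d => real"
 assumes T: "0 <= T" and g: "continuous_on S g" "\<And>x. x \<in> S ==> \<bar>g x\<bar> <= G"
  and close: "\<And>s. 0 <= s ==> s <= T ==> \<bar>(\<integral>w. g (X s w) \<partial>M) - a\<bar> <= e"
 shows "\<bar>(\<integral>w. (LINT s:{0<..T}|lborel. g (X s w)) \<partial>M) - T * a\<bar> <= T * e"
proof -
 let ?A = "\<lambda>m w. \<Sum>r<Suc m. g (X (pt T m r) w) * (T / real (Suc m))"
 have gi: "integrable M (\<lambda>w. g (X (pt T m r) w))" for m r
  by (rule integrable_AE_bounded[where c=G, OF meas_M[OF g_meas[OF g(1) pt_simps(3)[OF T]]]]) (rule AE_I2, intro g(2) X_S pt_simps(3)[OF T])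
 have lim: "(\<lambda>m. \<integral>w. ?A m w \<partial>M) \<longlonglongrightarrow> (\<integral>w. (LINT s:{0<..T}|lborel. g (X s w)) \<partial>M)"
 proof (rule bounded_AE_LIMSEQ(3))
  show "?A m \<in> borel_measurable M" for m
   by (intro borel_measurable_sum borel_measurable_times borel_measurable_const borel_measurable_integrable[OF gi])
  show "AE w in M. \<bar>?A m w\<bar> <= G * T" for m
  proof (rule AE_I2)
   fix w assume w: "w \<in> space M"
   have "\<bar>?A m w\<bar> <= (\<Sum>r<Suc m. G * (T / real (Suc m)))"
   proof (rule order_trans[OF sum_abs sum_mono])
    fix r
    have "\<bar>g (X (pt T m r) w)\<bar> <= G" by (intro g(2) X_S[OF w] pt_simps(3)[OF T])
    then show "\<bar>g (X (pt T m r) w) * (T / real (Suc m))\<bar> <= G * (T / real (Suc m))"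
     unfolding abs_mult using T by (intro mult_mono) auto
   qed
   also have "\<dots> = G * T" by (simp only: sum_constant card_lessThan) simp
   finally show "\<bar>?A m w\<bar> <= G * T" .
  qed
  show "AE w in M. (\<lambda>m. ?A m w) \<longlonglongrightarrow> (LINT s:{0<..T}|lborel. g (X s w))"
  proof (rule AE_I2)
   fix w assume w: "w \<in> space M"
   have c: "continuous_on {0..T} (\<lambda>s. g (X s w))"
    by (rule continuous_on_compose2[where t=S, OF g(1)]) (use X_cont X_S[OF w] w in \<open>auto simp: continuous_paths_def intro: continuous_on_subset\<close>)
   have ww: "(LINT s:{min (pt T m r) T<..min (pt T m (Suc r)) T}|lborel. (1::real)) = T / real (Suc m)" if "r < Suc m" for m r
    using pt_simps(4,5)[OF T, of m r] pt_simps(6)[OF T, of r m] pt_simps(6)[OF T, of "Suc r" m] that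
    by (simp add: set_lebesgue_integral_def min_absorb1)
   have "(\<lambda>m. \<Sum>r<Suc m. g (X (pt T m r) w) * (LINT s:{min (pt T m r) T<..min (pt T m (Suc r)) T}|lborel. 1))
    \<longlonglongrightarrow> (LINT s:{0<..T}|lborel. g (X s w) * 1)"
    by (rule riemann_sum_LIMSEQ[where g="\<lambda>s. g (X s w)" and b="\<lambda>_. 1" and B=1, OF sets_lborel T T order_refl lborel_Ioc_finite c]) auto
   moreover have "(\<Sum>r<Suc m. g (X (pt T m r) w) * (LINT s:{min (pt T m r) T<..min (pt T m (Suc r)) T}|lborel. 1)) = ?A m w" for m
    by (rule sum.cong[OF refl]) (use ww in \<open>simp del: of_nat_Suc\<close>)
   ultimately show "(\<lambda>m. ?A m w) \<longlonglongrightarrow> (LINT s:{0<..T}|lborel. g (X s w))" by (simp only: mult_1_right)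
  qed
 qed
 have "\<bar>(\<integral>w. ?A m w \<partial>M) - T * a\<bar> <= T * e" for m
 proof -
  have "(\<integral>w. ?A m w \<partial>M) = (\<Sum>r<Suc m. (\<integral>w. g (X (pt T m r) w) \<partial>M) * (T / real (Suc m)))"
   by (simp only: Bochner_Integration.integral_sum integrable_mult_left gi integral_mult_left_zero)
  moreover have "T * a = (\<Sum>r<Suc m. a * (T / real (Suc m)))" by (simp only: sum_constant card_lessThan) simp
  ultimately have eq: "(\<integral>w. ?A m w \<partial>M) - T * a = (\<Sum>r<Suc m. ((\<integral>w. g (X (pt T m r) w) \<partial>M) - a) * (T / real (Suc m)))"
   by (simp only: sum_subtractf left_diff_distrib)
  have "\<bar>\<Sum>r<Suc m. ((\<integral>w. g (X (pt T m r) w) \<partial>M) - a) * (T / real (Suc m))\<bar> <= (\<Sum>r<Suc m. e * (T / real (Suc m)))"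
  proof (rule order_trans[OF sum_abs sum_mono])
   fix r assume "r \<in> {..<Suc m}"
   then have "\<bar>(\<integral>w. g (X (pt T m r) w) \<partial>M) - a\<bar> <= e" using pt_simps(3,6)[OF T] by (intro close) auto
   then show "\<bar>((\<integral>w. g (X (pt T m r) w) \<partial>M) - a) * (T / real (Suc m))\<bar> <= e * (T / real (Suc m))"
    unfolding abs_mult using T by (intro mult_mono) auto
  qed
  also have "\<dots> = T * e" by (simp only: sum_constant card_lessThan) simp
  finally show ?thesis unfolding eq .
 qed
 then show ?thesis by (intro LIMSEQ_le_const2[OF tendsto_rabs[OF tendsto_diff[OF lim tendsto_const]]]) blast
qed

end

lemma linear_set_integral:
 fixes u :: "'d::finite => real => real" and v :: "'d => 'd => 'd => real => real"
 assumes u: "\<And>i. set_integrable \<nu> A (u i)" and v: "\<And>i j k. set_integrable \<nu> A (v i j k)"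
 shows "(\<Sum>i\<in>UNIV. LINT s:A|\<nu>. u i s) + 1/2 * (\<Sum>i\<in>UNIV. \<Sum>j\<in>UNIV. \<Sum>k\<in>UNIV. LINT s:A|\<nu>. v i j k s)
  = (LINT s:A|\<nu>. (\<Sum>i\<in>UNIV. u i s) + 1/2 * (\<Sum>i\<in>UNIV. \<Sum>j\<in>UNIV. \<Sum>k\<in>UNIV. v i j k s))"
proof -
 have eq: "indicator A s *\<^sub>R ((\<Sum>i\<in>UNIV. u i s) + 1/2 * (\<Sum>i\<in>UNIV. \<Sum>j\<in>UNIV. \<Sum>k\<in>UNIV. v i j k s))
  = (\<Sum>i\<in>UNIV. indicator A s *\<^sub>R u i s) + 1/2 * (\<Sum>i\<in>UNIV. \<Sum>j\<in>UNIV. \<Sum>k\<in>UNIV. indicator A s *\<^sub>R v i j k s)" for s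
  by (cases "s \<in> A") simp_all
 note i = u[unfolded set_integrable_def] v[unfolded set_integrable_def]
 show ?thesis unfolding set_lebesgue_integral_def eq
  by (simp only: Bochner_Integration.integral_add Bochner_Integration.integral_sum integral_mult_right_zero integrable_mult_right
   Bochner_Integration.integrable_sum i)
qed

section \<open>Dynkin's formula for the sticky solution\<close>

context sticky_solution
begin

text \<open>The boundary equation is stated with the factor \<open>\<rho>\<close> multiplied out: it
  then matches the integrals against \<open>dL\<close> directly, and \<open>\<rho> dL = dt\<close>
  on \<open>E\<close> brings back Lebesgue time.\<close>

lemma sticky_dynkin:
 fixes f g :: "real^'d => real" and p :: "'d => real^'d => real" and q :: "'d => 'd => real^'d => real"
 assumes f: "continuous_on S f" "\<And>x. x \<in> S ==> \<bar>f x\<bar> <= G"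
  and p: "\<And>i. continuous_on S (p i)" "\<And>i x. x \<in> S ==> \<bar>p i x\<bar> <= G"
  and q: "\<And>i j. continuous_on S (q i j)" "\<And>i j x. x \<in> S ==> \<bar>q i j x\<bar> <= G"
  and taylor: "\<And>A \<epsilon>. compact A ==> A \<subseteq> S ==> 0 < \<epsilon> ==> \<exists>\<delta>>0. \<forall>x\<in>A. \<forall>y\<in>A. dist y x < \<delta> -->
   \<bar>f y - f x - (\<Sum>i\<in>UNIV. p i x * (y - x) $ i) - 1/2 * (\<Sum>i\<in>UNIV. \<Sum>j\<in>UNIV. q i j x * (y - x) $ i * (y - x) $ j)\<bar> <= \<epsilon> * (dist y x)\<^sup>2"
  and g: "continuous_on S g" "\<And>x. x \<in> S ==> \<bar>g x\<bar> <= G'"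
  and bulk: "\<And>y. y \<in> S ==> g y = (\<Sum>i\<in>UNIV. p i y * \<mu> y $ i) + 1/2 * (\<Sum>i\<in>UNIV. \<Sum>j\<in>UNIV. \<Sum>k\<in>UNIV. q i j y * (\<sigma> y $ i $ k * \<sigma> y $ j $ k))"
  and bdry: "\<And>y. y \<in> E ==> \<rho> y * g y = (\<Sum>i\<in>UNIV. p i y * \<beta> y $ i) + 1/2 * (\<Sum>i\<in>UNIV. \<Sum>j\<in>UNIV. \<Sum>k\<in>UNIV. q i j y * (\<Gamma> y $ i $ k * \<Gamma> y $ j $ k))"
  and T: "0 <= T" and close: "\<And>s. 0 <= s ==> s <= T ==> \<bar>(\<integral>w. g (X s w) \<partial>M) - a\<bar> <= e"
 shows "\<bar>(\<integral>w. f (X T w) \<partial>M) - (\<integral>w. f (X 0 w) \<partial>M) - T * a\<bar> <= T * e"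
proof -
 obtain I J :: "'d => 'd => real => 'w => real" where
  I: "\<And>i j. ito_integral M F (\<lambda>t w. \<sigma> (X t w) $ i $ j) (\<lambda>t w. W t w $ j) (I i j)"
  and J: "\<And>i j. ito_integral M F (\<lambda>t w. indicator E (X t w) * \<Gamma> (X t w) $ i $ j) (\<lambda>t w. B (L t w) w $ j) (J i j)"
  and dec: "AE w in M. \<forall>t\<ge>0. X t w = x + (LINT s:{0..t}|lborel. \<mu> (X s w))
       - (LINT s:{0..t}|path_measure L w. (indicator E (X s w) * \<rho> (X s w)) *\<^sub>R \<mu> (X s w))
       + (\<chi> i. \<Sum>j\<in>UNIV. I i j t w)
       + (LINT s:{0..t}|path_measure L w. indicator E (X s w) *\<^sub>R \<beta> (X s w))
       + (\<chi> i. \<Sum>j\<in>UNIV. J i j t w)"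
  using sol unfolding weak_solution_def by blast
 \<comment> \<open>\<open>\<Gamma>\<close> lives on \<open>E\<close> only, whereas a continuous
   coefficient on all of \<open>S\<close> is called for. Tietze's theorem extends each entry with
   the same bound; the boundary clock sees only states in \<open>E\<close>, where nothing has
   changed.\<close>
 have "\<exists>\<gamma> :: real^'d => real. continuous_on UNIV \<gamma> \<and> (\<forall>y\<in>E. \<gamma> y = \<Gamma> y $ i $ j) \<and> (\<forall>y. \<bar>\<gamma> y\<bar> <= C)" for i j
 proof (rule Tietze[where S=E and U=UNIV and B=C and f="\<lambda>y. \<Gamma> y $ i $ j"])
  show "continuous_on E (\<lambda>y. \<Gamma> y $ i $ j)" by (intro continuous_on_component \<Gamma>(1))
  show "closedin (top_of_set UNIV) E" using closed_sets(2) by simp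
  show "norm (\<Gamma> y $ i $ j) <= C" if "y \<in> E" for y using \<Gamma>(2)[OF that] by simp
 qed (use C in auto)
 then obtain \<gamma> :: "'d => 'd => real^'d => real" where \<gamma>: "\<And>i j. continuous_on UNIV (\<gamma> i j)" "\<And>i j y. y \<in> E ==> \<gamma> i j y = \<Gamma> y $ i $ j" "\<And>i j y. \<bar>\<gamma> i j y\<bar> <= C"
  by metis
 define N where "N b j t w = (if b then W t w $ j else B (L t w) w $ j)" for b j t w
 define H where "H b i j t w = (if b then \<sigma> (X t w) $ i $ j else indicator E (X t w) * \<Gamma> (X t w) $ i $ j)" for b i j t w
 define K where "K b = (if b then I else J)" for b
 define h where "h b i j y = (if b then \<sigma> y $ i $ j else \<gamma> i j y)" for b i j y
 define bb where "bb b i y = (if b then \<mu> y $ i else indicator E y * \<beta> y $ i)" for b i y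
 \<comment> \<open>Steepened copies of the defining function \<open>\<Phi>\<close>, capped at
   \<open>1\<close>, separate the boundary from the interior.\<close>
 define \<psi> where "\<psi> m y = min 1 (real m * \<Phi> y)" for m y
 have S0: "y \<in> S \<longleftrightarrow> 0 <= \<Phi> y" and E0: "y \<in> E \<longleftrightarrow> \<Phi> y = 0" for y by (simp_all add: closed_domain_eq bdry_of_def)
 have br: "bracket M F (N b i) (N b j) (\<lambda>t w. if i = j then V b t w else 0)" for b i j
 proof -
  have 1: "bracket M F (\<lambda>t w. W t w $ i) (\<lambda>t w. W t w $ j) (\<lambda>t w. if i = j then t - bdry_clock \<Phi> \<rho> X L t w else 0)"
   and 2: "bracket M F (\<lambda>t w. B (L t w) w $ i) (\<lambda>t w. B (L t w) w $ j) (\<lambda>t w. if i = j then L t w else 0)"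
   using sol unfolding weak_solution_def by blast+
  have "bracket M F (N True i) (N True j) (\<lambda>t w. if i = j then V True t w else 0)"
   "bracket M F (N False i) (N False j) (\<lambda>t w. if i = j then V False t w else 0)"
   unfolding N_def[abs_def] V_def[abs_def] if_True if_False by (rule 1, rule 2)
  then show ?thesis by (rule bool.induct)
 qed
 have bbm: "(\<lambda>s. indicator {0..} s * bb b i (X s w)) \<in> borel_measurable borel" if w: "w \<in> space M" for b i w
 proof (cases b)
  case True
  then show ?thesis unfolding bb_def using path_meas_S[OF w, of "\<lambda>y. \<mu> y $ i"] \<mu>(1) by (simp add: continuous_on_component)
 next
  case False
  then show ?thesis unfolding bb_def using path_meas[OF w \<beta>_borel[of i]] by simp
 qed
 have bbb: "\<bar>bb b i y\<bar> <= C" if "y \<in> S" for b i y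
  using \<mu>(2)[OF that] \<beta>(2)[of y] C by (auto simp: bb_def indicator_def)
 have hc: "continuous_on S (h b i j)" for b i j
  unfolding h_def[abs_def] using \<sigma>(1) continuous_on_subset[OF \<gamma>(1)] by (cases b) (auto intro!: continuous_on_component)
 have hb: "\<bar>h b i j y\<bar> <= C" if "y \<in> S" for b i j y using \<sigma>(2)[OF that] \<gamma>(3) by (simp add: h_def)
 \<comment> \<open>The drift \<open>\<mu>\<close> against \<open>dt - \<rho> dL\<close> is regrouped
   as an integral against the bulk clock: by the sojourn condition the subtracted part is the
   Lebesgue time on \<open>E\<close>.\<close>
 have comp: "AE w in M. \<forall>t\<ge>0. \<forall>i. X t w $ i = x $ i
    + (\<Sum>b\<in>UNIV. LINT s:{0..t}|path_measure (V b) w. bb b i (X s w)) + (\<Sum>b\<in>UNIV. \<Sum>j\<in>UNIV. K b i j t w)"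
  using dec clock_paths L_facts AE_space
 proof eventually_elim
  case (elim w)
  note w = elim(7)
  show ?case
  proof (intro allI impI)
   fix t :: real and i assume t: "0 <= t"
   have VL: "V False = L" by (simp add: V_def[abs_def])
   have Lm: "mono_on {0..} (\<lambda>t. L t w)" "continuous_on {0..} (\<lambda>t. L t w)" using elim(3) by blast+
   have eL: "emeasure (path_measure L w) {0..t} < \<infinity>" using path_measure_Ioc(3)[where V=L and w=w, OF Lm t] by simp
   have vm: "(\<lambda>s. indicator {0..t} s *\<^sub>R (indicator E' (X s w) *\<^sub>R v (X s w))) \<in> borel_measurable borel"
    if v: "continuous_on E' v" "closed E'" for v :: "real^'d => real^'d" and E'
   proof -
    have b: "(\<lambda>y. indicator E' y *\<^sub>R v y) \<in> borel_measurable borel" by (rule borel_measurable_continuous_on_indicator[OF _ v(1)]) (use v(2) in simp)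
    have "continuous_on UNIV (\<lambda>s. X (max 0 s) w)"
     by (rule continuous_on_compose2[OF X_paths(1)[OF w]]) (auto intro!: continuous_intros)
    then have "(\<lambda>s. indicator {0..t} s *\<^sub>R (indicator E' (X (max 0 s) w) *\<^sub>R v (X (max 0 s) w))) \<in> borel_measurable borel"
     by (intro borel_measurable_scaleR[OF _ measurable_compose[OF borel_measurable_continuous_onI b]]) simp
    also have "(\<lambda>s. indicator {0..t} s *\<^sub>R (indicator E' (X (max 0 s) w) *\<^sub>R v (X (max 0 s) w))) = (\<lambda>s. indicator {0..t} s *\<^sub>R (indicator E' (X s w) *\<^sub>R v (X s w)))"
     by (auto simp: indicator_def fun_eq_iff max_def)
    finally show ?thesis .
   qed
   have nv: "norm v <= real CARD('d) * C" if "\<And>i. \<bar>v $ i\<bar> <= C" for v :: "real^'d"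
    using order_trans[OF norm_le_l1_cart sum_mono[of UNIV "\<lambda>i. \<bar>v $ i\<bar>" "\<lambda>_. C"]] that by simp
   have SX: "X s w \<in> S" if "0 <= s" for s by (rule X_paths(2)[OF w that])
   have i1: "integrable lborel (\<lambda>s. indicator {0..t} s *\<^sub>R \<mu> (X s w))"
   proof (rule Bochner_Integration.integrable_bound[of _ "\<lambda>s. indicator {0..t} s *\<^sub>R (real CARD('d) * C)"])
    show "integrable lborel (\<lambda>s. indicator {0..t} s *\<^sub>R (real CARD('d) * C))"
     using emeasure_lborel_cbox_finite[of 0 t] by (intro integrable_scaleR_left integrable_real_indicator) (auto simp: cbox_interval)
    have "(\<lambda>s. indicator {0..t} s *\<^sub>R (indicator S (X s w) *\<^sub>R \<mu> (X s w))) = (\<lambda>s. indicator {0..t} s *\<^sub>R \<mu> (X s w))"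
     using SX by (auto simp: indicator_def fun_eq_iff)
    then show "(\<lambda>s. indicator {0..t} s *\<^sub>R \<mu> (X s w)) \<in> borel_measurable lborel" using vm[OF \<mu>(1) closed_sets(1)] by simp
    show "AE s in lborel. norm (indicator {0..t} s *\<^sub>R \<mu> (X s w)) <= norm (indicator {0..t} s *\<^sub>R (real CARD('d) * C))"
     using nv[OF \<mu>(2)[OF SX]] C by (intro AE_I2) (auto simp: indicator_def)
   qed
   have i3: "integrable (path_measure L w) (\<lambda>s. indicator {0..t} s *\<^sub>R (indicator E (X s w) *\<^sub>R \<beta> (X s w)))"
   proof (rule Bochner_Integration.integrable_bound[of _ "\<lambda>s. indicator {0..t} s *\<^sub>R (real CARD('d) * C)"])
    show "integrable (path_measure L w) (\<lambda>s. indicator {0..t} s *\<^sub>R (real CARD('d) * C))"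
     using eL by (intro integrable_scaleR_left integrable_real_indicator) (auto simp: sets_path_measure)
    show "(\<lambda>s. indicator {0..t} s *\<^sub>R (indicator E (X s w) *\<^sub>R \<beta> (X s w))) \<in> borel_measurable (path_measure L w)"
     by (subst measurable_cong_sets[OF sets_path_measure refl]) (rule vm[OF \<beta>(1) closed_sets(2)])
    show "AE s in path_measure L w. norm (indicator {0..t} s *\<^sub>R (indicator E (X s w) *\<^sub>R \<beta> (X s w))) <= norm (indicator {0..t} s *\<^sub>R (real CARD('d) * C))"
     using nv[OF \<beta>(2)] C by (intro AE_I2) (auto simp: indicator_def)
   qed
   have i\<rho>: "integrable (path_measure L w) (\<lambda>s. indicator {0..t} s *\<^sub>R (indicator E (X s w) * \<rho> (X s w)))"
    using elim(5) t by (simp add: set_integrable_def)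
   have i2: "integrable (path_measure L w) (\<lambda>s. indicator {0..t} s *\<^sub>R ((indicator E (X s w) * \<rho> (X s w)) *\<^sub>R \<mu> (X s w)))"
   proof (rule Bochner_Integration.integrable_bound[OF integrable_mult_right[of "real CARD('d) * C", OF i\<rho>]])
    have "(\<lambda>s. (indicator {0..} s * (indicator E (X s w) * \<rho> (X s w))) *\<^sub>R (indicator {0..t} s *\<^sub>R (indicator S (X s w) *\<^sub>R \<mu> (X s w)))) \<in> borel_measurable borel"
     by (intro borel_measurable_scaleR path_meas[OF w \<rho>_borel] vm[OF \<mu>(1) closed_sets(1)])
    also have "(\<lambda>s. (indicator {0..} s * (indicator E (X s w) * \<rho> (X s w))) *\<^sub>R (indicator {0..t} s *\<^sub>R (indicator S (X s w) *\<^sub>R \<mu> (X s w))))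
     = (\<lambda>s. indicator {0..t} s *\<^sub>R ((indicator E (X s w) * \<rho> (X s w)) *\<^sub>R \<mu> (X s w)))"
     using SX by (auto simp: indicator_def fun_eq_iff)
    finally show "(\<lambda>s. indicator {0..t} s *\<^sub>R ((indicator E (X s w) * \<rho> (X s w)) *\<^sub>R \<mu> (X s w))) \<in> borel_measurable (path_measure L w)"
     by (subst measurable_cong_sets[OF sets_path_measure refl])
    show "AE s in path_measure L w. norm (indicator {0..t} s *\<^sub>R ((indicator E (X s w) * \<rho> (X s w)) *\<^sub>R \<mu> (X s w)))
     <= norm (real CARD('d) * C * (indicator {0..t} s *\<^sub>R (indicator E (X s w) * \<rho> (X s w))))"
    proof (rule AE_I2)
     fix s
     show "norm (indicator {0..t} s *\<^sub>R ((indicator E (X s w) * \<rho> (X s w)) *\<^sub>R \<mu> (X s w))) <= norm (real CARD('d) * C * (indicator {0..t} s *\<^sub>R (indicator E (X s w) * \<rho> (X s w))))"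
     proof (cases "s \<in> {0..t} \<and> X s w \<in> E")
      case True
      then have "norm (\<mu> (X s w)) <= real CARD('d) * C" using nv[OF \<mu>(2)[OF SX]] by simp
      then show ?thesis using True C by (simp add: abs_mult mult.commute mult_left_mono)
     qed (auto simp: indicator_def)
    qed
   qed
   have vi: "(LINT s:{0..t}|\<nu>. ww s) $ i = (LINT s:{0..t}|\<nu>. ww s $ i)" if "integrable \<nu> (\<lambda>s. indicator {0..t} s *\<^sub>R ww s)" for \<nu> and ww :: "real => real^'d"
    unfolding set_lebesgue_integral_def using integral_bounded_linear[OF bounded_linear_vec_nth[of i] that] by simp
   have k: "(\<lambda>s. indicator {0..t} s * \<mu> (X s w) $ i) \<in> borel_measurable borel"
   proof -
    have "(\<lambda>s. indicator {0..t} s * (indicator {0..} s * bb True i (X s w))) \<in> borel_measurable borel" using bbm[OF w, of True i] by simp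
    also have "(\<lambda>s. indicator {0..t} s * (indicator {0..} s * bb True i (X s w))) = (\<lambda>s. indicator {0..t} s * \<mu> (X s w) $ i)"
     by (auto simp: indicator_def fun_eq_iff bb_def)
    finally show ?thesis .
   qed
   have tr: "(LINT s:{0..t}|path_measure (V True) w. \<mu> (X s w) $ i) = (LINT s:{0..t}|lborel. (1 - indicator E (X s w)) * \<mu> (X s w) $ i)"
    "(LINT s:{0..t}|lborel. indicator E (X s w) * \<mu> (X s w) $ i) = (LINT s:{0..t}|path_measure L w. (indicator E (X s w) * \<rho> (X s w)) * \<mu> (X s w) $ i)"
    using elim(2) k by auto
   have si: "set_integrable lborel {0..t} (\<lambda>s. \<mu> (X s w) $ i)"
    unfolding set_integrable_def using integrable_bounded_linear[OF bounded_linear_vec_nth[of i] i1] by simp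
   have siE: "set_integrable lborel {0..t} (\<lambda>s. indicator E (X s w) * \<mu> (X s w) $ i)"
    unfolding set_integrable_def
   proof (rule Bochner_Integration.integrable_bound[OF si[unfolded set_integrable_def]])
    have "(\<lambda>s. (indicator {0..} s * indicator E (X s w)) * (indicator {0..t} s * \<mu> (X s w) $ i)) \<in> borel_measurable borel"
     by (intro borel_measurable_times path_meas[OF w E_borel] k)
    also have "(\<lambda>s. (indicator {0..} s * indicator E (X s w)) * (indicator {0..t} s * \<mu> (X s w) $ i)) = (\<lambda>s. indicator {0..t} s *\<^sub>R (indicator E (X s w) * \<mu> (X s w) $ i))"
     by (auto simp: indicator_def fun_eq_iff)
    finally show "(\<lambda>s. indicator {0..t} s *\<^sub>R (indicator E (X s w) * \<mu> (X s w) $ i)) \<in> borel_measurable lborel" by simp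
   qed (auto simp: indicator_def)
   have "(LINT s:{0..t}|path_measure (V True) w. \<mu> (X s w) $ i) = (LINT s:{0..t}|lborel. \<mu> (X s w) $ i) - (LINT s:{0..t}|lborel. indicator E (X s w) * \<mu> (X s w) $ i)"
    unfolding tr(1) left_diff_distrib mult_1_left by (rule set_integral_diff(2)[OF si siE])
   then have T1: "(LINT s:{0..t}|path_measure (V True) w. \<mu> (X s w) $ i) = (LINT s:{0..t}|lborel. \<mu> (X s w)) $ i
     - (LINT s:{0..t}|path_measure L w. (indicator E (X s w) * \<rho> (X s w)) *\<^sub>R \<mu> (X s w)) $ i"
    unfolding tr(2) vi[OF i1] vi[OF i2] by (simp only: vector_scaleR_component real_scaleR_def)
   have T2: "(LINT s:{0..t}|path_measure L w. indicator E (X s w) * \<beta> (X s w) $ i) = (LINT s:{0..t}|path_measure L w. indicator E (X s w) *\<^sub>R \<beta> (X s w)) $ i"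
    unfolding vi[OF i3] by (simp only: vector_scaleR_component real_scaleR_def)
   have "X t w = x + (LINT s:{0..t}|lborel. \<mu> (X s w))
       - (LINT s:{0..t}|path_measure L w. (indicator E (X s w) * \<rho> (X s w)) *\<^sub>R \<mu> (X s w))
       + (\<chi> i. \<Sum>j\<in>UNIV. I i j t w)
       + (LINT s:{0..t}|path_measure L w. indicator E (X s w) *\<^sub>R \<beta> (X s w))
       + (\<chi> i. \<Sum>j\<in>UNIV. J i j t w)" using elim(1) t by blast
   then have "X t w $ i = x $ i + (LINT s:{0..t}|path_measure (V True) w. \<mu> (X s w) $ i) + (\<Sum>j\<in>UNIV. I i j t w)
     + (LINT s:{0..t}|path_measure L w. indicator E (X s w) * \<beta> (X s w) $ i) + (\<Sum>j\<in>UNIV. J i j t w)"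
    unfolding T1 T2 by simp
   then show "X t w $ i = x $ i + (\<Sum>b\<in>UNIV. LINT s:{0..t}|path_measure (V b) w. bb b i (X s w)) + (\<Sum>b\<in>UNIV. \<Sum>j\<in>UNIV. K b i j t w)"
    by (simp add: UNIV_bool bb_def K_def VL)
  qed
 qed
 interpret D: driven_diffusion M F X x S E V N H K h bb C \<psi>
 proof (rule driven_diffusion.intro[OF usual_prob_space_axioms driven_diffusion_axioms.intro])
  show "closed S" by (rule closed_sets(1))
  show "adapted F X" "continuous_paths M X" using sol unfolding weak_solution_def by blast+
  show "adapted F (V b)" "AE_continuous_paths M (V b)" for b
   using br[of b undefined undefined] unfolding bracket_def by simp_all
  show "AE w in M. mono_on {0..} (\<lambda>t. V b t w)" "AE w in M. V b 0 w = 0"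
   "AE w in M. AE s in path_measure (V b) w. 0 <= s --> (X s w \<in> E \<longleftrightarrow> \<not> b)" for b
   using clock_paths by (eventually_elim, blast)+
  show "ito_integral M F (H b i j) (N b j) (K b i j)" for b i j
   using I[of i j] J[of i j] unfolding H_def[abs_def] N_def[abs_def] K_def by (cases b) simp_all
  show "H b i j s w = h b i j (X s w)" if "w \<in> space M" "0 <= s" "X s w \<in> E \<longleftrightarrow> \<not> b" for b i j s w
   using that(3) \<gamma>(2) by (auto simp: H_def h_def)
  show "\<bar>H b i j s w\<bar> <= C" if "w \<in> space M" "0 <= s" for b i j s w
   using \<sigma>(2)[OF X_paths(2)[OF that]] \<Gamma>(2)[of "X s w"] C by (auto simp: H_def indicator_def)
  show "continuous_on S (\<psi> m)" for m
   unfolding \<psi>_def[abs_def] by (intro continuous_intros continuous_on_subset[OF Phi]) auto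
  show "0 <= \<psi> m y \<and> \<psi> m y <= 1" if "y \<in> S" for m y using that by (simp add: \<psi>_def S0)
  show "\<psi> m y = 0" if "y \<in> S" "y \<in> E" for m y using that by (simp add: \<psi>_def E0)
  show "(\<lambda>m. \<psi> m y) \<longlonglongrightarrow> 1" if "y \<in> S" "y \<notin> E" for y
  proof -
   have pos: "0 < \<Phi> y" using that by (simp add: S0 E0)
   obtain m0 :: nat where m0: "1 / \<Phi> y <= real m0" using real_arch_simple by blast
   have "\<psi> m y = 1" if "m0 <= m" for m
   proof -
    have "1 / \<Phi> y <= real m" using m0 that by linarith
    then show ?thesis using pos by (simp add: \<psi>_def field_simps)
   qed
   then have "\<forall>\<^sub>F m in sequentially. \<psi> m y = 1" unfolding eventually_sequentially by blast
   then show ?thesis by (rule tendsto_eventually)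
  qed
 qed (use X_paths(2) br hc hb C bbm bbb comp in blast)+
 \<comment> \<open>The bulk identity contributes \<open>g dt\<close> off \<open>E\<close>, the
   boundary identity \<open>\<rho> g dL\<close>, which is \<open>g dt\<close> on \<open>E\<close>;
   together they cover all of Lebesgue time.\<close>
 have clocks: "AE w in M. \<forall>t\<ge>0. (\<Sum>i\<in>UNIV. \<Sum>b\<in>UNIV. LINT s:{0<..t}|path_measure (V b) w. p i (X s w) * bb b i (X s w))
   + 1/2 * (\<Sum>i\<in>UNIV. \<Sum>j\<in>UNIV. \<Sum>b\<in>UNIV. \<Sum>k\<in>UNIV. LINT s:{0<..t}|path_measure (V b) w. q i j (X s w) * (h b i k (X s w) * h b j k (X s w)))
   = (LINT s:{0<..t}|lborel. g (X s w))"
  using clock_paths AE_space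
 proof eventually_elim
  case (elim w)
  note w = elim(2)
  show ?case
  proof (intro allI impI)
   fix t :: real assume t: "0 <= t"
   let ?A = "{0<..t}"
   have V: "mono_on {0..} (\<lambda>t. V b t w)" "continuous_on {0..} (\<lambda>t. V b t w)" for b using elim(1) by blast+
   have fin: "emeasure (path_measure (V b) w) ?A < \<infinity>" for b
    by (subst path_measure_Ioc(1)[where V="V b" and w=w, OF V order_refl t]) simp
   have SX: "X s w \<in> S" if "s \<in> ?A" for s using X_paths(2)[OF w, of s] that by simp
   have Am: "(\<lambda>s. indicator ?A s * k s) \<in> borel_measurable borel" if "(\<lambda>s. indicator {0..} s * k s) \<in> borel_measurable borel" for k :: "real => real"
   proof -
    have "(\<lambda>s. indicator ?A s * (indicator {0..} s * k s)) \<in> borel_measurable borel" using that by simp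
    also have "(\<lambda>s. indicator ?A s * (indicator {0..} s * k s)) = (\<lambda>s. indicator ?A s * k s)" by (auto simp: indicator_def fun_eq_iff)
    finally show ?thesis .
   qed
   have u: "set_integrable (path_measure (V b) w) ?A (\<lambda>s. p i (X s w) * bb b i (X s w))" for b i
   proof (rule set_integrable_bounded_Ioc[OF sets_path_measure fin, of _ "G * C"])
    have "(\<lambda>s. (indicator {0..} s * p i (X s w)) * (indicator ?A s * bb b i (X s w))) \<in> borel_measurable borel"
     by (intro borel_measurable_times path_meas_S[OF w p(1)] Am bbm[OF w])
    also have "(\<lambda>s. (indicator {0..} s * p i (X s w)) * (indicator ?A s * bb b i (X s w))) = (\<lambda>s. indicator ?A s * (p i (X s w) * bb b i (X s w)))"
     by (auto simp: indicator_def fun_eq_iff)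
    finally show "(\<lambda>s. indicator ?A s * (p i (X s w) * bb b i (X s w))) \<in> borel_measurable borel" .
    fix s assume "s \<in> ?A"
    from SX[OF this] show "\<bar>p i (X s w) * bb b i (X s w)\<bar> <= G * C" unfolding abs_mult
     by (intro mult_mono' p(2) bbb) auto
   qed
   have v: "set_integrable (path_measure (V b) w) ?A (\<lambda>s. q i j (X s w) * (h b i k (X s w) * h b j k (X s w)))" for b i j k
   proof (rule set_integrable_bounded_Ioc[OF sets_path_measure fin, of _ "G * (C * C)"])
    show "(\<lambda>s. indicator ?A s * (q i j (X s w) * (h b i k (X s w) * h b j k (X s w)))) \<in> borel_measurable borel"
     by (intro Am path_meas_S[OF w] continuous_on_mult q(1) hc)
    fix s assume "s \<in> ?A"
    from SX[OF this] show "\<bar>q i j (X s w) * (h b i k (X s w) * h b j k (X s w))\<bar> <= G * (C * C)" unfolding abs_mult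
     by (intro mult_mono' q(2) hb) auto
   qed
   have gk: "(\<lambda>s. indicator ?A s * g (X s w)) \<in> borel_measurable borel" by (rule Am[OF path_meas_S[OF w g(1)]])
   have A: "?A \<in> sets borel" "?A \<subseteq> {0..}" by auto
   have tr: "(LINT s:?A|path_measure (V True) w. g (X s w)) = (LINT s:?A|lborel. (1 - indicator E (X s w)) * g (X s w))"
    "(LINT s:?A|lborel. indicator E (X s w) * g (X s w)) = (LINT s:?A|path_measure L w. (indicator E (X s w) * \<rho> (X s w)) * g (X s w))"
    using elim(1)[THEN conjunct2, THEN conjunct2, rule_format, OF A gk] by blast+
   let ?R = "\<lambda>b s. (\<Sum>i\<in>UNIV. p i (X s w) * bb b i (X s w)) + 1/2 * (\<Sum>i\<in>UNIV. \<Sum>j\<in>UNIV. \<Sum>k\<in>UNIV. q i j (X s w) * (h b i k (X s w) * h b j k (X s w)))"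
   have "(\<Sum>i\<in>UNIV. \<Sum>b\<in>UNIV. LINT s:?A|path_measure (V b) w. p i (X s w) * bb b i (X s w))
    + 1/2 * (\<Sum>i\<in>UNIV. \<Sum>j\<in>UNIV. \<Sum>b\<in>UNIV. \<Sum>k\<in>UNIV. LINT s:?A|path_measure (V b) w. q i j (X s w) * (h b i k (X s w) * h b j k (X s w)))
    = (\<Sum>b\<in>UNIV. (\<Sum>i\<in>UNIV. LINT s:?A|path_measure (V b) w. p i (X s w) * bb b i (X s w))
    + 1/2 * (\<Sum>i\<in>UNIV. \<Sum>j\<in>UNIV. \<Sum>k\<in>UNIV. LINT s:?A|path_measure (V b) w. q i j (X s w) * (h b i k (X s w) * h b j k (X s w))))"
    by (simp add: UNIV_bool sum.distrib algebra_simps)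
   also have "\<dots> = (\<Sum>b\<in>UNIV. LINT s:?A|path_measure (V b) w. ?R b s)"
    by (intro sum.cong refl linear_set_integral u v)
   also have "\<dots> = (LINT s:?A|path_measure (V True) w. ?R True s) + (LINT s:?A|path_measure (V False) w. ?R False s)"
    by (simp add: UNIV_bool)
   also have "(LINT s:?A|path_measure (V True) w. ?R True s) = (LINT s:?A|path_measure (V True) w. g (X s w))"
    unfolding set_lebesgue_integral_def
   proof (rule Bochner_Integration.integral_cong[OF refl])
    fix s show "indicator ?A s *\<^sub>R ?R True s = indicator ?A s *\<^sub>R g (X s w)"
     using bulk[OF SX[of s]] by (cases "s \<in> ?A") (simp_all add: bb_def h_def)
   qed
   also have "(LINT s:?A|path_measure (V False) w. ?R False s) = (LINT s:?A|path_measure L w. (indicator E (X s w) * \<rho> (X s w)) * g (X s w))"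
   proof -
    have VL: "V False = L" by (simp add: V_def[abs_def])
    have "AE s in path_measure (V False) w. 0 <= s --> (X s w \<in> E \<longleftrightarrow> \<not> False)" using elim(1) by blast
    then have ae: "AE s in path_measure L w. 0 <= s --> X s w \<in> E" unfolding VL by simp
    show ?thesis unfolding VL set_lebesgue_integral_def
    proof (rule Bochner_Integration.integral_cong_AE)
     show "(\<lambda>s. indicator ?A s *\<^sub>R ?R False s) \<in> borel_measurable (path_measure L w)"
     proof -
      have "set_integrable (path_measure (V False) w) ?A (?R False)"
      proof (intro set_integral_add(1) set_integrable_mult_right)
       show "set_integrable (path_measure (V False) w) ?A (\<lambda>s. \<Sum>i\<in>UNIV. p i (X s w) * bb False i (X s w))"
        unfolding set_integrable_def scaleR_sum_right by (intro Bochner_Integration.integrable_sum u[unfolded set_integrable_def])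
       show "set_integrable (path_measure (V False) w) ?A (\<lambda>s. \<Sum>i\<in>UNIV. \<Sum>j\<in>UNIV. \<Sum>k\<in>UNIV. q i j (X s w) * (h False i k (X s w) * h False j k (X s w)))"
        unfolding set_integrable_def scaleR_sum_right by (intro Bochner_Integration.integrable_sum v[unfolded set_integrable_def])
      qed
      then show ?thesis unfolding set_integrable_def VL by (rule borel_measurable_integrable)
     qed
     have "(\<lambda>s. (indicator {0..} s * (indicator E (X s w) * \<rho> (X s w))) * (indicator ?A s * g (X s w))) \<in> borel_measurable borel"
      by (intro borel_measurable_times path_meas[OF w \<rho>_borel] gk)
     also have "(\<lambda>s. (indicator {0..} s * (indicator E (X s w) * \<rho> (X s w))) * (indicator ?A s * g (X s w))) = (\<lambda>s. indicator ?A s *\<^sub>R (indicator E (X s w) * \<rho> (X s w) * g (X s w)))"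
      by (auto simp: indicator_def fun_eq_iff)
     finally show "(\<lambda>s. indicator ?A s *\<^sub>R (indicator E (X s w) * \<rho> (X s w) * g (X s w))) \<in> borel_measurable (path_measure L w)"
      by (subst measurable_cong_sets[OF sets_path_measure refl])
     show "AE s in path_measure L w. indicator ?A s *\<^sub>R ?R False s = indicator ?A s *\<^sub>R (indicator E (X s w) * \<rho> (X s w) * g (X s w))"
      using ae
     proof eventually_elim
      case (elim s)
      show ?case
      proof (cases "s \<in> ?A")
       case True
       then have "X s w \<in> E" using elim by simp
       then show ?thesis using bdry[of "X s w"] by (simp add: bb_def h_def \<gamma>(2))
      qed simp
     qed
    qed
   qed
   also have "\<dots> = (LINT s:?A|lborel. indicator E (X s w) * g (X s w))" by (rule tr(2)[symmetric])
   also note tr(1)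
   also have "(LINT s:?A|lborel. (1 - indicator E (X s w)) * g (X s w)) + (LINT s:?A|lborel. indicator E (X s w) * g (X s w)) = (LINT s:?A|lborel. g (X s w))"
   proof -
    have mE: "(\<lambda>s. indicator ?A s * (indicator E (X s w) * g (X s w))) \<in> borel_measurable borel"
    proof -
     have "(\<lambda>s. (indicator {0..} s * indicator E (X s w)) * (indicator ?A s * g (X s w))) \<in> borel_measurable borel"
      by (intro borel_measurable_times path_meas[OF w E_borel] gk)
     also have "(\<lambda>s. (indicator {0..} s * indicator E (X s w)) * (indicator ?A s * g (X s w))) = (\<lambda>s. indicator ?A s * (indicator E (X s w) * g (X s w)))"
      by (auto simp: indicator_def fun_eq_iff)
     finally show ?thesis .
    qed
    have iE: "set_integrable lborel ?A (\<lambda>s. indicator E (X s w) * g (X s w))"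
     by (rule set_integrable_bounded_Ioc[OF sets_lborel D.lborel_Ioc_finite mE, of G']) (use g(2)[OF SX] in \<open>force simp: indicator_def\<close>)
    have ig: "set_integrable lborel ?A (\<lambda>s. g (X s w))"
     by (rule set_integrable_bounded_Ioc[OF sets_lborel D.lborel_Ioc_finite gk, of G']) (use g(2)[OF SX] in blast)
    show ?thesis unfolding left_diff_distrib mult_1_left set_integral_diff(2)[OF ig iE] by simp
   qed
   finally show "(\<Sum>i\<in>UNIV. \<Sum>b\<in>UNIV. LINT s:?A|path_measure (V b) w. p i (X s w) * bb b i (X s w))
   + 1/2 * (\<Sum>i\<in>UNIV. \<Sum>j\<in>UNIV. \<Sum>b\<in>UNIV. \<Sum>k\<in>UNIV. LINT s:?A|path_measure (V b) w. q i j (X s w) * (h b i k (X s w) * h b j k (X s w)))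
   = (LINT s:?A|lborel. g (X s w))" .
  qed
 qed
 have dy: "(\<integral>w. f (X T w) \<partial>M) - (\<integral>w. f (X 0 w) \<partial>M) = (\<integral>w. (LINT s:{0<..T}|lborel. g (X s w)) \<partial>M)"
  by (rule D.dynkin[OF T f p q taylor g(2) clocks])
 show ?thesis unfolding dy by (rule D.time_average[OF T g close])
qed

end

section \<open>The generator\<close>

lemma C0_bounded:
 assumes S: "closed S" and f: "f \<in> C0 S"
 shows "\<exists>G\<ge>0. \<forall>x\<in>S. \<bar>f x\<bar> <= G"
proof -
 have c: "continuous_on S f" and l: "(f \<longlongrightarrow> 0) (inf at_infinity (principal S))" using f by (auto simp: C0_def)
 have "\<forall>\<^sub>F x in inf at_infinity (principal S). dist (f x) 0 < 1" by (rule tendstoD[OF l]) simp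
 then obtain b where b: "\<And>x. b <= norm x ==> x \<in> S ==> \<bar>f x\<bar> < 1"
  by (auto simp: eventually_inf_principal eventually_at_infinity dist_real_def)
 have "bounded (f ` (S \<inter> cball 0 b))"
  using S by (intro compact_imp_bounded compact_continuous_image continuous_on_subset[OF c] closed_Int_compact) auto
 then obtain G where "\<forall>y\<in>f ` (S \<inter> cball 0 b). norm y <= G" by (auto simp: bounded_iff)
 then have G: "\<bar>f x\<bar> <= G" if "x \<in> S" "norm x <= b" for x using that by auto
 have "\<bar>f x\<bar> <= max 1 G" if "x \<in> S" for x
  using b[of x] G[of x] that by (cases "b <= norm x") force+
 then show ?thesis by (intro exI[of _ "max 1 G"]) auto
qed

lemma C0_bounded_finite:
 fixes f :: "'i::finite => real^'d => real"
 assumes S: "closed S" and f: "\<And>i. f i \<in> C0 S"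
 shows "\<exists>G\<ge>0. \<forall>i. \<forall>x\<in>S. \<bar>f i x\<bar> <= G"
proof -
 obtain G where G: "\<And>i. 0 <= G i" "\<And>i x. x \<in> S ==> \<bar>f i x\<bar> <= G i" using C0_bounded[OF S f] by metis
 have "\<bar>f i x\<bar> <= (\<Sum>i\<in>UNIV. G i)" if "x \<in> S" for i x
  using G(2)[OF that, of i] member_le_sum[of i UNIV G] G(1) by force
 then show ?thesis using G(1) by (intro exI[of _ "\<Sum>i\<in>UNIV. G i"]) (auto intro: sum_nonneg)
qed

lemma C0_mult_bounded:
 assumes a: "continuous_on S a" "\<And>x. x \<in> S ==> \<bar>a x\<bar> <= A" and f: "f \<in> C0 S"
 shows "(\<lambda>x. a x * f x) \<in> C0 S"
proof -
 have c: "continuous_on S f" and l: "(f \<longlongrightarrow> 0) (inf at_infinity (principal S))" using f by (auto simp: C0_def)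
 have "((\<lambda>x. a x * f x) \<longlongrightarrow> 0) (inf at_infinity (principal S))"
 proof (rule tendsto_rabs_zero_cancel, rule tendsto_sandwich[OF _ _ tendsto_const])
  show "((\<lambda>x. A * \<bar>f x\<bar>) \<longlongrightarrow> 0) (inf at_infinity (principal S))"
   using tendsto_mult[OF tendsto_const tendsto_rabs[OF l], of A] by simp
  show "\<forall>\<^sub>F x in inf at_infinity (principal S). \<bar>a x * f x\<bar> <= A * \<bar>f x\<bar>"
   unfolding eventually_inf_principal abs_mult by (intro always_eventually allI impI mult_right_mono a) auto
 qed simp
 then show ?thesis using a(1) c by (auto simp: C0_def intro: continuous_on_mult)
qed

lemma C0_add: "f \<in> C0 S ==> g \<in> C0 S ==> (\<lambda>x. f x + g x) \<in> C0 S"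
 using tendsto_add[of f 0 "inf at_infinity (principal S)" g 0] by (auto simp: C0_def intro: continuous_on_add)

lemma C0_sum: "(\<And>i. i \<in> I ==> f i \<in> C0 S) ==> (\<lambda>x. \<Sum>i\<in>I. f i x) \<in> C0 S"
 using tendsto_sum[of I f "\<lambda>_. 0" "inf at_infinity (principal S)"] by (auto simp: C0_def intro: continuous_on_sum)

lemma C0_cong: "(\<And>x. x \<in> S ==> f x = g x) ==> f \<in> C0 S ==> g \<in> C0 S"
proof -
 assume eq: "\<And>x. x \<in> S ==> f x = g x" and f: "f \<in> C0 S"
 have cc: "continuous_on S f \<longleftrightarrow> continuous_on S g" by (rule continuous_on_cong[OF refl eq])
 have "(g \<longlongrightarrow> 0) (inf at_infinity (principal S)) \<longleftrightarrow> (f \<longlongrightarrow> 0) (inf at_infinity (principal S))"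
  by (rule tendsto_cong) (simp add: eventually_inf_principal eq)
 then show "g \<in> C0 S" using f cc by (auto simp: C0_def)
qed

lemma bounded_vec_components:
 fixes v :: "'a => real^'d"
 assumes "bounded (v ` S)" shows "\<exists>A\<ge>0. \<forall>x\<in>S. \<forall>i. \<bar>v x $ i\<bar> <= A"
proof -
 obtain A where A: "\<And>x. x \<in> S ==> norm (v x) <= A" using assms by (auto simp: bounded_iff)
 have "\<bar>v x $ i\<bar> <= max 0 A" if "x \<in> S" for x i using component_le_norm_cart[of "v x" i] A[OF that] by linarith
 then show ?thesis by (intro exI[of _ "max 0 A"]) auto
qed

lemma bounded_matrix_components:
 fixes v :: "'a => real^'d^'d"
 assumes "bounded (v ` S)" shows "\<exists>A\<ge>0. \<forall>x\<in>S. \<forall>i j. \<bar>v x $ i $ j\<bar> <= A"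
proof -
 obtain A where A: "\<And>x. x \<in> S ==> norm (v x) <= A" using assms by (auto simp: bounded_iff)
 have "\<bar>v x $ i $ j\<bar> <= max 0 A" if "x \<in> S" for x i j
  using component_le_norm_cart[of "v x $ i" j] Finite_Cartesian_Product.norm_nth_le[of "v x" i] A[OF that] by linarith
 then show ?thesis by (intro exI[of _ "max 0 A"]) auto
qed

lemma gram_component: "gram a x $ i $ j = (\<Sum>k\<in>UNIV. a x $ i $ k * a x $ j $ k)"
 by (simp add: gram_def matrix_matrix_mult_def transpose_def)

lemma second_order_op_gram:
 "second_order_op S b (gram a) f x = (\<Sum>i\<in>UNIV. partial_on S i f x * b x $ i)
  + 1/2 * (\<Sum>i\<in>UNIV. \<Sum>j\<in>UNIV. \<Sum>k\<in>UNIV. partial_on S i (partial_on S j f) x * (a x $ i $ k * a x $ j $ k))"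
 unfolding second_order_op_def gram_component by (simp only: sum_distrib_right sum_distrib_left mult.commute)

text \<open>The factor \<open>1 / sqrt (\<rho> x)\<close> enters the Gram matrix twice, so the
  single factor \<open>\<rho> x\<close> clears drift and diffusion alike.\<close>

lemma bdry_op_scale:
 assumes "0 < \<rho> x"
 shows "\<rho> x * bdry_op \<Phi> \<beta> \<Gamma> \<rho> f x = (\<Sum>i\<in>UNIV. partial_on (closed_domain \<Phi>) i f x * \<beta> x $ i)
  + 1/2 * (\<Sum>i\<in>UNIV. \<Sum>j\<in>UNIV. \<Sum>k\<in>UNIV. partial_on (closed_domain \<Phi>) i (partial_on (closed_domain \<Phi>) j f) x * (\<Gamma> x $ i $ k * \<Gamma> x $ j $ k))"
proof -
 let ?s = "1 / sqrt (\<rho> x)"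
 have ss: "\<rho> x * (?s * ?s) = 1" using assms by simp
 have "\<rho> x * (p * ((1 / \<rho> x) * b)) = p * b" for p b :: real using assms by simp
 moreover have "\<rho> x * (q * ((?s * u) * (?s * v))) = q * (u * v)" for q u v :: real
 proof -
  have "\<rho> x * (q * ((?s * u) * (?s * v))) = (\<rho> x * (?s * ?s)) * (q * (u * v))" by (simp only: mult_ac)
  then show ?thesis unfolding ss by simp
 qed
 ultimately show ?thesis
  unfolding bdry_op_def second_order_op_gram distrib_left mult.left_commute[of "\<rho> x" "1/2"] sum_distrib_left[of "\<rho> x"]
   vector_scaleR_component real_scaleR_def by presburger
qed

theorem theorem1:
  fixes \<Phi> :: "real^'d \<Rightarrow> real"
    and \<mu> \<beta> :: "real^'d \<Rightarrow> real^'d"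
    and \<sigma> \<Gamma> :: "real^'d \<Rightarrow> real^'d^'d"
    and \<rho> :: "real^'d \<Rightarrow> real"
    and \<Omega> :: "real^'d \<Rightarrow> 'w measure"
    and F :: "real^'d \<Rightarrow> real \<Rightarrow> 'w measure"
    and L :: "real^'d \<Rightarrow> real \<Rightarrow> 'w \<Rightarrow> real"
    and X W B :: "real^'d \<Rightarrow> real \<Rightarrow> 'w \<Rightarrow> real^'d"
    and f :: "real^'d \<Rightarrow> real"
  assumes Phi: "C2_bounded \<Phi>"
    and meas_bulk:
      "\<mu> \<in> borel_measurable (restrict_space borel (closed_domain \<Phi>))"
      "\<sigma> \<in> borel_measurable (restrict_space borel (closed_domain \<Phi>))"
    and meas_bdry:
      "\<beta> \<in> borel_measurable (restrict_space borel (bdry_of \<Phi>))"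
      "\<Gamma> \<in> borel_measurable (restrict_space borel (bdry_of \<Phi>))"
      "\<rho> \<in> borel_measurable (restrict_space borel (bdry_of \<Phi>))"
    and A1_bounded: "bounded (\<mu> ` closed_domain \<Phi>)" "bounded (\<sigma> ` closed_domain \<Phi>)"
    and A1_lipschitz:
      "\<exists>K. K-lipschitz_on (closed_domain \<Phi>) \<mu>" "\<exists>K. K-lipschitz_on (closed_domain \<Phi>) \<sigma>"
    and A1_full_rank: "\<forall>x\<in>closed_domain \<Phi>. rank (\<sigma> x) = CARD('d)"
    and A1_normal:
      "\<exists>C>0. \<forall>x\<in>bdry_of \<Phi>. inward_normal \<Phi> x \<bullet> (gram \<sigma> x *v inward_normal \<Phi> x) > C"
    and A2_bounded: "bounded (\<beta> ` bdry_of \<Phi>)" "bounded (\<Gamma> ` bdry_of \<Phi>)"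
    and A2_lipschitz: "\<exists>K. K-lipschitz_on (bdry_of \<Phi>) \<beta>" "\<exists>K. K-lipschitz_on (bdry_of \<Phi>) \<Gamma>"
    and A3: "\<forall>x\<in>bdry_of \<Phi>. transpose (\<Gamma> x) *v inward_normal \<Phi> x = 0"
    and A4_pos: "\<forall>x\<in>bdry_of \<Phi>. \<rho> x > 0"
    and A4_drift: "\<exists>C>0. \<forall>x\<in>bdry_of \<Phi>. \<beta> x \<bullet> inward_normal \<Phi> x > C"
    and solution: "\<forall>x\<in>closed_domain \<Phi>.
      weak_solution \<Phi> \<mu> \<sigma> \<beta> \<Gamma> \<rho> x (\<Omega> x) (F x) (X x) (L x) (W x) (B x)"
    and sojourn: "\<forall>x\<in>closed_domain \<Phi>. sojourn_condition \<Phi> \<rho> (\<Omega> x) (X x) (L x)"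
    and feller: "feller_semigroup (closed_domain \<Phi>) (transition_op \<Omega> X)"
    and f: "f \<in> C2_0 (closed_domain \<Phi>)"
    and wentzell: "\<forall>x\<in>bdry_of \<Phi>. bulk_op \<Phi> \<mu> \<sigma> f x = bdry_op \<Phi> \<beta> \<Gamma> \<rho> f x"
  shows "\<exists>g\<in>C0 (closed_domain \<Phi>).
      uniform_limit (closed_domain \<Phi>)
        (\<lambda>t x. (transition_op \<Omega> X t f x - f x) / t) g (at_right 0) \<and>
      (\<forall>x\<in>closed_domain \<Phi>.
        g x = indicator (domain_of \<Phi>) x * bulk_op \<Phi> \<mu> \<sigma> f x
            + indicator (bdry_of \<Phi>) x * bdry_op \<Phi> \<beta> \<Gamma> \<rho> f x)"
proof -
 let ?S = "closed_domain \<Phi>" and ?E = "bdry_of \<Phi>"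
 have Phi_cont: "continuous_on UNIV \<Phi>"
  using Phi unfolding C2_bounded_def C2_on_def by (blast intro: differentiable_imp_continuous_on)
 have S: "closed ?S" unfolding closed_domain_eq by (rule closed_Collect_le[OF _ Phi_cont]) simp
 have ES: "?E \<subseteq> ?S" by (auto simp: closed_domain_def)
 \<comment> \<open>With a vanishing gradient the vector \<open>inward_normal\<close> would be
   \<open>0\<close>, and its inner product with \<open>\<beta>\<close> could not be
   positive.\<close>
 have nz: "(\<chi> i. partial_on UNIV i \<Phi> y) \<noteq> 0" if "\<Phi> y = 0" for y
 proof
  assume "(\<chi> i. partial_on UNIV i \<Phi> y) = 0"
  then have "inward_normal \<Phi> y = 0" by (simp add: inward_normal_def Let_def)
  moreover have "y \<in> ?E" using that by (simp add: bdry_of_def)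
  ultimately show False using A4_drift by (metis inner_zero_right less_asym)
 qed
 define p where "p i = partial_on ?S i f" for i
 define q where "q i j = partial_on ?S i (partial_on ?S j f)" for i j
 \<comment> \<open>The Wentzell condition makes the bulk expression the right candidate on the
   boundary as well, so that one continuous function serves on all of the closed domain.\<close>
 define g where "g = bulk_op \<Phi> \<mu> \<sigma> f"
 have fC0: "f \<in> C0 ?S" "\<And>i. p i \<in> C0 ?S" "\<And>i j. q i j \<in> C0 ?S" and f2: "C2_on ?S f"
  using f by (simp_all add: C2_0_def p_def q_def)
 have C0_cont: "continuous_on ?S k" if "k \<in> C0 ?S" for k using that by (simp add: C0_def)
 obtain m1 where m1: "0 <= m1" "\<And>y. y \<in> ?S ==> \<bar>f y\<bar> <= m1" using C0_bounded[OF S fC0(1)] by blast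
 obtain m2 where m2: "0 <= m2" "\<And>y i. y \<in> ?S ==> \<bar>p i y\<bar> <= m2" using C0_bounded_finite[of ?S p, OF S fC0(2)] by blast
 have "\<exists>m\<ge>0. \<forall>ij. \<forall>y\<in>?S. \<bar>(case ij of (i, j) => q i j) y\<bar> <= m"
  by (rule C0_bounded_finite[OF S]) (use fC0(3) in \<open>simp split: prod.split\<close>)
 then obtain m3 where m3: "0 <= m3" "\<And>y i j. y \<in> ?S ==> \<bar>q i j y\<bar> <= m3" by auto
 define G where "G = m1 + m2 + m3"
 have fb: "\<bar>f y\<bar> <= G" and pb: "\<bar>p i y\<bar> <= G" and qb: "\<bar>q i j y\<bar> <= G" if "y \<in> ?S" for y i j
  using m1(1) m2(1) m3(1) m1(2)[OF that] m2(2)[OF that, of i] m3(2)[OF that, of i j] by (simp_all add: G_def)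
 obtain c1 where c1: "0 <= c1" "\<And>y i. y \<in> ?S ==> \<bar>\<mu> y $ i\<bar> <= c1" using bounded_vec_components[OF A1_bounded(1)] by blast
 obtain c2 where c2: "0 <= c2" "\<And>y i j. y \<in> ?S ==> \<bar>\<sigma> y $ i $ j\<bar> <= c2" using bounded_matrix_components[OF A1_bounded(2)] by blast
 obtain c3 where c3: "0 <= c3" "\<And>y i. y \<in> ?E ==> \<bar>\<beta> y $ i\<bar> <= c3" using bounded_vec_components[OF A2_bounded(1)] by blast
 obtain c4 where c4: "0 <= c4" "\<And>y i j. y \<in> ?E ==> \<bar>\<Gamma> y $ i $ j\<bar> <= c4" using bounded_matrix_components[OF A2_bounded(2)] by blast
 define C where "C = c1 + c2 + c3 + c4"
 have cont: "continuous_on ?S \<mu>" "continuous_on ?S \<sigma>" "continuous_on ?E \<beta>" "continuous_on ?E \<Gamma>"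
  using A1_lipschitz A2_lipschitz by (auto intro: lipschitz_on_continuous_on)
 have solution_at: "sticky_solution \<Phi> \<mu> \<beta> \<sigma> \<Gamma> \<rho> C x (\<Omega> x) (F x) (X x) (L x) (W x) (B x)" if x: "x \<in> ?S" for x
 proof
  show "\<bar>\<mu> y $ i\<bar> <= C" if "y \<in> ?S" for y i using c1(2)[OF that, of i] c2(1) c3(1) c4(1) by (simp add: C_def)
  show "\<bar>\<sigma> y $ i $ j\<bar> <= C" if "y \<in> ?S" for y i j using c2(2)[OF that, of i j] c1(1) c3(1) c4(1) by (simp add: C_def)
  show "\<bar>\<beta> y $ i\<bar> <= C" if "y \<in> ?E" for y i using c3(2)[OF that, of i] c1(1) c2(1) c4(1) by (simp add: C_def)
  show "\<bar>\<Gamma> y $ i $ j\<bar> <= C" if "y \<in> ?E" for y i j using c4(2)[OF that, of i j] c1(1) c2(1) c3(1) by (simp add: C_def)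
  show "0 <= C" using c1(1) c2(1) c3(1) c4(1) by (simp add: C_def)
 qed (use Phi_cont cont meas_bdry(3) A4_pos solution sojourn x in blast)+
 have taylor: "\<exists>\<delta>>0. \<forall>x\<in>A. \<forall>y\<in>A. dist y x < \<delta> -->
   \<bar>f y - f x - (\<Sum>i\<in>UNIV. p i x * (y - x) $ i) - 1/2 * (\<Sum>i\<in>UNIV. \<Sum>j\<in>UNIV. q i j x * (y - x) $ i * (y - x) $ j)\<bar> <= \<epsilon> * (dist y x)\<^sup>2"
  if A: "compact A" "A \<subseteq> ?S" and e: "0 < \<epsilon>" for A \<epsilon>
 proof -
  obtain \<delta> where d: "0 < \<delta>" "\<And>x y. x \<in> A ==> y \<in> A ==> dist y x < \<delta> ==>
   \<bar>f y - f x - (\<Sum>i\<in>UNIV. p i x * (y - x) $ i) - 1/2 * (\<Sum>i\<in>UNIV. \<Sum>j\<in>UNIV. q i j x * (y - x) $ i * (y - x) $ j)\<bar> <= \<epsilon> * (dist y x)\<^sup>2"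
   using taylor2_uniform[OF Phi nz f2 A e] unfolding p_def q_def by blast
  show ?thesis by (intro exI[of _ \<delta>] conjI ballI impI d)
 qed
 have bulk: "g y = (\<Sum>i\<in>UNIV. p i y * \<mu> y $ i) + 1/2 * (\<Sum>i\<in>UNIV. \<Sum>j\<in>UNIV. \<Sum>k\<in>UNIV. q i j y * (\<sigma> y $ i $ k * \<sigma> y $ j $ k))" for y
  unfolding g_def bulk_op_def second_order_op_gram p_def q_def ..
 have bdry: "\<rho> y * g y = (\<Sum>i\<in>UNIV. p i y * \<beta> y $ i) + 1/2 * (\<Sum>i\<in>UNIV. \<Sum>j\<in>UNIV. \<Sum>k\<in>UNIV. q i j y * (\<Gamma> y $ i $ k * \<Gamma> y $ j $ k))" if "y \<in> ?E" for y
 proof -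
  have "g y = bdry_op \<Phi> \<beta> \<Gamma> \<rho> f y" using wentzell that by (simp add: g_def)
  then show ?thesis using bdry_op_scale[of \<rho> y \<Phi> \<beta> \<Gamma> f] A4_pos that by (simp add: p_def q_def)
 qed
 \<comment> \<open>Membership in \<open>C0\<close> is what allows strong continuity of the semigroup
   to be applied to the limit itself.\<close>
 have gC0: "g \<in> C0 ?S"
 proof (rule C0_cong)
  show "(\<lambda>y. (\<Sum>i\<in>UNIV. \<mu> y $ i * p i y) + (\<Sum>i\<in>UNIV. \<Sum>j\<in>UNIV. \<Sum>k\<in>UNIV. (1/2 * (\<sigma> y $ i $ k * \<sigma> y $ j $ k)) * q i j y)) \<in> C0 ?S"
  proof (intro C0_add C0_sum)
   show "(\<lambda>y. \<mu> y $ i * p i y) \<in> C0 ?S" for i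
    by (rule C0_mult_bounded[OF _ c1(2) fC0(2)]) (intro continuous_on_component cont)
   show "(\<lambda>y. (1/2 * (\<sigma> y $ i $ k * \<sigma> y $ j $ k)) * q i j y) \<in> C0 ?S" for i j k
   proof (rule C0_mult_bounded[OF _ _ fC0(3)])
    show "continuous_on ?S (\<lambda>y. 1/2 * (\<sigma> y $ i $ k * \<sigma> y $ j $ k))"
     by (intro continuous_on_mult continuous_on_const continuous_on_component cont)
    show "\<bar>1/2 * (\<sigma> y $ i $ k * \<sigma> y $ j $ k)\<bar> <= 1/2 * (c2 * c2)" if "y \<in> ?S" for y
     unfolding abs_mult using c2(1) by (intro mult_mono c2(2) that) auto
   qed
  qed
  show "(\<Sum>i\<in>UNIV. \<mu> y $ i * p i y) + (\<Sum>i\<in>UNIV. \<Sum>j\<in>UNIV. \<Sum>k\<in>UNIV. (1/2 * (\<sigma> y $ i $ k * \<sigma> y $ j $ k)) * q i j y) = g y" for y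
   unfolding bulk by (simp only: sum_distrib_left mult_ac)
 qed
 obtain G' where gb: "\<And>y. y \<in> ?S ==> \<bar>g y\<bar> <= G'" using C0_bounded[OF S gC0] by blast
 have P0: "transition_op \<Omega> X 0 k y = k y" if "k \<in> C0 ?S" "y \<in> ?S" for k y
  using feller that unfolding feller_semigroup_def by blast
 have lim: "uniform_limit ?S (\<lambda>t. transition_op \<Omega> X t g) g (at_right 0)"
  using feller gC0 unfolding feller_semigroup_def by blast
 have "uniform_limit ?S (\<lambda>t x. (transition_op \<Omega> X t f x - f x) / t) g (at_right 0)"
 proof (rule uniform_limitI)
  fix e :: real assume e: "0 < e"
  have "\<forall>\<^sub>F t in at_right 0. \<forall>x\<in>?S. dist (transition_op \<Omega> X t g x) (g x) < e / 2"
   by (rule uniform_limitD[OF lim]) (use e in simp)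
  \<comment> \<open>This \<open>b\<close> serves all starting points at once and is the only
    threshold used below; uniformity of the limit comes from here.\<close>
  then obtain b where b: "0 < b" "\<And>t x. 0 < t ==> t < b ==> x \<in> ?S ==> dist (transition_op \<Omega> X t g x) (g x) < e / 2"
   unfolding eventually_at_right_field by blast
  have "dist ((transition_op \<Omega> X t f x - f x) / t) (g x) < e" if t: "0 < t" "t < b" and x: "x \<in> ?S" for t x
  proof -
   \<comment> \<open>Right limits at \<open>0\<close> say nothing about \<open>s = 0\<close>, which
     is covered by the identity at time \<open>0\<close>.\<close>
   have close: "\<bar>(\<integral>w. g (X x s w) \<partial>\<Omega> x) - g x\<bar> <= e / 2" if "0 <= s" "s <= t" for s
   proof (cases "s = 0")
    case True
    then show ?thesis using P0[OF gC0 x] e by (simp add: transition_op_def)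
   next
    case False
    then have "dist (transition_op \<Omega> X s g x) (g x) < e / 2" using that t by (intro b(2) x) auto
    then show ?thesis by (simp add: transition_op_def dist_real_def)
   qed
   interpret sticky_solution \<Phi> \<mu> \<beta> \<sigma> \<Gamma> \<rho> C x "\<Omega> x" "F x" "X x" "L x" "W x" "B x" by (rule solution_at[OF x])
   have "\<bar>(\<integral>w. f (X x t w) \<partial>\<Omega> x) - (\<integral>w. f (X x 0 w) \<partial>\<Omega> x) - t * g x\<bar> <= t * (e / 2)"
    by (rule sticky_dynkin[OF C0_cont[OF fC0(1)] fb C0_cont[OF fC0(2)] pb C0_cont[OF fC0(3)] qb taylor C0_cont[OF gC0] gb bulk bdry
      less_imp_le[OF t(1)] close])
   then have "\<bar>transition_op \<Omega> X t f x - f x - t * g x\<bar> <= t * (e / 2)"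
    using P0[OF fC0(1) x] by (simp add: transition_op_def)
   then have le: "\<bar>transition_op \<Omega> X t f x - f x - t * g x\<bar> / t <= e / 2" using t(1) by (simp add: field_simps)
   have "(transition_op \<Omega> X t f x - f x) / t - g x = (transition_op \<Omega> X t f x - f x - t * g x) / t"
    using t(1) by (simp add: field_simps)
   then have "dist ((transition_op \<Omega> X t f x - f x) / t) (g x) = \<bar>transition_op \<Omega> X t f x - f x - t * g x\<bar> / t"
    using t(1) by (simp add: dist_real_def)
   then show ?thesis using le e by linarith
  qed
  then show "\<forall>\<^sub>F t in at_right 0. \<forall>x\<in>?S. dist ((transition_op \<Omega> X t f x - f x) / t) (g x) < e"
   unfolding eventually_at_right_field using b(1) by blast
 qed
 moreover have "g x = indicator (domain_of \<Phi>) x * bulk_op \<Phi> \<mu> \<sigma> f x + indicator ?E x * bdry_op \<Phi> \<beta> \<Gamma> \<rho> f x" if "x \<in> ?S" for x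
  using that wentzell by (auto simp: g_def closed_domain_def domain_of_def bdry_of_def indicator_def)
 ultimately show ?thesis using gC0 by blast
qed

end
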